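(* Let $\Gamma'$ be a network with vertex set $\mathbf v(\Gamma')=[d]=\{1,\dots,d\}$ and edge set $\mathbf e(\Gamma')$, and let $\mathbf m'=(m'_e)_{e\in\mathbf e(\Gamma')}$ be an assignment of bond dimensions on $\Gamma'$. Let $\{i_1,\dots,i_s,j_1,\dots,j_s\}\subseteq\mathbf v(\Gamma')$ be a set of $2s$ vertices. Let $\Gamma$ be the augmentation of $\Gamma'$ at the nodes $\{i_r,j_r\}$ for $r=1,\dots,s$, with additional vertices $0_1,\dots,0_s$; that is, $\mathbf v(\Gamma)=[d]\cup\{0_1,\dots,0_s\}$ and $\mathbf e(\Gamma)=\mathbf e(\Gamma')\cup\{(0_r,i_r),(0_r,j_r):r=1,\dots,s\}$. Let $\mathbf m$ be the assignment of bond dimensions on $\Gamma$ with $m_e=m'_e$ for all $e\in\mathbf e(\Gamma')$ and $m_{0_ri_r}=m_{0_rj_r}=m_r$ for all $r\in[s]$. Let $\mathbf n$ be the assignment of physical dimensions on $\Gamma$ where $n_{0_r}=2$ for $r\in[s]$ and, for every $k\ne0_1,\dots,0_s$, $n_k=\prod_{e\in\mathbf e(\Gamma),\,e\ni k}m_e$ is the critical dimension. Then $(\Gamma,\mathbf m,\mathbf n)$ is defective and $$\delta^\Gamma_{\mathbf m,\mathbf n}=\mathrm{fiberdefect}^\Gamma_{\mathbf m,\mathbf n}=\sum_{r=1}^s(m_r-1)(m_{i_rj_r}^2-1).$$ Moreover, the generic element of $\mathcal{TNS}^\Gamma_{\mathbf m,\mathbf n}$ has a normal form $$T=\Big(\bigoplus_{k=1}^{m_1}J_1(z_{1,k})\Big)\boxtimes\cdots\boxtimes\Big(\bigoplus_{k=1}^{m_s}J_1(z_{s,k})\Big)\boxtimes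 T(\Gamma',\mathbf m')$$ with factors suitably tensored together.
   Context: Everything is over $\mathbb C$. A network is a finite connected graph; $m_{i_rj_r}$ denotes the bond dimension of the edge $(i_r,j_r)$. Tensor network varieties. For a finite connected graph $\Gamma$ with bond dimensions $\mathbf m=(m_e)_{e\in\mathbf e(\Gamma)}$ and physical dimensions $\mathbf n=(n_i)_{i\in\mathbf v(\Gamma)}$ (positive integers), orient the edges arbitrarily, take for each edge $e$ a bond space $E_e$ of dimension $m_e$ and its dual $E_e^*$, and set $W_i=\bigotimes_{e\ni i}E'_e$, where $E'_e=E_e$ if $i$ is the source of $e$ and $E_e'=E_e^*$ if $i$ is the target. The graph tensor is $T(\Gamma,\mathbf m)=\bigotimes_e\mathrm{id}_{E_e}\in\bigotimes_e(E_e\otimes E_e^* )\simeq\bigotimes_{i\in\mathbf v(\Gamma)}W_i$. With $V_i=\mathbb C^{n_i}$, $\mathcal{TNS}^\Gamma_{\mathbf m,\mathbf n}\subseteq\bigotimes_iV_i$ is the Zariski closure of the set of all $(\bigotimes_iX_i)(T(\Gamma,\mathbf m))$ with $X_i\in\mathrm{Hom}(W_i,V_i)$. Defects. The parameter count is $p=\sum_{i\in\mathbf v(\Gamma)}\big(n_i\prod_{e\ni i}m_e-1\big)-\sum_{e\in\mathbf e(\Gamma)}(m_e^2-1)+1$; the expected dimension is $\min\{p,\prod_in_i\}$; $\delta^\Gamma_{\mathbf m,\mathbf n}$ is the expected dimension minus $\dim\mathcal{TNS}^\Gamma_{\mathbf m,\mathbf n}$ (affine dimension); $\mathrm{fiberdefect}^\Gamma_{\mathbf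 m,\mathbf n}=p-\dim\mathcal{TNS}^\Gamma_{\mathbf m,\mathbf n}$. Defective means that the dimension is strictly smaller than the expected dimension. Normal form notation. "Normal form" is understood up to the action of $GL(V_1)\times\cdots\times GL(V_d)$, and the $z_{r,k}$ are generic elements of $V_{0_r}\simeq\mathbb C^2$. Let $V'_1,\dots,V'_d$ be the spaces $W_j$ of the network $(\Gamma',\mathbf m')$, so $T(\Gamma',\mathbf m')\in V_1'\otimes\cdots\otimes V_d'$. For each $r$ identify $V_{i_r}=\mathbb C^{m_r}\otimes V'_{i_r}$ and $V_{j_r}=\mathbb C^{m_r}\otimes V'_{j_r}$, and $V_k=V_k'$ for the remaining $k\in[d]$; let $(b_{r,k})_k$ and $(c_{r,k})_k$ be bases of the factors $\mathbb C^{m_r}$ in $V_{i_r}$ and $V_{j_r}$. Then $\bigoplus_{k=1}^{m_r}J_1(z_{r,k})=\sum_{k=1}^{m_r}z_{r,k}\otimes b_{r,k}\otimes c_{r,k}\in V_{0_r}\otimes\mathbb C^{m_r}\otimes\mathbb C^{m_r}$ (the diagonal pencil with entries $z_{r,k}$), and $\boxtimes$ denotes the Kronecker product: the tensor product of all these tensors with $T(\Gamma',\mathbf m')$, regrouped as an element of $V_{0_1}\otimes\cdots\otimes V_{0_s}\otimes V_1\otimes\cdots\otimes V_d$ via the identifications above.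
   Formalization: Defectiveness is claimed only when some r has m_r ≥ 2 and m_{i_r j_r} ≥ 2; otherwise (e.g. all m_r = 1, or s = 0) the displayed formula gives defect 0 and the network is not defective. The defect formula and the normal form carry no such restriction. *)

theory Defs
  imports Complex_Main "HOL.Hull" "HOL-Library.FuncSet" "Jordan_Normal_Form.Matrix"
begin

section \<open>Zariski topology on a coordinate space\<close>

text \<open>The affine space of complex vectors with finite coordinate set \<open>I\<close>; coordinates outside
  \<open>I\<close> are normalised to zero.\<close>

definition coord_space :: "'i set \<Rightarrow> ('i \<Rightarrow> complex) set" where
  "coord_space I = {x. \<forall>i. i \<notin> I \<longrightarrow> x i = 0}"

inductive_set poly_fun :: "'i set \<Rightarrow> (('i \<Rightarrow> complex) \<Rightarrow> complex) set" for I :: "'i set" where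
  const: "(\<lambda>x. c) \<in> poly_fun I"
| coord: "i \<in> I \<Longrightarrow> (\<lambda>x. x i) \<in> poly_fun I"
| add: "f \<in> poly_fun I \<Longrightarrow> g \<in> poly_fun I \<Longrightarrow> (\<lambda>x. f x + g x) \<in> poly_fun I"
| mult: "f \<in> poly_fun I \<Longrightarrow> g \<in> poly_fun I \<Longrightarrow> (\<lambda>x. f x * g x) \<in> poly_fun I"

definition zariski_closed :: "'i set \<Rightarrow> ('i \<Rightarrow> complex) set \<Rightarrow> bool" where
  "zariski_closed I Z \<longleftrightarrow>
     (\<exists>F \<subseteq> poly_fun I. Z = {x \<in> coord_space I. \<forall>f\<in>F. f x = 0})"

definition zariski_closure :: "'i set \<Rightarrow> ('i \<Rightarrow> complex) set \<Rightarrow> ('i \<Rightarrow> complex) set" where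
  "zariski_closure I A = (zariski_closed I) hull A"

definition zariski_irreducible :: "'i set \<Rightarrow> ('i \<Rightarrow> complex) set \<Rightarrow> bool" where
  "zariski_irreducible I Z \<longleftrightarrow> Z \<noteq> {} \<and>
     (\<forall>A B. zariski_closed I A \<and> zariski_closed I B \<and> Z \<subseteq> A \<union> B \<longrightarrow> Z \<subseteq> A \<or> Z \<subseteq> B)"

text \<open>Krull dimension of a closed set. For finite \<open>I\<close> the lengths of chains are bounded by
  \<open>card I\<close>, so the supremum in \<open>nat\<close> is a genuine maximum when the set is nonempty.\<close>

definition zariski_dim :: "'i set \<Rightarrow> ('i \<Rightarrow> complex) set \<Rightarrow> nat" where
  "zariski_dim I X = Sup {k. \<exists>C :: nat \<Rightarrow> ('i \<Rightarrow> complex) set.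
     (\<forall>l\<le>k. zariski_closed I (C l) \<and> zariski_irreducible I (C l) \<and> C l \<subseteq> X) \<and>
     (\<forall>l<k. C l \<subset> C (Suc l))}"

text \<open>A property holds for the generic element of a closed set \<open>X\<close> if it holds on a
  relatively open and dense subset of \<open>X\<close>.\<close>

definition generically :: "'i set \<Rightarrow> ('i \<Rightarrow> complex) set \<Rightarrow> (('i \<Rightarrow> complex) \<Rightarrow> bool) \<Rightarrow> bool" where
  "generically I X P \<longleftrightarrow>
     (\<exists>Z. zariski_closed I Z \<and> zariski_closure I (X - Z) = X \<and> (\<forall>T \<in> X - Z. P T))"

section \<open>Tensor network varieties\<close>

definition network :: "'v set \<Rightarrow> 'v set set \<Rightarrow> bool" where
  "network V E \<longleftrightarrow> finite V \<and> V \<noteq> {} \<and>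
     (\<forall>e\<in>E. \<exists>u\<in>V. \<exists>v\<in>V. u \<noteq> v \<and> e = {u, v}) \<and>
     (\<forall>u\<in>V. \<forall>v\<in>V. (u, v) \<in> {(a, b). {a, b} \<in> E}\<^sup>*)"

text \<open>Tensors are coordinate arrays: if \<open>B v\<close> indexes a basis of the factor at \<open>v\<close>, the tensor
  product over \<open>v \<in> V\<close> is \<open>coord_space (Pi\<^sub>E V B)\<close>. The local space \<open>W\<^sub>v\<close> has as basis the products
  of one standard basis (or dual basis) vector for every edge at \<open>v\<close>.\<close>

definition bond_basis :: "'v set set \<Rightarrow> ('v set \<Rightarrow> nat) \<Rightarrow> 'v \<Rightarrow> ('v set \<Rightarrow> nat) set" where
  "bond_basis E m v = Pi\<^sub>E {e \<in> E. v \<in> e} (\<lambda>e. {..<m e})"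

definition phys_basis :: "('v \<Rightarrow> nat) \<Rightarrow> 'v \<Rightarrow> nat set" where
  "phys_basis n v = {..<n v}"

text \<open>The identity of an edge space is the sum of (basis vector) tensor (dual basis vector), so in
  these bases the product of all edge identities has entry 1 exactly where the two endpoints of
  every edge carry the same index. This is independent of the orientation of the edges.\<close>

definition graph_tensor ::
  "'v set \<Rightarrow> 'v set set \<Rightarrow> ('v set \<Rightarrow> nat) \<Rightarrow> ('v \<Rightarrow> 'v set \<Rightarrow> nat) \<Rightarrow> complex" where
  "graph_tensor V E m x =
     of_bool (x \<in> Pi\<^sub>E V (bond_basis E m) \<and> (\<forall>e\<in>E. \<forall>u\<in>e. \<forall>v\<in>e. x u e = x v e))"

text \<open>The tensor product of the linear maps with matrices \<open>X v\<close> (rows indexed by \<open>C v\<close>, columns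
  by \<open>B v\<close>), applied to a tensor.\<close>

definition local_maps :: "'v set \<Rightarrow> ('v \<Rightarrow> 'b set) \<Rightarrow> ('v \<Rightarrow> 'c set) \<Rightarrow>
    ('v \<Rightarrow> 'c \<Rightarrow> 'b \<Rightarrow> complex) \<Rightarrow> (('v \<Rightarrow> 'b) \<Rightarrow> complex) \<Rightarrow> ('v \<Rightarrow> 'c) \<Rightarrow> complex" where
  "local_maps V B C X T y =
     (if y \<in> Pi\<^sub>E V C then \<Sum>x \<in> Pi\<^sub>E V B. (\<Prod>v\<in>V. X v (y v) (x v)) * T x else 0)"

definition tns :: "'v set \<Rightarrow> 'v set set \<Rightarrow> ('v set \<Rightarrow> nat) \<Rightarrow> ('v \<Rightarrow> nat) \<Rightarrow> (('v \<Rightarrow> nat) \<Rightarrow> complex) set" where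
  "tns V E m n = zariski_closure (Pi\<^sub>E V (phys_basis n))
     (range (\<lambda>X. local_maps V (bond_basis E m) (phys_basis n) X (graph_tensor V E m)))"

definition tns_dim :: "'v set \<Rightarrow> 'v set set \<Rightarrow> ('v set \<Rightarrow> nat) \<Rightarrow> ('v \<Rightarrow> nat) \<Rightarrow> int" where
  "tns_dim V E m n = int (zariski_dim (Pi\<^sub>E V (phys_basis n)) (tns V E m n))"

definition param_count :: "'v set \<Rightarrow> 'v set set \<Rightarrow> ('v set \<Rightarrow> nat) \<Rightarrow> ('v \<Rightarrow> nat) \<Rightarrow> int" where
  "param_count V E m n =
     (\<Sum>v\<in>V. int (n v * (\<Prod>e \<in> {e \<in> E. v \<in> e}. m e)) - 1) - (\<Sum>e\<in>E. (int (m e))\<^sup>2 - 1) + 1"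

definition expected_dim :: "'v set \<Rightarrow> 'v set set \<Rightarrow> ('v set \<Rightarrow> nat) \<Rightarrow> ('v \<Rightarrow> nat) \<Rightarrow> int" where
  "expected_dim V E m n = min (param_count V E m n) (int (\<Prod>v\<in>V. n v))"

definition defect :: "'v set \<Rightarrow> 'v set set \<Rightarrow> ('v set \<Rightarrow> nat) \<Rightarrow> ('v \<Rightarrow> nat) \<Rightarrow> int" where
  "defect V E m n = expected_dim V E m n - tns_dim V E m n"

definition fiberdefect :: "'v set \<Rightarrow> 'v set set \<Rightarrow> ('v set \<Rightarrow> nat) \<Rightarrow> ('v \<Rightarrow> nat) \<Rightarrow> int" where
  "fiberdefect V E m n = param_count V E m n - tns_dim V E m n"

definition defective :: "'v set \<Rightarrow> 'v set set \<Rightarrow> ('v set \<Rightarrow> nat) \<Rightarrow> ('v \<Rightarrow> nat) \<Rightarrow> bool" where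
  "defective V E m n \<longleftrightarrow> tns_dim V E m n < expected_dim V E m n"

section \<open>Augmentation and the normal form\<close>

text \<open>In the augmented network the vertex \<open>k \<in> [d]\<close> is \<open>Inl k\<close> and the new vertex \<open>0\<^sub>r\<close> is
  \<open>Inr r\<close>.\<close>

definition aug_vertices :: "nat \<Rightarrow> nat \<Rightarrow> (nat + nat) set" where
  "aug_vertices d s = Inl ` {1..d} \<union> Inr ` {1..s}"

definition aug_edges :: "nat set set \<Rightarrow> nat \<Rightarrow> (nat \<Rightarrow> nat) \<Rightarrow> (nat \<Rightarrow> nat) \<Rightarrow> (nat + nat) set set" where
  "aug_edges E' s i j = (\<lambda>e. Inl ` e) ` E' \<union>
     (\<lambda>r. {Inr r, Inl (i r)}) ` {1..s} \<union> (\<lambda>r. {Inr r, Inl (j r)}) ` {1..s}"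

text \<open>Coordinates of the direct sum of the \<open>J\<^sub>1(z k)\<close>, \<open>k < q\<close>.\<close>

definition diagonal_pencil :: "nat \<Rightarrow> (nat \<Rightarrow> nat \<Rightarrow> complex) \<Rightarrow> nat \<Rightarrow> nat \<Rightarrow> nat \<Rightarrow> complex" where
  "diagonal_pencil q z a b c = (\<Sum>k<q. z k a * of_bool (b = k) * of_bool (c = k))"

text \<open>The identifications of \<open>V\<^sub>k\<close> with \<open>\<complex>\<^bsup>q r\<^esup> \<otimes> V'\<^sub>k\<close> for \<open>k = i r\<close> or \<open>k = j r\<close>, and with
  \<open>V'\<^sub>k\<close> otherwise, as bijections of bases: \<open>\<alpha> k\<close> and \<open>\<beta> k\<close> return the two components of a
  basis index of \<open>V\<^sub>k\<close> (\<open>\<alpha> k\<close> is meaningless if \<open>k\<close> is none of the \<open>i r\<close>, \<open>j r\<close>).\<close>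

definition identification :: "nat \<Rightarrow> nat \<Rightarrow> (nat \<Rightarrow> nat) \<Rightarrow> (nat \<Rightarrow> nat) \<Rightarrow> (nat \<Rightarrow> nat) \<Rightarrow>
    nat set set \<Rightarrow> (nat set \<Rightarrow> nat) \<Rightarrow> (nat + nat \<Rightarrow> nat) \<Rightarrow>
    (nat \<Rightarrow> nat \<Rightarrow> nat) \<Rightarrow> (nat \<Rightarrow> nat \<Rightarrow> nat set \<Rightarrow> nat) \<Rightarrow> bool" where
  "identification d s i j q E' m' n \<alpha> \<beta> \<longleftrightarrow>
     (\<forall>r\<in>{1..s}. \<forall>k\<in>{i r, j r}.
        bij_betw (\<lambda>a. (\<alpha> k a, \<beta> k a)) (phys_basis n (Inl k)) ({..<q r} \<times> bond_basis E' m' k)) \<and>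
     (\<forall>k \<in> {1..d} - (i ` {1..s} \<union> j ` {1..s}).
        bij_betw (\<beta> k) (phys_basis n (Inl k)) (bond_basis E' m' k))"

text \<open>Entries of a Kronecker product are products of entries. The vector \<open>z\<^sub>r\<^sub>,\<^sub>k\<close> of
  \<open>\<complex>\<^sup>2\<close> has coordinates \<open>z (r, k, 0)\<close> and \<open>z (r, k, 1)\<close>, with \<open>k\<close> counted from 0.\<close>

definition normal_form :: "nat \<Rightarrow> nat \<Rightarrow> (nat \<Rightarrow> nat) \<Rightarrow> (nat \<Rightarrow> nat) \<Rightarrow> (nat \<Rightarrow> nat) \<Rightarrow>
    nat set set \<Rightarrow> (nat set \<Rightarrow> nat) \<Rightarrow> (nat + nat \<Rightarrow> nat) \<Rightarrow>
    (nat \<Rightarrow> nat \<Rightarrow> nat) \<Rightarrow> (nat \<Rightarrow> nat \<Rightarrow> nat set \<Rightarrow> nat) \<Rightarrow>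
    (nat \<times> nat \<times> nat \<Rightarrow> complex) \<Rightarrow> (nat + nat \<Rightarrow> nat) \<Rightarrow> complex" where
  "normal_form d s i j q E' m' n \<alpha> \<beta> z x =
     (if x \<in> Pi\<^sub>E (aug_vertices d s) (phys_basis n) then
        (\<Prod>r\<in>{1..s}. diagonal_pencil (q r) (\<lambda>k a. z (r, k, a))
           (x (Inr r)) (\<alpha> (i r) (x (Inl (i r)))) (\<alpha> (j r) (x (Inl (j r))))) *
        graph_tensor {1..d} E' m' (\<lambda>k\<in>{1..d}. \<beta> k (x (Inl k)))
      else 0)"

definition pencil_params :: "nat \<Rightarrow> (nat \<Rightarrow> nat) \<Rightarrow> (nat \<times> nat \<times> nat) set" where
  "pencil_params s q = (SIGMA r:{1..s}. {..<q r} \<times> {..<2})"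

definition GL :: "nat \<Rightarrow> complex mat set" where
  "GL N = {A \<in> carrier_mat N N. invertible_mat A}"

text \<open>The group \<open>GL(V\<^sub>1) \<times> \<dots> \<times> GL(V\<^sub>d)\<close> acts trivially on the factors at the new vertices.\<close>

definition gl_act :: "nat \<Rightarrow> nat \<Rightarrow> (nat + nat \<Rightarrow> nat) \<Rightarrow> (nat \<Rightarrow> complex mat) \<Rightarrow>
    ((nat + nat \<Rightarrow> nat) \<Rightarrow> complex) \<Rightarrow> (nat + nat \<Rightarrow> nat) \<Rightarrow> complex" where
  "gl_act d s n g = local_maps (aug_vertices d s) (phys_basis n) (phys_basis n)
     (\<lambda>v a b. case v of Inl k \<Rightarrow> g k $$ (a, b) | Inr r \<Rightarrow> of_bool (a = b))"

end

theory Submission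
  imports Defs "Jordan_Normal_Form.Determinant" "HOL-Computational_Algebra.Fundamental_Theorem_Algebra"
begin

text \<open>
  The closure of the image of a polynomial map is irreducible, its dimension is the generic rank of
  the derivative, and the image of a nonempty open set contains an open dense part of it. A generic
  pencil of matrices has the form \<open>P\<close> times a diagonal pencil times \<open>R\<close>, and \<open>P\<close> and \<open>R\<close> can be
  absorbed into the maps at \<open>i\<^sub>r\<close> and \<open>j\<^sub>r\<close>; so the tensor network variety is the closure of the set of
  all \<open>g \<cdot> normal_form z\<close>. In the normal form the new bond and the edge \<open>(i\<^sub>r, j\<^sub>r)\<close> merge into one bond
  whose index set is divided into \<open>m\<^sub>r\<close> blocks. The kernel of the derivative of
  \<open>(z, g) \<mapsto> g \<cdot> normal_form z\<close> is spanned by rescalings of the \<open>z\<^sub>r\<^sub>,\<^sub>k\<close>, by scalars at the vertices and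
  by changes of basis of the bonds that preserve the blocks: the edge \<open>(i\<^sub>r, j\<^sub>r)\<close> contributes an
  independent change of basis for every block, instead of a single one, which gives the
  \<open>(m\<^sub>r - 1) (m\<^sub>i\<^sub>r\<^sub>j\<^sub>r\<^sup>2 - 1)\<close> missing dimensions. That the kernel is not larger is
  verified at one point, where the equations of the derivative couple only configurations that differ
  in the edges at one vertex. Finally the parameter count never exceeds the dimension of the ambient
  space, so defect and fibre defect coincide.
\<close>



section \<open>Polynomial functions\<close>

text \<open>The dimension in \<open>zariski_dim\<close> is the length of chains of irreducible
  closed sets, so both bounds have to be extracted from chains. From above, a chain of length k
  yields k algebraically independent functions, and the kernel directions \<open>kvec\<close>, which
  are independent wherever \<open>nondeg\<close> is nonzero, limit how many of them the parameters
  can carry. From below, a chain is built by releasing one parameter after the other around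
  \<open>base_point\<close>; injectivity of the derivative on a coordinate slice at this single
  point suffices, because rank can only drop at special points. The pencil vectors at the base point
  are \<open>(1, b)\<close> for the block b: they are pairwise independent, which is what forbids
  mixing of different blocks. The formula for the defect gives 0 if for each r either
  \<open>q r = 1\<close> or the edge between \<open>i r\<close> and \<open>j r\<close> has bond
  dimension 1; therefore strict defectivity is asserted under the existence of an r with both
  numbers at least 2. Genericity of the vectors z is rendered by an arbitrary proper closed set
  \<open>Z\<close> that they have to avoid.\<close>

lemma poly_fun_cong:
  assumes "f \<in> poly_fun I" "\<And>i. i \<in> I \<Longrightarrow> x i = y i"
  shows "f x = f y"
  using assms by (induction rule: poly_fun.induct) auto

lemma poly_fun_mono: "f \<in> poly_fun I \<Longrightarrow> I \<subseteq> J \<Longrightarrow> f \<in> poly_fun J"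
  by (induction rule: poly_fun.induct) (auto intro: poly_fun.intros)

lemma poly_fun_cmult: "f \<in> poly_fun I \<Longrightarrow> (\<lambda>x. c * f x) \<in> poly_fun I"
  using poly_fun.mult[OF poly_fun.const] .

lemma poly_fun_uminus: "f \<in> poly_fun I \<Longrightarrow> (\<lambda>x. - f x) \<in> poly_fun I"
  using poly_fun_cmult[of f I "-1"] by simp

lemma poly_fun_diff: "f \<in> poly_fun I \<Longrightarrow> g \<in> poly_fun I \<Longrightarrow> (\<lambda>x. f x - g x) \<in> poly_fun I"
  using poly_fun.add[OF _ poly_fun_uminus, of f I g] by simp

lemma poly_fun_sum:
  "(\<And>a. a \<in> A \<Longrightarrow> f a \<in> poly_fun I) \<Longrightarrow> (\<lambda>x. \<Sum>a\<in>A. f a x) \<in> poly_fun I"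
  by (induction A rule: infinite_finite_induct) (auto intro: poly_fun.intros)

lemma poly_fun_prod:
  "(\<And>a. a \<in> A \<Longrightarrow> f a \<in> poly_fun I) \<Longrightarrow> (\<lambda>x. \<Prod>a\<in>A. f a x) \<in> poly_fun I"
  by (induction A rule: infinite_finite_induct) (auto intro: poly_fun.intros)

lemma poly_fun_power: "f \<in> poly_fun I \<Longrightarrow> (\<lambda>x. f x ^ n) \<in> poly_fun I"
  by (induction n) (auto intro: poly_fun.intros)

lemma poly_fun_compose:
  assumes "f \<in> poly_fun J" "\<And>j. j \<in> J \<Longrightarrow> (\<lambda>x. F x j) \<in> poly_fun I"
  shows "(\<lambda>x. f (F x)) \<in> poly_fun I"
  using assms by (induction rule: poly_fun.induct) (auto intro: poly_fun.intros)

lemmas poly_fun_intros = poly_fun.intros poly_fun_cmult poly_fun_uminus poly_fun_diff poly_fun_sum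
  poly_fun_prod poly_fun_power

section \<open>Restriction to lines, limits and derivatives of polynomial functions\<close>

lemma poly_fun_on_line:
  assumes "f \<in> poly_fun I"
  shows "\<exists>p. \<forall>t. f (\<lambda>i. a i + t * v i) = poly p t"
  using assms
proof (induction rule: poly_fun.induct)
  case (const c)
  show ?case by (rule exI[of _ "[:c:]"]) simp
next
  case (coord i)
  show ?case by (rule exI[of _ "[:a i, v i:]"]) simp
next
  case (add f g)
  then obtain p q where "\<forall>t. f (\<lambda>i. a i + t * v i) = poly p t"
    "\<forall>t. g (\<lambda>i. a i + t * v i) = poly q t" by blast
  then show ?case by (intro exI[of _ "p + q"]) simp
next
  case (mult f g)
  then obtain p q where "\<forall>t. f (\<lambda>i. a i + t * v i) = poly p t"
    "\<forall>t. g (\<lambda>i. a i + t * v i) = poly q t" by blast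
  then show ?case by (intro exI[of _ "p * q"]) simp
qed

text \<open>On the line through \<open>a\<close> and \<open>b\<close> both functions become nonzero
  univariate polynomials, since one is nonzero at parameter 0 and the other at parameter 1; their
  product has a non-root. This is the source of the genericity arguments below: open conditions that
  can be met separately can be met together.\<close>

lemma poly_fun_domain:
  assumes "f \<in> poly_fun I" "g \<in> poly_fun I" "f a \<noteq> 0" "g b \<noteq> 0"
  shows "\<exists>x. f x * g x \<noteq> 0"
proof -
  obtain p where p: "\<forall>t. f (\<lambda>i. a i + t * (b i - a i)) = poly p t"
    using poly_fun_on_line[OF assms(1), of a "\<lambda>i. b i - a i"] by blast
  obtain q where q: "\<forall>t. g (\<lambda>i. a i + t * (b i - a i)) = poly q t"
    using poly_fun_on_line[OF assms(2), of a "\<lambda>i. b i - a i"] by blast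
  have "p \<noteq> 0" using p[rule_format, of 0] assms(3) by auto
  moreover have "q \<noteq> 0" using q[rule_format, of 1] assms(4) by auto
  ultimately have "p * q \<noteq> 0" by simp
  then obtain t where "poly (p * q) t \<noteq> 0" using poly_all_0_iff_0 by blast
  then show ?thesis using p q by (intro exI[of _ "\<lambda>i. a i + t * (b i - a i)"]) simp
qed

lemma poly_fun_domain_prod:
  assumes "finite A" "\<And>a. a \<in> A \<Longrightarrow> f a \<in> poly_fun I" "\<And>a. a \<in> A \<Longrightarrow> \<exists>x. f a x \<noteq> 0"
  shows "\<exists>x. (\<Prod>a\<in>A. f a x) \<noteq> 0"
  using assms
proof (induction A rule: finite_induct)
  case (insert a A)
  then obtain x y where "f a x \<noteq> 0" "(\<Prod>a\<in>A. f a y) \<noteq> 0" by blast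
  then have "\<exists>x. f a x * (\<Prod>a\<in>A. f a x) \<noteq> 0"
    using insert.prems by (intro poly_fun_domain[of "f a" I "\<lambda>x. \<Prod>a\<in>A. f a x" x y]) (auto intro: poly_fun_prod)
  then show ?case using insert by simp
qed simp

lemma poly_fun_tendsto:
  assumes "f \<in> poly_fun I" "\<And>i. i \<in> I \<Longrightarrow> ((\<lambda>t. u t i) \<longlongrightarrow> v i) F"
  shows "((\<lambda>t. f (u t)) \<longlongrightarrow> f v) F"
  using assms by (induction rule: poly_fun.induct) (auto intro!: tendsto_intros)

text \<open>The chain rule along arbitrary curves is taken as the definition of a gradient: it
  passes through sums and products by the usual rules, without formal partial derivatives, and it is
  the property that all later uses rely on.\<close>

definition is_grad :: "'i set \<Rightarrow> (('i \<Rightarrow> complex) \<Rightarrow> complex) \<Rightarrow> ('i \<Rightarrow> ('i \<Rightarrow> complex) \<Rightarrow> complex) \<Rightarrow> bool" where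
  "is_grad I f df \<longleftrightarrow> (\<forall>\<gamma> \<gamma>' t0.
     (\<forall>i\<in>I. ((\<lambda>t. \<gamma> t i) has_field_derivative \<gamma>' i) (at t0)) \<longrightarrow>
     ((\<lambda>t. f (\<gamma> t)) has_field_derivative (\<Sum>i\<in>I. df i (\<gamma> t0) * \<gamma>' i)) (at t0))"

lemma poly_fun_deriv_ex:
  assumes "f \<in> poly_fun I" "finite I"
  shows "\<exists>df. is_grad I f df"
  using assms(1)
proof (induction rule: poly_fun.induct)
  case (const c)
  have "is_grad I (\<lambda>x. c) (\<lambda>i x. 0)"
    by (simp add: is_grad_def)
  then show ?case by blast
next
  case (coord i)
  have *: "(\<Sum>j\<in>I. of_bool (j = i) * \<gamma>' j) = \<gamma>' i" for \<gamma>' :: "'a \<Rightarrow> complex"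
  proof -
    have "(\<Sum>j\<in>I. of_bool (j = i) * \<gamma>' j) = (\<Sum>j\<in>I. if j = i then \<gamma>' j else 0)"
      by (intro sum.cong) auto
    then show ?thesis using coord assms(2) by simp
  qed
  have "is_grad I (\<lambda>x. x i) (\<lambda>j x. of_bool (j = i))"
    using coord unfolding is_grad_def * by simp
  then show ?case by blast
next
  case (add f g)
  then obtain df dg where *: "is_grad I f df" "is_grad I g dg" by blast
  have "is_grad I (\<lambda>x. f x + g x) (\<lambda>i x. df i x + dg i x)"
    unfolding is_grad_def
  proof (intro allI impI)
    fix \<gamma> :: "complex \<Rightarrow> 'a \<Rightarrow> complex" and \<gamma>' t0
    assume "\<forall>i\<in>I. ((\<lambda>t. \<gamma> t i) has_field_derivative \<gamma>' i) (at t0)"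
    then have "((\<lambda>t. f (\<gamma> t)) has_field_derivative (\<Sum>i\<in>I. df i (\<gamma> t0) * \<gamma>' i)) (at t0)"
      "((\<lambda>t. g (\<gamma> t)) has_field_derivative (\<Sum>i\<in>I. dg i (\<gamma> t0) * \<gamma>' i)) (at t0)"
      using * unfolding is_grad_def by blast+
    from DERIV_add[OF this]
    show "((\<lambda>t. f (\<gamma> t) + g (\<gamma> t)) has_field_derivative
        (\<Sum>i\<in>I. (df i (\<gamma> t0) + dg i (\<gamma> t0)) * \<gamma>' i)) (at t0)"
      by (simp add: ring_distribs sum.distrib)
  qed
  then show ?case by blast
next
  case (mult f g)
  then obtain df dg where *: "is_grad I f df" "is_grad I g dg" by blast
  have "is_grad I (\<lambda>x. f x * g x) (\<lambda>i x. df i x * g x + dg i x * f x)"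
    unfolding is_grad_def
  proof (intro allI impI)
    fix \<gamma> :: "complex \<Rightarrow> 'a \<Rightarrow> complex" and \<gamma>' t0
    assume "\<forall>i\<in>I. ((\<lambda>t. \<gamma> t i) has_field_derivative \<gamma>' i) (at t0)"
    then have "((\<lambda>t. f (\<gamma> t)) has_field_derivative (\<Sum>i\<in>I. df i (\<gamma> t0) * \<gamma>' i)) (at t0)"
      "((\<lambda>t. g (\<gamma> t)) has_field_derivative (\<Sum>i\<in>I. dg i (\<gamma> t0) * \<gamma>' i)) (at t0)"
      using * unfolding is_grad_def by blast+
    from DERIV_mult[OF this]
    show "((\<lambda>t. f (\<gamma> t) * g (\<gamma> t)) has_field_derivative
        (\<Sum>i\<in>I. (df i (\<gamma> t0) * g (\<gamma> t0) + dg i (\<gamma> t0) * f (\<gamma> t0)) * \<gamma>' i)) (at t0)"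
      by (simp add: ring_distribs sum.distrib sum_distrib_left mult_ac)
  qed
  then show ?case by blast
qed

definition pdiff :: "'i set \<Rightarrow> (('i \<Rightarrow> complex) \<Rightarrow> complex) \<Rightarrow> 'i \<Rightarrow> ('i \<Rightarrow> complex) \<Rightarrow> complex" where
  "pdiff I f = (SOME df. is_grad I f df)"

lemma pdiff_is_grad: "f \<in> poly_fun I \<Longrightarrow> finite I \<Longrightarrow> is_grad I f (pdiff I f)"
  unfolding pdiff_def by (rule someI_ex[OF poly_fun_deriv_ex])

lemma pdiff_deriv:
  assumes "f \<in> poly_fun I" "finite I"
    "\<And>i. i \<in> I \<Longrightarrow> ((\<lambda>t. \<gamma> t i) has_field_derivative \<gamma>' i) (at t0)"
  shows "((\<lambda>t. f (\<gamma> t)) has_field_derivative (\<Sum>i\<in>I. pdiff I f i (\<gamma> t0) * \<gamma>' i)) (at t0)"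
  using pdiff_is_grad[OF assms(1,2)] assms(3) unfolding is_grad_def by blast

definition dir_deriv :: "'i set \<Rightarrow> (('i \<Rightarrow> complex) \<Rightarrow> complex) \<Rightarrow> ('i \<Rightarrow> complex) \<Rightarrow> ('i \<Rightarrow> complex) \<Rightarrow> complex" where
  "dir_deriv I f x v = (\<Sum>i\<in>I. pdiff I f i x * v i)"

lemma dir_deriv_has_deriv:
  assumes "f \<in> poly_fun I" "finite I"
  shows "((\<lambda>t. f (\<lambda>i. x i + t * v i)) has_field_derivative dir_deriv I f x v) (at 0)"
proof -
  have "((\<lambda>t. f ((\<lambda>t i. x i + t * v i) t)) has_field_derivative
      (\<Sum>i\<in>I. pdiff I f i ((\<lambda>t i. x i + t * v i) 0) * v i)) (at 0)"
    by (rule pdiff_deriv[OF assms]) (auto intro!: derivative_eq_intros)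
  then show ?thesis by (simp add: dir_deriv_def)
qed

lemma dir_deriv_eq:
  assumes "f \<in> poly_fun I" "finite I"
    "((\<lambda>t. f (\<lambda>i. x i + t * v i)) has_field_derivative D) (at 0)"
  shows "dir_deriv I f x v = D"
  using DERIV_unique[OF dir_deriv_has_deriv[OF assms(1,2)] assms(3)] .

lemma dir_deriv_sum: "dir_deriv I f x (\<lambda>i. \<Sum>l\<in>K. c l * v l i) = (\<Sum>l\<in>K. c l * dir_deriv I f x (v l))"
  unfolding dir_deriv_def
  by (simp add: sum_distrib_left mult_ac sum.swap[of _ K])

section \<open>Univariate polynomials with polynomial functions as coefficients\<close>

text \<open>Polynomials in one distinguished variable over the ring of polynomial functions in
  \<open>C\<close>. The number \<open>n\<close> is a common degree bound and not the degree, since a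
  leading coefficient may vanish at some points.\<close>

definition polyfam :: "'i set \<Rightarrow> nat \<Rightarrow> (('i \<Rightarrow> complex) \<Rightarrow> complex poly) set" where
  "polyfam C n = {p. (\<forall>k. (\<lambda>x. coeff (p x) k) \<in> poly_fun C) \<and> (\<forall>x. degree (p x) \<le> n)}"

lemma polyfam_coeff: "p \<in> polyfam C n \<Longrightarrow> (\<lambda>x. coeff (p x) k) \<in> poly_fun C"
  by (simp add: polyfam_def)

lemma polyfam_degree: "p \<in> polyfam C n \<Longrightarrow> degree (p x) \<le> n"
  by (simp add: polyfam_def)

lemma polyfam_mono: "p \<in> polyfam C n \<Longrightarrow> n \<le> n' \<Longrightarrow> p \<in> polyfam C n'"
  unfolding polyfam_def using le_trans by blast

lemma polyfam_add: "p \<in> polyfam C n \<Longrightarrow> q \<in> polyfam C n \<Longrightarrow> (\<lambda>x. p x + q x) \<in> polyfam C n"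
  by (auto simp: polyfam_def intro: poly_fun_intros degree_add_le)

lemma polyfam_diff: "p \<in> polyfam C n \<Longrightarrow> q \<in> polyfam C n \<Longrightarrow> (\<lambda>x. p x - q x) \<in> polyfam C n"
  by (auto simp: polyfam_def intro: poly_fun_intros degree_diff_le)

lemma polyfam_mult:
  "p \<in> polyfam C n \<Longrightarrow> q \<in> polyfam C n' \<Longrightarrow> (\<lambda>x. p x * q x) \<in> polyfam C (n + n')"
  unfolding polyfam_def
  by (auto simp: coeff_mult intro!: poly_fun_sum poly_fun.mult intro: order.trans[OF degree_mult_le add_mono])

lemma polyfam_monom: "c \<in> poly_fun C \<Longrightarrow> k \<le> n \<Longrightarrow> (\<lambda>x. monom (c x) k) \<in> polyfam C n"
  unfolding polyfam_def
proof (intro CollectI conjI allI)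
  fix l assume "c \<in> poly_fun C"
  then show "(\<lambda>x. coeff (monom (c x) k) l) \<in> poly_fun C"
    by (cases "k = l") (auto intro: poly_fun.const)
qed (auto intro: order.trans[OF degree_monom_le])

lemma polyfam_const: "c \<in> poly_fun C \<Longrightarrow> (\<lambda>x. [:c x:]) \<in> polyfam C n"
  using polyfam_monom[of c C 0 n] by (simp add: monom_0)

lemma polyfam_smult: "c \<in> poly_fun C \<Longrightarrow> p \<in> polyfam C n \<Longrightarrow> (\<lambda>x. smult (c x) (p x)) \<in> polyfam C n"
  unfolding polyfam_def
  by (auto intro: poly_fun.mult order.trans[OF degree_smult_le])

text \<open>The coordinate \<open>i\<close> is singled out as main variable; this reduces algebraic
  dependence and elimination to univariate polynomials.\<close>

lemma poly_fun_insert_polyfam: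
  assumes "f \<in> poly_fun (insert i C)" "i \<notin> C"
  shows "\<exists>n. \<exists>p\<in>polyfam C n. \<forall>x t. f (x(i := t)) = poly (p x) t"
  using assms(1)
proof (induction rule: poly_fun.induct)
  case (const c)
  show ?case by (intro exI[of _ 0] bexI[of _ "\<lambda>x. [:c:]"]) (auto intro: polyfam_const poly_fun.const)
next
  case (coord j)
  show ?case
  proof (cases "j = i")
    case True
    show ?thesis
      by (intro exI[of _ 1] bexI[of _ "\<lambda>x. monom 1 1"])
        (auto simp: True poly_monom intro: polyfam_monom poly_fun.const)
  next
    case False
    then show ?thesis using coord
      by (intro exI[of _ 0] bexI[of _ "\<lambda>x. [:x j:]"]) (auto intro: polyfam_const poly_fun.coord)
  qed
next
  case (add f g)
  then obtain n p n' q where *: "p \<in> polyfam C n" "q \<in> polyfam C n'"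
    "\<forall>x t. f (x(i := t)) = poly (p x) t" "\<forall>x t. g (x(i := t)) = poly (q x) t" by blast
  then have "p \<in> polyfam C (max n n')" "q \<in> polyfam C (max n n')"
    by (auto intro: polyfam_mono)
  then show ?case using *(3,4)
    by (intro exI[of _ "max n n'"] bexI[of _ "\<lambda>x. p x + q x"] polyfam_add) (simp_all del: fun_upd_apply)
next
  case (mult f g)
  then obtain n p n' q where *: "p \<in> polyfam C n" "q \<in> polyfam C n'"
    "\<forall>x t. f (x(i := t)) = poly (p x) t" "\<forall>x t. g (x(i := t)) = poly (q x) t" by blast
  then show ?case
    by (intro exI[of _ "n + n'"] bexI[of _ "\<lambda>x. p x * q x"] polyfam_mult) (simp_all del: fun_upd_apply)
qed

lemma polyfam_imp_poly_fun:
  assumes "p \<in> polyfam C n" "c \<in> poly_fun D" "C \<subseteq> D"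
  shows "(\<lambda>x. poly (p x) (c x)) \<in> poly_fun D"
proof -
  have "poly (p x) (c x) = (\<Sum>k\<le>n. coeff (p x) k * c x ^ k)" for x
    unfolding poly_altdef using polyfam_degree[OF assms(1), of x]
    by (intro sum.mono_neutral_left) (auto intro: coeff_eq_0)
  moreover have "(\<lambda>x. \<Sum>k\<le>n. coeff (p x) k * c x ^ k) \<in> poly_fun D"
    by (intro poly_fun_intros assms poly_fun_mono[OF polyfam_coeff[OF assms(1)]])
  ultimately show ?thesis by simp
qed

lemma polyfam_cong:
  assumes "p \<in> polyfam C n" "\<And>i. i \<in> C \<Longrightarrow> x i = y i"
  shows "p x = p y"
  by (rule poly_eqI) (rule poly_fun_cong[OF polyfam_coeff[OF assms(1)] assms(2)])

text \<open>\<open>poly_shift k\<close> drops the \<open>k\<close> lowest coefficients; where these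
  are zero it is the division by the k-th power of the variable.\<close>

lemma polyfam_shift:
  "p \<in> polyfam C n \<Longrightarrow> (\<lambda>x. poly_shift k (p x)) \<in> polyfam C (n - k)"
  unfolding polyfam_def
proof (intro CollectI conjI allI)
  fix x assume p: "p \<in> {p. (\<forall>k. (\<lambda>x. coeff (p x) k) \<in> poly_fun C) \<and> (\<forall>x. degree (p x) \<le> n)}"
  show "degree (poly_shift k (p x)) \<le> n - k"
  proof (rule degree_le, intro allI impI)
    fix i assume "n - k < i"
    moreover have "degree (p x) \<le> n" using p by simp
    ultimately show "coeff (poly_shift k (p x)) i = 0"
      by (simp add: coeff_poly_shift coeff_eq_0)
  qed
qed (simp add: coeff_poly_shift)

lemma polyfam_pderiv:
  "p \<in> polyfam C n \<Longrightarrow> (\<lambda>x. pderiv (p x)) \<in> polyfam C (n - 1)"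
  unfolding polyfam_def
  by (auto simp: coeff_pderiv degree_pderiv intro: poly_fun_intros intro!: diff_le_mono)


section \<open>Linear algebra in coordinates\<close>

text \<open>Gaussian elimination by induction on the coordinates: a vector with a nonzero entry at
  \<open>b\<close> serves as pivot, and subtracting multiples of it clears the coordinate
  \<open>b\<close> from all others.\<close>

lemma linear_relation_exists:
  fixes u :: "'a \<Rightarrow> 'b \<Rightarrow> complex"
  assumes "finite B" "finite A" "card B < card A"
  shows "\<exists>c. (\<exists>a\<in>A. c a \<noteq> 0) \<and> (\<forall>b\<in>B. (\<Sum>a\<in>A. c a * u a b) = 0)"
  using assms
proof (induction B arbitrary: A u rule: finite_induct)
  case empty
  then have "A \<noteq> {}" by auto
  then show ?case by (intro exI[of _ "\<lambda>_. 1"]) auto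
next
  case (insert b B)
  show ?case
  proof (cases "\<forall>a\<in>A. u a b = 0")
    case True
    then show ?thesis using insert.IH[of A u] insert.prems insert.hyps by auto
  next
    case False
    then obtain a0 where a0: "a0 \<in> A" "u a0 b \<noteq> 0" by blast
    define u' where "u' a x = u a x - u a b / u a0 b * u a0 x" for a x
    have "card B < card (A - {a0})" using insert a0 by simp
    then obtain c where c: "\<exists>a\<in>A - {a0}. c a \<noteq> 0" "\<forall>x\<in>B. (\<Sum>a\<in>A - {a0}. c a * u' a x) = 0"
      using insert.IH[of "A - {a0}" u'] insert.prems by auto
    define c0 where "c0 = - (\<Sum>a\<in>A - {a0}. c a * u a b / u a0 b)"
    define d where "d = c(a0 := c0)"
    have sum_d: "(\<Sum>a\<in>A. d a * u a x) = (\<Sum>a\<in>A - {a0}. c a * u' a x)" for x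
    proof -
      have "(\<Sum>a\<in>A. d a * u a x) = c0 * u a0 x + (\<Sum>a\<in>A - {a0}. c a * u a x)"
        using a0 insert.prems by (subst sum.remove[of A a0]) (auto simp: d_def intro!: sum.cong)
      also have "c0 * u a0 x = - (\<Sum>a\<in>A - {a0}. c a * (u a b / u a0 b * u a0 x))"
        by (simp add: c0_def sum_distrib_left mult_ac)
      finally show ?thesis by (simp add: u'_def ring_distribs sum_subtractf)
    qed
    have "u' a b = 0" for a using a0 by (simp add: u'_def)
    then have "\<forall>x\<in>insert b B. (\<Sum>a\<in>A. d a * u a x) = 0" using c(2) by (auto simp: sum_d)
    moreover have "\<exists>a\<in>A. d a \<noteq> 0" using c(1) by (auto simp: d_def)
    ultimately show ?thesis by blast
  qed
qed

text \<open>Functionals dual to linearly independent vectors. They are used to choose as many linear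
  functions of the output as there are independent directions of a derivative.\<close>

lemma left_inverse_exists:
  fixes u :: "'a \<Rightarrow> 'b \<Rightarrow> complex"
  assumes "finite A" "finite B"
    "\<And>c. (\<And>b. b \<in> B \<Longrightarrow> (\<Sum>a\<in>A. c a * u a b) = 0) \<Longrightarrow> (\<And>a. a \<in> A \<Longrightarrow> c a = 0)"
  shows "\<exists>R. \<forall>a\<in>A. \<forall>a'\<in>A. (\<Sum>b\<in>B. R a b * u a' b) = of_bool (a = a')"
  using assms(1,3)
proof (induction A rule: finite_induct)
  case (insert a0 A)
  have "\<exists>R. \<forall>a\<in>A. \<forall>a'\<in>A. (\<Sum>b\<in>B. R a b * u a' b) = of_bool (a = a')"
  proof (rule insert.IH)
    fix c a assume c: "\<And>b. b \<in> B \<Longrightarrow> (\<Sum>a\<in>A. c a * u a b) = 0" and a: "a \<in> A"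
    have "(c(a0 := 0)) a = 0"
    proof (rule insert.prems[of "c(a0 := 0)" a])
      fix b assume b: "b \<in> B"
      have "(\<Sum>a\<in>insert a0 A. (c(a0 := 0)) a * u a b) = (\<Sum>a\<in>A. c a * u a b)"
        using insert.hyps by (auto intro!: sum.cong)
      then show "(\<Sum>a\<in>insert a0 A. (c(a0 := 0)) a * u a b) = 0" using c[OF b] by simp
    qed (use a in simp)
    moreover have "a \<noteq> a0" using a insert.hyps by auto
    ultimately show "c a = 0" by simp
  qed
  then obtain R where R: "\<forall>a\<in>A. \<forall>a'\<in>A. (\<Sum>b\<in>B. R a b * u a' b) = of_bool (a = a')" by blast
  \<comment> \<open>The component of \<open>u a0\<close> in the span of the old vectors, as measured
    by the dual functionals found so far. Independence leaves a nonzero rest at some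
    \<open>b0\<close>.\<close>
  define s where "s a = (\<Sum>b\<in>B. R a b * u a0 b)" for a
  have "\<exists>b0\<in>B. u a0 b0 - (\<Sum>a\<in>A. s a * u a b0) \<noteq> 0"
  proof (rule ccontr)
    assume "\<not> ?thesis"
    then have h: "u a0 b - (\<Sum>a\<in>A. s a * u a b) = 0" if "b \<in> B" for b using that by blast
    have "((\<lambda>a. - s a)(a0 := 1)) a0 = 0"
    proof (rule insert.prems[of "(\<lambda>a. - s a)(a0 := 1)" a0])
      fix b assume b: "b \<in> B"
      have "(\<Sum>a\<in>insert a0 A. ((\<lambda>a. - s a)(a0 := 1)) a * u a b) = u a0 b + (\<Sum>a\<in>A. - s a * u a b)"
        using insert.hyps by (auto intro!: sum.cong)
      then show "(\<Sum>a\<in>insert a0 A. ((\<lambda>a. - s a)(a0 := 1)) a * u a b) = 0"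
        using h[OF b] by (simp add: sum_negf)
    qed simp
    then show False by simp
  qed
  then obtain b0 where b0: "b0 \<in> B" "u a0 b0 - (\<Sum>a\<in>A. s a * u a b0) \<noteq> 0" by blast
  define e where "e = u a0 b0 - (\<Sum>a\<in>A. s a * u a b0)"
  \<comment> \<open>Evaluation at \<open>b0\<close>, corrected by the old functionals: it kills
    every old vector and takes the value 1 on \<open>u a0\<close>.\<close>
  define \<rho> where "\<rho> b = (of_bool (b = b0) - (\<Sum>a\<in>A. R a b * u a b0)) / e" for b
  have \<rho>_apply: "(\<Sum>b\<in>B. \<rho> b * x b) = (x b0 - (\<Sum>a\<in>A. (\<Sum>b\<in>B. R a b * x b) * u a b0)) / e" for x
  proof -
    have "(\<Sum>b\<in>B. \<rho> b * x b) = (\<Sum>b\<in>B. of_bool (b = b0) * x b - (\<Sum>a\<in>A. R a b * x b * u a b0)) / e"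
      unfolding \<rho>_def sum_divide_distrib
      by (intro sum.cong refl) (simp add: ring_distribs sum_distrib_right sum_distrib_left mult_ac diff_divide_distrib)
    also have "(\<Sum>b\<in>B. of_bool (b = b0) * x b - (\<Sum>a\<in>A. R a b * x b * u a b0)) =
        (\<Sum>b\<in>B. of_bool (b = b0) * x b) - (\<Sum>a\<in>A. (\<Sum>b\<in>B. R a b * x b) * u a b0)"
      by (simp add: sum_subtractf sum.swap[of _ B A] sum_distrib_right)
    also have "(\<Sum>b\<in>B. of_bool (b = b0) * x b) = x b0"
      using b0(1) assms(2) by (subst sum.remove[of B b0]) auto
    finally show ?thesis .
  qed
  have \<rho>_A: "(\<Sum>b\<in>B. \<rho> b * u a b) = 0" if "a \<in> A" for a
  proof -
    have "(\<Sum>a'\<in>A. (\<Sum>b\<in>B. R a' b * u a b) * u a' b0) = (\<Sum>a'\<in>A. of_bool (a' = a) * u a' b0)"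
      using R that by (intro sum.cong) auto
    also have "\<dots> = u a b0" using that insert.hyps by (subst sum.remove[of A a]) auto
    finally show ?thesis by (simp add: \<rho>_apply)
  qed
  have \<rho>_0: "(\<Sum>b\<in>B. \<rho> b * u a0 b) = 1"
    using b0(2) by (simp add: \<rho>_apply s_def e_def)
  define R' where "R' = (\<lambda>a b. if a = a0 then \<rho> b else R a b - s a * \<rho> b)"
  have "(\<Sum>b\<in>B. R' a b * u a' b) = of_bool (a = a')" if a: "a \<in> insert a0 A" "a' \<in> insert a0 A" for a a'
  proof (cases "a = a0")
    case True
    then show ?thesis using \<rho>_A \<rho>_0 a insert.hyps by (auto simp: R'_def)
  next
    case False
    then have aA: "a \<in> A" using a by simp
    have "(\<Sum>b\<in>B. R' a b * u a' b) = (\<Sum>b\<in>B. R a b * u a' b) - s a * (\<Sum>b\<in>B. \<rho> b * u a' b)"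
      using False by (simp add: R'_def ring_distribs sum_subtractf sum_distrib_left mult_ac)
    then show ?thesis using \<rho>_A \<rho>_0 a False R aA by (cases "a' = a0") (auto simp: s_def)
  qed
  then show ?case by blast
qed simp

section \<open>Dominant maps\<close>

text \<open>In the scaling variable t, the coefficient of the k-th power is the homogeneous part of
  degree k of \<open>f\<close> around \<open>c\<close>, as a polynomial function of the direction
  \<open>y\<close>.\<close>

lemma poly_fun_translate_expand:
  assumes "f \<in> poly_fun I"
  shows "\<exists>n. \<exists>p\<in>polyfam I n. \<forall>y t. f (\<lambda>i. c i + t * y i) = poly (p y) t"
  using assms
proof (induction rule: poly_fun.induct)
  case (const c)
  show ?case by (intro exI[of _ 0] bexI[of _ "\<lambda>x. [:c:]"]) (auto intro: polyfam_const poly_fun.const)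
next
  case (coord j)
  have "(\<lambda>y. [:c j:] + monom (y j) 1) \<in> polyfam I 1"
    using coord by (intro polyfam_add polyfam_const polyfam_monom) (auto intro: poly_fun_intros)
  then show ?case by (intro exI[of _ 1] bexI) (auto simp: poly_monom)
next
  case (add f g)
  then obtain n p n' q where *: "p \<in> polyfam I n" "q \<in> polyfam I n'"
    "\<forall>y t. f (\<lambda>i. c i + t * y i) = poly (p y) t" "\<forall>y t. g (\<lambda>i. c i + t * y i) = poly (q y) t" by blast
  then have "p \<in> polyfam I (max n n')" "q \<in> polyfam I (max n n')"
    by (auto intro: polyfam_mono)
  then show ?case using *(3,4)
    by (intro exI[of _ "max n n'"] bexI[of _ "\<lambda>x. p x + q x"] polyfam_add) simp_all
next
  case (mult f g)
  then obtain n p n' q where *: "p \<in> polyfam I n" "q \<in> polyfam I n'"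
    "\<forall>y t. f (\<lambda>i. c i + t * y i) = poly (p y) t" "\<forall>y t. g (\<lambda>i. c i + t * y i) = poly (q y) t" by blast
  then show ?case
    by (intro exI[of _ "n + n'"] bexI[of _ "\<lambda>x. p x * q x"] polyfam_mult) simp_all
qed

text \<open>Expand \<open>P\<close> around the image of the base point into homogeneous parts: along a curve
  whose image has tangent \<open>v\<close>, the part of lowest order dominates, so it vanishes at \<open>v\<close>.\<close>

lemma surjective_derivative_imp_dominant:
  fixes F :: "('a \<Rightarrow> complex) \<Rightarrow> 'j \<Rightarrow> complex"
  assumes P: "P \<in> poly_fun J" and vanish: "\<And>x. P (F x) = 0"
    and surj: "\<And>v. \<exists>w. \<forall>j\<in>J. ((\<lambda>t. F (\<lambda>i. a i + t * w i) j) has_field_derivative v j) (at 0)"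
  shows "P y = 0"
proof (rule ccontr)
  assume Py: "P y \<noteq> 0"
  obtain n p where p: "p \<in> polyfam J n" "\<And>y t. P (\<lambda>i. F a i + t * y i) = poly (p y) t"
    using poly_fun_translate_expand[OF P, of "F a"] by blast
  have "poly (p (\<lambda>i. y i - F a i)) 1 \<noteq> 0" using Py by (subst p(2)[symmetric]) simp
  then have "p (\<lambda>i. y i - F a i) \<noteq> 0" by auto
  then have ex: "\<exists>k y. coeff (p y) k \<noteq> 0" by (auto simp: poly_eq_iff)
  \<comment> \<open>The lowest degree in which the homogeneous part of \<open>P\<close> around the
    image point is not identically zero; \<open>v\<close> is a direction in which it does not
    vanish.\<close>
  define m where "m = (LEAST k. \<exists>y. coeff (p y) k \<noteq> 0)"
  obtain v where v: "coeff (p v) m \<noteq> 0" using LeastI_ex[OF ex] unfolding m_def by blast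
  have low: "coeff (p y) k = 0" if "k < m" for k y using not_less_Least[OF that[unfolded m_def]] by blast
  obtain w where w: "\<And>j. j \<in> J \<Longrightarrow> ((\<lambda>t. F (\<lambda>i. a i + t * w i) j) has_field_derivative v j) (at 0)"
    using surj by blast
  \<comment> \<open>With the difference quotient the point on the curve is exactly
    \<open>F a + t * u t\<close>, so the expansion applies in the varying direction
    \<open>u t\<close>, which tends to \<open>v\<close>.\<close>
  define u where "u t j = (F (\<lambda>i. a i + t * w i) j - F a j) / t" for t j
  have u: "((\<lambda>t. u t j) \<longlongrightarrow> v j) (at 0)" if "j \<in> J" for j
    using w[OF that] unfolding u_def has_field_derivative_def has_derivative_def DERIV_def
    using w[OF that] by (simp add: DERIV_def)
  define s where "s y = poly_shift m (p y)" for y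
  have sfam: "s \<in> polyfam J (n - m)" unfolding s_def by (rule polyfam_shift[OF p(1)])
  have ps: "p y = monom 1 m * s y" for y
  proof (rule poly_eqI)
    fix k show "coeff (p y) k = coeff (monom 1 m * s y) k"
      using low by (cases "k < m") (auto simp: s_def coeff_monom_mult coeff_poly_shift)
  qed
  have zero: "poly (s (u t)) t = 0" if "t \<noteq> 0" for t
  proof -
    have "(\<lambda>i. F a i + t * u t i) = F (\<lambda>i. a i + t * w i)" using that by (auto simp: u_def)
    then have "poly (p (u t)) t = 0" using vanish p(2)[of t "u t"] by simp
    then show ?thesis using that by (simp add: ps poly_monom)
  qed
  have eq: "poly (s y) t = (\<Sum>k\<le>n - m. coeff (s y) k * t ^ k)" for y t
    unfolding poly_altdef using polyfam_degree[OF sfam, of y]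
    by (intro sum.mono_neutral_left) (auto intro: coeff_eq_0)
  have "((\<lambda>t. \<Sum>k\<le>n - m. coeff (s (u t)) k * t ^ k) \<longlongrightarrow> (\<Sum>k\<le>n - m. coeff (s v) k * 0 ^ k)) (at 0)"
    by (intro tendsto_sum tendsto_mult tendsto_power tendsto_ident_at poly_fun_tendsto[OF polyfam_coeff[OF sfam]] u)
  then have "((\<lambda>t. poly (s (u t)) t) \<longlongrightarrow> poly (s v) 0) (at 0)" by (simp add: eq)
  moreover have "((\<lambda>t. poly (s (u t)) t) \<longlongrightarrow> 0) (at 0)"
    by (rule tendsto_eventually) (auto simp: zero eventually_at_filter)
  ultimately have "poly (s v) 0 = 0" by (rule LIM_unique)
  then show False using v by (simp add: s_def poly_0_coeff_0 coeff_poly_shift)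
qed

section \<open>More polynomials than variables are algebraically dependent\<close>

lemma sum_PiE_insert:
  assumes "j \<notin> J"
  shows "sum f (Pi\<^sub>E (insert j J) T) = (\<Sum>k\<in>T j. \<Sum>\<mu>\<in>Pi\<^sub>E J T. f (\<mu>(j := k)))"
proof -
  have "sum f (Pi\<^sub>E (insert j J) T) = (\<Sum>(k, \<mu>)\<in>T j \<times> Pi\<^sub>E J T. f (\<mu>(j := k)))"
    unfolding PiE_insert_eq
    by (subst sum.reindex[OF inj_combinator[OF assms]]) (auto intro: sum.cong)
  then show ?thesis by (simp add: sum.cartesian_product)
qed

lemma monomials_independent:
  assumes "finite J"
    and "\<And>y. (\<Sum>\<mu>\<in>J \<rightarrow>\<^sub>E {..<t}. c \<mu> * (\<Prod>j\<in>J. y j ^ \<mu> j)) = (0::complex)"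
    and "\<mu> \<in> J \<rightarrow>\<^sub>E {..<t}"
  shows "c \<mu> = 0"
  using assms
proof (induction J arbitrary: c \<mu> rule: finite_induct)
  case empty
  then show ?case by auto
next
  case (insert j J)
  define c' where "c' k y = (\<Sum>\<mu>\<in>J \<rightarrow>\<^sub>E {..<t}. c (\<mu>(j := k)) * (\<Prod>j\<in>J. y j ^ \<mu> j))" for k y
  have exp: "(\<Sum>\<mu>\<in>insert j J \<rightarrow>\<^sub>E {..<t}. c \<mu> * (\<Prod>j\<in>insert j J. y j ^ \<mu> j)) = (\<Sum>k<t. c' k y * y j ^ k)" for y
  proof -
    have "(\<Prod>i\<in>insert j J. y i ^ (\<mu>(j := k)) i) = (\<Prod>i\<in>J. y i ^ \<mu> i) * y j ^ k" for k and \<mu> :: "'a \<Rightarrow> nat"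
    proof -
      have "(\<Prod>i\<in>J. y i ^ (\<mu>(j := k)) i) = (\<Prod>i\<in>J. y i ^ \<mu> i)"
        by (intro prod.cong refl) (use insert.hyps in auto)
      then show ?thesis using insert.hyps by simp
    qed
    then show ?thesis
      unfolding sum_PiE_insert[OF insert.hyps(2)] c'_def sum_distrib_right
      by (intro sum.cong refl) (simp add: mult_ac)
  qed
  have c': "c' k y = 0" if "k < t" for k y
  proof -
    have "poly (\<Sum>k<t. monom (c' k y) k) x = 0" for x
    proof -
      have "(\<Sum>k<t. c' k (y(j := x)) * x ^ k) = 0"
        using insert.prems(1)[of "y(j := x)"] unfolding exp by (simp only: fun_upd_same)
      moreover have "c' k (y(j := x)) = c' k y" for k
        unfolding c'_def using insert.hyps by (intro sum.cong prod.cong arg_cong2[of _ _ _ _ "(*)"]) auto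
      ultimately show ?thesis by (simp add: poly_sum poly_monom)
    qed
    then have "(\<Sum>k<t. monom (c' k y) k) = 0" using poly_all_0_iff_0 by blast
    then have "coeff (\<Sum>k<t. monom (c' k y) k) k = 0" by simp
    then show ?thesis using that by (simp add: coeff_sum if_distrib sum.delta cong: if_cong)
  qed
  have mu: "\<mu> j < t" "restrict \<mu> J \<in> J \<rightarrow>\<^sub>E {..<t}"
    using insert.prems(2) by auto
  have "c ((restrict \<mu> J)(j := \<mu> j)) = 0"
    using insert.IH[of "\<lambda>\<nu>. c (\<nu>(j := \<mu> j))"] c'[OF mu(1)] mu(2) unfolding c'_def by blast
  moreover have "(restrict \<mu> J)(j := \<mu> j) = \<mu>"
    using insert.prems(2) by (auto simp: fun_eq_iff PiE_def extensional_def)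
  ultimately show ?case by simp
qed

text \<open>The exponents are bounded in each variable separately, so that the number of monomials
  is the plain power \<open>(e + 1) ^ card I\<close>.\<close>

definition mono_span :: "'i set \<Rightarrow> nat \<Rightarrow> (('i \<Rightarrow> complex) \<Rightarrow> complex) set" where
  "mono_span I e = {f. \<exists>c. \<forall>x. f x = (\<Sum>\<alpha>\<in>I \<rightarrow>\<^sub>E {..e}. c \<alpha> * (\<Prod>i\<in>I. x i ^ \<alpha> i))}"

lemma mono_span_intro:
  assumes "finite I" "finite A" "\<And>a i. a \<in> A \<Longrightarrow> i \<in> I \<Longrightarrow> \<epsilon> a i \<le> e"
    "\<And>x. f x = (\<Sum>a\<in>A. c a * (\<Prod>i\<in>I. x i ^ \<epsilon> a i))"
  shows "f \<in> mono_span I e"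
proof -
  define g where "g a = restrict (\<epsilon> a) I" for a
  have "f x = (\<Sum>\<alpha>\<in>I \<rightarrow>\<^sub>E {..e}. (\<Sum>a\<in>{a \<in> A. g a = \<alpha>}. c a) * (\<Prod>i\<in>I. x i ^ \<alpha> i))" for x
  proof -
    have "f x = (\<Sum>a\<in>A. c a * (\<Prod>i\<in>I. x i ^ g a i))"
      unfolding assms(4) by (intro sum.cong arg_cong2[of _ _ _ _ "(*)"] prod.cong) (auto simp: g_def)
    also have "\<dots> = (\<Sum>\<alpha>\<in>I \<rightarrow>\<^sub>E {..e}. \<Sum>a\<in>{a \<in> A. g a = \<alpha>}. c a * (\<Prod>i\<in>I. x i ^ g a i))"
      by (rule sum.group[symmetric]) (use assms in \<open>auto simp: g_def intro!: finite_PiE\<close>)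
    also have "\<dots> = (\<Sum>\<alpha>\<in>I \<rightarrow>\<^sub>E {..e}. (\<Sum>a\<in>{a \<in> A. g a = \<alpha>}. c a) * (\<Prod>i\<in>I. x i ^ \<alpha> i))"
      unfolding sum_distrib_right by (intro sum.cong) auto
    finally show ?thesis .
  qed
  then show ?thesis unfolding mono_span_def by (intro CollectI exI allI)
qed

lemma mono_span_mono:
  assumes "finite I" "f \<in> mono_span I e" "e \<le> e'"
  shows "f \<in> mono_span I e'"
proof -
  obtain c where c: "\<And>x. f x = (\<Sum>\<alpha>\<in>I \<rightarrow>\<^sub>E {..e}. c \<alpha> * (\<Prod>i\<in>I. x i ^ \<alpha> i))"
    using assms(2) unfolding mono_span_def by blast
  show ?thesis
    by (rule mono_span_intro[OF assms(1) _ _ c]) (use assms(1,3) in \<open>auto intro!: finite_PiE dest!: PiE_mem\<close>)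
qed

lemma mono_span_add:
  assumes "f \<in> mono_span I e" "g \<in> mono_span I e"
  shows "(\<lambda>x. f x + g x) \<in> mono_span I e"
proof -
  obtain c d where "\<And>x. f x = (\<Sum>\<alpha>\<in>I \<rightarrow>\<^sub>E {..e}. c \<alpha> * (\<Prod>i\<in>I. x i ^ \<alpha> i))"
    "\<And>x. g x = (\<Sum>\<alpha>\<in>I \<rightarrow>\<^sub>E {..e}. d \<alpha> * (\<Prod>i\<in>I. x i ^ \<alpha> i))"
    using assms unfolding mono_span_def by blast
  then have "f x + g x = (\<Sum>\<alpha>\<in>I \<rightarrow>\<^sub>E {..e}. (c \<alpha> + d \<alpha>) * (\<Prod>i\<in>I. x i ^ \<alpha> i))" for x
    by (simp add: ring_distribs sum.distrib)
  then show ?thesis unfolding mono_span_def by (intro CollectI exI allI)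
qed

lemma mono_span_mult:
  assumes "finite I" "f \<in> mono_span I e" "g \<in> mono_span I e'"
  shows "(\<lambda>x. f x * g x) \<in> mono_span I (e + e')"
proof -
  obtain c d where c: "\<And>x. f x = (\<Sum>\<alpha>\<in>I \<rightarrow>\<^sub>E {..e}. c \<alpha> * (\<Prod>i\<in>I. x i ^ \<alpha> i))"
    and d: "\<And>x. g x = (\<Sum>\<alpha>\<in>I \<rightarrow>\<^sub>E {..e'}. d \<alpha> * (\<Prod>i\<in>I. x i ^ \<alpha> i))"
    using assms unfolding mono_span_def by blast
  show ?thesis
  proof (rule mono_span_intro[OF assms(1)])
    show "f x * g x = (\<Sum>a\<in>(I \<rightarrow>\<^sub>E {..e}) \<times> (I \<rightarrow>\<^sub>E {..e'}). (c (fst a) * d (snd a)) *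
        (\<Prod>i\<in>I. x i ^ (fst a i + snd a i)))" for x
      unfolding c d sum_product sum.cartesian_product
      by (intro sum.cong) (auto simp: power_add prod.distrib)
  qed (use assms(1) in \<open>auto intro!: finite_PiE add_mono dest!: PiE_mem\<close>)
qed

lemma poly_fun_mono_span:
  assumes "f \<in> poly_fun I" "finite I"
  shows "\<exists>e. f \<in> mono_span I e"
  using assms(1)
proof (induction rule: poly_fun.induct)
  case (const c)
  have "(\<lambda>x. c) \<in> mono_span I 0"
    by (rule mono_span_intro[of I "{()}" "\<lambda>_ _. 0" _ _ "\<lambda>_. c"]) (use assms(2) in auto)
  then show ?case by blast
next
  case (coord j)
  have "(\<lambda>x. x j) \<in> mono_span I 1"
  proof (rule mono_span_intro[of I "{()}" "\<lambda>_ i. of_bool (i = j)" _ _ "\<lambda>_. 1"])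
    fix x :: "'a \<Rightarrow> complex"
    have "(\<Prod>i\<in>I. x i ^ of_bool (i = j)) = (\<Prod>i\<in>I. if i = j then x i else 1)"
      by (intro prod.cong) auto
    then show "x j = (\<Sum>a\<in>{()}. 1 * (\<Prod>i\<in>I. x i ^ of_bool (i = j)))" using coord assms(2) by simp
  qed (use assms(2) in auto)
  then show ?case by blast
next
  case (add f g)
  then obtain e e' where "f \<in> mono_span I e" "g \<in> mono_span I e'" by blast
  then have "(\<lambda>x. f x + g x) \<in> mono_span I (max e e')"
    by (intro mono_span_add) (auto intro: mono_span_mono[OF assms(2)])
  then show ?case by blast
next
  case (mult f g)
  then show ?case using mono_span_mult[OF assms(2)] by blast
qed

lemma mono_span_one: "finite I \<Longrightarrow> (\<lambda>x. 1) \<in> mono_span I e"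
  by (rule mono_span_intro[of I "{()}" "\<lambda>_ _. 0" _ _ "\<lambda>_. 1"]) auto

lemma mono_span_power:
  assumes "finite I" "f \<in> mono_span I e"
  shows "(\<lambda>x. f x ^ k) \<in> mono_span I (k * e)"
proof (induction k)
  case (Suc k)
  then show ?case using mono_span_mult[OF assms Suc] by simp
qed (simp add: mono_span_one[OF assms(1)])

lemma mono_span_prod:
  assumes "finite I" "finite J" "\<And>j. j \<in> J \<Longrightarrow> f j \<in> mono_span I e"
  shows "(\<lambda>x. \<Prod>j\<in>J. f j x) \<in> mono_span I (card J * e)"
  using assms(2,3)
proof (induction J rule: finite_induct)
  case (insert j J)
  then show ?case using mono_span_mult[OF assms(1), of "f j" e "\<lambda>x. \<Prod>j\<in>J. f j x" "card J * e"] by simp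
qed (simp add: mono_span_one[OF assms(1)])

text \<open>A dimension count. The products of powers of the \<open>F x j\<close> with exponents
  below \<open>t\<close> number \<open>t ^ card J\<close>, while the monomials needed to express
  them grow only like a constant times \<open>t ^ card I\<close>. For large \<open>t\<close> the
  products are linearly dependent, and \<open>monomials_independent\<close> shows that the
  dependence is a nonzero polynomial.\<close>

lemma algebraic_relation_exists:
  fixes F :: "('i \<Rightarrow> complex) \<Rightarrow> 'j \<Rightarrow> complex"
  assumes "finite I" "finite J" "card I < card J" "\<And>j. j \<in> J \<Longrightarrow> (\<lambda>x. F x j) \<in> poly_fun I"
  shows "\<exists>P\<in>poly_fun J. (\<forall>x. P (F x) = 0) \<and> (\<exists>y. P y \<noteq> 0)"
proof -
  have "\<exists>e. \<forall>j\<in>J. (\<lambda>x. F x j) \<in> mono_span I e"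
  proof -
    have "\<forall>j\<in>J. \<exists>e. (\<lambda>x. F x j) \<in> mono_span I e"
      using poly_fun_mono_span[OF assms(4) assms(1)] by blast
    then obtain e where e: "\<forall>j\<in>J. (\<lambda>x. F x j) \<in> mono_span I (e j)" by metis
    have "(\<lambda>x. F x j) \<in> mono_span I (Max (e ` J))" if "j \<in> J" for j
      by (rule mono_span_mono[OF assms(1)]) (use e that assms(2) in auto)
    then show ?thesis by blast
  qed
  then obtain e where e: "\<And>j. j \<in> J \<Longrightarrow> (\<lambda>x. F x j) \<in> mono_span I e" by blast
  \<comment> \<open>The monomial count is at most \<open>(a * t) ^ card I\<close>; a number
    \<open>t\<close> above \<open>a ^ card I\<close> makes this smaller than
    \<open>t ^ (card I + 1)\<close>.\<close>
  define a where "a = Suc (card J * e)"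
  define t where "t = Suc (a ^ card I)"
  let ?A = "J \<rightarrow>\<^sub>E {..<t}" and ?B = "I \<rightarrow>\<^sub>E {..card J * (t * e)}"
  have "(\<lambda>x. \<Prod>j\<in>J. F x j ^ \<mu> j) \<in> mono_span I (card J * (t * e))" if "\<mu> \<in> ?A" for \<mu>
  proof (rule mono_span_prod[OF assms(1,2)])
    fix j assume j: "j \<in> J"
    have "\<mu> j * e \<le> t * e" using that j by (intro mult_right_mono) (auto dest!: PiE_mem)
    then show "(\<lambda>x. F x j ^ \<mu> j) \<in> mono_span I (t * e)"
      using mono_span_mono[OF assms(1) mono_span_power[OF assms(1) e[OF j]]] by blast
  qed
  then have "\<forall>\<mu>\<in>?A. \<exists>c. \<forall>x. (\<Prod>j\<in>J. F x j ^ \<mu> j) = (\<Sum>\<alpha>\<in>?B. c \<alpha> * (\<Prod>i\<in>I. x i ^ \<alpha> i))"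
    by (simp add: mono_span_def)
  from bchoice[OF this] obtain u where
    "\<forall>\<mu>\<in>?A. \<forall>x. (\<Prod>j\<in>J. F x j ^ \<mu> j) = (\<Sum>\<alpha>\<in>?B. u \<mu> \<alpha> * (\<Prod>i\<in>I. x i ^ \<alpha> i))" ..
  then have u: "(\<Prod>j\<in>J. F x j ^ \<mu> j) = (\<Sum>\<alpha>\<in>?B. u \<mu> \<alpha> * (\<Prod>i\<in>I. x i ^ \<alpha> i))" if "\<mu> \<in> ?A" for \<mu> x
    using that by simp
  have "card ?B = Suc (card J * (t * e)) ^ card I" using assms(1) by (simp add: card_PiE)
  also have "\<dots> \<le> (a * t) ^ card I"
    by (intro power_mono) (auto simp: a_def t_def algebra_simps)
  also have "\<dots> < t ^ Suc (card I)"
    by (simp add: power_mult_distrib) (simp add: t_def)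
  also have "\<dots> \<le> t ^ card J" using assms(3) by (intro power_increasing) (auto simp: t_def)
  also have "\<dots> = card ?A" using assms(2) by (simp add: card_PiE)
  finally have "card ?B < card ?A" .
  then obtain c where c: "\<exists>\<mu>\<in>?A. c \<mu> \<noteq> 0" "\<forall>\<alpha>\<in>?B. (\<Sum>\<mu>\<in>?A. c \<mu> * u \<mu> \<alpha>) = 0"
    using linear_relation_exists[of ?B ?A u] assms(1,2) by (auto intro!: finite_PiE)
  define P where "P y = (\<Sum>\<mu>\<in>?A. c \<mu> * (\<Prod>j\<in>J. y j ^ \<mu> j))" for y
  have "P \<in> poly_fun J" unfolding P_def by (intro poly_fun_intros)
  moreover have "P (F x) = 0" for x
  proof -
    have "P (F x) = (\<Sum>\<mu>\<in>?A. \<Sum>\<alpha>\<in>?B. c \<mu> * u \<mu> \<alpha> * (\<Prod>i\<in>I. x i ^ \<alpha> i))"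
      unfolding P_def by (intro sum.cong refl) (simp add: u sum_distrib_left mult_ac)
    also have "\<dots> = (\<Sum>\<alpha>\<in>?B. (\<Sum>\<mu>\<in>?A. c \<mu> * u \<mu> \<alpha>) * (\<Prod>i\<in>I. x i ^ \<alpha> i))"
      by (subst sum.swap) (simp add: sum_distrib_right)
    finally show ?thesis using c(2) by simp
  qed
  moreover have "\<exists>y. P y \<noteq> 0"
  proof (rule ccontr)
    assume "\<not> ?thesis"
    then have "P y = 0" for y by simp
    then have "c \<mu> = 0" if "\<mu> \<in> ?A" for \<mu>
      using monomials_independent[OF assms(2) _ that, of c] unfolding P_def by simp
    then show False using c(1) by simp
  qed
  ultimately show ?thesis by blast
qed


section \<open>Algebraic independence on a set of points, and tangent vectors\<close>

definition alg_indep_on :: "'x set \<Rightarrow> 'j set \<Rightarrow> ('x \<Rightarrow> 'j \<Rightarrow> complex) \<Rightarrow> bool" where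
  "alg_indep_on X J F \<longleftrightarrow> (\<forall>P\<in>poly_fun J. (\<forall>x\<in>X. P (F x) = 0) \<longrightarrow> (\<forall>y. P y = 0))"

lemma alg_indep_onD:
  "alg_indep_on X J F \<Longrightarrow> P \<in> poly_fun J \<Longrightarrow> (\<And>x. x \<in> X \<Longrightarrow> P (F x) = 0) \<Longrightarrow> P y = 0"
  unfolding alg_indep_on_def by blast

text \<open>Moving \<open>y i\<close> alone leaves \<open>p y\<close> unchanged, so the partial
  derivative is that of a univariate polynomial.\<close>

lemma pdiff_polyfam:
  assumes "p \<in> polyfam C n" "i \<notin> C" "finite C"
  shows "pdiff (insert i C) (\<lambda>y. poly (p y) (y i)) i x = poly (pderiv (p x)) (x i)"
proof -
  let ?D = "insert i C" and ?R = "\<lambda>y. poly (p y) (y i)"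
  define \<delta> where "\<delta> t = x(i := x i + t)" for t :: complex
  have R: "?R \<in> poly_fun ?D"
    by (rule polyfam_imp_poly_fun[OF assms(1)]) (auto intro: poly_fun.coord)
  have "((\<lambda>t. ?R (\<delta> t)) has_field_derivative (\<Sum>d\<in>?D. pdiff ?D ?R d (\<delta> 0) * of_bool (d = i))) (at 0)"
  proof (rule pdiff_deriv[OF R])
    fix d
    show "((\<lambda>t. \<delta> t d) has_field_derivative of_bool (d = i)) (at 0)"
      by (cases "d = i") (auto simp: \<delta>_def intro!: derivative_eq_intros)
  qed (use assms in simp)
  moreover have "(\<Sum>d\<in>?D. pdiff ?D ?R d (\<delta> 0) * of_bool (d = i)) = pdiff ?D ?R i x"
    using assms by (subst sum.insert) (auto simp: \<delta>_def intro!: sum.neutral)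
  ultimately have "((\<lambda>t. ?R (\<delta> t)) has_field_derivative pdiff ?D ?R i x) (at 0)" by simp
  moreover have "?R (\<delta> t) = poly (p x) (x i + t)" for t
  proof -
    have "p (\<delta> t) = p x" by (rule polyfam_cong[OF assms(1)]) (use assms in \<open>auto simp: \<delta>_def\<close>)
    then show ?thesis by (simp add: \<delta>_def)
  qed
  moreover have "((\<lambda>t. poly (p x) (x i + t)) has_field_derivative poly (pderiv (p x)) (x i)) (at 0)"
  proof -
    have "((\<lambda>t. poly (p x) (x i + t)) has_field_derivative poly (pderiv (p x)) (x i + 0) * 1) (at 0)"
      by (rule DERIV_chain2[OF poly_DERIV]) (auto intro!: derivative_eq_intros)
    then show ?thesis by simp
  qed
  ultimately show ?thesis using DERIV_unique by simp
qed

text \<open>A relation of least degree is separable, as the characteristic is zero.\<close>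

lemma separable_relation_exists:
  assumes "alg_indep_on X C \<Phi>" "p \<in> polyfam C n" "\<And>x. x \<in> X \<Longrightarrow> poly (p (\<Phi> x)) (\<tau> x) = 0" "p y \<noteq> 0"
  shows "\<exists>n. \<exists>p\<in>polyfam C n. (\<forall>x\<in>X. poly (p (\<Phi> x)) (\<tau> x) = 0) \<and>
    (\<exists>x\<in>X. poly (pderiv (p (\<Phi> x))) (\<tau> x) \<noteq> 0)"
  using assms(2-4)
proof (induction n arbitrary: p y rule: less_induct)
  case (less n)
  show ?case
  proof (cases "\<exists>x\<in>X. poly (pderiv (p (\<Phi> x))) (\<tau> x) \<noteq> 0")
    case True
    then show ?thesis using less.prems by blast
  next
    case van: False
    have n: "n \<noteq> 0" if "pderiv (p y) \<noteq> 0" for y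
      using that polyfam_degree[OF less.prems(1), of y] by (auto simp: pderiv_eq_0_iff)
    show ?thesis
    proof (cases "\<exists>y. pderiv (p y) \<noteq> 0")
      case True
      then obtain y where y: "pderiv (p y) \<noteq> 0" by blast
      show ?thesis
        by (rule less.IH[of "n - 1" "\<lambda>x. pderiv (p x)" y, OF _ polyfam_pderiv[OF less.prems(1)]])
          (use n[OF y] y van in auto)
    next
      case False
      have const: "p y = [:coeff (p y) 0:]" for y
        using False degree_0_id[of "p y"] by (auto simp: pderiv_eq_0_iff)
      have "coeff (p y) 0 = 0"
      proof (rule alg_indep_onD[OF assms(1) polyfam_coeff[OF less.prems(1)]])
        fix x assume "x \<in> X"
        then show "coeff (p (\<Phi> x)) 0 = 0"
          using less.prems(2)[of x] const[of "\<Phi> x"] by (metis poly_const_conv poly_0_coeff_0 mult_zero_right add.right_neutral poly_pCons poly_0)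
      qed
      then show ?thesis using const[of y] less.prems(3) by simp
    qed
  qed
qed

text \<open>Source coordinates are added to \<open>F\<close> as long as the system stays
  algebraically independent. It has at most \<open>card I\<close> members, and every other
  coordinate is algebraic over a maximal one. At a point where the separable relations have nonzero
  derivative, a tangent vector annihilated by the whole system is zero: differentiating the relation
  of a coordinate leaves only the entry of the vector there. The function \<open>h\<close> lets the
  point avoid a given hypersurface.\<close>

lemma alg_indep_tangent_bound:
  fixes F :: "('p \<Rightarrow> complex) \<Rightarrow> nat \<Rightarrow> complex"
  assumes I: "finite I" and F: "\<And>j. j < k \<Longrightarrow> (\<lambda>x. F x j) \<in> poly_fun I"
    and indep: "alg_indep_on UNIV {..<k} F"
    and h: "h \<in> poly_fun I" "h x0 \<noteq> 0"
  shows "\<exists>q. \<exists>S\<subseteq>I. h q \<noteq> 0 \<and> k + card S \<le> card I \<and>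
    (\<forall>v. (\<forall>j<k. dir_deriv I (\<lambda>x. F x j) q v = 0) \<and> (\<forall>i\<in>S. v i = 0) \<longrightarrow> (\<forall>i\<in>I. v i = 0))"
proof -
  define \<Phi> :: "('p \<Rightarrow> complex) \<Rightarrow> nat + 'p \<Rightarrow> complex" where "\<Phi> x = case_sum (F x) x" for x
  define J :: "'p set \<Rightarrow> (nat + 'p) set" where "J S = Inl ` {..<k} \<union> Inr ` S" for S
  have \<Phi>poly: "(\<lambda>x. \<Phi> x d) \<in> poly_fun I" if "S \<subseteq> I" "d \<in> J S" for S d
    using that F by (auto simp: J_def \<Phi>_def intro!: poly_fun.coord)
  define \<S> where "\<S> = {S. S \<subseteq> I \<and> alg_indep_on UNIV (J S) \<Phi>}"
  have "alg_indep_on UNIV (J {}) \<Phi>"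
    unfolding alg_indep_on_def
  proof (intro ballI impI allI)
    fix P and y :: "nat + 'p \<Rightarrow> complex" assume P: "P \<in> poly_fun (J {})" "\<forall>x\<in>UNIV. P (\<Phi> x) = 0"
    have cong: "P z = P (case_sum (z \<circ> Inl) (\<lambda>_. 0))" for z
      by (rule poly_fun_cong[OF P(1)]) (auto simp: J_def)
    have "P (case_sum (y \<circ> Inl) (\<lambda>_. 0)) = 0"
    proof (rule alg_indep_onD[OF indep, of "\<lambda>y. P (case_sum y (\<lambda>_. 0))"])
      show "(\<lambda>y. P (case_sum y (\<lambda>_. 0))) \<in> poly_fun {..<k}"
        by (rule poly_fun_compose[OF P(1)]) (auto simp: J_def intro: poly_fun.coord)
      show "P (case_sum (F x) (\<lambda>_. 0)) = 0" for x
        using P(2) cong[of "\<Phi> x"] by (simp add: \<Phi>_def comp_def)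
    qed
    then show "P y = 0" by (subst cong) simp
  qed
  then have "{} \<in> \<S>" by (simp add: \<S>_def)
  moreover have "finite \<S>" using I by (simp add: \<S>_def)
  ultimately obtain S where S: "S \<in> \<S>" "\<And>T. T \<in> \<S> \<Longrightarrow> S \<subseteq> T \<Longrightarrow> S = T"
    using finite_has_maximal[of \<S>] by blast
  have SI: "S \<subseteq> I" and Sind: "alg_indep_on UNIV (J S) \<Phi>" using S(1) by (auto simp: \<S>_def)
  have fin: "finite S" "finite (J S)" using SI I by (auto simp: J_def dest: finite_subset)
  have "card (J S) = k + card S"
    unfolding J_def by (subst card_Un_disjoint) (use fin in \<open>auto simp: card_image\<close>)
  moreover have "card (J S) \<le> card I"
  proof (rule ccontr)
    assume "\<not> ?thesis"
    then have "\<exists>P\<in>poly_fun (J S). (\<forall>x. P (\<Phi> x) = 0) \<and> (\<exists>y. P y \<noteq> 0)"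
      using I fin \<Phi>poly[OF SI] by (intro algebraic_relation_exists) auto
    then show False using Sind unfolding alg_indep_on_def by blast
  qed
  ultimately have card: "k + card S \<le> card I" by simp
  have "\<exists>n. \<exists>p\<in>polyfam (J S) n. (\<forall>x. poly (p (\<Phi> x)) (x i) = 0) \<and>
      (\<exists>x. poly (pderiv (p (\<Phi> x))) (x i) \<noteq> 0)" if i: "i \<in> I - S" for i
  proof -
    have iJ: "Inr i \<notin> J S" using i by (auto simp: J_def)
    have "insert i S \<notin> \<S>" using S(2)[of "insert i S"] i by auto
    then have "\<not> alg_indep_on UNIV (J (insert i S)) \<Phi>" using SI i by (simp add: \<S>_def)
    moreover have "J (insert i S) = insert (Inr i) (J S)" by (auto simp: J_def)
    ultimately obtain P y where P: "P \<in> poly_fun (insert (Inr i) (J S))" "\<And>x. P (\<Phi> x) = 0" "P y \<noteq> 0"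
      unfolding alg_indep_on_def by auto
    obtain n p where p: "p \<in> polyfam (J S) n" "\<And>y t. P (y(Inr i := t)) = poly (p y) t"
      using poly_fun_insert_polyfam[OF P(1) iJ] by blast
    have "poly (p (\<Phi> x)) (x i) = 0" for x
    proof -
      have "(\<Phi> x)(Inr i := x i) = \<Phi> x" by (auto simp: \<Phi>_def)
      then show ?thesis using p(2)[of "\<Phi> x" "x i"] P(2) by simp
    qed
    moreover have "p y \<noteq> 0" using p(2)[of y "y (Inr i)"] P(3) by auto
    ultimately show ?thesis
      using separable_relation_exists[OF Sind p(1), of "\<lambda>x. x i" y] by simp
  qed
  then have "\<forall>i\<in>I - S. \<exists>p. (\<exists>n. p \<in> polyfam (J S) n) \<and> (\<forall>x. poly (p (\<Phi> x)) (x i) = 0) \<and>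
      (\<exists>x. poly (pderiv (p (\<Phi> x))) (x i) \<noteq> 0)" by blast
  from bchoice[OF this] obtain p where p: "\<And>i. i \<in> I - S \<Longrightarrow> \<exists>n. p i \<in> polyfam (J S) n"
    "\<And>i x. i \<in> I - S \<Longrightarrow> poly (p i (\<Phi> x)) (x i) = 0"
    "\<And>i. i \<in> I - S \<Longrightarrow> \<exists>x. poly (pderiv (p i (\<Phi> x))) (x i) \<noteq> 0" by blast
  \<comment> \<open>The derivative of the i-th relation with respect to its own coordinate. As each
    of these functions is somewhere nonzero, some point avoids all their zero sets together with
    that of \<open>h\<close>.\<close>
  define \<theta> where "\<theta> i x = poly (pderiv (p i (\<Phi> x))) (x i)" for i x
  have \<theta>: "\<theta> i \<in> poly_fun I" if i: "i \<in> I - S" for i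
  proof -
    obtain n where n: "p i \<in> polyfam (J S) n" using p(1)[OF i] by blast
    have P: "(\<lambda>y. poly (pderiv (p i y)) (y (Inr i))) \<in> poly_fun (J (insert i S))"
      by (rule polyfam_imp_poly_fun[OF polyfam_pderiv[OF n]]) (auto simp: J_def intro: poly_fun.coord)
    have "insert i S \<subseteq> I" using i SI by auto
    from poly_fun_compose[OF P \<Phi>poly[OF this]]
    have "(\<lambda>x. poly (pderiv (p i (\<Phi> x))) (\<Phi> x (Inr i))) \<in> poly_fun I" .
    then show ?thesis by (simp add: \<theta>_def[abs_def] \<Phi>_def)
  qed
  have "\<exists>x. (\<Prod>i\<in>I - S. \<theta> i x) \<noteq> 0"
    using poly_fun_domain_prod[of "I - S" \<theta> I] I \<theta> p(3) by (simp add: \<theta>_def)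
  then obtain x1 where "(\<Prod>i\<in>I - S. \<theta> i x1) \<noteq> 0" by blast
  with h obtain q where "h q * (\<Prod>i\<in>I - S. \<theta> i q) \<noteq> 0"
    using poly_fun_domain[OF h(1) poly_fun_prod[of "I - S" \<theta> I]] \<theta> by blast
  then have q: "h q \<noteq> 0" "\<And>i. i \<in> I - S \<Longrightarrow> \<theta> i q \<noteq> 0" using I by auto
  have "v i = 0" if v: "\<forall>j<k. dir_deriv I (\<lambda>x. F x j) q v = 0" "\<forall>i\<in>S. v i = 0" and i: "i \<in> I" for v i
  proof (cases "i \<in> S")
    case False
    then have i: "i \<in> I - S" using i by simp
    obtain n where n: "p i \<in> polyfam (J S) n" using p(1)[OF i] by blast
    have iJ: "Inr i \<notin> J S" using i by (auto simp: J_def)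
    let ?D = "insert (Inr i) (J S)" and ?R = "\<lambda>y. poly (p i y) (y (Inr i))"
    \<comment> \<open>Along this line the components in \<open>J S\<close> have derivative zero at 0
      by the assumptions on \<open>v\<close>, while the relation vanishes identically; so its
      derivative, \<open>\<theta> i q * v i\<close>, is zero.\<close>
    define \<gamma> where "\<gamma> t = \<Phi> (\<lambda>i. q i + t * v i)" for t
    have \<gamma>0: "\<gamma> 0 = \<Phi> q" by (simp add: \<gamma>_def)
    have R: "?R \<in> poly_fun ?D"
      by (rule polyfam_imp_poly_fun[OF n]) (auto intro: poly_fun.coord)
    have "((\<lambda>t. ?R (\<gamma> t)) has_field_derivative
        (\<Sum>d\<in>?D. pdiff ?D ?R d (\<gamma> 0) * (if d = Inr i then v i else 0))) (at 0)"
    proof (rule pdiff_deriv[OF R])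
      fix d assume "d \<in> ?D"
      then consider "d = Inr i" | j where "d = Inl j" "j < k" | s where "d = Inr s" "s \<in> S" "s \<noteq> i"
        using i by (auto simp: J_def)
      then show "((\<lambda>t. \<gamma> t d) has_field_derivative (if d = Inr i then v i else 0)) (at 0)"
      proof cases
        case 2
        then show ?thesis using dir_deriv_has_deriv[OF F I, of j q v] v(1) by (simp add: \<gamma>_def \<Phi>_def)
      qed (use v(2) in \<open>auto simp: \<gamma>_def \<Phi>_def intro!: derivative_eq_intros\<close>)
    qed (use fin in simp)
    moreover have "(\<Sum>d\<in>?D. pdiff ?D ?R d (\<gamma> 0) * (if d = Inr i then v i else 0)) = \<theta> i q * v i"
    proof -
      have "(\<Sum>d\<in>?D. pdiff ?D ?R d (\<gamma> 0) * (if d = Inr i then v i else 0)) = pdiff ?D ?R (Inr i) (\<Phi> q) * v i"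
        using fin iJ by (subst sum.insert) (auto simp: \<gamma>0 intro!: sum.neutral)
      also have "pdiff ?D ?R (Inr i) (\<Phi> q) = \<theta> i q"
        by (subst pdiff_polyfam[OF n iJ]) (use fin in \<open>auto simp: \<theta>_def \<Phi>_def\<close>)
      finally show ?thesis .
    qed
    moreover have "?R (\<gamma> t) = 0" for t
      using p(2)[OF i, of "\<lambda>i. q i + t * v i"] by (simp add: \<gamma>_def \<Phi>_def)
    ultimately have "((\<lambda>t. 0) has_field_derivative \<theta> i q * v i) (at 0)" by simp
    then have "\<theta> i q * v i = 0" using DERIV_unique DERIV_const by blast
    then show ?thesis using q(2)[OF i] by simp
  qed (use v in simp)
  then show ?thesis using q(1) card SI by blast
qed


section \<open>Dimension of the closure of the image of a polynomial map\<close>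

lemma zariski_closedI:
  assumes "f \<in> poly_fun I"
  shows "zariski_closed I {x \<in> coord_space I. f x = 0}"
  unfolding zariski_closed_def by (rule exI[of _ "{f}"]) (use assms in auto)

lemma zariski_closed_subset: "zariski_closed I Z \<Longrightarrow> Z \<subseteq> coord_space I"
  by (auto simp: zariski_closed_def)

lemma zariski_closed_separate:
  assumes "zariski_closed I Z" "x \<in> coord_space I" "x \<notin> Z"
  obtains f where "f \<in> poly_fun I" "\<And>z. z \<in> Z \<Longrightarrow> f z = 0" "f x \<noteq> 0"
  using assms unfolding zariski_closed_def by blast

lemma zariski_closure_eq:
  assumes "A \<subseteq> coord_space I"
  shows "zariski_closure I A = {x \<in> coord_space I. \<forall>f\<in>poly_fun I. (\<forall>a\<in>A. f a = 0) \<longrightarrow> f x = 0}" (is "_ = ?C")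
proof -
  have "zariski_closed I ?C"
    unfolding zariski_closed_def by (rule exI[of _ "{f \<in> poly_fun I. \<forall>a\<in>A. f a = 0}"]) auto
  moreover have "?C \<subseteq> Z" if Z: "zariski_closed I Z" "A \<subseteq> Z" for Z
  proof
    fix x assume x: "x \<in> ?C"
    show "x \<in> Z"
    proof (rule ccontr)
      assume "x \<notin> Z"
      then obtain f where "f \<in> poly_fun I" "\<And>z. z \<in> Z \<Longrightarrow> f z = 0" "f x \<noteq> 0"
        using zariski_closed_separate[OF Z(1)] x by blast
      then show False using x Z(2) by blast
    qed
  qed
  ultimately show ?thesis unfolding zariski_closure_def
    by (intro hull_unique) (use assms in auto)
qed

lemma zariski_closed_closure:
  assumes "A \<subseteq> coord_space I"
  shows "zariski_closed I (zariski_closure I A)"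
  unfolding zariski_closure_eq[OF assms] zariski_closed_def
  by (rule exI[of _ "{f \<in> poly_fun I. \<forall>a\<in>A. f a = 0}"]) auto

lemma zariski_closure_vanish:
  assumes "A \<subseteq> coord_space I" "f \<in> poly_fun I" "\<And>a. a \<in> A \<Longrightarrow> f a = 0" "x \<in> zariski_closure I A"
  shows "f x = 0"
  using assms by (simp add: zariski_closure_eq)

lemma subset_zariski_closure: "A \<subseteq> zariski_closure I A"
  unfolding zariski_closure_def by (rule hull_subset)

lemma zariski_closure_minimal: "zariski_closed I Z \<Longrightarrow> A \<subseteq> Z \<Longrightarrow> zariski_closure I A \<subseteq> Z"
  unfolding zariski_closure_def by (rule hull_minimal)

lemma zariski_closure_mono: "A \<subseteq> B \<Longrightarrow> zariski_closure I A \<subseteq> zariski_closure I B"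
  unfolding zariski_closure_def by (rule hull_mono)

lemma zariski_irreducible_prime:
  assumes "zariski_irreducible I Z" "Z \<subseteq> coord_space I" "f \<in> poly_fun I" "g \<in> poly_fun I"
    "\<And>x. x \<in> Z \<Longrightarrow> f x * g x = 0" "x1 \<in> Z" "f x1 \<noteq> 0" "x \<in> Z"
  shows "g x = 0"
proof -
  have "Z \<subseteq> {x \<in> coord_space I. f x = 0} \<union> {x \<in> coord_space I. g x = 0}"
    using assms(2,5) by fastforce
  then have "Z \<subseteq> {x \<in> coord_space I. f x = 0} \<or> Z \<subseteq> {x \<in> coord_space I. g x = 0}"
    using assms(1) zariski_closedI[OF assms(3)] zariski_closedI[OF assms(4)]
    unfolding zariski_irreducible_def by blast
  then show ?thesis using assms(6-8) by auto
qed

text \<open>If neither of two closed sets contains the range, each has an equation whose pullback is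
  a nonzero polynomial. The product of the pullbacks is then nonzero at some point, whose image lies
  in neither set.\<close>

lemma zariski_irreducible_closure_range:
  fixes \<phi> :: "('p \<Rightarrow> complex) \<Rightarrow> 'b \<Rightarrow> complex"
  assumes "\<And>b. b \<in> B \<Longrightarrow> (\<lambda>x. \<phi> x b) \<in> poly_fun I" "range \<phi> \<subseteq> coord_space B"
  shows "zariski_irreducible B (zariski_closure B (range \<phi>))"
  unfolding zariski_irreducible_def
proof (intro conjI allI impI)
  show "zariski_closure B (range \<phi>) \<noteq> {}" using subset_zariski_closure[of "range \<phi>" B] by blast
next
  fix A C assume *: "zariski_closed B A \<and> zariski_closed B C \<and> zariski_closure B (range \<phi>) \<subseteq> A \<union> C"
  show "zariski_closure B (range \<phi>) \<subseteq> A \<or> zariski_closure B (range \<phi>) \<subseteq> C"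
  proof (rule ccontr)
    assume "\<not> ?thesis"
    then have "\<not> range \<phi> \<subseteq> A" "\<not> range \<phi> \<subseteq> C" using * zariski_closure_minimal by blast+
    then obtain x y where "\<phi> x \<notin> A" "\<phi> y \<notin> C" by blast
    moreover have "\<phi> x \<in> coord_space B" for x using assms(2) by blast
    ultimately obtain f g where fg: "f \<in> poly_fun B" "\<And>z. z \<in> A \<Longrightarrow> f z = 0" "f (\<phi> x) \<noteq> 0"
      "g \<in> poly_fun B" "\<And>z. z \<in> C \<Longrightarrow> g z = 0" "g (\<phi> y) \<noteq> 0"
      using * zariski_closed_separate by metis
    have "\<exists>x. f (\<phi> x) * g (\<phi> x) \<noteq> 0"
      by (rule poly_fun_domain[of _ I _ x y]) (use fg assms(1) in \<open>auto intro: poly_fun_compose\<close>)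
    moreover have "\<phi> x \<in> A \<union> C" for x using * subset_zariski_closure[of "range \<phi>" B] by blast
    ultimately show False using fg(2,5) by (metis UnE mult_eq_0_iff)
  qed
qed

text \<open>In a relation for the enlarged system the part free of \<open>g\<close> vanishes on
  \<open>Z\<close>, where \<open>g\<close> is zero, and hence identically by independence on
  \<open>Z\<close>. What remains is divisible by \<open>g\<close>, and this factor may be cancelled
  on the irreducible set \<open>Z'\<close>; the induction is on the degree in
  \<open>g\<close>.\<close>

lemma alg_indep_extend:
  assumes irr: "zariski_irreducible I Z'" "Z' \<subseteq> coord_space I" and Z: "Z \<subseteq> Z'"
    and f: "\<And>j. j < l \<Longrightarrow> f j \<in> poly_fun I" "alg_indep_on Z {..<l} (\<lambda>x j. f j x)"
    and g: "g \<in> poly_fun I" "\<And>x. x \<in> Z \<Longrightarrow> g x = 0" "x1 \<in> Z'" "g x1 \<noteq> 0"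
  shows "alg_indep_on Z' {..<Suc l} (\<lambda>x j. (f(l := g)) j x)"
  unfolding alg_indep_on_def
proof (intro ballI impI allI)
  fix P y assume P: "P \<in> poly_fun {..<Suc l}" "\<forall>x\<in>Z'. P (\<lambda>j. (f(l := g)) j x) = 0"
  let ?f = "\<lambda>x j. f j x"
  have claim: "p y = 0" if "p \<in> polyfam {..<l} n" "\<And>x. x \<in> Z' \<Longrightarrow> poly (p (?f x)) (g x) = 0" for p n y
    using that
  proof (induction n arbitrary: p)
    case (0 p)
    have const: "p y = [:coeff (p y) 0:]" for y
      using polyfam_degree[OF 0(1), of y] by (intro degree_0_id[symmetric]) simp
    have "coeff (p y) 0 = 0"
    proof (rule alg_indep_onD[OF f(2) polyfam_coeff[OF 0(1)]])
      fix x assume "x \<in> Z"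
      then have "poly [:coeff (p (?f x)) 0:] (g x) = 0" using 0(2)[of x] Z const[of "?f x"] by auto
      then show "coeff (p (?f x)) 0 = 0" by simp
    qed
    then show ?case using const[of y] by simp
  next
    case (Suc n p)
    have c0: "coeff (p y) 0 = 0" for y
    proof (rule alg_indep_onD[OF f(2) polyfam_coeff[OF Suc.prems(1)]])
      fix x assume "x \<in> Z"
      then show "coeff (p (?f x)) 0 = 0"
        using Suc.prems(2)[of x] Z g(2)[of x] by (auto simp: poly_0_coeff_0)
    qed
    define p' where "p' y = poly_shift 1 (p y)" for y
    have p': "p' \<in> polyfam {..<l} n" unfolding p'_def using polyfam_shift[OF Suc.prems(1), of 1] by simp
    have pp': "p y = pCons 0 (p' y)" for y
    proof (rule poly_eqI)
      fix k show "coeff (p y) k = coeff (pCons 0 (p' y)) k"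
        using c0 by (cases k) (auto simp: p'_def coeff_poly_shift)
    qed
    have "p' y = 0"
    proof (rule Suc.IH[OF p'])
      fix x assume x: "x \<in> Z'"
      have poly: "(\<lambda>x. poly (p' (?f x)) (g x)) \<in> poly_fun I"
      proof -
        have "(\<lambda>y. poly (p' y) (y l)) \<in> poly_fun {..<Suc l}"
          by (rule polyfam_imp_poly_fun[OF p']) (auto intro: poly_fun.coord)
        then have "(\<lambda>x. (\<lambda>y. poly (p' y) (y l)) (\<lambda>j. (f(l := g)) j x)) \<in> poly_fun I"
          by (rule poly_fun_compose) (use f g in \<open>auto simp: less_Suc_eq\<close>)
        moreover have "p' (\<lambda>j. (f(l := g)) j x) = p' (?f x)" for x
          by (rule polyfam_cong[OF p']) auto
        ultimately show ?thesis by simp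
      qed
      show "poly (p' (?f x)) (g x) = 0"
        by (rule zariski_irreducible_prime[OF irr g(1) poly _ g(3,4) x])
          (use Suc.prems(2) pp' in auto)
    qed
    then show ?case by (simp add: pp')
  qed
  obtain n p where p: "p \<in> polyfam {..<l} n" "\<And>y t. P (y(l := t)) = poly (p y) t"
    using poly_fun_insert_polyfam[of P l "{..<l}"] P(1) by (auto simp: lessThan_Suc)
  have "p y = 0"
  proof (rule claim[OF p(1)])
    fix x assume x: "x \<in> Z'"
    have "(\<lambda>j. (f(l := g)) j x) = (?f x)(l := g x)" by auto
    then show "poly (p (?f x)) (g x) = 0" using P(2) x p(2)[of "?f x" "g x"] by auto
  qed
  then show "P y = 0" using p(2)[of y "y l"] by simp
qed

text \<open>Each strict inclusion supplies a function that vanishes on the smaller set but not on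
  the larger one, and such a function extends an independent system.\<close>

lemma irreducible_chain_alg_indep:
  assumes "\<And>l. l \<le> k \<Longrightarrow> zariski_closed I (C l) \<and> zariski_irreducible I (C l)" "\<And>l. l < k \<Longrightarrow> C l \<subset> C (Suc l)"
  shows "\<exists>f. (\<forall>j<k. f j \<in> poly_fun I) \<and> alg_indep_on (C k) {..<k} (\<lambda>x j. f j x)"
  using assms
proof (induction k)
  case 0
  then have "C 0 \<noteq> {}" by (auto simp: zariski_irreducible_def)
  then show ?case by (auto simp: alg_indep_on_def intro: poly_fun_cong[of _ "{}", THEN trans])
next
  case (Suc k)
  then obtain f where f: "\<forall>j<k. f j \<in> poly_fun I" "alg_indep_on (C k) {..<k} (\<lambda>x j. f j x)"
    by (metis less_SucI le_SucI)
  have sub: "C k \<subset> C (Suc k)" using Suc.prems by simp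
  then obtain x1 where x1: "x1 \<in> C (Suc k)" "x1 \<notin> C k" by blast
  have cs: "C (Suc k) \<subseteq> coord_space I" using Suc.prems(1) zariski_closed_subset by blast
  obtain g where g: "g \<in> poly_fun I" "\<And>z. z \<in> C k \<Longrightarrow> g z = 0" "g x1 \<noteq> 0"
    using zariski_closed_separate[of I "C k" x1] Suc.prems(1)[of k] x1 cs by auto
  have "alg_indep_on (C (Suc k)) {..<Suc k} (\<lambda>x j. (f(k := g)) j x)"
    by (rule alg_indep_extend[OF _ cs _ _ f(2) g(1) _ x1(1) g(3)]) (use Suc.prems(1)[of "Suc k"] sub f g in auto)
  moreover have "\<forall>j<Suc k. (f(k := g)) j \<in> poly_fun I" using f g by auto
  ultimately show ?case by blast
qed

text \<open>Functions independent on the top of the chain stay independent when pulled back to the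
  parameters. The tangent bound then yields coordinates \<open>S\<close> that determine every
  direction killed by the pullbacks. The kernel directions are of this kind and independent, so
  there are at most \<open>card S\<close> of them.\<close>

lemma chain_length_bound:
  fixes \<phi> :: "('p \<Rightarrow> complex) \<Rightarrow> 'b \<Rightarrow> complex" and \<kappa> :: "('p \<Rightarrow> complex) \<Rightarrow> 'k \<Rightarrow> 'p \<Rightarrow> complex"
  assumes fin: "finite I" "finite B" "finite K"
    and \<phi>: "\<And>b. b \<in> B \<Longrightarrow> (\<lambda>x. \<phi> x b) \<in> poly_fun I" "range \<phi> \<subseteq> coord_space B"
    and h: "h \<in> poly_fun I" "h x0 \<noteq> 0"
    and kernel: "\<And>x l b. h x \<noteq> 0 \<Longrightarrow> l \<in> K \<Longrightarrow> b \<in> B \<Longrightarrow>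
      ((\<lambda>t. \<phi> (\<lambda>i. x i + t * \<kappa> x l i) b) has_field_derivative 0) (at 0)"
    and indep: "\<And>x c l. h x \<noteq> 0 \<Longrightarrow> (\<And>i. i \<in> I \<Longrightarrow> (\<Sum>l\<in>K. c l * \<kappa> x l i) = 0) \<Longrightarrow> l \<in> K \<Longrightarrow> c l = 0"
    and C: "\<And>l. l \<le> k \<Longrightarrow> zariski_closed B (C l) \<and> zariski_irreducible B (C l)" "\<And>l. l < k \<Longrightarrow> C l \<subset> C (Suc l)"
      "C k \<subseteq> zariski_closure B (range \<phi>)"
  shows "k + card K \<le> card I"
proof -
  obtain f where f: "\<And>j. j < k \<Longrightarrow> f j \<in> poly_fun B" "alg_indep_on (C k) {..<k} (\<lambda>x j. f j x)"
    using irreducible_chain_alg_indep[of k B C] C(1,2) by blast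
  define F where "F x j = f j (\<phi> x)" for x j
  have F: "(\<lambda>x. F x j) \<in> poly_fun I" if "j < k" for j
    unfolding F_def by (rule poly_fun_compose[OF f(1)[OF that] \<phi>(1)])
  have "alg_indep_on UNIV {..<k} F"
    unfolding alg_indep_on_def
  proof (intro ballI impI allI)
    fix P y assume P: "P \<in> poly_fun {..<k}" "\<forall>x\<in>UNIV. P (F x) = 0"
    show "P y = 0"
    proof (rule alg_indep_onD[OF f(2) P(1)])
      fix x assume x: "x \<in> C k"
      have "(\<lambda>x. P (\<lambda>j. f j x)) \<in> poly_fun B" by (rule poly_fun_compose[OF P(1)]) (use f(1) in auto)
      then show "P (\<lambda>j. f j x) = 0"
        by (rule zariski_closure_vanish[OF \<phi>(2)]) (use P(2) x C(3) in \<open>auto simp: F_def[abs_def]\<close>)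
    qed
  qed
  then have "\<exists>q. \<exists>S\<subseteq>I. h q \<noteq> 0 \<and> k + card S \<le> card I \<and>
      (\<forall>v. (\<forall>j<k. dir_deriv I (\<lambda>x. F x j) q v = 0) \<and> (\<forall>i\<in>S. v i = 0) \<longrightarrow> (\<forall>i\<in>I. v i = 0))"
    by (intro alg_indep_tangent_bound[OF fin(1) F _ h])
  then obtain q S where S: "S \<subseteq> I" "h q \<noteq> 0" "k + card S \<le> card I"
    and inj': "\<forall>v. (\<forall>j<k. dir_deriv I (\<lambda>x. F x j) q v = 0) \<and> (\<forall>i\<in>S. v i = 0) \<longrightarrow> (\<forall>i\<in>I. v i = 0)"
    by (elim exE conjE)
  have inj: "v i = 0" if "\<And>j. j < k \<Longrightarrow> dir_deriv I (\<lambda>x. F x j) q v = 0" "\<And>i. i \<in> S \<Longrightarrow> v i = 0" "i \<in> I" for v i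
    using inj' that by simp
  have "card K \<le> card S"
  proof (rule ccontr)
    assume "\<not> ?thesis"
    then obtain c where c: "\<exists>l\<in>K. c l \<noteq> 0" "\<forall>i\<in>S. (\<Sum>l\<in>K. c l * \<kappa> q l i) = 0"
      using linear_relation_exists[of S K "\<kappa> q"] fin S(1) finite_subset[OF S(1)] by auto
    have "(\<Sum>l\<in>K. c l * \<kappa> q l i) = 0" if "i \<in> I" for i
    proof (rule inj[OF _ _ that])
      fix j assume j: "j < k"
      have "dir_deriv I (\<lambda>x. F x j) q (\<kappa> q l) = 0" if l: "l \<in> K" for l
      proof (rule dir_deriv_eq[OF F[OF j] fin(1)])
        have "((\<lambda>t. f j (\<phi> (\<lambda>i. q i + t * \<kappa> q l i))) has_field_derivative
           (\<Sum>b\<in>B. pdiff B (f j) b (\<phi> (\<lambda>i. q i + 0 * \<kappa> q l i)) * 0)) (at 0)"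
          by (rule pdiff_deriv[OF f(1)[OF j] fin(2)]) (rule kernel[OF S(2) l])
        then show "((\<lambda>t. F (\<lambda>i. q i + t * \<kappa> q l i) j) has_field_derivative 0) (at 0)"
          by (simp add: F_def)
      qed
      then show "dir_deriv I (\<lambda>x. F x j) q (\<lambda>i. \<Sum>l\<in>K. c l * \<kappa> q l i) = 0"
        by (simp add: dir_deriv_sum)
    qed (use c in simp)
    then show False using indep[OF S(2)] c(1) by blast
  qed
  then show ?thesis using S(3) by simp
qed

lemma poly_fun_affine_restrict: "(\<lambda>x. p j + (if j \<in> W then x j else 0)) \<in> poly_fun W"
  by (cases "j \<in> W") (auto intro: poly_fun.intros)

text \<open>On the smaller image, which depends on \<open>card W\<close> parameters, any
  \<open>card W + 1\<close> functions satisfy an algebraic relation. Releasing also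
  \<open>a0\<close> makes suitable linear functions of the output dominant, since the derivative at
  \<open>p\<close> is injective on the slice; so the relation fails on the larger image.\<close>

lemma closure_image_strict_mono:
  fixes \<phi> :: "('p \<Rightarrow> complex) \<Rightarrow> 'b \<Rightarrow> complex"
  assumes fin: "finite I" "finite B"
    and \<phi>: "\<And>b. b \<in> B \<Longrightarrow> (\<lambda>x. \<phi> x b) \<in> poly_fun I" "range \<phi> \<subseteq> coord_space B"
    and W: "insert a0 W \<subseteq> I" "a0 \<notin> W"
    and inj: "\<And>v i. (\<And>i. i \<notin> insert a0 W \<Longrightarrow> v i = 0) \<Longrightarrow>
      (\<And>b. b \<in> B \<Longrightarrow> ((\<lambda>t. \<phi> (\<lambda>i. p i + t * v i) b) has_field_derivative 0) (at 0)) \<Longrightarrow> v i = 0"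
  shows "zariski_closure B (range (\<lambda>x. \<phi> (\<lambda>i. p i + (if i \<in> W then x i else 0)))) \<subset>
    zariski_closure B (range (\<lambda>x. \<phi> (\<lambda>i. p i + (if i \<in> insert a0 W then x i else 0))))"
proof -
  let ?A = "insert a0 W"
  define \<Phi> where "\<Phi> W x = \<phi> (\<lambda>i. p i + (if i \<in> W then x i else 0))" for W x
  have finA: "finite ?A" by (rule finite_subset[OF W(1) fin(1)])
  have \<Phi>cs: "range (\<Phi> W) \<subseteq> coord_space B" for W using \<phi>(2) by (auto simp: \<Phi>_def)
  have \<Phi>poly: "(\<lambda>x. \<Phi> W x b) \<in> poly_fun W" if "b \<in> B" for W b
    unfolding \<Phi>_def by (rule poly_fun_compose[OF \<phi>(1)[OF that] poly_fun_affine_restrict])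
  have "\<Phi> W x \<in> range (\<Phi> ?A)" for x
  proof -
    have "\<Phi> W x = \<Phi> ?A (\<lambda>i. if i \<in> W then x i else 0)" 
      unfolding \<Phi>_def by (rule arg_cong[of _ _ \<phi>]) auto
    then show ?thesis by blast
  qed
  then have sub: "zariski_closure B (range (\<Phi> W)) \<subseteq> zariski_closure B (range (\<Phi> ?A))"
    by (intro zariski_closure_mono) auto
  have neq: False if eq: "zariski_closure B (range (\<Phi> ?A)) \<subseteq> zariski_closure B (range (\<Phi> W))"
  proof -
    define u where "u a b = dir_deriv I (\<lambda>x. \<phi> x b) p (\<lambda>i. of_bool (i = a))" for a b
    have lin: "dir_deriv I (\<lambda>x. \<phi> x b) p (\<lambda>i. if i \<in> ?A then v i else 0) = (\<Sum>a\<in>?A. v a * u a b)" for v b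
    proof -
      have "(\<Sum>a\<in>?A. v a * of_bool (i = a)) = (if i \<in> ?A then v i else 0)" for i
      proof -
        have "(\<Sum>a\<in>?A. v a * of_bool (i = a)) = (\<Sum>a\<in>?A. if a = i then v a else 0)"
          by (intro sum.cong) auto
        then show ?thesis using finA by (simp only: sum.delta)
      qed
      then have "(\<lambda>i. if i \<in> ?A then v i else 0) = (\<lambda>i. \<Sum>a\<in>?A. v a * of_bool (i = a))" by presburger
      then show ?thesis by (simp only: dir_deriv_sum u_def)
    qed
    have "\<exists>R. \<forall>a\<in>?A. \<forall>a'\<in>?A. (\<Sum>b\<in>B. R a b * u a' b) = of_bool (a = a')"
    proof (rule left_inverse_exists[OF finA fin(2)])
      fix c a assume c: "\<And>b. b \<in> B \<Longrightarrow> (\<Sum>a\<in>?A. c a * u a b) = 0" and a: "a \<in> ?A"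
      have "(\<lambda>i. if i \<in> ?A then c i else 0) a = 0"
      proof (rule inj)
        fix b assume b: "b \<in> B"
        show "((\<lambda>t. \<phi> (\<lambda>i. p i + t * (if i \<in> ?A then c i else 0)) b) has_field_derivative 0) (at 0)"
          using dir_deriv_has_deriv[OF \<phi>(1)[OF b] fin(1), of p "\<lambda>i. if i \<in> ?A then c i else 0"]
          by (simp only: lin c[OF b])
      qed simp
      then show "c a = 0" using a by simp
    qed
    then obtain R where R: "\<And>a a'. a \<in> ?A \<Longrightarrow> a' \<in> ?A \<Longrightarrow> (\<Sum>b\<in>B. R a b * u a' b) = of_bool (a = a')" by blast
    \<comment> \<open>Linear functions of the output whose derivative along the slice is the
      identity.\<close>
    define G where "G y a = (\<Sum>b\<in>B. R a b * y b)" for y a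
    have Gpoly: "(\<lambda>y. G y a) \<in> poly_fun B" for a
      unfolding G_def by (intro poly_fun_intros)
    have "card W < card ?A" "finite W" using finA W by auto
    then have "\<exists>P\<in>poly_fun ?A. (\<forall>x. P (G (\<Phi> W x)) = 0) \<and> (\<exists>y. P y \<noteq> 0)"
      by (intro algebraic_relation_exists[of W ?A] finA poly_fun_compose[OF Gpoly] \<Phi>poly)
    then obtain P y where P: "P \<in> poly_fun ?A" "\<And>x. P (G (\<Phi> W x)) = 0" "P y \<noteq> 0" by blast
    have "P (G (\<Phi> ?A x)) = 0" for x
    proof (rule zariski_closure_vanish[OF \<Phi>cs[of W], where f = "\<lambda>y. P (G y)"])
      show "(\<lambda>y. P (G y)) \<in> poly_fun B" by (rule poly_fun_compose[OF P(1) Gpoly])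
      show "\<Phi> ?A x \<in> zariski_closure B (range (\<Phi> W))" using eq subset_zariski_closure[of "range (\<Phi> ?A)" B] by blast
    qed (use P(2) in auto)
    then have "P y = 0"
    proof (rule surjective_derivative_imp_dominant[OF P(1), where a = "\<lambda>_. 0"])
      fix v
      show "\<exists>w. \<forall>a\<in>?A. ((\<lambda>t. G (\<Phi> ?A (\<lambda>i. 0 + t * w i)) a) has_field_derivative v a) (at 0)"
      proof (intro exI[of _ v] ballI)
        fix a assume a: "a \<in> ?A"
        let ?v = "\<lambda>i. if i \<in> ?A then v i else 0"
        have eq: "\<Phi> ?A (\<lambda>i. 0 + t * v i) = \<phi> (\<lambda>i. p i + t * ?v i)" for t
          unfolding \<Phi>_def by (intro arg_cong[of _ _ \<phi>]) auto
        have "((\<lambda>t. \<Sum>b\<in>B. R a b * \<phi> (\<lambda>i. p i + t * ?v i) b) has_field_derivative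
            (\<Sum>b\<in>B. R a b * dir_deriv I (\<lambda>x. \<phi> x b) p ?v)) (at 0)"
          by (intro DERIV_sum DERIV_cmult dir_deriv_has_deriv \<phi>(1) fin(1))
        also have "(\<Sum>b\<in>B. R a b * dir_deriv I (\<lambda>x. \<phi> x b) p ?v) = (\<Sum>b\<in>B. \<Sum>a'\<in>?A. v a' * (R a b * u a' b))"
          unfolding lin sum_distrib_left by (intro sum.cong refl) (simp add: mult_ac)
        also have "\<dots> = (\<Sum>a'\<in>?A. v a' * (\<Sum>b\<in>B. R a b * u a' b))"
          by (subst sum.swap) (simp only: sum_distrib_left)
        also have "\<dots> = (\<Sum>a'\<in>?A. if a' = a then v a' else 0)"
          by (intro sum.cong refl) (use R a in auto)
        also have "\<dots> = v a" using finA a by (simp only: sum.delta if_True)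
        finally show "((\<lambda>t. G (\<Phi> ?A (\<lambda>i. 0 + t * v i)) a) has_field_derivative v a) (at 0)"
          by (simp only: eq G_def)
      qed
    qed
    then show False using P(3) by simp
  qed
  show ?thesis using sub neq unfolding \<Phi>_def by blast
qed

text \<open>The kernel directions at all points with \<open>h\<close> nonzero bound the dimension
  from above, injectivity at the single point \<open>p\<close> bounds it from below, and the
  equation between the cardinalities makes the bounds meet.\<close>

lemma zariski_dim_closure_range:
  fixes \<phi> :: "('p \<Rightarrow> complex) \<Rightarrow> 'b \<Rightarrow> complex" and \<kappa> :: "('p \<Rightarrow> complex) \<Rightarrow> 'k \<Rightarrow> 'p \<Rightarrow> complex"
  assumes fin: "finite I" "finite B" "finite K"
    and \<phi>: "\<And>b. b \<in> B \<Longrightarrow> (\<lambda>x. \<phi> x b) \<in> poly_fun I" "range \<phi> \<subseteq> coord_space B"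
    and h: "h \<in> poly_fun I" "h x0 \<noteq> 0"
    and kernel: "\<And>x l b. h x \<noteq> 0 \<Longrightarrow> l \<in> K \<Longrightarrow> b \<in> B \<Longrightarrow>
      ((\<lambda>t. \<phi> (\<lambda>i. x i + t * \<kappa> x l i) b) has_field_derivative 0) (at 0)"
    and indep: "\<And>x c l. h x \<noteq> 0 \<Longrightarrow> (\<And>i. i \<in> I \<Longrightarrow> (\<Sum>l\<in>K. c l * \<kappa> x l i) = 0) \<Longrightarrow> l \<in> K \<Longrightarrow> c l = 0"
    and W: "W \<subseteq> I" "card W + card K = card I"
    and inj: "\<And>v i. (\<And>i. i \<notin> W \<Longrightarrow> v i = 0) \<Longrightarrow>
      (\<And>b. b \<in> B \<Longrightarrow> ((\<lambda>t. \<phi> (\<lambda>i. p i + t * v i) b) has_field_derivative 0) (at 0)) \<Longrightarrow> v i = 0"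
  shows "zariski_dim B (zariski_closure B (range \<phi>)) = card W"
proof -
  let ?X = "zariski_closure B (range \<phi>)"
  define chain where "chain k C \<longleftrightarrow> (\<forall>l\<le>k. zariski_closed B (C l) \<and> zariski_irreducible B (C l) \<and> C l \<subseteq> ?X) \<and>
     (\<forall>l<k. C l \<subset> C (Suc l))" for k and C :: "nat \<Rightarrow> ('b \<Rightarrow> complex) set"
  have upper: "k \<le> card W" if "chain k C" for k C
  proof -
    have "k + card K \<le> card I"
    proof (rule chain_length_bound[OF fin])
      show "l \<le> k \<Longrightarrow> zariski_closed B (C l) \<and> zariski_irreducible B (C l)" "l < k \<Longrightarrow> C l \<subset> C (Suc l)" for l
        using that by (auto simp: chain_def)
      show "C k \<subseteq> ?X" using that by (auto simp: chain_def)
    qed (fact \<phi> h kernel indep)+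
    then show ?thesis using W(2) by simp
  qed
  have finW: "finite W" using W fin finite_subset by blast
  obtain e where e: "bij_betw e {..<card W} W"
    using ex_bij_betw_nat_finite[OF finW] by (auto simp: atLeast0LessThan)
  \<comment> \<open>The parameters in \<open>W\<close> are released one at a time around
    \<open>p\<close>; the closures of the restricted images form the chain.\<close>
  define Wl where "Wl l = e ` {..<l}" for l
  define C where "C l = zariski_closure B (range (\<lambda>x. \<phi> (\<lambda>i. p i + (if i \<in> Wl l then x i else 0))))" for l
  have Wsub: "Wl l \<subseteq> W" if "l \<le> card W" for l using that e by (auto simp: Wl_def bij_betw_def)
  have "chain (card W) C"
    unfolding chain_def
  proof (intro conjI allI impI)
    fix l
    have cs: "range (\<lambda>x. \<phi> (\<lambda>i. p i + (if i \<in> Wl l then x i else 0))) \<subseteq> coord_space B" using \<phi>(2) by auto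
    show "zariski_closed B (C l)" unfolding C_def by (rule zariski_closed_closure[OF cs])
    show "zariski_irreducible B (C l)" unfolding C_def
      by (rule zariski_irreducible_closure_range[where I = "Wl l", OF poly_fun_compose[OF \<phi>(1)] cs])
        (auto intro: poly_fun_affine_restrict)
    show "C l \<subseteq> ?X" unfolding C_def by (rule zariski_closure_mono) auto
  next
    fix l assume l: "l < card W"
    have Suc: "Wl (Suc l) = insert (e l) (Wl l)" by (simp add: Wl_def lessThan_Suc)
    have "e l \<notin> Wl l" 
    proof
      assume "e l \<in> Wl l"
      then obtain x where x: "x < l" "e l = e x" by (auto simp: Wl_def)
      then have "l = x" using e l by (intro inj_onD[of e "{..<card W}" l x]) (auto simp: bij_betw_def)
      then show False using x by simp
    qed
    have W': "insert (e l) (Wl l) \<subseteq> W" using Wsub[of "Suc l"] l Suc by simp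
    show "C l \<subset> C (Suc l)" unfolding C_def Suc
    proof (rule closure_image_strict_mono[OF fin(1,2) \<phi>])
      show "insert (e l) (Wl l) \<subseteq> I" using W' W(1) by (rule order.trans)
      fix v i
      assume v1: "\<And>i. i \<notin> insert (e l) (Wl l) \<Longrightarrow> v i = 0"
        and v2: "\<And>b. b \<in> B \<Longrightarrow> ((\<lambda>t. \<phi> (\<lambda>i. p i + t * v i) b) has_field_derivative 0) (at 0)"
      show "v i = 0"
      proof (rule inj)
        fix i assume "i \<notin> W"
        then show "v i = 0" using v1[of i] W' by blast
      qed (rule v2)
    qed (use \<open>e l \<notin> Wl l\<close> in simp_all)
  qed
  then have "card W \<in> {k. \<exists>C. chain k C}" by blast
  then show ?thesis unfolding zariski_dim_def chain_def[symmetric]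
    by (intro cSup_eq_maximum) (use upper in auto)
qed


section \<open>The image of a polynomial map contains an open dense subset of its closure\<close>

text \<open>\<open>zariski_hull C \<Phi>\<close> is the closure of the range of \<open>\<Phi>\<close>, without the normalisation of the
  coordinates outside \<open>C\<close>.\<close>

definition zariski_hull :: "'i set \<Rightarrow> ('x \<Rightarrow> 'i \<Rightarrow> complex) \<Rightarrow> ('i \<Rightarrow> complex) set" where
  "zariski_hull C \<Phi> = {y. \<forall>f\<in>poly_fun C. (\<forall>x. f (\<Phi> x) = 0) \<longrightarrow> f y = 0}"

lemma zariski_hullD:
  "y \<in> zariski_hull C \<Phi> \<Longrightarrow> f \<in> poly_fun C \<Longrightarrow> (\<And>x. f (\<Phi> x) = 0) \<Longrightarrow> f y = 0"
  unfolding zariski_hull_def by blast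

text \<open>Division with remainder without inverting the leading coefficient: multiplication by a
  power of it keeps all coefficients polynomial. The leading coefficient is formal, namely the one
  at the degree bound \<open>n\<close>, and may vanish at some \<open>y\<close>.\<close>

lemma pseudo_division:
  assumes p: "p \<in> polyfam C n" and n: "n \<noteq> 0" and Q: "Q \<in> polyfam C N"
  shows "\<exists>e. \<exists>A\<in>polyfam C (N - n). \<exists>R\<in>polyfam C (n - 1).
    \<forall>y. smult (coeff (p y) n ^ e) (Q y) = A y * p y + R y"
  using Q
proof (induction N arbitrary: Q)
  case 0
  then have "Q \<in> polyfam C (n - 1)" by (auto intro: polyfam_mono)
  then show ?case
    by (intro exI[of _ 0] bexI[of _ "\<lambda>y. 0"] bexI[of _ Q]) (auto simp: polyfam_def intro: poly_fun.const)
next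
  case (Suc N)
  show ?case
  proof (cases "Suc N < n")
    case True
    then have "Q \<in> polyfam C (n - 1)" using Suc.prems by (auto intro: polyfam_mono)
    then show ?thesis
      by (intro exI[of _ 0] bexI[of _ "\<lambda>y. 0"] bexI[of _ Q]) (auto simp: polyfam_def intro: poly_fun.const)
  next
    case False
    then have le: "n \<le> Suc N" by simp
    let ?a = "\<lambda>y. coeff (p y) n" and ?q = "\<lambda>y. coeff (Q y) (Suc N)"
    define Q' where "Q' y = smult (?a y) (Q y) - monom (?q y) (Suc N - n) * p y" for y
    have mon: "(\<lambda>y. monom (?q y) (Suc N - n)) \<in> polyfam C (Suc N - n)"
      by (rule polyfam_monom[OF polyfam_coeff[OF Suc.prems]]) simp
    have "(\<lambda>y. monom (?q y) (Suc N - n) * p y) \<in> polyfam C (Suc N)"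
      using polyfam_mult[OF mon p] le by simp
    then have Q'fam: "Q' \<in> polyfam C (Suc N)"
      unfolding Q'_def by (intro polyfam_diff polyfam_smult polyfam_coeff[OF p] Suc.prems)
    have "coeff (Q' y) (Suc N) = 0" for y
      using le by (simp add: Q'_def coeff_monom_mult)
    then have "degree (Q' y) \<le> N" for y
      using polyfam_degree[OF Q'fam, of y] by (metis degree_0 leading_coeff_0_iff le_SucE le0)
    then have "Q' \<in> polyfam C N" using Q'fam by (simp add: polyfam_def)
    from Suc.IH[OF this] obtain e A R where IH: "A \<in> polyfam C (N - n)" "R \<in> polyfam C (n - 1)"
      "\<And>y. smult (?a y ^ e) (Q' y) = A y * p y + R y" by blast
    define A' where "A' y = A y + smult (?a y ^ e) (monom (?q y) (Suc N - n))" for y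
    have "A' \<in> polyfam C (Suc N - n)"
      unfolding A'_def
      by (intro polyfam_add polyfam_smult mon poly_fun_power polyfam_coeff[OF p] polyfam_mono[OF IH(1)]) simp
    moreover have "smult (?a y ^ Suc e) (Q y) = A' y * p y + R y" for y
    proof -
      have "smult (?a y ^ Suc e) (Q y) = smult (?a y ^ e) (Q' y) + smult (?a y ^ e) (monom (?q y) (Suc N - n)) * p y"
        by (simp add: Q'_def smult_diff_right mult_ac)
      then show ?thesis by (simp add: IH(3) A'_def ring_distribs)
    qed
    ultimately show ?thesis using IH(2) by blast
  qed
qed

lemma coeff_mult_degree_bounds:
  fixes p q :: "complex poly"
  assumes "degree p \<le> a" "degree q \<le> b"
  shows "coeff (p * q) (a + b) = coeff p a * coeff q b"
proof (cases "degree p = a \<and> degree q = b")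
  case True
  then show ?thesis using coeff_mult_degree_sum[of p q] by auto
next
  case False
  then have "degree p < a \<or> degree q < b" using assms by auto
  moreover have "degree (p * q) < a + b"
    using degree_mult_le[of p q] assms False by linarith
  ultimately show ?thesis by (auto simp: coeff_eq_0)
qed

lemma polyfam_truncate:
  assumes "p \<in> polyfam C (Suc n)"
  shows "(\<lambda>y. p y - monom (coeff (p y) (Suc n)) (Suc n)) \<in> polyfam C n" (is "?p \<in> _")
proof -
  have fam: "?p \<in> polyfam C (Suc n)"
    by (intro polyfam_diff assms polyfam_monom polyfam_coeff[OF assms] order.refl)
  have "coeff (?p y) (Suc n) = 0" for y by simp
  then have "degree (?p y) \<le> n" for y
    using polyfam_degree[OF fam, of y] by (metis degree_0 leading_coeff_0_iff le_SucE le0)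
  then show ?thesis using fam by (simp add: polyfam_def)
qed

text \<open>Eliminating the coordinate \<open>i\<close>: if it is transcendental over the coordinates in \<open>C\<close>, every
  value of it extends a point. Otherwise divide by a relation \<open>p\<close> of least degree, whose roots are the
  extensions; as \<open>p\<close> is irreducible over the generic point, the ideal of \<open>H\<close> contains a nonzero \<open>c\<close>
  that does not involve \<open>i\<close>.\<close>

lemma eliminate_coordinate:
  fixes \<Phi> :: "'x \<Rightarrow> 'i \<Rightarrow> complex"
  assumes i: "i \<notin> C"
    and prime: "\<And>f g x y. f \<in> poly_fun (insert i C) \<Longrightarrow> g \<in> poly_fun (insert i C) \<Longrightarrow>
      f (\<Phi> x) \<noteq> 0 \<Longrightarrow> g (\<Phi> y) \<noteq> 0 \<Longrightarrow> \<exists>x. f (\<Phi> x) * g (\<Phi> x) \<noteq> 0"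
    and H: "H \<in> poly_fun (insert i C)" "H (\<Phi> x0) \<noteq> 0"
  shows "\<exists>H'\<in>poly_fun C. (\<exists>x. H' (\<Phi> x) \<noteq> 0) \<and>
    (\<forall>y\<in>zariski_hull C \<Phi>. H' y \<noteq> 0 \<longrightarrow>
      (\<exists>t. y(i := t) \<in> zariski_hull (insert i C) \<Phi> \<and> H (y(i := t)) \<noteq> 0))"
proof -
  \<comment> \<open>\<open>ev\<close> inserts the coordinate \<open>i\<close> of a point of the
    range, and \<open>nz\<close> says that a coefficient is nonzero as a function on the range.
    Relations are judged through these two and not as formal polynomials.\<close>
  define ev where "ev p x = poly (p (\<Phi> x)) (\<Phi> x i)" for p :: "('i \<Rightarrow> complex) \<Rightarrow> complex poly" and x
  define nz where "nz p k \<longleftrightarrow> (\<exists>x. coeff (p (\<Phi> x)) k \<noteq> 0)" for p :: "('i \<Rightarrow> complex) \<Rightarrow> complex poly" and k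
  have evpoly: "(\<lambda>y. poly (p y) (y i)) \<in> poly_fun (insert i C)" if "p \<in> polyfam C n" for p n
    by (rule polyfam_imp_poly_fun[OF that]) (auto intro: poly_fun.coord)
  have evprime: "\<exists>x. ev p x * ev q x \<noteq> 0" if "p \<in> polyfam C n" "q \<in> polyfam C n'" "ev p x \<noteq> 0" "ev q y \<noteq> 0" for p q n n' x y
    using prime[OF evpoly[OF that(1)] evpoly[OF that(2)]] that(3,4) by (simp add: ev_def)
  have Cprime: "\<exists>x. f (\<Phi> x) * g (\<Phi> x) \<noteq> 0" if "f \<in> poly_fun C" "g \<in> poly_fun C" "f (\<Phi> x) \<noteq> 0" "g (\<Phi> y) \<noteq> 0" for f g x y
    using prime[OF poly_fun_mono[OF that(1)] poly_fun_mono[OF that(2)]] that(3,4) by blast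
  obtain N pH where pH: "pH \<in> polyfam C N" "\<And>y t. H (y(i := t)) = poly (pH y) t"
    using poly_fun_insert_polyfam[OF H(1) i] by blast
  have Hev: "H (\<Phi> x) = ev pH x" for x using pH(2)[of "\<Phi> x" "\<Phi> x i"] by (simp add: ev_def)
  have repr: "\<exists>n. \<exists>p\<in>polyfam C n. (\<forall>y t. f (y(i := t)) = poly (p y) t) \<and> (\<forall>x. ev p x = f (\<Phi> x))"
    if f: "f \<in> poly_fun (insert i C)" for f
  proof -
    obtain n p where p: "p \<in> polyfam C n" "\<And>y t. f (y(i := t)) = poly (p y) t"
      using poly_fun_insert_polyfam[OF f i] by blast
    have "ev p x = f (\<Phi> x)" for x using p(2)[of "\<Phi> x" "\<Phi> x i"] by (simp add: ev_def)
    then show ?thesis using p by blast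
  qed
  show ?thesis
  proof (cases "\<exists>n. \<exists>p\<in>polyfam C n. (\<forall>x. ev p x = 0) \<and> (\<exists>k. nz p k)")
    \<comment> \<open>No relation holds for the coordinate \<open>i\<close>: every value of it is
      admissible, and \<open>H\<close> has to remain a nonzero polynomial in that value.\<close>
    case False
    have "pH (\<Phi> x0) \<noteq> 0" using H(2) Hev[of x0] by (auto simp: ev_def)
    then obtain k where k: "coeff (pH (\<Phi> x0)) k \<noteq> 0" by (auto simp: poly_eq_iff)
    show ?thesis
    proof (intro bexI[of _ "\<lambda>y. coeff (pH y) k"] conjI ballI impI)
      fix y assume y: "y \<in> zariski_hull C \<Phi>" "coeff (pH y) k \<noteq> 0"
      then have "pH y \<noteq> 0" by auto
      then obtain t where t: "poly (pH y) t \<noteq> 0" using poly_all_0_iff_0 by blast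
      have "y(i := t) \<in> zariski_hull (insert i C) \<Phi>"
        unfolding zariski_hull_def
      proof (intro CollectI ballI impI)
        fix f assume f: "f \<in> poly_fun (insert i C)" "\<forall>x. f (\<Phi> x) = 0"
        then obtain n p where p: "p \<in> polyfam C n" "\<forall>y t. f (y(i := t)) = poly (p y) t" "\<forall>x. ev p x = f (\<Phi> x)"
          using repr by blast
        have "\<not> nz p k" for k using False p f(2) by metis
        then have "coeff (p y) k = 0" for k
          by (intro zariski_hullD[OF y(1) polyfam_coeff[OF p(1)]]) (simp add: nz_def)
        then have "p y = 0" by (simp add: poly_eq_iff)
        then show "f (y(i := t)) = 0" using p(2) by simp
      qed
      then show "\<exists>t. y(i := t) \<in> zariski_hull (insert i C) \<Phi> \<and> H (y(i := t)) \<noteq> 0"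
        using t pH(2) by auto
    qed (use k polyfam_coeff[OF pH(1)] in auto)
  next
    case True
    have trunc_ev: "ev (\<lambda>y. p y - monom (coeff (p y) m) m) x = ev p x" if "\<not> nz p m" for p m x
      using that by (auto simp: nz_def ev_def)
    have trunc_nz: "nz (\<lambda>y. p y - monom (coeff (p y) m) m) k = nz p k" if "\<not> nz p m" for p m k
      using that by (auto simp: nz_def)
    \<comment> \<open>Coefficients that vanish on the whole range are stripped from the top, so that
      the formal leading coefficient becomes nonzero at some point of the range.\<close>
    have top: "\<exists>m\<le>n. \<exists>q\<in>polyfam C m. nz q m \<and> (\<forall>x. ev q x = ev p x)"
      if "p \<in> polyfam C n" "nz p k" for p n k
      using that
    proof (induction n arbitrary: p)
      case 0
      have "k = 0"
      proof (rule ccontr)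
        assume "k \<noteq> 0"
        then have "coeff (p y) k = 0" for y using polyfam_degree[OF 0(1), of y] by (intro coeff_eq_0) simp
        then show False using 0(2) by (simp add: nz_def)
      qed
      then show ?case using 0 by blast
    next
      case (Suc n)
      show ?case
      proof (cases "nz p (Suc n)")
        case False
        have "\<exists>m\<le>n. \<exists>q\<in>polyfam C m. nz q m \<and> (\<forall>x. ev q x = ev (\<lambda>y. p y - monom (coeff (p y) (Suc n)) (Suc n)) x)"
          by (rule Suc.IH[OF polyfam_truncate[OF Suc.prems(1)]]) (use Suc.prems(2) trunc_nz[OF False] in simp)
        then show ?thesis using trunc_ev[OF False] le_SucI by metis
      qed (use Suc.prems in blast)
    qed
    define rel where "rel n \<longleftrightarrow> (\<exists>p\<in>polyfam C n. (\<forall>x. ev p x = 0) \<and> nz p n)" for n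
    have "\<exists>n. rel n"
    proof -
      obtain n p k where "p \<in> polyfam C n" "\<forall>x. ev p x = 0" "nz p k" using True by blast
      then show ?thesis using top[of p n k] unfolding rel_def by metis
    qed
    define n where "n = (LEAST n. rel n)"
    have "rel n" using LeastI_ex[OF \<open>\<exists>n. rel n\<close>] by (simp add: n_def)
    then obtain p where p: "p \<in> polyfam C n" "\<And>x. ev p x = 0" "nz p n" unfolding rel_def by blast
    have nmin: "\<not> rel k" if "k < n" for k using not_less_Least that by (auto simp: n_def)
    have low: "\<not> nz r k" if "r \<in> polyfam C (n - 1)" "\<And>x. ev r x = 0" "n \<noteq> 0" for r k
    proof
      assume "nz r k"
      from top[OF that(1) this] obtain m q where "m \<le> n - 1" "q \<in> polyfam C m" "nz q m" "\<forall>x. ev q x = ev r x" by blast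
      then have "rel m" "m < n" using that(2,3) by (auto simp: rel_def)
      then show False using nmin by blast
    qed
    have n0: "n \<noteq> 0"
    proof
      assume n: "n = 0"
      obtain x where x: "coeff (p (\<Phi> x)) 0 \<noteq> 0" using p(3) n by (auto simp: nz_def)
      have "p (\<Phi> x) = [:coeff (p (\<Phi> x)) 0:]"
        using polyfam_degree[OF p(1), of "\<Phi> x"] n by (intro degree_0_id[symmetric]) simp
      then have "ev p x = coeff (p (\<Phi> x)) 0" unfolding ev_def by (metis poly_0_coeff_0 poly_const_conv)
      then show False using x p(2) by simp
    qed
    define a where "a y = coeff (p y) n" for y
    have a: "a \<in> poly_fun C" unfolding a_def[abs_def] by (rule polyfam_coeff[OF p(1)])
    obtain xa where xa: "a (\<Phi> xa) \<noteq> 0" using p(3) by (auto simp: nz_def a_def)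
    \<comment> \<open>Multiples of \<open>H\<close> as functions on the range. The aim is a nonzero
      multiple that does not involve the coordinate \<open>i\<close>.\<close>
    define inK where "inK g \<longleftrightarrow> (\<exists>n. \<exists>B\<in>polyfam C n. \<forall>x. ev g x = ev B x * ev pH x)" for g
    define relK where "relK m \<longleftrightarrow> (\<exists>g\<in>polyfam C m. inK g \<and> nz g m)" for m
    have topK: "\<exists>m\<le>k. relK m" if "r \<in> polyfam C k" "inK r" "ev r x \<noteq> 0" for r k x
    proof -
      have "r (\<Phi> x) \<noteq> 0" using that(3) by (auto simp: ev_def)
      then obtain j where "nz r j" by (auto simp: poly_eq_iff nz_def)
      from top[OF that(1) this] obtain m q where "m \<le> k" "q \<in> polyfam C m" "nz q m" "\<forall>x. ev q x = ev r x" by blast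
      then show ?thesis using that(2) unfolding relK_def inK_def by metis
    qed
    have ev_div: "c (\<Phi> x) * ev Q x = ev A x * ev P x + ev R x"
      if "\<And>y. smult (c y) (Q y) = A y * P y + R y" for c Q A P R x
      using arg_cong[OF that[of "\<Phi> x"], of "\<lambda>q. poly q (\<Phi> x i)"] by (simp add: ev_def)
    have apow: "\<exists>x. (a (\<Phi> x) ^ e) * f (\<Phi> x) \<noteq> 0" if "f \<in> poly_fun (insert i C)" "f (\<Phi> y) \<noteq> 0" for e f y
    proof (rule prime[where x = xa, OF _ that(1) _ that(2)])
      show "(\<lambda>y. a y ^ e) \<in> poly_fun (insert i C)" by (intro poly_fun_power poly_fun_mono[OF a]) auto
    qed (use xa in simp)
    \<comment> \<open>The remainder of a power of \<open>a\<close> times \<open>H\<close> modulo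
      \<open>p\<close> is a nonzero multiple of \<open>H\<close> of degree below
      \<open>n\<close>.\<close>
    have "\<exists>m<n. relK m"
    proof -
      obtain e A R where d: "A \<in> polyfam C (N - n)" "R \<in> polyfam C (n - 1)"
        "\<And>y. smult (a y ^ e) (pH y) = A y * p y + R y"
        using pseudo_division[OF p(1) n0 pH(1)] unfolding a_def by blast
      have evR: "ev R x = a (\<Phi> x) ^ e * ev pH x" for x
        using ev_div[of "\<lambda>y. a y ^ e" pH A p R x] d(3) p(2) by simp
      have "inK R" unfolding inK_def
        by (intro exI[of _ 0] bexI[of _ "\<lambda>y. [:a y ^ e:]"] polyfam_const poly_fun_power a)
          (simp add: evR, simp add: ev_def)
      moreover obtain x where "ev R x \<noteq> 0" using apow[OF H(1) H(2), of e] by (auto simp: evR Hev)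
      ultimately obtain m where "m \<le> n - 1" "relK m" using topK[OF d(2)] by blast
      then show ?thesis using n0 by (intro exI[of _ m]) auto
    qed
    then obtain m1 where m1: "m1 < n" "relK m1" by blast
    define m where "m = (LEAST m. relK m)"
    have mK: "relK m" "m < n" using LeastI[of relK, OF m1(2)] Least_le[of relK, OF m1(2)] m1(1) by (auto simp: m_def)
    obtain g where g: "g \<in> polyfam C m" "inK g" "nz g m" using mK(1) unfolding relK_def by blast
    obtain nB B where B: "B \<in> polyfam C nB" "\<And>x. ev g x = ev B x * ev pH x" using g(2) unfolding inK_def by blast
    \<comment> \<open>A multiple \<open>g\<close> of least positive degree would divide
      \<open>p\<close> up to a factor: the remainder is again a multiple of \<open>H\<close> of
      smaller degree, hence zero on the range, and by primeness the quotient is a relation of degree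
      \<open>n - m\<close>, against the choice of \<open>n\<close>.\<close>
    have m0: "m = 0"
    proof (rule ccontr)
      assume m0: "m \<noteq> 0"
      let ?b = "\<lambda>y. coeff (g y) m"
      obtain e A R where d: "A \<in> polyfam C (n - m)" "R \<in> polyfam C (m - 1)"
        "\<And>y. smult (?b y ^ e) (p y) = A y * g y + R y"
        using pseudo_division[OF g(1) m0 p(1)] by blast
      have evR: "ev R x = - (ev A x * ev g x)" for x
        using ev_div[of "\<lambda>y. ?b y ^ e" p A g R x] d(3) p(2) by (simp add: eq_neg_iff_add_eq_0 add.commute)
      have "(\<lambda>y. A y * B y) \<in> polyfam C (n - m + nB)" by (rule polyfam_mult[OF d(1) B(1)])
      then have "(\<lambda>y. smult (-1) (A y * B y)) \<in> polyfam C (n - m + nB)"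
        using polyfam_smult[OF poly_fun.const[of "-1" C]] by blast
      then have "inK R" unfolding inK_def
        by (intro exI bexI[rotated]) (auto simp: evR B(2), simp add: ev_def)
      have evR0: "ev R x = 0" for x
      proof (rule ccontr)
        assume "ev R x \<noteq> 0"
        from topK[OF d(2) \<open>inK R\<close> this] obtain m' where "m' \<le> m - 1" "relK m'" by blast
        then have "m' < m" using m0 by linarith
        then show False using not_less_Least[of m' relK] \<open>relK m'\<close> unfolding m_def by blast
      qed
      have "\<exists>x. ev g x \<noteq> 0"
      proof (rule ccontr)
        assume "\<not> ?thesis"
        then have "rel m" using g unfolding rel_def by blast
        then show False using nmin mK(2) by blast
      qed
      then obtain xg where xg: "ev g xg \<noteq> 0" by blast
      have evA: "ev A x = 0" for x
      proof (rule ccontr)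
        assume "ev A x \<noteq> 0"
        then obtain z where "ev A z * ev g z \<noteq> 0" using evprime[OF d(1) g(1) _ xg] by blast
        then show False using evR[of z] evR0[of z] by simp
      qed
      have lead: "?b y ^ e * coeff (p y) n = coeff (A y) (n - m) * ?b y" for y
      proof -
        have "coeff (R y) n = 0" using polyfam_degree[OF d(2), of y] mK(2) m0 by (intro coeff_eq_0) simp
        moreover have "coeff (A y * g y) ((n - m) + m) = coeff (A y) (n - m) * coeff (g y) m"
          by (rule coeff_mult_degree_bounds[OF polyfam_degree[OF d(1)] polyfam_degree[OF g(1)]])
        ultimately show ?thesis using arg_cong[OF d(3)[of y], of "\<lambda>q. coeff q n"] mK(2) by simp
      qed
      obtain xb where xb: "?b (\<Phi> xb) \<noteq> 0" using g(3) by (auto simp: nz_def)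
      have "\<exists>x. ?b (\<Phi> x) ^ e * a (\<Phi> x) \<noteq> 0"
        by (rule Cprime[where x = xb, OF poly_fun_power[OF polyfam_coeff[OF g(1)]] a _ xa]) (use xb in simp)
      then have "nz A (n - m)" using lead by (auto simp: nz_def a_def)
      then have "rel (n - m)" using d(1) evA unfolding rel_def by blast
      then show False using nmin[of "n - m"] m0 mK(2) by simp
    qed
    define c where "c y = coeff (g y) 0" for y
    have c: "c \<in> poly_fun C" unfolding c_def[abs_def] by (rule polyfam_coeff[OF g(1)])
    have evg: "ev g x = c (\<Phi> x)" for x
    proof -
      have "g (\<Phi> x) = [:coeff (g (\<Phi> x)) 0:]"
        using polyfam_degree[OF g(1), of "\<Phi> x"] m0 by (intro degree_0_id[symmetric]) simp
      then show ?thesis unfolding ev_def c_def by (metis poly_0_coeff_0 poly_const_conv)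
    qed
    obtain xc where xc: "c (\<Phi> xc) \<noteq> 0" using g(3) m0 by (auto simp: nz_def c_def)
    show ?thesis
    proof (intro bexI[of _ "\<lambda>y. a y * c y"] conjI ballI impI)
      show "\<exists>x. a (\<Phi> x) * c (\<Phi> x) \<noteq> 0" by (rule Cprime[OF a c xa xc])
      fix y assume y: "y \<in> zariski_hull C \<Phi>" "a y * c y \<noteq> 0"
      then have "a y \<noteq> 0" by simp
      then have "degree (p y) = n" using polyfam_degree[OF p(1), of y] le_degree[of "p y" n] by (simp add: a_def)
      then have "\<not> constant (poly (p y))" using n0 by (simp add: constant_degree)
      then obtain t where t: "poly (p y) t = 0" using fundamental_theorem_of_algebra by blast
      have hull: "y(i := t) \<in> zariski_hull (insert i C) \<Phi>"
        unfolding zariski_hull_def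
      proof (intro CollectI ballI impI)
        fix f assume f: "f \<in> poly_fun (insert i C)" "\<forall>x. f (\<Phi> x) = 0"
        then obtain k q where q: "q \<in> polyfam C k" "\<forall>y t. f (y(i := t)) = poly (q y) t" "\<forall>x. ev q x = f (\<Phi> x)"
          using repr by blast
        obtain e A R where d: "A \<in> polyfam C (k - n)" "R \<in> polyfam C (n - 1)"
          "\<And>y. smult (a y ^ e) (q y) = A y * p y + R y"
          using pseudo_division[OF p(1) n0 q(1)] unfolding a_def by blast
        have "ev R x = 0" for x
          using ev_div[of "\<lambda>y. a y ^ e" q A p R x] d(3) p(2) q(3) f(2) by simp
        then have "\<not> nz R j" for j using low[OF d(2) _ n0] by blast
        then have "coeff (R y) j = 0" for j
          by (intro zariski_hullD[OF y(1) polyfam_coeff[OF d(2)]]) (auto simp: nz_def)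
        then have "R y = 0" by (simp add: poly_eq_iff)
        then have "a y ^ e * poly (q y) t = 0"
          using arg_cong[OF d(3)[of y], of "\<lambda>q. poly q t"] t by simp
        then show "f (y(i := t)) = 0" using q(2) \<open>a y \<noteq> 0\<close> by simp
      qed
      \<comment> \<open>The identity between \<open>c\<close> and the multiple of \<open>H\<close>
        holds on the range and therefore on the hull; so a nonzero \<open>c y\<close> forces
        \<open>H\<close> to be nonzero at the extended point.\<close>
      have "(\<lambda>y. c y - poly (B y) (y i) * H y) (y(i := t)) = 0"
      proof (rule zariski_hullD[OF hull])
        show "(\<lambda>y. c y - poly (B y) (y i) * H y) \<in> poly_fun (insert i C)"
          by (intro poly_fun_diff poly_fun.mult evpoly[OF B(1)] H(1) poly_fun_mono[OF c]) auto
        show "c (\<Phi> x) - poly (B (\<Phi> x)) (\<Phi> x i) * H (\<Phi> x) = 0" for x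
          using B(2)[of x] evg[of x] Hev[of x] by (simp add: ev_def)
      qed
      moreover have "c (y(i := t)) = c y" by (rule poly_fun_cong[OF c]) (use i in auto)
      ultimately have "H (y(i := t)) \<noteq> 0" using y(2) by auto
      then show "\<exists>t. y(i := t) \<in> zariski_hull (insert i C) \<Phi> \<and> H (y(i := t)) \<noteq> 0" using hull by blast
    qed (intro poly_fun.mult a c)
  qed
qed

text \<open>One coordinate is eliminated at a time; the function produced by one step is the
  condition \<open>H\<close> for the next.\<close>

lemma eliminate_coordinates:
  fixes \<Phi> :: "'x \<Rightarrow> 'i \<Rightarrow> complex"
  assumes "finite S" "S \<inter> C = {}"
    and prime: "\<And>f g x y. f \<in> poly_fun (S \<union> C) \<Longrightarrow> g \<in> poly_fun (S \<union> C) \<Longrightarrow>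
      f (\<Phi> x) \<noteq> 0 \<Longrightarrow> g (\<Phi> y) \<noteq> 0 \<Longrightarrow> \<exists>x. f (\<Phi> x) * g (\<Phi> x) \<noteq> 0"
    and H: "H \<in> poly_fun (S \<union> C)" "H (\<Phi> x0) \<noteq> 0"
  shows "\<exists>H'\<in>poly_fun C. (\<exists>x. H' (\<Phi> x) \<noteq> 0) \<and>
    (\<forall>y\<in>zariski_hull C \<Phi>. H' y \<noteq> 0 \<longrightarrow>
      (\<exists>z\<in>zariski_hull (S \<union> C) \<Phi>. (\<forall>i. i \<notin> S \<longrightarrow> z i = y i) \<and> H z \<noteq> 0))"
  using assms
proof (induction S arbitrary: H x0 rule: finite_induct)
  case empty
  then show ?case by (intro bexI[of _ H]) auto
next
  case (insert i S)
  have "\<exists>H1\<in>poly_fun (S \<union> C). (\<exists>x. H1 (\<Phi> x) \<noteq> 0) \<and>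
    (\<forall>y\<in>zariski_hull (S \<union> C) \<Phi>. H1 y \<noteq> 0 \<longrightarrow>
      (\<exists>t. y(i := t) \<in> zariski_hull (insert i (S \<union> C)) \<Phi> \<and> H (y(i := t)) \<noteq> 0))"
    by (rule eliminate_coordinate[where ?x0.0 = x0]) (use insert.prems insert.hyps in auto)
  then obtain H1 x1 where H1: "H1 \<in> poly_fun (S \<union> C)" "H1 (\<Phi> x1) \<noteq> 0"
    "\<And>y. y \<in> zariski_hull (S \<union> C) \<Phi> \<Longrightarrow> H1 y \<noteq> 0 \<Longrightarrow>
      (\<exists>t. y(i := t) \<in> zariski_hull (insert i (S \<union> C)) \<Phi> \<and> H (y(i := t)) \<noteq> 0)" by blast
  have mono: "f \<in> poly_fun (insert i S \<union> C)" if "f \<in> poly_fun (S \<union> C)" for f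
    by (rule poly_fun_mono[OF that]) auto
  have "\<exists>H'\<in>poly_fun C. (\<exists>x. H' (\<Phi> x) \<noteq> 0) \<and>
    (\<forall>y\<in>zariski_hull C \<Phi>. H' y \<noteq> 0 \<longrightarrow>
      (\<exists>z\<in>zariski_hull (S \<union> C) \<Phi>. (\<forall>i. i \<notin> S \<longrightarrow> z i = y i) \<and> H1 z \<noteq> 0))"
    by (rule insert.IH[OF _ _ H1(1,2)]) (use insert.prems(1,2) mono in auto)
  then obtain H' x' where H': "H' \<in> poly_fun C" "H' (\<Phi> x') \<noteq> 0"
    "\<And>y. y \<in> zariski_hull C \<Phi> \<Longrightarrow> H' y \<noteq> 0 \<Longrightarrow>
      (\<exists>z\<in>zariski_hull (S \<union> C) \<Phi>. (\<forall>i. i \<notin> S \<longrightarrow> z i = y i) \<and> H1 z \<noteq> 0)" by blast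
  show ?case
  proof (intro bexI[OF _ H'(1)] conjI ballI impI exI[of _ x'] H'(2))
    fix y assume "y \<in> zariski_hull C \<Phi>" "H' y \<noteq> 0"
    then obtain z where z: "z \<in> zariski_hull (S \<union> C) \<Phi>" "\<forall>i. i \<notin> S \<longrightarrow> z i = y i" "H1 z \<noteq> 0" using H'(3) by blast
    then obtain t where "z(i := t) \<in> zariski_hull (insert i (S \<union> C)) \<Phi>" "H (z(i := t)) \<noteq> 0" using H1(3) by blast
    then show "\<exists>z\<in>zariski_hull (insert i S \<union> C) \<Phi>. (\<forall>j. j \<notin> insert i S \<longrightarrow> z j = y j) \<and> H z \<noteq> 0"
      using z(2) by (intro bexI[of _ "z(i := t)"]) auto
  qed
qed

text \<open>The parameters are eliminated from the graph of \<open>\<phi>\<close>. A point of the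
  closure outside some hypersurface extends to a point of the hull of the graph at which
  \<open>h\<close> is nonzero, and since the graph is given by polynomial equations, the added
  coordinates form a genuine preimage.\<close>

lemma image_contains_open:
  fixes \<phi> :: "('p \<Rightarrow> complex) \<Rightarrow> 'b \<Rightarrow> complex"
  assumes I: "finite I"
    and \<phi>: "\<And>b. b \<in> B \<Longrightarrow> (\<lambda>x. \<phi> x b) \<in> poly_fun I" "range \<phi> \<subseteq> coord_space B"
    and h: "h \<in> poly_fun I" "h x0 \<noteq> 0"
  shows "generically B (zariski_closure B (range \<phi>)) (\<lambda>T. \<exists>x\<in>coord_space I. h x \<noteq> 0 \<and> T = \<phi> x)"
proof -
  let ?X = "zariski_closure B (range \<phi>)"
  define \<Phi> :: "('p \<Rightarrow> complex) \<Rightarrow> 'b + 'p \<Rightarrow> complex" where "\<Phi> x = case_sum (\<phi> x) x" for x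
  let ?S = "Inr ` I :: ('b + 'p) set" and ?C = "Inl ` B :: ('b + 'p) set"
  have \<Phi>poly: "(\<lambda>x. \<Phi> x d) \<in> poly_fun I" if "d \<in> ?S \<union> ?C" for d
    using that \<phi>(1) by (auto simp: \<Phi>_def intro: poly_fun.coord)
  have inr: "(\<lambda>z. f (z \<circ> Inr)) \<in> poly_fun (?S \<union> ?C)" if "f \<in> poly_fun I" for f
    by (rule poly_fun_compose[OF that]) (auto simp: comp_def intro: poly_fun.coord)
  have "\<exists>H'\<in>poly_fun ?C. (\<exists>x. H' (\<Phi> x) \<noteq> 0) \<and>
    (\<forall>y\<in>zariski_hull ?C \<Phi>. H' y \<noteq> 0 \<longrightarrow>
      (\<exists>z\<in>zariski_hull (?S \<union> ?C) \<Phi>. (\<forall>i. i \<notin> ?S \<longrightarrow> z i = y i) \<and> h (z \<circ> Inr) \<noteq> 0))"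
  proof (rule eliminate_coordinates)
    fix f g :: "('b + 'p \<Rightarrow> complex) \<Rightarrow> complex" and x y
    assume fg: "f \<in> poly_fun (?S \<union> ?C)" "g \<in> poly_fun (?S \<union> ?C)" "f (\<Phi> x) \<noteq> 0" "g (\<Phi> y) \<noteq> 0"
    show "\<exists>x. f (\<Phi> x) * g (\<Phi> x) \<noteq> 0"
      by (rule poly_fun_domain[of _ I _ x y]) (use fg \<Phi>poly in \<open>auto intro: poly_fun_compose\<close>)
  next
    show "h (\<Phi> x0 \<circ> Inr) \<noteq> 0" using h(2) by (simp add: \<Phi>_def comp_def)
  qed (use I inr[OF h(1)] in auto)
  then obtain H' x' where H': "H' \<in> poly_fun ?C" "H' (\<Phi> x') \<noteq> 0"
    and ext: "\<And>y. y \<in> zariski_hull ?C \<Phi> \<Longrightarrow> H' y \<noteq> 0 \<Longrightarrow>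
      (\<exists>z\<in>zariski_hull (?S \<union> ?C) \<Phi>. (\<forall>i. i \<notin> ?S \<longrightarrow> z i = y i) \<and> h (z \<circ> Inr) \<noteq> 0)" by blast
  \<comment> \<open>The eliminated condition as a function of the output alone; its zero set is what
    is removed from the closure.\<close>
  define G where "G y = H' (case_sum y (\<lambda>_. 0))" for y
  have G: "G \<in> poly_fun B" unfolding G_def
    by (rule poly_fun_compose[OF H'(1)]) (auto intro: poly_fun.coord)
  have H'cong: "H' (case_sum y u) = G y" for y u unfolding G_def
    by (rule poly_fun_cong[OF H'(1)]) auto
  define Z where "Z = {T \<in> coord_space B. G T = 0}"
  have Z: "zariski_closed B Z" unfolding Z_def by (rule zariski_closedI[OF G])
  have Xcs: "?X \<subseteq> coord_space B" by (auto simp: zariski_closure_eq[OF \<phi>(2)])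
  have "zariski_closure B (?X - Z) = ?X"
  proof
    show "zariski_closure B (?X - Z) \<subseteq> ?X"
      by (rule zariski_closure_minimal[OF zariski_closed_closure[OF \<phi>(2)]]) auto
    show "?X \<subseteq> zariski_closure B (?X - Z)"
    proof
      fix T assume T: "T \<in> ?X"
      have cs: "?X - Z \<subseteq> coord_space B" using Xcs by blast
      have "f T = 0" if f: "f \<in> poly_fun B" "\<forall>a\<in>?X - Z. f a = 0" for f
      proof (rule zariski_irreducible_prime[OF zariski_irreducible_closure_range[OF \<phi>] Xcs G f(1) _ _ _ T])
        show "G x * f x = 0" if "x \<in> ?X" for x using that f(2) Xcs by (auto simp: Z_def)
        show "\<phi> x' \<in> ?X" using subset_zariski_closure[of "range \<phi>" B] by blast
        show "G (\<phi> x') \<noteq> 0" using H'(2) by (simp add: \<Phi>_def H'cong)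
      qed
      then show "T \<in> zariski_closure B (?X - Z)" using T Xcs by (auto simp: zariski_closure_eq[OF cs])
    qed
  qed
  moreover have "\<exists>x\<in>coord_space I. h x \<noteq> 0 \<and> T = \<phi> x" if T: "T \<in> ?X - Z" for T
  proof -
    have "case_sum T (\<lambda>_. 0) \<in> zariski_hull ?C \<Phi>"
      unfolding zariski_hull_def
    proof (intro CollectI ballI impI)
      fix f :: "('b + 'p \<Rightarrow> complex) \<Rightarrow> complex" assume f: "f \<in> poly_fun ?C" "\<forall>x. f (\<Phi> x) = 0"
      have cong: "f (case_sum y u) = f (case_sum y (\<lambda>_. 0))" for y u
        by (rule poly_fun_cong[OF f(1)]) auto
      show "f (case_sum T (\<lambda>_. 0)) = 0"
      proof (rule zariski_closure_vanish[OF \<phi>(2), where f = "\<lambda>y. f (case_sum y (\<lambda>_. 0))"])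
        show "(\<lambda>y. f (case_sum y (\<lambda>_. 0))) \<in> poly_fun B"
          by (rule poly_fun_compose[OF f(1)]) (auto intro: poly_fun.coord)
        fix a assume "a \<in> range \<phi>"
        then obtain x where "a = \<phi> x" by blast
        then show "f (case_sum a (\<lambda>_. 0)) = 0" using f(2) cong[of "\<phi> x" x] by (simp add: \<Phi>_def)
      next
      qed (use T in simp)
    qed
    moreover have "H' (case_sum T (\<lambda>_. 0)) \<noteq> 0" using T Xcs by (auto simp: Z_def H'cong)
    ultimately obtain z where z: "z \<in> zariski_hull (?S \<union> ?C) \<Phi>" "\<forall>i. i \<notin> ?S \<longrightarrow> z i = case_sum T (\<lambda>_. 0) i"
      "h (z \<circ> Inr) \<noteq> 0" using ext by blast
    define x where "x i = (if i \<in> I then z (Inr i) else 0)" for i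
    have xz: "f (z \<circ> Inr) = f x" if "f \<in> poly_fun I" for f
      by (rule poly_fun_cong[OF that]) (auto simp: x_def)
    have "T b = \<phi> x b" for b
    proof (cases "b \<in> B")
      case True
      have "(\<lambda>z. z (Inl b) - \<phi> (z \<circ> Inr) b) z = 0"
      proof (rule zariski_hullD[OF z(1)])
        show "(\<lambda>z. z (Inl b) - \<phi> (z \<circ> Inr) b) \<in> poly_fun (?S \<union> ?C)"
          using True by (intro poly_fun_diff inr[OF \<phi>(1)]) (auto intro: poly_fun.coord)
      qed (simp add: \<Phi>_def comp_def)
      then show ?thesis using z(2)[rule_format, of "Inl b"] xz[OF \<phi>(1)[OF True]] by (simp add: image_iff)
    next
      case False
      have "\<phi> x \<in> coord_space B" "T \<in> coord_space B" using \<phi>(2) T Xcs by auto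
      then show ?thesis using False by (simp add: coord_space_def)
    qed
    moreover have "x \<in> coord_space I" by (simp add: x_def coord_space_def)
    ultimately show ?thesis using z(3) xz[OF h(1)] by auto
  qed
  ultimately show ?thesis using Z unfolding generically_def by blast
qed


section \<open>Network tensors with block diagonal bonds\<close>

text \<open>A simple graph whose edge \<open>e\<close> carries the labels \<open>Lab e\<close>, pairs of a block index and an
  index of the old bond; the edges \<open>ed r\<close> are the ones joining \<open>i\<^sub>r\<close> and \<open>j\<^sub>r\<close>, whose block index
  is the index of the diagonal pencil. The parameter \<open>Inl (r, b, a)\<close> is the coordinate \<open>a\<close> of
  \<open>z\<^sub>r\<^sub>,\<^sub>b\<close>, and \<open>Inr (k, y, c)\<close> is the entry of the matrix at \<open>k\<close> in row \<open>y\<close> and column \<open>c\<close>.\<close>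

type_synonym ('v, 'r) param = "'r \<times> nat \<times> nat + 'v \<times> nat \<times> ('v set \<Rightarrow> nat \<times> nat)"

locale block_network =
  fixes V :: "'v set" and E :: "'v set set" and S :: "'r set" and ed :: "'r \<Rightarrow> 'v set"
    and Q M :: "'v set \<Rightarrow> nat" and N :: "'v \<Rightarrow> nat" and \<gamma> :: "'v \<Rightarrow> nat \<Rightarrow> 'v set \<Rightarrow> nat \<times> nat"
    and src tgt :: "'v set \<Rightarrow> 'v" and k0 :: 'v
  assumes finV: "finite V" and k0: "k0 \<in> V"
    and edge: "\<And>e. e \<in> E \<Longrightarrow> e = {src e, tgt e} \<and> src e \<noteq> tgt e \<and> src e \<in> V \<and> tgt e \<in> V"
    and finS: "finite S" and ed: "\<And>r. r \<in> S \<Longrightarrow> ed r \<in> E" and inj_ed: "inj_on ed S"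
    and Qpos: "\<And>e. e \<in> E \<Longrightarrow> 0 < Q e" and Mpos: "\<And>e. e \<in> E \<Longrightarrow> 0 < M e"
    and Q1: "\<And>e. e \<in> E \<Longrightarrow> e \<notin> ed ` S \<Longrightarrow> Q e = 1"
    and \<gamma>: "\<And>k. k \<in> V \<Longrightarrow> bij_betw (\<gamma> k) {..<N k} (Pi\<^sub>E {e \<in> E. k \<in> e} (\<lambda>e. {..<Q e} \<times> {..<M e}))"
begin

abbreviation Lab :: "'v set \<Rightarrow> (nat \<times> nat) set" where "Lab e \<equiv> {..<Q e} \<times> {..<M e}"
abbreviation inc :: "'v \<Rightarrow> 'v set set" where "inc k \<equiv> {e \<in> E. k \<in> e}"
abbreviation Col :: "'v \<Rightarrow> ('v set \<Rightarrow> nat \<times> nat) set" where "Col k \<equiv> Pi\<^sub>E (inc k) Lab"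
abbreviation Conf :: "('v set \<Rightarrow> nat \<times> nat) set" where "Conf \<equiv> Pi\<^sub>E E Lab"
abbreviation loc :: "'v \<Rightarrow> ('v set \<Rightarrow> nat \<times> nat) \<Rightarrow> ('v set \<Rightarrow> nat \<times> nat)" where
  "loc k \<kappa> \<equiv> restrict \<kappa> (inc k)"

definition params :: "('v, 'r) param set" where
  "params = Inl ` (SIGMA r:S. {..<Q (ed r)} \<times> {..<2}) \<union> Inr ` (SIGMA k:V. {..<N k} \<times> Col k)"

definition pencil_part :: "(('v, 'r) param \<Rightarrow> complex) \<Rightarrow> ('r \<Rightarrow> nat) \<Rightarrow> ('v set \<Rightarrow> nat \<times> nat) \<Rightarrow> complex" where
  "pencil_part x a \<kappa> = (\<Prod>r\<in>S. x (Inl (r, fst (\<kappa> (ed r)), a r)))"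

definition tensor :: "(('v, 'r) param \<Rightarrow> complex) \<Rightarrow> ('r \<Rightarrow> nat) \<Rightarrow> ('v \<Rightarrow> nat) \<Rightarrow> complex" where
  "tensor x a y = (\<Sum>\<kappa>\<in>Conf. pencil_part x a \<kappa> * (\<Prod>k\<in>V. x (Inr (k, y k, loc k \<kappa>))))"

definition tensor_deriv :: "(('v, 'r) param \<Rightarrow> complex) \<Rightarrow> (('v, 'r) param \<Rightarrow> complex) \<Rightarrow>
    ('r \<Rightarrow> nat) \<Rightarrow> ('v \<Rightarrow> nat) \<Rightarrow> complex" where
  "tensor_deriv x v a y = (\<Sum>\<kappa>\<in>Conf.
     (\<Sum>r\<in>S. v (Inl (r, fst (\<kappa> (ed r)), a r)) * (\<Prod>r'\<in>S - {r}. x (Inl (r', fst (\<kappa> (ed r')), a r'))))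
       * (\<Prod>k\<in>V. x (Inr (k, y k, loc k \<kappa>)))
     + pencil_part x a \<kappa> * (\<Sum>k\<in>V. v (Inr (k, y k, loc k \<kappa>)) * (\<Prod>l\<in>V - {k}. x (Inr (l, y l, loc l \<kappa>)))))"

lemma finE: "finite E"
proof (rule finite_subset)
  show "E \<subseteq> Pow V"
  proof
    fix e assume "e \<in> E"
    with edge[of e] have "e = {src e, tgt e}" "src e \<in> V" "tgt e \<in> V" by auto
    then show "e \<in> Pow V" by (metis Pow_iff empty_subsetI insert_subset)
  qed
qed (simp add: finV)

lemma finConf: "finite Conf" and finCol: "finite (Col k)"
  using finE by (auto intro!: finite_PiE)

lemma finparams: "finite params"
  unfolding params_def using finS finV finCol by (intro finite_UnI finite_imageI finite_SigmaI) auto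

lemma loc_Col: "\<kappa> \<in> Conf \<Longrightarrow> loc k \<kappa> \<in> Col k"
  by auto

lemma tensor_has_deriv:
  "((\<lambda>t. tensor (\<lambda>i. x i + t * v i) a y) has_field_derivative tensor_deriv x v a y) (at 0)"
proof -
  have lin: "((\<lambda>t. x p + t * v p) has_field_derivative v p) (at 0)" for p
    by (auto intro!: derivative_eq_intros)
  have P: "((\<lambda>t. pencil_part (\<lambda>i. x i + t * v i) a \<kappa>) has_field_derivative
      (\<Sum>r\<in>S. v (Inl (r, fst (\<kappa> (ed r)), a r)) * (\<Prod>r'\<in>S - {r}. x (Inl (r', fst (\<kappa> (ed r')), a r'))))) (at 0)" for \<kappa>
    using has_field_derivative_prod[of S "\<lambda>r t. x (Inl (r, fst (\<kappa> (ed r)), a r)) + t * v (Inl (r, fst (\<kappa> (ed r)), a r))"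
      "\<lambda>r. v (Inl (r, fst (\<kappa> (ed r)), a r))" 0] lin by (simp add: pencil_part_def)
  have G: "((\<lambda>t. \<Prod>k\<in>V. x (Inr (k, y k, loc k \<kappa>)) + t * v (Inr (k, y k, loc k \<kappa>))) has_field_derivative
      (\<Sum>k\<in>V. v (Inr (k, y k, loc k \<kappa>)) * (\<Prod>l\<in>V - {k}. x (Inr (l, y l, loc l \<kappa>))))) (at 0)" for \<kappa>
    using has_field_derivative_prod[of V "\<lambda>k t. x (Inr (k, y k, loc k \<kappa>)) + t * v (Inr (k, y k, loc k \<kappa>))"
      "\<lambda>k. v (Inr (k, y k, loc k \<kappa>))" 0] lin by simp
  have "((\<lambda>t. \<Sum>\<kappa>\<in>Conf. pencil_part (\<lambda>i. x i + t * v i) a \<kappa> *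
      (\<Prod>k\<in>V. x (Inr (k, y k, loc k \<kappa>)) + t * v (Inr (k, y k, loc k \<kappa>)))) has_field_derivative
      tensor_deriv x v a y) (at 0)"
    unfolding tensor_deriv_def
    by (rule DERIV_sum, rule DERIV_cong[OF DERIV_mult[OF P G]]) (simp add: pencil_part_def mult_ac)
  then show ?thesis by (simp add: tensor_def)
qed

lemma tensor_poly_fun:
  assumes "\<And>r. r \<in> S \<Longrightarrow> a r < 2" "\<And>k. k \<in> V \<Longrightarrow> y k < N k"
  shows "(\<lambda>x. tensor x a y) \<in> poly_fun params"
  unfolding tensor_def pencil_part_def
proof (intro poly_fun_sum poly_fun.mult poly_fun_prod poly_fun.coord)
  fix \<kappa> r assume \<kappa>: "\<kappa> \<in> Conf" "r \<in> S"
  then have "\<kappa> (ed r) \<in> Lab (ed r)" using ed by (auto dest: PiE_mem)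
  then show "Inl (r, fst (\<kappa> (ed r)), a r) \<in> params" using \<kappa> assms by (auto simp: params_def)
next
  fix \<kappa> k assume "\<kappa> \<in> Conf" "k \<in> V"
  then show "Inr (k, y k, loc k \<kappa>) \<in> params" using assms loc_Col[of \<kappa> k] unfolding params_def by blast
qed

subsection \<open>Tangent vectors in the kernel\<close>

text \<open>Pairs of labels in a common block are the matrix units of the block preserving changes
  of basis on \<open>e\<close>. One diagonal unit is left out: the identity on \<open>e\<close> acts
  by opposite scalars at the two endpoints and is already a combination of vertex scalars.\<close>

abbreviation edge_idx :: "'v set \<Rightarrow> ((nat \<times> nat) \<times> (nat \<times> nat)) set" where
  "edge_idx e \<equiv> {(l, l'). l \<in> Lab e \<and> l' \<in> Lab e \<and> fst l = fst l' \<and> (l, l') \<noteq> ((0, 0), (0, 0))}"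

text \<open>Infinitesimal scalars at the vertices fix the tensor when they add up to zero, so one
  vertex \<open>k0\<close> serves to compensate all the others.\<close>

definition kidx :: "('r \<times> nat + ('v set \<times> (nat \<times> nat) \<times> (nat \<times> nat)) + 'v) set" where
  "kidx = (SIGMA r:S. {..<Q (ed r)}) <+>
    ((SIGMA e:E. edge_idx e) <+> (V - {k0}))"

text \<open>The directions come from the rescalings of the \<open>z\<^sub>r\<^sub>,\<^sub>b\<close>, compensated at \<open>tgt (ed r)\<close>, from the
  changes of basis on the edges that respect the blocks, and from the scalars at the vertices.\<close>

definition kvec :: "(('v, 'r) param \<Rightarrow> complex) \<Rightarrow> 'r \<times> nat + ('v set \<times> (nat \<times> nat) \<times> (nat \<times> nat)) + 'v \<Rightarrow>
    ('v, 'r) param \<Rightarrow> complex" where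
  "kvec x ix p = (case ix of
     Inl (r, b) \<Rightarrow> (case p of Inl (r', b', a) \<Rightarrow> if r' = r \<and> b' = b then x p else 0
       | Inr (k, y, c) \<Rightarrow> if k = tgt (ed r) \<and> fst (c (ed r)) = b then - x p else 0)
   | Inr (Inl (e, l, l')) \<Rightarrow> (case p of Inl _ \<Rightarrow> 0
       | Inr (k, y, c) \<Rightarrow> (if k = src e \<and> c e = l' then x (Inr (k, y, c(e := l))) else 0)
           - (if k = tgt e \<and> c e = l then x (Inr (k, y, c(e := l'))) else 0))
   | Inr (Inr k1) \<Rightarrow> (case p of Inl _ \<Rightarrow> 0
       | Inr (k, y, c) \<Rightarrow> (if k = k1 then x p else 0) - (if k = k0 then x p else 0)))"

lemma finite_edge_idx:
  "finite (edge_idx e)"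
  by (rule finite_subset[of _ "Lab e \<times> Lab e"]) auto

lemma finkidx: "finite kidx"
  unfolding kidx_def using finS finV finE finite_edge_idx by (intro finite_Plus finite_SigmaI) auto

lemma sum_single_factor:
  assumes "k \<in> V"
  shows "(\<Sum>l\<in>V. (if l = k then f l else 0) * (\<Prod>i\<in>V - {l}. g i)) = f k * (\<Prod>i\<in>V - {k}. g i :: complex)"
proof -
  have "(\<Sum>l\<in>V. (if l = k then f l else 0) * (\<Prod>i\<in>V - {l}. g i)) =
      (\<Sum>l\<in>V. if l = k then f l * (\<Prod>i\<in>V - {l}. g i) else 0)"
    by (intro sum.cong) auto
  then show ?thesis using assms finV by simp
qed

lemma prod_remove_V: "k \<in> V \<Longrightarrow> f k * (\<Prod>i\<in>V - {k}. f i) = (\<Prod>i\<in>V. f i :: complex)"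
  using finV by (simp add: prod.remove[of V k])

lemma kvec_rescale:
  assumes r: "r \<in> S"
  shows "tensor_deriv x (kvec x (Inl (r, b))) a y = 0"
  unfolding tensor_deriv_def
proof (rule sum.neutral, rule ballI)
  fix \<kappa> assume \<kappa>: "\<kappa> \<in> Conf"
  let ?b = "fst (\<kappa> (ed r)) = b" and ?k = "tgt (ed r)"
  have k: "?k \<in> V" "ed r \<in> inc ?k" using edge[OF ed[OF r]] ed[OF r] by auto
  have "(\<Sum>s\<in>S. kvec x (Inl (r, b)) (Inl (s, fst (\<kappa> (ed s)), a s)) *
      (\<Prod>r'\<in>S - {s}. x (Inl (r', fst (\<kappa> (ed r')), a r')))) =
      (\<Sum>s\<in>S. if s = r then (if ?b then x (Inl (s, fst (\<kappa> (ed s)), a s)) else 0) *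
      (\<Prod>r'\<in>S - {s}. x (Inl (r', fst (\<kappa> (ed r')), a r'))) else 0)"
    by (intro sum.cong) (auto simp: kvec_def)
  also have "\<dots> = (if ?b then pencil_part x a \<kappa> else 0)"
    using r finS by (simp add: pencil_part_def prod.remove[of S r])
  finally have 1: "(\<Sum>s\<in>S. kvec x (Inl (r, b)) (Inl (s, fst (\<kappa> (ed s)), a s)) *
      (\<Prod>r'\<in>S - {s}. x (Inl (r', fst (\<kappa> (ed r')), a r')))) = (if ?b then pencil_part x a \<kappa> else 0)" .
  have "(\<Sum>k\<in>V. kvec x (Inl (r, b)) (Inr (k, y k, loc k \<kappa>)) * (\<Prod>l\<in>V - {k}. x (Inr (l, y l, loc l \<kappa>)))) =
     (\<Sum>k\<in>V. (if k = ?k then (if ?b then - x (Inr (k, y k, loc k \<kappa>)) else 0) else 0) * (\<Prod>l\<in>V - {k}. x (Inr (l, y l, loc l \<kappa>))))"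
    using k(2) by (intro sum.cong) (auto simp: kvec_def)
  also have "\<dots> = (if ?b then - (\<Prod>k\<in>V. x (Inr (k, y k, loc k \<kappa>))) else 0)"
    unfolding sum_single_factor[OF k(1)] using prod_remove_V[OF k(1), of "\<lambda>k. x (Inr (k, y k, loc k \<kappa>))"] by simp
  finally show "(\<Sum>s\<in>S. kvec x (Inl (r, b)) (Inl (s, fst (\<kappa> (ed s)), a s)) *
      (\<Prod>r'\<in>S - {s}. x (Inl (r', fst (\<kappa> (ed r')), a r')))) * (\<Prod>k\<in>V. x (Inr (k, y k, loc k \<kappa>))) +
      pencil_part x a \<kappa> * (\<Sum>k\<in>V. kvec x (Inl (r, b)) (Inr (k, y k, loc k \<kappa>)) * (\<Prod>l\<in>V - {k}. x (Inr (l, y l, loc l \<kappa>)))) = 0"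
    unfolding 1 by simp
qed

lemma kvec_scalar:
  assumes k1: "k1 \<in> V"
  shows "tensor_deriv x (kvec x (Inr (Inr k1))) a y = 0"
  unfolding tensor_deriv_def
proof (rule sum.neutral, rule ballI)
  fix \<kappa> assume \<kappa>: "\<kappa> \<in> Conf"
  let ?g = "\<lambda>k. x (Inr (k, y k, loc k \<kappa>))"
  have "(\<Sum>k\<in>V. kvec x (Inr (Inr k1)) (Inr (k, y k, loc k \<kappa>)) * (\<Prod>l\<in>V - {k}. ?g l)) =
     (\<Sum>k\<in>V. (if k = k1 then ?g k else 0) * (\<Prod>l\<in>V - {k}. ?g l)) - (\<Sum>k\<in>V. (if k = k0 then ?g k else 0) * (\<Prod>l\<in>V - {k}. ?g l))"
    unfolding sum_subtractf[symmetric] by (intro sum.cong) (auto simp: kvec_def ring_distribs)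
  also have "\<dots> = 0"
    unfolding sum_single_factor[OF k1] sum_single_factor[OF k0] prod_remove_V[OF k1, of ?g] prod_remove_V[OF k0, of ?g] by simp
  finally show "(\<Sum>s\<in>S. kvec x (Inr (Inr k1)) (Inl (s, fst (\<kappa> (ed s)), a s)) *
      (\<Prod>r'\<in>S - {s}. x (Inl (r', fst (\<kappa> (ed r')), a r')))) * (\<Prod>k\<in>V. ?g k) +
      pencil_part x a \<kappa> * (\<Sum>k\<in>V. kvec x (Inr (Inr k1)) (Inr (k, y k, loc k \<kappa>)) * (\<Prod>l\<in>V - {k}. ?g l)) = 0"
    by (simp add: kvec_def)
qed

lemma conf_upd: "\<kappa> \<in> Conf \<Longrightarrow> e \<in> E \<Longrightarrow> l \<in> Lab e \<Longrightarrow> \<kappa>(e := l) \<in> Conf"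
  by (rule PiE_I) (auto dest: PiE_mem PiE_arb split: if_splits)

lemma loc_upd: "loc k (\<kappa>(e := l)) = (if e \<in> inc k then (loc k \<kappa>)(e := l) else loc k \<kappa>)"
  by auto

lemma loc_upd_other: "e \<in> E \<Longrightarrow> k \<noteq> src e \<Longrightarrow> k \<noteq> tgt e \<Longrightarrow> loc k (\<kappa>(e := l)) = loc k \<kappa>"
  using edge by (subst loc_upd) auto

lemma src_inc: "e \<in> E \<Longrightarrow> e \<in> inc (src e)" and tgt_inc: "e \<in> E \<Longrightarrow> e \<in> inc (tgt e)"
  using edge by auto

text \<open>The unit acts at \<open>src e\<close> and with opposite sign at \<open>tgt e\<close>.
  Relabelling \<open>e\<close> carries the configurations of one sum to those of the other, and the
  pencil factor does not change because both labels lie in the same block.\<close>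

lemma kvec_edge:
  assumes e: "e \<in> E" and l: "l \<in> Lab e" "l' \<in> Lab e" "fst l = fst l'"
  shows "tensor_deriv x (kvec x (Inr (Inl (e, l, l')))) a y = 0"
proof -
  let ?u = "src e" and ?v = "tgt e" and ?kv = "kvec x (Inr (Inl (e, l, l')))"
  let ?g = "\<lambda>\<kappa> k. x (Inr (k, y k, loc k \<kappa>))"
  have uv: "?u \<in> V" "?v \<in> V" "?u \<noteq> ?v" using edge[OF e] by auto
  \<comment> \<open>In \<open>f1\<close> and \<open>f2\<close> one endpoint of \<open>e\<close> sees
    a different label on \<open>e\<close> than the rest of the network.\<close>
  define f1 where "f1 \<kappa> = pencil_part x a \<kappa> * (\<Prod>k\<in>V. ?g (if k = ?u then \<kappa>(e := l) else \<kappa>) k)" for \<kappa>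
  define f2 where "f2 \<kappa> = pencil_part x a \<kappa> * (\<Prod>k\<in>V. ?g (if k = ?v then \<kappa>(e := l') else \<kappa>) k)" for \<kappa>
  have "tensor_deriv x ?kv a y = (\<Sum>\<kappa>\<in>Conf. (if \<kappa> e = l' then f1 \<kappa> else 0) - (if \<kappa> e = l then f2 \<kappa> else 0))"
    unfolding tensor_deriv_def
  proof (rule sum.cong[OF refl])
    fix \<kappa> assume \<kappa>: "\<kappa> \<in> Conf"
    have "(\<Sum>k\<in>V. ?kv (Inr (k, y k, loc k \<kappa>)) * (\<Prod>l\<in>V - {k}. ?g \<kappa> l)) =
        (\<Sum>k\<in>V. (if k = ?u then if \<kappa> e = l' then ?g (\<kappa>(e := l)) k else 0 else 0) * (\<Prod>l\<in>V - {k}. ?g \<kappa> l)) -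
        (\<Sum>k\<in>V. (if k = ?v then if \<kappa> e = l then ?g (\<kappa>(e := l')) k else 0 else 0) * (\<Prod>l\<in>V - {k}. ?g \<kappa> l))"
      unfolding sum_subtractf[symmetric] using src_inc[OF e] tgt_inc[OF e]
      by (intro sum.cong refl) (auto simp: kvec_def ring_distribs loc_upd simp del: restrict_upd)
    also have "\<dots> = (if \<kappa> e = l' then ?g (\<kappa>(e := l)) ?u * (\<Prod>l\<in>V - {?u}. ?g \<kappa> l) else 0) -
        (if \<kappa> e = l then ?g (\<kappa>(e := l')) ?v * (\<Prod>l\<in>V - {?v}. ?g \<kappa> l) else 0)"
      unfolding sum_single_factor[OF uv(1)] sum_single_factor[OF uv(2)] by simp
    also have "?g (\<kappa>(e := l)) ?u * (\<Prod>l\<in>V - {?u}. ?g \<kappa> l) = (\<Prod>k\<in>V. ?g (if k = ?u then \<kappa>(e := l) else \<kappa>) k)"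
      by (subst prod_remove_V[OF uv(1), symmetric]) (auto intro!: arg_cong2[of _ _ _ _ "(*)"] prod.cong)
    also have "?g (\<kappa>(e := l')) ?v * (\<Prod>l\<in>V - {?v}. ?g \<kappa> l) = (\<Prod>k\<in>V. ?g (if k = ?v then \<kappa>(e := l') else \<kappa>) k)"
      by (subst prod_remove_V[OF uv(2), symmetric]) (auto intro!: arg_cong2[of _ _ _ _ "(*)"] prod.cong)
    finally have *: "(\<Sum>k\<in>V. ?kv (Inr (k, y k, loc k \<kappa>)) * (\<Prod>l\<in>V - {k}. ?g \<kappa> l)) =
        (if \<kappa> e = l' then (\<Prod>k\<in>V. ?g (if k = ?u then \<kappa>(e := l) else \<kappa>) k) else 0) -
        (if \<kappa> e = l then (\<Prod>k\<in>V. ?g (if k = ?v then \<kappa>(e := l') else \<kappa>) k) else 0)" .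
    show "(\<Sum>r\<in>S. ?kv (Inl (r, fst (\<kappa> (ed r)), a r)) * (\<Prod>r'\<in>S - {r}. x (Inl (r', fst (\<kappa> (ed r')), a r')))) *
        (\<Prod>k\<in>V. ?g \<kappa> k) + pencil_part x a \<kappa> * (\<Sum>k\<in>V. ?kv (Inr (k, y k, loc k \<kappa>)) * (\<Prod>l\<in>V - {k}. ?g \<kappa> l)) =
        (if \<kappa> e = l' then f1 \<kappa> else 0) - (if \<kappa> e = l then f2 \<kappa> else 0)"
      unfolding * f1_def f2_def by (simp add: kvec_def ring_distribs)
  qed
  also have "\<dots> = (\<Sum>\<kappa>\<in>{\<kappa> \<in> Conf. \<kappa> e = l'}. f1 \<kappa>) - (\<Sum>\<kappa>\<in>{\<kappa> \<in> Conf. \<kappa> e = l}. f2 \<kappa>)"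
    using finConf by (simp add: sum_subtractf sum.inter_filter)
  also have "(\<Sum>\<kappa>\<in>{\<kappa> \<in> Conf. \<kappa> e = l'}. f1 \<kappa>) = (\<Sum>\<kappa>\<in>{\<kappa> \<in> Conf. \<kappa> e = l}. f2 \<kappa>)"
  proof (rule sum.reindex_bij_witness[of _ "\<lambda>\<kappa>. \<kappa>(e := l')" "\<lambda>\<kappa>. \<kappa>(e := l)"])
    fix \<kappa> assume \<kappa>: "\<kappa> \<in> {\<kappa> \<in> Conf. \<kappa> e = l'}"
    have "pencil_part x a (\<kappa>(e := l)) = pencil_part x a \<kappa>"
      unfolding pencil_part_def using \<kappa> l(3) by (intro prod.cong) auto
    moreover have "?g (if k = ?v then \<kappa>(e := l, e := l') else \<kappa>(e := l)) k = ?g (if k = ?u then \<kappa>(e := l) else \<kappa>) k" for k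
    proof -
      have "\<kappa>(e := l, e := l') = \<kappa>" using \<kappa> by auto
      then show ?thesis using uv loc_upd_other[OF e, of k \<kappa> l] by auto
    qed
    ultimately show "f2 (\<kappa>(e := l)) = f1 \<kappa>" unfolding f1_def f2_def by simp
  qed (use conf_upd[OF _ e] l in auto)
  finally show ?thesis by simp
qed

lemma kvec_kernel: "ix \<in> kidx \<Longrightarrow> tensor_deriv x (kvec x ix) a y = 0"
  unfolding kidx_def using kvec_rescale kvec_edge kvec_scalar by blast

end


lemma sum_eq_single:
  assumes "finite A" "p0 \<in> A" "\<And>p. p \<in> A \<Longrightarrow> p \<noteq> p0 \<Longrightarrow> f p = 0"
  shows "sum f A = (f p0 :: 'a :: comm_monoid_add)"
proof -
  have "sum f A = sum f {p0}" by (rule sum.mono_neutral_right) (use assms in auto)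
  then show ?thesis by simp
qed

lemma prod_of_bool_eq: "finite A \<Longrightarrow> (\<Prod>x\<in>A. of_bool (P x)) = (of_bool (\<forall>x\<in>A. P x) :: complex)"
  by (induction A rule: finite_induct) auto

context block_network
begin

section \<open>Linear independence of the kernel directions\<close>

definition conf0 :: "'v set \<Rightarrow> nat \<times> nat" where
  "conf0 = (\<lambda>e\<in>E. (0, 0))"

lemma conf0: "conf0 \<in> Conf"
  using Qpos Mpos by (auto simp: conf0_def)

lemma conf0_upd: "e \<in> E \<Longrightarrow> l \<in> Lab e \<Longrightarrow> conf0(e := l) \<in> Conf"
  by (rule conf_upd[OF conf0])

lemma loc_conf0: "e \<in> inc k \<Longrightarrow> loc k conf0 e = (0, 0)"
  by (simp add: conf0_def)

lemma loc_conf0_upd: "e \<in> inc k \<Longrightarrow> loc k (conf0(e' := l)) e = (if e = e' then l else (0, 0))"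
  by (simp add: conf0_def)

lemma sum_kidx:
  "(\<Sum>ix\<in>kidx. f ix) = (\<Sum>p\<in>(SIGMA r:S. {..<Q (ed r)}). f (Inl p)) +
    ((\<Sum>p\<in>(SIGMA e:E. edge_idx e). f (Inr (Inl p)))
      + (\<Sum>k\<in>V - {k0}. f (Inr (Inr k))))"
  unfolding kidx_def using finS finV finE finite_edge_idx
  by (subst sum.Plus; (intro finite_Plus finite_SigmaI)?; (subst sum.Plus)?) (auto intro!: finite_SigmaI simp: comp_def)

text \<open>The pencil coordinates with \<open>a = 0\<close> isolate the rescalings. In the rest of
  the relation the vertex matrices can be cancelled, as they are injective on columns; the
  coefficients are then read off at columns that are zero up to a single edge.\<close>

lemma kvec_independent:
  assumes nz: "\<And>r b. r \<in> S \<Longrightarrow> b < Q (ed r) \<Longrightarrow> x (Inl (r, b, 0)) \<noteq> 0"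
    and inj: "\<And>k f c. k \<in> V \<Longrightarrow> (\<And>y. y < N k \<Longrightarrow> (\<Sum>c\<in>Col k. x (Inr (k, y, c)) * f c) = 0) \<Longrightarrow> c \<in> Col k \<Longrightarrow> f c = 0"
    and rel: "\<And>p. p \<in> params \<Longrightarrow> (\<Sum>ix\<in>kidx. C ix * kvec x ix p) = 0"
    and ix: "ix \<in> kidx"
  shows "C ix = 0"
proof -
  let ?KE = "SIGMA e:E. edge_idx e"
  have finKE: "finite ?KE" using finE finite_edge_idx by (intro finite_SigmaI)
  have C1: "C (Inl (r, b)) = 0" if rb: "r \<in> S" "b < Q (ed r)" for r b
  proof -
    have "kvec x ix (Inl (r, b, 0)) = (if ix = Inl (r, b) then x (Inl (r, b, 0)) else 0)" for ix
      by (auto simp: kvec_def split: sum.split prod.split)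
    then have "(\<Sum>ix\<in>kidx. C ix * kvec x ix (Inl (r, b, 0))) = (\<Sum>ix\<in>kidx. if ix = Inl (r, b) then C ix * x (Inl (r, b, 0)) else 0)"
      by (intro sum.cong) auto
    also have "\<dots> = C (Inl (r, b)) * x (Inl (r, b, 0))"
    proof -
      have "Inl (r, b) \<in> kidx" using rb by (auto simp: kidx_def)
      then show ?thesis using finkidx by simp
    qed
    finally show ?thesis using rel[of "Inl (r, b, 0)"] nz[OF rb] rb by (simp add: params_def)
  qed
  \<comment> \<open>The combination of scalars and edge units as a matrix on the columns at
    \<open>k\<close>, before it is multiplied by the vertex matrix.\<close>
  define mat where "mat k cc c' =
      (\<Sum>(e, l, l')\<in>?KE. C (Inr (Inl (e, l, l'))) * (of_bool (k = src e \<and> cc e = l' \<and> c' = cc(e := l)) - of_bool (k = tgt e \<and> cc e = l \<and> c' = cc(e := l'))))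
      + (\<Sum>k1\<in>V - {k0}. C (Inr (Inr k1)) * (of_bool (k = k1 \<and> c' = cc) - of_bool (k = k0 \<and> c' = cc)))" for k cc c'
  have mat0: "mat k cc c' = 0" if k: "k \<in> V" and cc: "cc \<in> Col k" "c' \<in> Col k" for k cc c'
  proof (rule inj[OF k _ cc(2)])
    fix y assume y: "y < N k"
    have pick: "(\<Sum>c'\<in>Col k. x (Inr (k, y, c')) * of_bool (P \<and> c' = d)) = (if P then x (Inr (k, y, d)) else 0)"
      if "P \<Longrightarrow> d \<in> Col k" for P d
    proof (cases P)
      case True
      then have "(\<Sum>c'\<in>Col k. x (Inr (k, y, c')) * of_bool (P \<and> c' = d)) = x (Inr (k, y, d)) * of_bool (P \<and> d = d)"
        using that by (intro sum_eq_single finCol) auto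
      then show ?thesis using True by simp
    qed simp
    have upd: "cc(e := l) \<in> Col k" if "e \<in> inc k" "l \<in> Lab e" for e l
      by (rule PiE_I) (use that cc(1) in \<open>auto dest: PiE_mem PiE_arb split: if_splits\<close>)
    have edge_term: "(\<Sum>c'\<in>Col k. x (Inr (k, y, c')) * (of_bool (k = src e \<and> cc e = l' \<and> c' = cc(e := l)) - of_bool (k = tgt e \<and> cc e = l \<and> c' = cc(e := l')))) =
        kvec x (Inr (Inl (e, l, l'))) (Inr (k, y, cc))" if "(e, l, l') \<in> ?KE" for e l l'
    proof -
      have KE: "e \<in> E" "l \<in> Lab e" "l' \<in> Lab e" using that by auto
      have 1: "(\<Sum>c'\<in>Col k. x (Inr (k, y, c')) * of_bool ((k = src e \<and> cc e = l') \<and> c' = cc(e := l))) =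
          (if k = src e \<and> cc e = l' then x (Inr (k, y, cc(e := l))) else 0)"
        by (rule pick) (use upd[OF _ KE(2)] src_inc[OF KE(1)] in blast)
      have 2: "(\<Sum>c'\<in>Col k. x (Inr (k, y, c')) * of_bool ((k = tgt e \<and> cc e = l) \<and> c' = cc(e := l'))) =
          (if k = tgt e \<and> cc e = l then x (Inr (k, y, cc(e := l'))) else 0)"
        by (rule pick) (use upd[OF _ KE(3)] tgt_inc[OF KE(1)] in blast)
      show ?thesis
        unfolding right_diff_distrib sum_subtractf 1[unfolded conj_assoc] 2[unfolded conj_assoc] by (simp add: kvec_def)
    qed
    have vertex_term: "(\<Sum>c'\<in>Col k. x (Inr (k, y, c')) * (of_bool (k = k1 \<and> c' = cc) - of_bool (k = k0 \<and> c' = cc))) =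
        kvec x (Inr (Inr k1)) (Inr (k, y, cc))" for k1
    proof -
      have 1: "(\<Sum>c'\<in>Col k. x (Inr (k, y, c')) * of_bool (k = k' \<and> c' = cc)) = (if k = k' then x (Inr (k, y, cc)) else 0)" for k'
        by (rule pick) (rule cc(1))
      show ?thesis unfolding right_diff_distrib sum_subtractf 1 by (simp add: kvec_def)
    qed
    have "(\<Sum>c'\<in>Col k. x (Inr (k, y, c')) * mat k cc c') =
        (\<Sum>(e, l, l')\<in>?KE. C (Inr (Inl (e, l, l'))) * (\<Sum>c'\<in>Col k. x (Inr (k, y, c')) * (of_bool (k = src e \<and> cc e = l' \<and> c' = cc(e := l)) - of_bool (k = tgt e \<and> cc e = l \<and> c' = cc(e := l')))))
        + (\<Sum>k1\<in>V - {k0}. C (Inr (Inr k1)) * (\<Sum>c'\<in>Col k. x (Inr (k, y, c')) * (of_bool (k = k1 \<and> c' = cc) - of_bool (k = k0 \<and> c' = cc))))"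
      unfolding mat_def ring_distribs(1) sum.distrib sum_distrib_left
      by (intro arg_cong2[of _ _ _ _ "(+)"]; subst sum.swap; intro sum.cong refl; simp add: case_prod_unfold mult_ac)
    also have "\<dots> = (\<Sum>p\<in>?KE. C (Inr (Inl p)) * kvec x (Inr (Inl p)) (Inr (k, y, cc))) + (\<Sum>k1\<in>V - {k0}. C (Inr (Inr k1)) * kvec x (Inr (Inr k1)) (Inr (k, y, cc)))"
      using edge_term vertex_term by (intro arg_cong2[of _ _ _ _ "(+)"] sum.cong refl) (auto simp only: case_prod_unfold split_paired_all fst_conv snd_conv)
    also have "\<dots> = (\<Sum>ix\<in>kidx. C ix * kvec x ix (Inr (k, y, cc)))"
    proof -
      have "(\<Sum>p\<in>(SIGMA r:S. {..<Q (ed r)}). C (Inl p) * kvec x (Inl p) (Inr (k, y, cc))) = 0"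
        by (rule sum.neutral) (use C1 in auto)
      then show ?thesis unfolding sum_kidx by (simp only: add_0)
    qed
    also have "\<dots> = 0" by (rule rel) (use k y cc in \<open>auto simp: params_def\<close>)
    finally show "(\<Sum>c'\<in>Col k. x (Inr (k, y, c')) * mat k cc c') = 0" .
  qed
  \<comment> \<open>Only scalars contribute to the diagonal entry at the zero column, because the
    edge units that fix it are the ones left out of \<open>edge_idx\<close>.\<close>
  have C3: "C (Inr (Inr k)) = 0" if k: "k \<in> V - {k0}" for k
  proof -
    have k': "k \<in> V" using k by simp
    have "(\<Sum>(e, l, l')\<in>?KE. C (Inr (Inl (e, l, l'))) * (of_bool (k = src e \<and> loc k conf0 e = l' \<and> loc k conf0 = (loc k conf0)(e := l)) - of_bool (k = tgt e \<and> loc k conf0 e = l \<and> loc k conf0 = (loc k conf0)(e := l')))) = 0"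
    proof (rule sum.neutral, rule ballI)
      fix p assume p: "p \<in> ?KE"
      obtain e l l' where pe: "p = (e, l, l')" by (cases p) auto
      have e: "e \<in> E" "(l, l') \<noteq> ((0, 0), (0, 0))" using p pe by auto
      have "\<not> (k = src e \<and> loc k conf0 e = l' \<and> loc k conf0 = (loc k conf0)(e := l))"
      proof
        assume h: "k = src e \<and> loc k conf0 e = l' \<and> loc k conf0 = (loc k conf0)(e := l)"
        then have i: "e \<in> inc k" and eq: "loc k conf0 = (loc k conf0)(e := l)" using src_inc[OF e(1)] by blast+
        from fun_cong[OF eq, of e] have "loc k conf0 e = l" by (simp only: fun_upd_same)
        moreover have "loc k conf0 e = (0, 0)" by (rule loc_conf0[OF i])
        ultimately have "l = (0, 0)" "l' = (0, 0)" using h by metis+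
        then show False using e(2) by simp
      qed
      moreover have "\<not> (k = tgt e \<and> loc k conf0 e = l \<and> loc k conf0 = (loc k conf0)(e := l'))"
      proof
        assume h: "k = tgt e \<and> loc k conf0 e = l \<and> loc k conf0 = (loc k conf0)(e := l')"
        then have i: "e \<in> inc k" and eq: "loc k conf0 = (loc k conf0)(e := l')" using tgt_inc[OF e(1)] by blast+
        from fun_cong[OF eq, of e] have "loc k conf0 e = l'" by (simp only: fun_upd_same)
        moreover have "loc k conf0 e = (0, 0)" by (rule loc_conf0[OF i])
        ultimately have "l = (0, 0)" "l' = (0, 0)" using h by metis+
        then show False using e(2) by simp
      qed
      ultimately show "(\<lambda>(e, l, l'). C (Inr (Inl (e, l, l'))) * (of_bool (k = src e \<and> loc k conf0 e = l' \<and> loc k conf0 = (loc k conf0)(e := l)) - of_bool (k = tgt e \<and> loc k conf0 e = l \<and> loc k conf0 = (loc k conf0)(e := l')))) p = 0"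
        unfolding pe prod.case by (simp only: of_bool_eq diff_zero mult_zero_right)
    qed
    moreover have "(\<Sum>k1\<in>V - {k0}. C (Inr (Inr k1)) * (of_bool (k = k1 \<and> loc k conf0 = loc k conf0) - of_bool (k = k0 \<and> loc k conf0 = loc k conf0))) = C (Inr (Inr k))"
      using k finV by (subst sum_eq_single[where ?p0.0 = k]) auto
    ultimately show ?thesis using mat0[OF k' loc_Col[OF conf0] loc_Col[OF conf0]] unfolding mat_def by (simp only: add_0)
  qed
  \<comment> \<open>Once the scalars are gone, the entry between the columns carrying
    \<open>l0'\<close> and \<open>l0\<close> on \<open>e0\<close> and zero elsewhere is met by a
    single edge unit. At \<open>src e0\<close> the opposite term of that unit does not
    interfere.\<close>
  have C2: "C (Inr (Inl (e0, l0, l0'))) = 0" if e0: "(e0, l0, l0') \<in> ?KE" for e0 l0 l0'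
  proof -
    let ?k = "src e0" and ?cc = "loc (src e0) (conf0(e0 := l0'))" and ?c' = "loc (src e0) (conf0(e0 := l0))"
    have e: "e0 \<in> E" "l0 \<in> Lab e0" "l0' \<in> Lab e0" "(l0, l0') \<noteq> ((0, 0), (0, 0))" using e0 by auto
    have k: "?k \<in> V" using edge[OF e(1)] by simp
    have val: "?cc e = (if e = e0 then l0' else (0, 0))" "?c' e = (if e = e0 then l0 else (0, 0))" if "e \<in> inc ?k" for e
      using loc_conf0_upd[OF that] by auto
    have "(\<Sum>p\<in>?KE. (\<lambda>(e, l, l'). C (Inr (Inl (e, l, l'))) * (of_bool (?k = src e \<and> ?cc e = l' \<and> ?c' = ?cc(e := l)) - of_bool (?k = tgt e \<and> ?cc e = l \<and> ?c' = ?cc(e := l')))) p)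
       = (\<lambda>(e, l, l'). C (Inr (Inl (e, l, l'))) * (of_bool (?k = src e \<and> ?cc e = l' \<and> ?c' = ?cc(e := l)) - of_bool (?k = tgt e \<and> ?cc e = l \<and> ?c' = ?cc(e := l')))) (e0, l0, l0')"
    proof (rule sum_eq_single[OF finKE e0])
      fix p assume p: "p \<in> ?KE" "p \<noteq> (e0, l0, l0')"
      obtain e l l' where pe: "p = (e, l, l')" by (cases p) auto
      have eE: "e \<in> E" "(l, l') \<noteq> ((0, 0), (0, 0))" using p pe by auto
      have 1: False if h: "?k = src e" "?cc e = l'" "?c' = ?cc(e := l)"
      proof -
        have i: "e \<in> inc ?k" using src_inc[OF eE(1)] h(1) by simp
        have "?c' e = l" using fun_cong[OF h(3), of e] by (simp only: fun_upd_same)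
        then have "l = (if e = e0 then l0 else (0, 0))" "l' = (if e = e0 then l0' else (0, 0))"
          using h(2) unfolding val[OF i] by simp_all
        then show False using p(2) pe eE(2) by (cases "e = e0") simp_all
      qed
      have 2: False if h: "?k = tgt e" "?cc e = l" "?c' = ?cc(e := l')"
      proof -
        have i: "e \<in> inc ?k" using tgt_inc[OF eE(1)] h(1) by simp
        have "?c' e = l'" using fun_cong[OF h(3), of e] by (simp only: fun_upd_same)
        then have "l' = (if e = e0 then l0 else (0, 0))" "l = (if e = e0 then l0' else (0, 0))"
          using h(2) unfolding val[OF i] by simp_all
        moreover have "e \<noteq> e0" using h(1) edge[OF e(1)] by metis
        ultimately show False using eE(2) by simp
      qed
      show "(\<lambda>(e, l, l'). C (Inr (Inl (e, l, l'))) * (of_bool (?k = src e \<and> ?cc e = l' \<and> ?c' = ?cc(e := l)) - of_bool (?k = tgt e \<and> ?cc e = l \<and> ?c' = ?cc(e := l')))) p = 0"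
      proof -
        have n: "\<not> (?k = src e \<and> ?cc e = l' \<and> ?c' = ?cc(e := l))"
          by (intro notI, elim conjE) (rule 1)
        have n': "\<not> (?k = tgt e \<and> ?cc e = l \<and> ?c' = ?cc(e := l'))"
          by (intro notI, elim conjE) (rule 2)
        show ?thesis unfolding pe prod.case by (simp only: n n' of_bool_eq diff_zero mult_zero_right)
      qed
    qed
    also have "\<dots> = C (Inr (Inl (e0, l0, l0')))"
    proof -
      have "?cc e0 = l0'" using val(1)[OF src_inc[OF e(1)]] by simp
      moreover have "?c' = ?cc(e0 := l0)" using src_inc[OF e(1)] by auto
      moreover have "?k \<noteq> tgt e0" using edge[OF e(1)] by auto
      ultimately show ?thesis by (simp del: restrict_upd restrict_apply)
    qed
    finally have "mat ?k ?cc ?c' = C (Inr (Inl (e0, l0, l0')))"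
      unfolding mat_def using C3 by simp
    then show ?thesis using mat0[OF k loc_Col[OF conf0_upd[OF e(1,3)]] loc_Col[OF conf0_upd[OF e(1,2)]]] by simp
  qed
  show ?thesis using ix C1 C2 C3 unfolding kidx_def by blast
qed

subsection \<open>The tangent map at a base point\<close>

text \<open>The vertex matrices are identities once rows are identified with columns by
  \<open>\<gamma>\<close>. Coordinate 0 of the pencils does not distinguish the blocks, and
  coordinate 1 weights each block by its index.\<close>

definition base_point :: "('v, 'r) param \<Rightarrow> complex" where
  "base_point p = (case p of Inl (r, b, a) \<Rightarrow> if a = 0 then 1 else of_nat b | Inr (k, y, c) \<Rightarrow> of_bool (\<gamma> k y = c))"

definition row :: "'v \<Rightarrow> ('v set \<Rightarrow> nat \<times> nat) \<Rightarrow> nat" where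
  "row k = inv_into {..<N k} (\<gamma> k)"

lemma row: "k \<in> V \<Longrightarrow> c \<in> Col k \<Longrightarrow> row k c < N k \<and> \<gamma> k (row k c) = c"
  using \<gamma>[of k] inv_into_into[of c "\<gamma> k" "{..<N k}"] f_inv_into_f[of c "\<gamma> k" "{..<N k}"]
  unfolding row_def bij_betw_def by auto

lemma row_surj: "k \<in> V \<Longrightarrow> y < N k \<Longrightarrow> \<gamma> k y \<in> Col k \<and> row k (\<gamma> k y) = y"
  using \<gamma>[of k] unfolding row_def bij_betw_def by (auto simp: inv_into_f_f)

text \<open>Coordinates that are normalised to zero on a slice transversal to the kernel.\<close>

definition gauge_coord :: "'r \<times> nat + ('v set \<times> (nat \<times> nat) \<times> (nat \<times> nat)) + 'v \<Rightarrow> ('v, 'r) param" where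
  "gauge_coord ix = (case ix of Inl (r, b) \<Rightarrow> Inl (r, b, 0)
    | Inr (Inl (e, l, l')) \<Rightarrow> Inr (src e, row (src e) (loc (src e) (conf0(e := l))), loc (src e) (conf0(e := l')))
    | Inr (Inr k) \<Rightarrow> Inr (k, row k (loc k conf0), loc k conf0))"

lemma gauge_coord_params: "gauge_coord ` kidx \<subseteq> params"
proof
  fix p assume "p \<in> gauge_coord ` kidx"
  then obtain ix where ix: "ix \<in> kidx" "p = gauge_coord ix" by blast
  then consider r b where "ix = Inl (r, b)" "r \<in> S" "b < Q (ed r)"
    | e l l' where "ix = Inr (Inl (e, l, l'))" "e \<in> E" "l \<in> Lab e" "l' \<in> Lab e" | k where "ix = Inr (Inr k)" "k \<in> V"
    unfolding kidx_def by blast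
  then show "p \<in> params"
  proof cases
    case 2
    then have "src e \<in> V" using edge by blast
    then show ?thesis
      using 2 ix(2) row[OF _ loc_Col[OF conf0_upd[OF 2(2,3)]], of "src e"] loc_Col[OF conf0_upd[OF 2(2,4)], of "src e"]
      by (simp add: params_def gauge_coord_def image_iff del: restrict_upd restrict_PiE_iff restrict_apply)
  next
    case 3
    then show ?thesis using ix(2) row[OF _ loc_Col[OF conf0], of k] loc_Col[OF conf0, of k]
      by (simp add: params_def gauge_coord_def image_iff del: restrict_PiE_iff restrict_apply)
  qed (use ix in \<open>auto simp: params_def gauge_coord_def\<close>)
qed

lemma kidx_intros:
  "r \<in> S \<Longrightarrow> b < Q (ed r) \<Longrightarrow> Inl (r, b) \<in> kidx"
  "e \<in> E \<Longrightarrow> l \<in> Lab e \<Longrightarrow> l' \<in> Lab e \<Longrightarrow> fst l = fst l' \<Longrightarrow> (l, l') \<noteq> ((0, 0), (0, 0)) \<Longrightarrow> Inr (Inl (e, l, l')) \<in> kidx"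
  "k \<in> V \<Longrightarrow> k \<noteq> k0 \<Longrightarrow> Inr (Inr k) \<in> kidx"
  unfolding kidx_def by blast+

lemma kidxE:
  assumes "ix \<in> kidx"
  obtains (rescale) r b where "ix = Inl (r, b)" "r \<in> S" "b < Q (ed r)"
    | (edge) e l l' where "ix = Inr (Inl (e, l, l'))" "e \<in> E" "l \<in> Lab e" "l' \<in> Lab e" "fst l = fst l'" "(l, l') \<noteq> ((0, 0), (0, 0))"
    | (scalar) k where "ix = Inr (Inr k)" "k \<in> V" "k \<noteq> k0"
  using assms unfolding kidx_def by blast

text \<open>Two edges with the same source could share an entry only where both labels are
  \<open>(0, 0)\<close>, and this pair is excluded; the same exclusion separates edges from
  scalars.\<close>

lemma inj_gauge_coord: "inj_on gauge_coord kidx"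
proof (rule inj_onI)
  fix ix ix' assume ix: "ix \<in> kidx" "ix' \<in> kidx" and eq: "gauge_coord ix = gauge_coord ix'"
  have ee: "(e, l, l') = (f, g, g')"
    if e: "e \<in> E" "l \<in> Lab e" "l' \<in> Lab e" "(l, l') \<noteq> ((0, 0), (0, 0))"
      and f: "f \<in> E" "g \<in> Lab f" "g' \<in> Lab f" "(g, g') \<noteq> ((0, 0), (0, 0))"
      and eq: "gauge_coord (Inr (Inl (e, l, l'))) = gauge_coord (Inr (Inl (f, g, g')))" for e l l' f g g'
  proof -
    have k: "src e = src f" "row (src e) (loc (src e) (conf0(e := l))) = row (src e) (loc (src e) (conf0(f := g)))"
      "loc (src e) (conf0(e := l')) = loc (src e) (conf0(f := g'))" using eq by (auto simp: gauge_coord_def)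
    have V: "src e \<in> V" using edge[OF e(1)] by simp
    have l: "loc (src e) (conf0(e := l)) = loc (src e) (conf0(f := g))"
      using row[OF V loc_Col[OF conf0_upd[OF e(1,2)]]] row[OF V loc_Col[OF conf0_upd[OF f(1,2)]]] k(2) by metis
    have i: "e \<in> inc (src e)" "f \<in> inc (src e)" using src_inc[OF e(1)] src_inc[OF f(1)] k(1) by auto
    have g: "(if f = e then l else (0, 0)) = g" "(if f = e then l' else (0, 0)) = g'"
      using fun_cong[OF l, of f] fun_cong[OF k(3), of f] unfolding loc_conf0_upd[OF i(2)] by simp_all
    show ?thesis using f(4) g by (cases "f = e") simp_all
  qed
  have ek: False
    if e: "e \<in> E" "l \<in> Lab e" "l' \<in> Lab e" "(l, l') \<noteq> ((0, 0), (0, 0))"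
      and eq: "gauge_coord (Inr (Inl (e, l, l'))) = gauge_coord (Inr (Inr k))" for e l l' k
  proof -
    have k: "src e = k" "row (src e) (loc (src e) (conf0(e := l))) = row (src e) (loc (src e) conf0)"
      "loc (src e) (conf0(e := l')) = loc (src e) conf0" using eq by (auto simp: gauge_coord_def)
    have V: "src e \<in> V" using edge[OF e(1)] by simp
    have l: "loc (src e) (conf0(e := l)) = loc (src e) conf0"
      using row[OF V loc_Col[OF conf0_upd[OF e(1,2)]]] row[OF V loc_Col[OF conf0]] k(2) by metis
    show False
      using fun_cong[OF l, of e] fun_cong[OF k(3), of e] loc_conf0_upd[OF src_inc[OF e(1)], of e]
        loc_conf0[OF src_inc[OF e(1)]] e(4) by auto
  qed
  from ix(1) show "ix = ix'"
  proof (cases rule: kidxE)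
    case (rescale r b)
    from ix(2) rescale eq show ?thesis by (cases rule: kidxE) (simp_all add: gauge_coord_def)
  next
    case (edge e l l')
    from ix(2) show ?thesis
    proof (cases rule: kidxE)
      case (edge f g g')
      then show ?thesis using ee[of e l l' f g g'] \<open>ix = _\<close> \<open>e \<in> E\<close> \<open>l \<in> Lab e\<close> \<open>l' \<in> Lab e\<close> \<open>(l, l') \<noteq> _\<close> eq by simp
    next
      case (scalar k)
      then show ?thesis using ek[of e l l' k] edge eq by simp
    qed (use edge eq in \<open>simp add: gauge_coord_def\<close>)
  next
    case (scalar k)
    from ix(2) show ?thesis
    proof (cases rule: kidxE)
      case (edge e l l')
      then show ?thesis using ek[of e l l' k] scalar eq by simp
    qed (use scalar eq in \<open>simp_all add: gauge_coord_def\<close>)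
  qed
qed

text \<open>Every edge has an endpoint other than \<open>l\<close>, so the remaining vertices see
  all labels.\<close>

lemma conf_eq_off_vertex:
  assumes "\<kappa> \<in> Conf" "\<kappa>' \<in> Conf" "\<And>l'. l' \<in> V - {l} \<Longrightarrow> loc l' \<kappa> = loc l' \<kappa>'"
  shows "\<kappa> = \<kappa>'"
proof (rule PiE_ext[OF assms(1,2)])
  fix e assume e: "e \<in> E"
  obtain l' where "l' \<in> V - {l}" "e \<in> inc l'" using edge[OF e] src_inc[OF e] tgt_inc[OF e] by (metis DiffI singletonD)
  then show "\<kappa> e = \<kappa>' e" using fun_cong[OF assms(3), of l' e] by simp
qed

lemma sum_off_vertex:
  assumes "\<kappa>1 \<in> Conf" "\<And>l'. l' \<in> V - {l} \<Longrightarrow> w l' = loc l' \<kappa>1"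
  shows "(\<Sum>\<kappa>\<in>Conf. F \<kappa> * of_bool (\<forall>l'\<in>V - {l}. w l' = loc l' \<kappa>)) = (F \<kappa>1 :: complex)"
proof -
  have "(\<Sum>\<kappa>\<in>Conf. F \<kappa> * of_bool (\<forall>l'\<in>V - {l}. w l' = loc l' \<kappa>)) = F \<kappa>1 * of_bool (\<forall>l'\<in>V - {l}. w l' = loc l' \<kappa>1)"
  proof (rule sum_eq_single[OF finConf assms(1)])
    fix \<kappa> assume \<kappa>: "\<kappa> \<in> Conf" "\<kappa> \<noteq> \<kappa>1"
    have "\<not> (\<forall>l'\<in>V - {l}. w l' = loc l' \<kappa>)"
    proof
      assume "\<forall>l'\<in>V - {l}. w l' = loc l' \<kappa>"
      then have "\<kappa> = \<kappa>1" by (intro conf_eq_off_vertex[OF \<kappa>(1) assms(1), of l]) (metis assms(2))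
      then show False using \<kappa>(2) by simp
    qed
    then show "F \<kappa> * of_bool (\<forall>l'\<in>V - {l}. w l' = loc l' \<kappa>) = 0" by (simp only: of_bool_eq mult_zero_right)
  qed
  also have "\<dots> = F \<kappa>1" using assms(2) by simp
  finally show ?thesis .
qed

section \<open>The equations of the derivative at the base point\<close>

definition pencil_deriv :: "(('v, 'r) param \<Rightarrow> complex) \<Rightarrow> ('r \<Rightarrow> nat) \<Rightarrow> ('v set \<Rightarrow> nat \<times> nat) \<Rightarrow> complex" where
  "pencil_deriv v a \<kappa> = (\<Sum>r\<in>S. v (Inl (r, fst (\<kappa> (ed r)), a r)) *
     (\<Prod>r'\<in>S - {r}. base_point (Inl (r', fst (\<kappa> (ed r')), a r'))))"

text \<open>With identity matrices at the vertices, the output entry with columns \<open>w\<close>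
  receives only configurations that agree with \<open>w\<close> at all vertices, or at all but the
  one whose matrix is varied.\<close>

lemma base_deriv:
  assumes w: "\<And>k. k \<in> V \<Longrightarrow> w k \<in> Col k"
  shows "tensor_deriv base_point v a (\<lambda>k. row k (w k)) =
    (\<Sum>\<kappa>\<in>Conf. pencil_deriv v a \<kappa> * of_bool (\<forall>k\<in>V. w k = loc k \<kappa>)) +
    (\<Sum>l\<in>V. \<Sum>\<kappa>\<in>Conf. (pencil_part base_point a \<kappa> * v (Inr (l, row l (w l), loc l \<kappa>))) *
      of_bool (\<forall>l'\<in>V - {l}. w l' = loc l' \<kappa>))"
proof -
  have b: "base_point (Inr (k, row k (w k), c)) = of_bool (w k = c)" if "k \<in> V" for k c
    using row[OF that w[OF that]] by (simp add: base_point_def)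
  have P: "(\<Prod>k\<in>V. base_point (Inr (k, row k (w k), loc k \<kappa>))) = of_bool (\<forall>k\<in>V. w k = loc k \<kappa>)" for \<kappa>
    by (subst prod_of_bool_eq[OF finV, symmetric]) (intro prod.cong refl b)
  have P': "(\<Prod>k\<in>V - {l}. base_point (Inr (k, row k (w k), loc k \<kappa>))) = of_bool (\<forall>k\<in>V - {l}. w k = loc k \<kappa>)" for \<kappa> l
    by (subst prod_of_bool_eq[symmetric]) (use finV in \<open>auto intro!: prod.cong b\<close>)
  show ?thesis
    unfolding tensor_deriv_def P P' pencil_deriv_def[symmetric] sum.distrib sum_distrib_left
    by (subst (2) sum.swap) (simp only: mult.assoc)
qed

lemma pencil_part_base0: "pencil_part base_point (\<lambda>_. 0) \<kappa> = 1"
  by (simp add: pencil_part_def base_point_def)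

lemma pencil_part_base1:
  assumes "r \<in> S"
  shows "pencil_part base_point (\<lambda>s. of_bool (s = r)) \<kappa> = of_nat (fst (\<kappa> (ed r)))"
proof -
  have "pencil_part base_point (\<lambda>s. of_bool (s = r)) \<kappa> = (\<Prod>s\<in>S. if s = r then of_nat (fst (\<kappa> (ed s))) else 1)"
    unfolding pencil_part_def by (intro prod.cong) (auto simp: base_point_def)
  then show ?thesis using assms finS by simp
qed

lemma edge_unique: "e1 \<in> E \<Longrightarrow> e2 \<in> E \<Longrightarrow> k \<in> e1 \<Longrightarrow> l \<in> e1 \<Longrightarrow> k \<in> e2 \<Longrightarrow> l \<in> e2 \<Longrightarrow> k \<noteq> l \<Longrightarrow> e1 = e2"
  using edge[of e1] edge[of e2] by (metis doubleton_eq_iff empty_iff insert_iff)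

text \<open>The tested output, in which \<open>k\<close> sees the label \<open>\<mu>\<close> on
  \<open>e\<close> and all others see \<open>\<kappa>\<close>, is inconsistent on \<open>e\<close>
  alone. Varying one matrix can repair this only at \<open>k\<close>, with configuration
  \<open>\<kappa>\<close>, or at \<open>l\<close>, with the updated configuration; so the equation
  has two terms.\<close>

lemma base_deriv_one_edge:
  assumes D: "\<forall>a y. (\<forall>r\<in>S. a r < 2) \<longrightarrow> (\<forall>k\<in>V. y k < N k) \<longrightarrow> tensor_deriv base_point v a y = 0"
    and a: "\<forall>r\<in>S. a r < 2" and \<kappa>: "\<kappa> \<in> Conf" and e: "e \<in> E" "k \<in> e" "l \<in> e" "k \<noteq> l" and \<mu>: "\<mu> \<in> Lab e" "\<mu> \<noteq> \<kappa> e"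
  shows "pencil_part base_point a \<kappa> * v (Inr (k, row k (loc k (\<kappa>(e := \<mu>))), loc k \<kappa>)) +
    pencil_part base_point a (\<kappa>(e := \<mu>)) * v (Inr (l, row l (loc l \<kappa>), loc l (\<kappa>(e := \<mu>)))) = 0"
proof -
  let ?\<kappa> = "\<kappa>(e := \<mu>)"
  have \<kappa>': "?\<kappa> \<in> Conf" by (rule conf_upd[OF \<kappa> e(1) \<mu>(1)])
  define w where "w i = (if i = k then loc k ?\<kappa> else loc i \<kappa>)" for i
  have w: "w i \<in> Col i" for i using loc_Col[OF \<kappa>, of i] loc_Col[OF \<kappa>', of k] by (simp add: w_def del: restrict_PiE_iff)
  have kl: "k \<in> V" "l \<in> V" "e = {k, l}"
  proof -
    have *: "e = {src e, tgt e}" "src e \<in> V" "tgt e \<in> V" using edge[OF e(1)] by auto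
    then have in_e: "k \<in> {src e, tgt e}" "l \<in> {src e, tgt e}" using e(2,3) by metis+
    then show "k \<in> V" "l \<in> V" using *(2,3) by (metis insertE singletonD)+
    have "{src e, tgt e} = {k, l}" using in_e e(4) by auto
    then show "e = {k, l}" using *(1) by metis
  qed
  have inc: "e \<in> inc k" "e \<in> inc l" using e by auto
  have neqk: "loc k ?\<kappa> \<noteq> loc k \<kappa>" 
  proof
    assume h: "loc k ?\<kappa> = loc k \<kappa>"
    from fun_cong[OF h, of e] show False using inc \<mu> by simp
  qed
  define F where "F i \<kappa>' = pencil_part base_point a \<kappa>' * v (Inr (i, row i (w i), loc i \<kappa>'))" for i \<kappa>'
  have 1: "(\<Sum>\<kappa>'\<in>Conf. F k \<kappa>' * of_bool (\<forall>l'\<in>V - {k}. w l' = loc l' \<kappa>')) = F k \<kappa>"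
    by (rule sum_off_vertex[OF \<kappa>]) (simp add: w_def)
  have 2: "(\<Sum>\<kappa>'\<in>Conf. F l \<kappa>' * of_bool (\<forall>l'\<in>V - {l}. w l' = loc l' \<kappa>')) = F l ?\<kappa>"
  proof (rule sum_off_vertex[OF \<kappa>'])
    fix i assume i: "i \<in> V - {l}"
    show "w i = loc i ?\<kappa>"
    proof (cases "i = k")
      case False
      then have "e \<notin> inc i" using i kl by auto
      then show ?thesis using False by (simp only: loc_upd w_def if_False)
    qed (simp add: w_def)
  qed
  have 3: "(\<Sum>\<kappa>'\<in>Conf. F i \<kappa>' * of_bool (\<forall>l'\<in>V - {i}. w l' = loc l' \<kappa>')) = 0" if i: "i \<in> V" "i \<noteq> k" "i \<noteq> l" for i
  proof (rule sum.neutral, rule ballI)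
    fix \<kappa>' assume "\<kappa>' \<in> Conf"
    have "\<not> (\<forall>l'\<in>V - {i}. w l' = loc l' \<kappa>')"
    proof
      assume h: "\<forall>l'\<in>V - {i}. w l' = loc l' \<kappa>'"
      have "loc k ?\<kappa> e = loc k \<kappa>' e" "loc l \<kappa> e = loc l \<kappa>' e"
        using bspec[OF h, of k] bspec[OF h, of l] kl i e(4) by (auto simp: w_def)
      then show False using inc \<mu> by simp
    qed
    then show "F i \<kappa>' * of_bool (\<forall>l'\<in>V - {i}. w l' = loc l' \<kappa>') = 0" by (simp only: of_bool_eq mult_zero_right)
  qed
  have 0: "(\<Sum>\<kappa>'\<in>Conf. pencil_deriv v a \<kappa>' * of_bool (\<forall>i\<in>V. w i = loc i \<kappa>')) = 0"
  proof (rule sum.neutral, rule ballI)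
    fix \<kappa>' assume \<kappa>'': "\<kappa>' \<in> Conf"
    have "\<not> (\<forall>i\<in>V. w i = loc i \<kappa>')"
    proof
      assume h: "\<forall>i\<in>V. w i = loc i \<kappa>'"
      then have "\<kappa>' = \<kappa>" by (intro conf_eq_off_vertex[OF \<kappa>'' \<kappa>, of k]) (auto simp: w_def)
      then show False using h kl(1) neqk by (auto simp: w_def)
    qed
    then show "pencil_deriv v a \<kappa>' * of_bool (\<forall>i\<in>V. w i = loc i \<kappa>') = 0" by (simp only: of_bool_eq mult_zero_right)
  qed
  have "0 = tensor_deriv base_point v a (\<lambda>k. row k (w k))"
    by (rule D[rule_format, symmetric]) (use a row w in auto)
  also have "\<dots> = (\<Sum>i\<in>V. \<Sum>\<kappa>'\<in>Conf. F i \<kappa>' * of_bool (\<forall>l'\<in>V - {i}. w l' = loc l' \<kappa>'))"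
    unfolding base_deriv[of w, OF w] 0 F_def by simp
  also have "\<dots> = (\<Sum>i\<in>{k, l}. \<Sum>\<kappa>'\<in>Conf. F i \<kappa>' * of_bool (\<forall>l'\<in>V - {i}. w l' = loc l' \<kappa>'))"
    by (rule sum.mono_neutral_right) (use finV kl 3 in auto)
  also have "\<dots> = F k \<kappa> + F l ?\<kappa>" using e(4) 1 2 by simp
  finally show ?thesis using e(4) by (simp add: F_def w_def)
qed

text \<open>An inconsistency on two edges at \<open>k\<close> can only be repaired at
  \<open>k\<close>, since in a simple graph no other vertex lies on both. A single term
  survives.\<close>

lemma base_deriv_two_edges:
  assumes D: "\<forall>a y. (\<forall>r\<in>S. a r < 2) \<longrightarrow> (\<forall>k\<in>V. y k < N k) \<longrightarrow> tensor_deriv base_point v a y = 0"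
    and \<kappa>: "\<kappa> \<in> Conf" and k: "k \<in> V" and c: "c \<in> Col k"
    and e: "e1 \<in> inc k" "e2 \<in> inc k" "e1 \<noteq> e2" "c e1 \<noteq> \<kappa> e1" "c e2 \<noteq> \<kappa> e2"
  shows "v (Inr (k, row k c, loc k \<kappa>)) = 0"
proof -
  let ?a = "\<lambda>_::'r. 0::nat"
  define w where "w i = (if i = k then c else loc i \<kappa>)" for i
  have w: "w i \<in> Col i" for i using loc_Col[OF \<kappa>, of i] c by (simp add: w_def del: restrict_PiE_iff)
  define F where "F i \<kappa>' = pencil_part base_point ?a \<kappa>' * v (Inr (i, row i (w i), loc i \<kappa>'))" for i \<kappa>'
  have 1: "(\<Sum>\<kappa>'\<in>Conf. F k \<kappa>' * of_bool (\<forall>l'\<in>V - {k}. w l' = loc l' \<kappa>')) = F k \<kappa>"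
    by (rule sum_off_vertex[OF \<kappa>]) (simp add: w_def)
  have 3: "(\<Sum>\<kappa>'\<in>Conf. F i \<kappa>' * of_bool (\<forall>l'\<in>V - {i}. w l' = loc l' \<kappa>')) = 0" if i: "i \<in> V" "i \<noteq> k" for i
  proof (rule sum.neutral, rule ballI)
    fix \<kappa>' assume "\<kappa>' \<in> Conf"
    have "\<not> (\<forall>l'\<in>V - {i}. w l' = loc l' \<kappa>')"
    proof
      assume h: "\<forall>l'\<in>V - {i}. w l' = loc l' \<kappa>'"
      have i_in: "i \<in> e" if e: "e \<in> inc k" "c e \<noteq> \<kappa> e" for e
      proof (rule ccontr)
        assume ni: "i \<notin> e"
        obtain o' where o: "o' \<in> V" "o' \<in> e" "o' \<noteq> k" using edge[of e] e(1) by (metis (no_types, lifting) insertCI mem_Collect_eq)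
        have "c e = loc k \<kappa>' e" using bspec[OF h, of k] k i by (simp add: w_def)
        moreover have "loc o' \<kappa> = loc o' \<kappa>'"
        proof -
          have "o' \<noteq> i" using o ni by blast
          then show ?thesis using bspec[OF h, of o'] o by (simp only: w_def if_False) simp
        qed
        then have "loc o' \<kappa> e = loc o' \<kappa>' e" by (rule fun_cong)
        ultimately show False using e o by simp
      qed
      have "e1 = e2" using e i_in[of e1] i_in[of e2] i(2) by (intro edge_unique[of e1 e2 k i]) auto
      then show False using e(3) by simp
    qed
    then show "F i \<kappa>' * of_bool (\<forall>l'\<in>V - {i}. w l' = loc l' \<kappa>') = 0" by (simp only: of_bool_eq mult_zero_right)
  qed
  have 0: "(\<Sum>\<kappa>'\<in>Conf. pencil_deriv v ?a \<kappa>' * of_bool (\<forall>i\<in>V. w i = loc i \<kappa>')) = 0"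
  proof (rule sum.neutral, rule ballI)
    fix \<kappa>' assume \<kappa>'': "\<kappa>' \<in> Conf"
    have "\<not> (\<forall>i\<in>V. w i = loc i \<kappa>')"
    proof
      assume h: "\<forall>i\<in>V. w i = loc i \<kappa>'"
      then have "\<kappa>' = \<kappa>" by (intro conf_eq_off_vertex[OF \<kappa>'' \<kappa>, of k]) (auto simp: w_def)
      then have "c = loc k \<kappa>" using h k by (auto simp: w_def)
      then show False using e by simp
    qed
    then show "pencil_deriv v ?a \<kappa>' * of_bool (\<forall>i\<in>V. w i = loc i \<kappa>') = 0" by (simp only: of_bool_eq mult_zero_right)
  qed
  have "0 = tensor_deriv base_point v ?a (\<lambda>k. row k (w k))"
    by (rule D[rule_format, symmetric]) (use row w in auto)
  also have "\<dots> = (\<Sum>i\<in>V. \<Sum>\<kappa>'\<in>Conf. F i \<kappa>' * of_bool (\<forall>l'\<in>V - {i}. w l' = loc l' \<kappa>'))"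
    unfolding base_deriv[of w, OF w] 0 F_def by simp
  also have "\<dots> = (\<Sum>i\<in>{k}. \<Sum>\<kappa>'\<in>Conf. F i \<kappa>' * of_bool (\<forall>l'\<in>V - {i}. w l' = loc l' \<kappa>'))"
    by (rule sum.mono_neutral_right) (use finV k 3 in auto)
  also have "\<dots> = F k \<kappa>" using 1 by simp
  finally show ?thesis by (simp add: F_def w_def pencil_part_base0)
qed

text \<open>A consistent output is reached by varying the pencils or any one of the vertices, always
  through the configuration \<open>\<kappa>\<close> itself.\<close>

lemma base_deriv_diagonal:
  assumes D: "\<forall>a y. (\<forall>r\<in>S. a r < 2) \<longrightarrow> (\<forall>k\<in>V. y k < N k) \<longrightarrow> tensor_deriv base_point v a y = 0"
    and a: "\<forall>r\<in>S. a r < 2" and \<kappa>: "\<kappa> \<in> Conf"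
  shows "pencil_deriv v a \<kappa> + pencil_part base_point a \<kappa> * (\<Sum>l\<in>V. v (Inr (l, row l (loc l \<kappa>), loc l \<kappa>))) = 0"
proof -
  define w where "w i = loc i \<kappa>" for i
  have w: "w i \<in> Col i" for i using loc_Col[OF \<kappa>, of i] by (simp add: w_def del: restrict_PiE_iff)
  have 1: "(\<Sum>\<kappa>'\<in>Conf. F \<kappa>' * of_bool (\<forall>l'\<in>V - {k}. w l' = loc l' \<kappa>')) = F \<kappa>" for k and F :: "_ \<Rightarrow> complex"
    by (rule sum_off_vertex[OF \<kappa>]) (simp add: w_def)
  have 0: "(\<Sum>\<kappa>'\<in>Conf. pencil_deriv v a \<kappa>' * of_bool (\<forall>i\<in>V. w i = loc i \<kappa>')) = pencil_deriv v a \<kappa> * of_bool (\<forall>i\<in>V. w i = loc i \<kappa>)"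
  proof (rule sum_eq_single[OF finConf \<kappa>])
    fix \<kappa>' assume \<kappa>'': "\<kappa>' \<in> Conf" "\<kappa>' \<noteq> \<kappa>"
    have "\<not> (\<forall>i\<in>V. w i = loc i \<kappa>')"
    proof
      assume h: "\<forall>i\<in>V. w i = loc i \<kappa>'"
      then have "\<kappa>' = \<kappa>" by (intro conf_eq_off_vertex[OF \<kappa>''(1) \<kappa>, of k0]) (auto simp: w_def)
      then show False using \<kappa>'' by simp
    qed
    then show "pencil_deriv v a \<kappa>' * of_bool (\<forall>i\<in>V. w i = loc i \<kappa>') = 0" by (simp only: of_bool_eq mult_zero_right)
  qed
  have "0 = tensor_deriv base_point v a (\<lambda>k. row k (w k))"
    by (rule D[rule_format, symmetric]) (use a row w in auto)
  also have "\<dots> = pencil_deriv v a \<kappa> + (\<Sum>i\<in>V. pencil_part base_point a \<kappa> * v (Inr (i, row i (w i), loc i \<kappa>)))"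
    unfolding base_deriv[of w, OF w] 0 1 by (simp add: w_def)
  finally show ?thesis by (simp add: w_def sum_distrib_left)
qed

end


context block_network
begin

definition ext_conf :: "'v \<Rightarrow> ('v set \<Rightarrow> nat \<times> nat) \<Rightarrow> 'v set \<Rightarrow> nat \<times> nat" where
  "ext_conf k c = (\<lambda>e\<in>E. if k \<in> e then c e else (0, 0))"

lemma ext_conf: "c \<in> Col k \<Longrightarrow> ext_conf k c \<in> Conf"
  unfolding ext_conf_def restrict_PiE_iff
proof (rule ballI)
  fix e assume "c \<in> Col k" "e \<in> E"
  then show "(if k \<in> e then c e else (0, 0)) \<in> Lab e"
    using PiE_mem[of c "inc k" Lab e] Qpos[of e] Mpos[of e] by simp
qed

lemma loc_ext_conf: "c \<in> Col k \<Longrightarrow> loc k (ext_conf k c) = c"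
  by (rule extensionalityI[of _ "inc k"]) (auto simp: ext_conf_def PiE_def)

text \<open>Off the diagonal, entries changing two edges vanish at once. Entries changing one edge
  come in pairs at its two endpoints: within a block the entry at the source is normalised to zero,
  and between blocks the two pencil coordinates give independent equations. On the diagonal the sum
  over the vertices is zero for every configuration, and the normalisations propagate from
  \<open>conf0\<close> to one changed label and then to arbitrary columns.\<close>

lemma base_point_injective:
  assumes v0: "\<And>p. p \<notin> params - gauge_coord ` kidx \<Longrightarrow> v p = 0"
    and D: "\<forall>a y. (\<forall>r\<in>S. a r < 2) \<longrightarrow> (\<forall>k\<in>V. y k < N k) \<longrightarrow> tensor_deriv base_point v a y = 0"
  shows "v p = 0"
proof -
  let ?a0 = "\<lambda>_::'r. 0::nat"
  define A where "A k c c' = v (Inr (k, row k c, c'))" for k c c'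
  have gauge: "v (gauge_coord ix) = 0" if "ix \<in> kidx" for ix
    by (rule v0) (use that in auto)
  have gz: "v (Inl (r, b, 0)) = 0" if "r \<in> S" "b < Q (ed r)" for r b
    using gauge[OF kidx_intros(1)[OF that]] by (simp add: gauge_coord_def)
  have ge: "A (src e) (loc (src e) (conf0(e := l))) (loc (src e) (conf0(e := l'))) = 0"
    if "e \<in> E" "l \<in> Lab e" "l' \<in> Lab e" "fst l = fst l'" "(l, l') \<noteq> ((0, 0), (0, 0))" for e l l'
    using gauge[OF kidx_intros(2)[OF that]] by (simp add: gauge_coord_def A_def)
  have gk: "A k (loc k conf0) (loc k conf0) = 0" if "k \<in> V" "k \<noteq> k0" for k
    using gauge[OF kidx_intros(3)[OF that]] by (simp add: gauge_coord_def A_def)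
  have one: "pencil_part base_point a \<kappa> * A k (loc k (\<kappa>(e := m))) (loc k \<kappa>) +
      pencil_part base_point a (\<kappa>(e := m)) * A l (loc l \<kappa>) (loc l (\<kappa>(e := m))) = 0"
    if "\<forall>r\<in>S. a r < 2" "\<kappa> \<in> Conf" "e \<in> E" "k \<in> e" "l \<in> e" "k \<noteq> l" "m \<in> Lab e" "m \<noteq> \<kappa> e" for a \<kappa> e k l m
    unfolding A_def by (rule base_deriv_one_edge[OF D that])
  have neg: "A k (loc k (\<kappa>(e := m))) (loc k \<kappa>) = - A l (loc l \<kappa>) (loc l (\<kappa>(e := m)))"
    if "\<kappa> \<in> Conf" "e \<in> E" "k \<in> e" "l \<in> e" "k \<noteq> l" "m \<in> Lab e" "m \<noteq> \<kappa> e" for \<kappa> e k l m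
    using one[of ?a0, OF _ that] by (simp add: pencil_part_base0 eq_neg_iff_add_eq_0)
  have same_block_tgt: "A (tgt e) (loc (tgt e) (\<kappa>(e := m))) (loc (tgt e) \<kappa>) = 0"
    if \<kappa>: "\<kappa> \<in> Conf" and e: "e \<in> E" and m: "m \<in> Lab e" "m \<noteq> \<kappa> e" "fst m = fst (\<kappa> e)" for \<kappa> e m
  proof -
    let ?t = "tgt e" and ?s = "src e"
    \<comment> \<open>The entry depends only on labels at \<open>tgt e\<close>. With all other
      labels set to zero, \<open>src e\<close> sees at most the label of \<open>e\<close>, and there
      the normalisation applies.\<close>
    let ?\<kappa> = "ext_conf ?t (loc ?t \<kappa>)"
    have st: "?s \<in> e" "?t \<in> e" "?s \<noteq> ?t" "e \<in> inc ?t" "e \<in> inc ?s" using edge[OF e] e by auto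
    have C: "?\<kappa> \<in> Conf" by (rule ext_conf[OF loc_Col[OF \<kappa>]])
    have \<kappa>e: "?\<kappa> e = \<kappa> e" "\<kappa> e \<in> Lab e" using st e \<kappa> by (auto simp: ext_conf_def dest: PiE_mem)
    have lt: "loc ?t ?\<kappa> = loc ?t \<kappa>" by (rule loc_ext_conf[OF loc_Col[OF \<kappa>]])
    have ls: "loc ?s ?\<kappa> = loc ?s (conf0(e := \<kappa> e))"
    proof (rule restrict_ext)
      fix f assume f: "f \<in> inc ?s"
      show "?\<kappa> f = (conf0(e := \<kappa> e)) f"
      proof (cases "f = e")
        case False
        then have "?t \<notin> f" using edge_unique[of f e ?s ?t] f st e by auto
        then show ?thesis using False f by (simp add: ext_conf_def conf0_def)
      qed (simp add: \<kappa>e)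
    qed
    have "A ?t (loc ?t (?\<kappa>(e := m))) (loc ?t ?\<kappa>) = - A ?s (loc ?s ?\<kappa>) (loc ?s (?\<kappa>(e := m)))"
      by (rule neg[OF C e]) (use st m \<kappa>e in auto)
    also have "loc ?s (?\<kappa>(e := m)) = loc ?s (conf0(e := m))"
      using ls st(5) by (simp only: loc_upd if_True) simp
    also have "A ?s (loc ?s ?\<kappa>) (loc ?s (conf0(e := m))) = 0"
      unfolding ls by (rule ge[OF e \<kappa>e(2) m(1)]) (use m in auto)
    finally show ?thesis using lt by (simp only: loc_upd minus_zero)
  qed
  have same_block: "A k (loc k (\<kappa>(e := m))) (loc k \<kappa>) = 0"
    if \<kappa>: "\<kappa> \<in> Conf" and e: "e \<in> E" "k \<in> e" and m: "m \<in> Lab e" "m \<noteq> \<kappa> e" "fst m = fst (\<kappa> e)" for \<kappa> e k m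
  proof (cases "k = tgt e")
    case True
    then show ?thesis using same_block_tgt[OF \<kappa> e(1) m] by (simp only:)
  next
    case False
    have st: "tgt e \<in> e" using edge[OF e(1)] by auto
    let ?\<kappa> = "\<kappa>(e := m)"
    have \<kappa>e: "\<kappa> e \<in> Lab e" using \<kappa> e by (auto dest: PiE_mem)
    have "A k (loc k ?\<kappa>) (loc k \<kappa>) = - A (tgt e) (loc (tgt e) \<kappa>) (loc (tgt e) ?\<kappa>)"
      by (rule neg[OF \<kappa> e st False m(1,2)])
    also have "A (tgt e) (loc (tgt e) \<kappa>) (loc (tgt e) ?\<kappa>) = 0"
    proof -
      have eq: "?\<kappa>(e := \<kappa> e) = \<kappa>" by simp
      have "A (tgt e) (loc (tgt e) (?\<kappa>(e := \<kappa> e))) (loc (tgt e) ?\<kappa>) = 0"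
        by (rule same_block_tgt[OF conf_upd[OF \<kappa> e(1) m(1)] e(1) \<kappa>e]) (use m in auto)
      then show ?thesis unfolding eq .
    qed
    finally show ?thesis by (simp only: minus_zero)
  qed
  have other_block: "A k (loc k (\<kappa>(e := m))) (loc k \<kappa>) = 0"
    if \<kappa>: "\<kappa> \<in> Conf" and e: "e \<in> E" "k \<in> e" and m: "m \<in> Lab e" "fst m \<noteq> fst (\<kappa> e)" for \<kappa> e k m
  proof -
    have \<kappa>e: "\<kappa> e \<in> Lab e" using \<kappa> e by (auto dest: PiE_mem)
    have "e \<in> ed ` S"
    proof (rule ccontr)
      assume "e \<notin> ed ` S"
      then have "Q e = 1" by (rule Q1[OF e(1)])
      then show False using m \<kappa>e by auto
    qed
    then obtain r where r: "r \<in> S" "e = ed r" by blast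
    obtain l where l: "l \<in> e" "k \<noteq> l" using edge[OF e(1)] e(2) by (metis insertCI)
    have me: "m \<noteq> \<kappa> e" using m(2) by auto
    let ?A = "A k (loc k (\<kappa>(e := m))) (loc k \<kappa>)" and ?B = "A l (loc l \<kappa>) (loc l (\<kappa>(e := m)))"
    have AB: "?A = - ?B" by (rule neg[OF \<kappa> e l m(1) me])
    \<comment> \<open>Testing with coordinate 1 in the r-th pencil only weights the two terms by
      their block indices. Together with the unweighted equation \<open>AB\<close> this kills both,
      because the indices differ.\<close>
    have "of_nat (fst (\<kappa> e)) * ?A + of_nat (fst m) * ?B = 0"
      using one[of "\<lambda>s. of_bool (s = r)", OF _ \<kappa> e l m(1) me] r by (simp add: pencil_part_base1 del: restrict_upd restrict_apply)
    then have "(of_nat (fst m) - of_nat (fst (\<kappa> e))) * ?B = 0" unfolding AB by (simp add: algebra_simps del: restrict_upd restrict_apply)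
    moreover have "(of_nat (fst m) :: complex) - of_nat (fst (\<kappa> e)) \<noteq> 0" using m(2) by simp
    ultimately have "?B = 0" by (simp only: mult_eq_0_iff) blast
    then show ?thesis using AB by (simp only: minus_zero)
  qed
  have off_diag: "A k c' c = 0" if k: "k \<in> V" and c: "c \<in> Col k" "c' \<in> Col k" and ne: "c' \<noteq> c" for k c c'
  proof -
    let ?\<kappa> = "ext_conf k c"
    have C: "?\<kappa> \<in> Conf" and lc: "loc k ?\<kappa> = c" using ext_conf[OF c(1)] loc_ext_conf[OF c(1)] by auto
    have val: "?\<kappa> e = c e" if "e \<in> inc k" for e using that by (simp add: ext_conf_def)
    obtain e where e: "e \<in> inc k" "c' e \<noteq> c e" using PiE_ext[OF c(2,1)] ne by blast
    show ?thesis
    proof (cases "\<exists>f\<in>inc k. f \<noteq> e \<and> c' f \<noteq> c f")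
      case True
      then obtain f where f: "f \<in> inc k" "f \<noteq> e" "c' f \<noteq> c f" by blast
      have "v (Inr (k, row k c', loc k ?\<kappa>)) = 0"
        by (rule base_deriv_two_edges[OF D C k c(2) e(1) f(1)]) (use e f val in auto)
      then show ?thesis by (simp only: A_def lc)
    next
      case False
      have c'e: "c' e \<in> Lab e" using c(2) e(1) by (auto dest: PiE_mem)
      have "c' = loc k (?\<kappa>(e := c' e))"
      proof (rule PiE_ext[OF c(2) loc_Col[OF conf_upd[OF C _ c'e]]])
        fix f assume "f \<in> inc k"
        then show "c' f = loc k (?\<kappa>(e := c' e)) f" using False val[of f] by auto
      qed (use e in simp)
      moreover have "A k (loc k (?\<kappa>(e := c' e))) (loc k ?\<kappa>) = 0"
        using same_block[OF C _ _ c'e] other_block[OF C _ _ c'e] e val[OF e(1)] by (cases "fst (c' e) = fst (c e)") auto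
      ultimately show ?thesis using lc by metis
    qed
  qed
  have diag_sum: "(\<Sum>l\<in>V. A l (loc l \<kappa>) (loc l \<kappa>)) = 0" if \<kappa>: "\<kappa> \<in> Conf" for \<kappa>
  proof -
    have "pencil_deriv v ?a0 \<kappa> = 0"
      unfolding pencil_deriv_def
    proof (rule sum.neutral, rule ballI)
      fix r assume r: "r \<in> S"
      then have "\<kappa> (ed r) \<in> Lab (ed r)" using \<kappa> ed by (auto dest: PiE_mem)
      then have "fst (\<kappa> (ed r)) < Q (ed r)" by auto
      then show "v (Inl (r, fst (\<kappa> (ed r)), 0)) * (\<Prod>r'\<in>S - {r}. base_point (Inl (r', fst (\<kappa> (ed r')), 0))) = 0"
        using gz[OF r] by simp
    qed
    then show ?thesis using base_deriv_diagonal[OF D _ \<kappa>, of ?a0] by (simp add: pencil_part_base0 A_def)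
  qed
  have d0: "A k (loc k conf0) (loc k conf0) = 0" if k: "k \<in> V" for k
  proof (cases "k = k0")
    case True
    have "(\<Sum>l\<in>V. A l (loc l conf0) (loc l conf0)) = A k0 (loc k0 conf0) (loc k0 conf0)"
      by (rule sum_eq_single[OF finV k0]) (rule gk)
    then show ?thesis using diag_sum[OF conf0] True by simp
  qed (use gk k in simp)
  have ds: "A (src e) (loc (src e) (conf0(e := l))) (loc (src e) (conf0(e := l))) = 0" if e: "e \<in> E" "l \<in> Lab e" for e l
  proof (cases "l = (0, 0)")
    case True
    then have "conf0(e := l) = conf0" using e(1) by (auto simp: conf0_def)
    then show ?thesis using d0[of "src e"] edge[OF e(1)] by simp
  qed (use ge[OF e(1) e(2) e(2)] in simp)
  have d1: "A k (loc k (conf0(e := l))) (loc k (conf0(e := l))) = 0" if e: "e \<in> E" "l \<in> Lab e" and k: "k \<in> V" for e l k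
  proof -
    have st: "src e \<in> V" "tgt e \<in> V" using edge[OF e(1)] by auto
    have other: "A i (loc i (conf0(e := l))) (loc i (conf0(e := l))) = 0" if "i \<in> V" "i \<noteq> tgt e" for i
      using d0[OF that(1)] ds[OF e] loc_upd_other[OF e(1), of i conf0 l] that(2) by (cases "i = src e") auto
    have "(\<Sum>i\<in>V. A i (loc i (conf0(e := l))) (loc i (conf0(e := l)))) = A (tgt e) (loc (tgt e) (conf0(e := l))) (loc (tgt e) (conf0(e := l)))"
      by (rule sum_eq_single[OF finV st(2)]) (rule other)
    then have "A (tgt e) (loc (tgt e) (conf0(e := l))) (loc (tgt e) (conf0(e := l))) = 0"
      using diag_sum[OF conf0_upd[OF e]] by simp
    then show ?thesis using other[OF k] by (cases "k = tgt e") auto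
  qed
  have diag: "A k c c = 0" if k: "k \<in> V" and c: "c \<in> Col k" for k c
  proof -
    let ?\<kappa> = "ext_conf k c"
    have C: "?\<kappa> \<in> Conf" and lc: "loc k ?\<kappa> = c" using ext_conf[OF c(1)] loc_ext_conf[OF c(1)] by auto
    \<comment> \<open>Another vertex shares at most one edge with \<open>k\<close>, so its column
      has at most one nonzero label and is covered by \<open>d0\<close> or
      \<open>d1\<close>.\<close>
    have other: "A l (loc l ?\<kappa>) (loc l ?\<kappa>) = 0" if l: "l \<in> V" "l \<noteq> k" for l
    proof (cases "\<exists>e\<in>E. k \<in> e \<and> l \<in> e")
      case True
      then obtain e where e: "e \<in> E" "k \<in> e" "l \<in> e" by blast
      have ce: "c e \<in> Lab e" using c e by (auto dest: PiE_mem)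
      have "loc l ?\<kappa> = loc l (conf0(e := c e))"
      proof (rule restrict_ext)
        fix f assume f: "f \<in> inc l"
        show "?\<kappa> f = (conf0(e := c e)) f"
          using edge_unique[of f e k l] f e l by (cases "f = e") (auto simp: ext_conf_def conf0_def)
      qed
      then show ?thesis using d1[OF e(1) ce l(1)] by metis
    next
      case False
      have "loc l ?\<kappa> = loc l conf0"
        by (rule restrict_ext) (use False in \<open>auto simp: ext_conf_def conf0_def\<close>)
      then show ?thesis using d0[OF l(1)] by metis
    qed
    have "(\<Sum>l\<in>V. A l (loc l ?\<kappa>) (loc l ?\<kappa>)) = A k (loc k ?\<kappa>) (loc k ?\<kappa>)"
      by (rule sum_eq_single[OF finV k]) (rule other)
    then show ?thesis using diag_sum[OF C] lc by metis
  qed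
  have z1: "v (Inl (r, b, 1)) = 0" if r: "r \<in> S" "b < Q (ed r)" for r b
  proof -
    \<comment> \<open>With coordinate 1 at \<open>r\<close> only, every other pencil term contains a
      tangent entry at coordinate 0, which is normalised to zero.\<close>
    let ?a = "\<lambda>s. of_bool (s = r) :: nat" and ?\<kappa> = "conf0(ed r := (b, 0))"
    have l: "(b, 0) \<in> Lab (ed r)" using r Mpos[OF ed[OF r(1)]] by auto
    have C: "?\<kappa> \<in> Conf" by (rule conf0_upd[OF ed[OF r(1)] l])
    have "pencil_deriv v ?a ?\<kappa> = v (Inl (r, fst (?\<kappa> (ed r)), ?a r)) *
        (\<Prod>r'\<in>S - {r}. base_point (Inl (r', fst (?\<kappa> (ed r')), ?a r')))"
      unfolding pencil_deriv_def
    proof (rule sum_eq_single[OF finS r(1)])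
      fix s assume s: "s \<in> S" "s \<noteq> r"
      then have "?\<kappa> (ed s) \<in> Lab (ed s)" using C ed by (meson PiE_mem)
      then have "fst (?\<kappa> (ed s)) < Q (ed s)" by (simp only: mem_Times_iff lessThan_iff)
      then show "v (Inl (s, fst (?\<kappa> (ed s)), ?a s)) * (\<Prod>r'\<in>S - {s}. base_point (Inl (r', fst (?\<kappa> (ed r')), ?a r'))) = 0"
        using gz[OF s(1)] s(2) by simp
    qed
    also have "(\<Prod>r'\<in>S - {r}. base_point (Inl (r', fst (?\<kappa> (ed r')), ?a r'))) = 1"
      by (rule prod.neutral) (auto simp: base_point_def)
    finally have "pencil_deriv v ?a ?\<kappa> = v (Inl (r, b, 1))" by (simp add: fun_upd_same del: fun_upd_apply)
    moreover have "pencil_deriv v ?a ?\<kappa> + pencil_part base_point ?a ?\<kappa> * (\<Sum>l\<in>V. v (Inr (l, row l (loc l ?\<kappa>), loc l ?\<kappa>))) = 0"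
      by (rule base_deriv_diagonal[OF D _ C]) auto
    moreover have "(\<Sum>l\<in>V. v (Inr (l, row l (loc l ?\<kappa>), loc l ?\<kappa>))) = 0"
      using diag_sum[OF C] unfolding A_def .
    ultimately show ?thesis by (simp only: mult_zero_right add_0_right)
  qed
  show "v p = 0"
  proof (cases "p \<in> params")
    case True
    then consider r b a where "p = Inl (r, b, a)" "r \<in> S" "b < Q (ed r)" "a < 2"
      | k y c where "p = Inr (k, y, c)" "k \<in> V" "y < N k" "c \<in> Col k" unfolding params_def by blast
    then show ?thesis
    proof cases
      case 1
      then have "a = 0 \<or> a = 1" by auto
      then show ?thesis using gz[OF 1(2,3)] z1[OF 1(2,3)] 1(1) by auto
    next
      case 2
      have g: "\<gamma> k y \<in> Col k" "row k (\<gamma> k y) = y" using row_surj[OF 2(2,3)] by auto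
      have "A k (\<gamma> k y) c = 0" using diag[OF 2(2,4)] off_diag[OF 2(2,4) g(1)] by (cases "\<gamma> k y = c") auto
      then show ?thesis using 2(1) g(2) by (simp add: A_def)
    qed
  qed (use v0 in simp)
qed

subsection \<open>Dimension count\<close>

definition vertex_mat :: "(('v, 'r) param \<Rightarrow> complex) \<Rightarrow> 'v \<Rightarrow> complex mat" where
  "vertex_mat x k = mat (N k) (N k) (\<lambda>(a, b). x (Inr (k, a, \<gamma> k b)))"

text \<open>Where this is nonzero the kernel directions are independent: the first product separates
  the rescalings, and the determinants allow the vertex matrices to be cancelled. The determinants
  also put these matrices into \<open>GL\<close> for the normal form.\<close>

definition nondeg :: "(('v, 'r) param \<Rightarrow> complex) \<Rightarrow> complex" where
  "nondeg x = (\<Prod>r\<in>S. \<Prod>b<Q (ed r). x (Inl (r, b, 0))) * (\<Prod>k\<in>V. det (vertex_mat x k))"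

lemma nondeg_poly_fun: "nondeg \<in> poly_fun params"
  unfolding nondeg_def[abs_def]
proof (intro poly_fun.mult poly_fun_prod poly_fun.coord)
  fix r b assume "r \<in> S" "b \<in> {..<Q (ed r)}"
  then show "Inl (r, b, 0) \<in> params" by (auto simp: params_def)
next
  fix k assume k: "k \<in> V"
  have "det (vertex_mat x k) = (\<Sum>p\<in>{p. p permutes {0..<N k}}. signof p * (\<Prod>i = 0..<N k. x (Inr (k, i, \<gamma> k (p i)))))" for x
    by (subst det_def'[of _ "N k"]) (auto simp: vertex_mat_def permutes_in_image intro!: sum.cong prod.cong)
  moreover have "(\<lambda>x. \<Sum>p\<in>{p. p permutes {0..<N k}}. signof p * (\<Prod>i = 0..<N k. x (Inr (k, i, \<gamma> k (p i))))) \<in> poly_fun params"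
  proof (intro poly_fun_sum poly_fun_cmult poly_fun_prod poly_fun.coord)
    fix p i assume "p \<in> {p. p permutes {0..<N k}}" "i \<in> {0..<N k}"
    then have "p i < N k" "i < N k" using permutes_in_image[of p "{0..<N k}" i] by auto
    then show "Inr (k, i, \<gamma> k (p i)) \<in> params" using k row_surj[OF k] unfolding params_def by blast
  qed
  ultimately show "(\<lambda>x. det (vertex_mat x k)) \<in> poly_fun params" by simp
qed

lemma nondeg_base_point: "nondeg base_point \<noteq> 0"
proof -
  have "vertex_mat base_point k = 1\<^sub>m (N k)" if k: "k \<in> V" for k
  proof (rule eq_matI)
    fix a b assume "a < dim_row (1\<^sub>m (N k))" "b < dim_col (1\<^sub>m (N k))"
    then have ab: "a < N k" "b < N k" by auto
    have "(\<gamma> k a = \<gamma> k b) = (a = b)" using \<gamma>[OF k] ab by (auto simp: bij_betw_def dest: inj_onD)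
    then show "vertex_mat base_point k $$ (a, b) = 1\<^sub>m (N k) $$ (a, b)"
      using ab by (simp add: vertex_mat_def base_point_def)
  qed (auto simp: vertex_mat_def)
  then show ?thesis using finS finV by (simp add: nondeg_def base_point_def)
qed

lemma sum_Col_rows: "k \<in> V \<Longrightarrow> (\<Sum>c\<in>Col k. f c) = (\<Sum>b<N k. f (\<gamma> k b))"
  using sum.reindex_bij_betw[OF \<gamma>, of k f] by simp

lemma nondeg_injective:
  assumes "nondeg x \<noteq> 0" and k: "k \<in> V" and f: "\<And>y. y < N k \<Longrightarrow> (\<Sum>c\<in>Col k. x (Inr (k, y, c)) * f c) = 0"
    and c: "c \<in> Col k"
  shows "f c = 0"
proof -
  have det: "det (vertex_mat x k) \<noteq> 0" using assms(1) k finV by (auto simp: nondeg_def)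
  have carr: "vertex_mat x k \<in> carrier_mat (N k) (N k)" by (simp add: vertex_mat_def)
  define u where "u = vec (N k) (\<lambda>b. f (\<gamma> k b))"
  have "vertex_mat x k *\<^sub>v u = 0\<^sub>v (N k)"
  proof (rule eq_vecI)
    fix y assume "y < dim_vec (0\<^sub>v (N k))"
    then have y: "y < N k" by simp
    have "(vertex_mat x k *\<^sub>v u) $ y = (\<Sum>b<N k. x (Inr (k, y, \<gamma> k b)) * f (\<gamma> k b))"
      using y by (simp add: vertex_mat_def u_def scalar_prod_def atLeast0LessThan)
    also have "\<dots> = 0" using f[OF y] sum_Col_rows[OF k, of "\<lambda>c. x (Inr (k, y, c)) * f c"] by simp
    finally show "(vertex_mat x k *\<^sub>v u) $ y = 0\<^sub>v (N k) $ y" using y by simp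
  qed (simp add: vertex_mat_def)
  then have "u = 0\<^sub>v (N k)"
    using det det_0_iff_vec_prod_zero_field[OF carr] by (metis u_def vec_carrier)
  then have "f (\<gamma> k b) = 0" if "b < N k" for b using that by (metis index_vec index_zero_vec(1) u_def)
  then show ?thesis using row[OF k c] by metis
qed

lemma card_params: "card params = (\<Sum>r\<in>S. 2 * Q (ed r)) + (\<Sum>k\<in>V. N k ^ 2)"
proof -
  have Col: "card (Col k) = N k" if "k \<in> V" for k using bij_betw_same_card[OF \<gamma>[OF that]] by simp
  have "card params = card (SIGMA r:S. {..<Q (ed r)} \<times> {..<2::nat}) + card (SIGMA k:V. {..<N k} \<times> Col k)"
    unfolding params_def using finS finV finCol
    by (subst card_Un_disjoint) (auto simp: card_image intro!: finite_imageI finite_SigmaI)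
  also have "card (SIGMA r:S. {..<Q (ed r)} \<times> {..<2::nat}) = (\<Sum>r\<in>S. 2 * Q (ed r))"
    using finS by (simp add: card_cartesian_product mult.commute)
  also have "card (SIGMA k:V. {..<N k} \<times> Col k) = (\<Sum>k\<in>V. N k ^ 2)"
    using finV finCol by (simp add: card_cartesian_product Col power2_eq_square)
  finally show ?thesis .
qed

text \<open>Each edge has \<open>Q e * M e ^ 2\<close> matrix units except the one left out, and
  each vertex other than \<open>k0\<close> has one scalar. The corrections stand on the left to
  avoid truncated subtraction.\<close>

lemma card_kidx: "card kidx + card E + 1 = (\<Sum>r\<in>S. Q (ed r)) + (\<Sum>e\<in>E. Q e * (M e)^2) + card V"
proof -
  have e: "card (edge_idx e) + 1 = Q e * (M e)^2"
    if e: "e \<in> E" for e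
  proof -
    let ?f = "\<lambda>(b, c, c'). ((b, c), (b, c'))"
    have "{(l, l'). l \<in> Lab e \<and> l' \<in> Lab e \<and> fst l = fst l'} = ?f ` ({..<Q e} \<times> {..<M e} \<times> {..<M e})"
      by (force simp: image_iff)
    moreover have "inj_on ?f ({..<Q e} \<times> {..<M e} \<times> {..<M e})" by (auto simp: inj_on_def)
    ultimately have c: "card {(l, l'). l \<in> Lab e \<and> l' \<in> Lab e \<and> fst l = fst l'} = Q e * (M e)^2"
      by (simp add: card_image card_cartesian_product power2_eq_square)
    have "{(l, l'). l \<in> Lab e \<and> l' \<in> Lab e \<and> fst l = fst l'} =
       insert ((0, 0), (0, 0)) (edge_idx e)"
      using Qpos[OF e] Mpos[OF e] by auto
    then show ?thesis using c finite_edge_idx[of e] by simp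
  qed
  have "card kidx = (\<Sum>r\<in>S. Q (ed r)) + ((\<Sum>e\<in>E. card (edge_idx e)) + (card V - 1))"
    unfolding kidx_def using finS finV finE finite_edge_idx k0
    by (subst card_Plus; (intro finite_SigmaI finite_Plus)?; (subst card_Plus)?) (auto intro!: finite_SigmaI)
  moreover have "(\<Sum>e\<in>E. card (edge_idx e)) + card E = (\<Sum>e\<in>E. Q e * (M e)^2)"
  proof -
    have "(\<Sum>e\<in>E. card (edge_idx e) + 1) = (\<Sum>e\<in>E. Q e * (M e)^2)"
      by (rule sum.cong[OF refl e])
    then show ?thesis unfolding sum.distrib by simp
  qed
  moreover have "card V > 0" using k0 finV by (auto simp: card_gt_0_iff)
  ultimately show ?thesis by simp
qed

definition out_index :: "('v + 'r \<Rightarrow> nat) set" where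
  "out_index = Pi\<^sub>E (Inl ` V \<union> Inr ` S) (case_sum (\<lambda>k. {..<N k}) (\<lambda>r. {..<2}))"

definition tensor_map :: "(('v, 'r) param \<Rightarrow> complex) \<Rightarrow> ('v + 'r \<Rightarrow> nat) \<Rightarrow> complex" where
  "tensor_map x y = (if y \<in> out_index then tensor x (\<lambda>r. y (Inr r)) (\<lambda>k. y (Inl k)) else 0)"

lemma out_indexD:
  assumes "y \<in> out_index"
  shows "r \<in> S \<Longrightarrow> y (Inr r) < 2" "k \<in> V \<Longrightarrow> y (Inl k) < N k"
proof -
  show "y (Inr r) < 2" if "r \<in> S"
    using PiE_mem[OF assms[unfolded out_index_def], of "Inr r"] that by simp
  show "y (Inl k) < N k" if "k \<in> V"
    using PiE_mem[OF assms[unfolded out_index_def], of "Inl k"] that by simp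
qed

lemma tensor_map_poly_fun: "(\<lambda>x. tensor_map x y) \<in> poly_fun params"
  by (cases "y \<in> out_index")
    (auto simp: tensor_map_def intro!: tensor_poly_fun poly_fun.const dest: out_indexD)

lemma tensor_map_coord_space: "range tensor_map \<subseteq> coord_space out_index"
  by (auto simp: coord_space_def tensor_map_def)

lemma finite_out_index: "finite out_index"
  unfolding out_index_def using finV finS by (intro finite_PiE) (auto split: sum.split)

lemma tensor_map_cong:
  assumes "\<And>p. p \<in> params \<Longrightarrow> x p = x' p"
  shows "tensor_map x y = tensor_map x' y"
  using poly_fun_cong[OF tensor_map_poly_fun assms] .

lemma tensor_map_has_deriv:
  assumes "y \<in> out_index"
  shows "((\<lambda>t. tensor_map (\<lambda>i. x i + t * v i) y) has_field_derivative
    tensor_deriv x v (\<lambda>r. y (Inr r)) (\<lambda>k. y (Inl k))) (at 0)"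
  using tensor_has_deriv[of x v "\<lambda>r. y (Inr r)" "\<lambda>k. y (Inl k)"] assms by (simp add: tensor_map_def)

text \<open>There are as many gauge coordinates as kernel directions, so the slice without them has
  the size at which the upper and the lower bound agree.\<close>

lemma zariski_dim_tensor_map:
  "zariski_dim out_index (zariski_closure out_index (range tensor_map)) + card kidx = card params"
proof -
  let ?W = "params - gauge_coord ` kidx"
  have cardW: "card ?W + card kidx = card params"
    using card_Diff_subset[OF _ gauge_coord_params] card_image[OF inj_gauge_coord]
      card_mono[OF finparams gauge_coord_params] finkidx by simp
  have "zariski_dim out_index (zariski_closure out_index (range tensor_map)) = card ?W"
  proof (rule zariski_dim_closure_range[where \<kappa> = kvec, OF finparams finite_out_index finkidx
        tensor_map_poly_fun tensor_map_coord_space nondeg_poly_fun nondeg_base_point _ _ _ cardW])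
    fix x l y assume "l \<in> kidx" "y \<in> out_index"
    then show "((\<lambda>t. tensor_map (\<lambda>i. x i + t * kvec x l i) y) has_field_derivative 0) (at 0)"
      using tensor_map_has_deriv[of y x "kvec x l"] kvec_kernel by simp
  next
    fix x c l assume x: "nondeg x \<noteq> 0" and c: "\<And>i. i \<in> params \<Longrightarrow> (\<Sum>l\<in>kidx. c l * kvec x l i) = 0" and l: "l \<in> kidx"
    show "c l = 0"
    proof (rule kvec_independent[OF _ _ c l])
      fix r b assume "r \<in> S" "b < Q (ed r)"
      then show "x (Inl (r, b, 0)) \<noteq> 0" using x finS by (auto simp: nondeg_def)
    qed (rule nondeg_injective[OF x])
  next
    fix v i
    assume v: "\<And>i. i \<notin> ?W \<Longrightarrow> v i = 0"
      and D: "\<And>y. y \<in> out_index \<Longrightarrow> ((\<lambda>t. tensor_map (\<lambda>i. base_point i + t * v i) y) has_field_derivative 0) (at 0)"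
    have "\<forall>a y. (\<forall>r\<in>S. a r < 2) \<longrightarrow> (\<forall>k\<in>V. y k < N k) \<longrightarrow> tensor_deriv base_point v a y = 0"
    proof (intro allI impI)
      fix a :: "'r \<Rightarrow> nat" and y :: "'v \<Rightarrow> nat" assume ay: "\<forall>r\<in>S. a r < 2" "\<forall>k\<in>V. y k < N k"
      define Y where "Y = restrict (case_sum y a) (Inl ` V \<union> Inr ` S)"
      have Y: "Y \<in> out_index" using ay by (auto simp: Y_def out_index_def)
      have "tensor_deriv base_point v a y = tensor_deriv base_point v (\<lambda>r. Y (Inr r)) (\<lambda>k. Y (Inl k))"
        unfolding tensor_deriv_def pencil_part_def
        by (intro sum.cong arg_cong2[of _ _ _ _ "(+)"] arg_cong2[of _ _ _ _ "(*)"] prod.cong) (auto simp: Y_def)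
      also have "\<dots> = 0" using DERIV_unique[OF tensor_map_has_deriv[OF Y] D[OF Y]] .
      finally show "tensor_deriv base_point v a y = 0" .
    qed
    then show "v i = 0" using v by (rule base_point_injective[rotated])
  qed auto
  then show ?thesis using cardW by simp
qed

end


section \<open>Tensor network states of the augmented network\<close>

text \<open>The graph tensor is the indicator of the families of local indices that agree along the
  edges, and these correspond to one label per edge.\<close>

lemma local_maps_graph_tensor:
  assumes "finite V" "finite E" "\<And>e. e \<in> E \<Longrightarrow> e \<subseteq> V \<and> e \<noteq> {}" and y: "y \<in> Pi\<^sub>E V C"
  shows "local_maps V (bond_basis E m) C X (graph_tensor V E m) y =
    (\<Sum>\<kappa>\<in>Pi\<^sub>E E (\<lambda>e. {..<m e}). \<Prod>v\<in>V. X v (y v) (restrict \<kappa> {e \<in> E. v \<in> e}))"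
proof -
  let ?f = "\<lambda>\<kappa>. \<lambda>v\<in>V. restrict \<kappa> {e \<in> E. v \<in> e}" and ?K = "Pi\<^sub>E E (\<lambda>e. {..<m e})"
  have fin: "finite (Pi\<^sub>E V (bond_basis E m))"
    using assms(1,2) by (auto intro!: finite_PiE simp: bond_basis_def)
  have inj: "inj_on ?f ?K"
  proof (rule inj_onI, rule PiE_ext)
    fix \<kappa> \<kappa>' e assume \<kappa>: "\<kappa> \<in> ?K" "\<kappa>' \<in> ?K" "?f \<kappa> = ?f \<kappa>'" and e: "e \<in> E"
    obtain v where v: "v \<in> e" "v \<in> V" using assms(3)[OF e] by blast
    show "\<kappa> e = \<kappa>' e" using fun_cong[OF fun_cong[OF \<kappa>(3), of v], of e] v e by simp
  qed
  have sub: "?f ` ?K \<subseteq> Pi\<^sub>E V (bond_basis E m)"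
    unfolding image_subset_iff restrict_PiE_iff bond_basis_def
  proof (intro ballI)
    fix \<kappa> v e assume "\<kappa> \<in> ?K" "e \<in> {e \<in> E. v \<in> e}"
    then show "\<kappa> e \<in> {..<m e}" using PiE_mem[of \<kappa> E "\<lambda>e. {..<m e}" e] by simp
  qed
  have zero: "graph_tensor V E m x = 0" if x: "x \<in> Pi\<^sub>E V (bond_basis E m) - ?f ` ?K" for x
  proof (rule ccontr)
    assume "graph_tensor V E m x \<noteq> 0"
    then have "\<forall>e\<in>E. \<forall>u\<in>e. \<forall>v\<in>e. x u e = x v e"
      unfolding graph_tensor_def of_bool_eq_0_iff not_not by (rule conjunct2)
    then have cons: "x u e = x v e" if "e \<in> E" "u \<in> e" "v \<in> e" for e u v using that by blast
    define \<kappa> where "\<kappa> = (\<lambda>e\<in>E. x (SOME v. v \<in> e) e)"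
    have some: "(SOME v. v \<in> e) \<in> e" if "e \<in> E" for e
      using assms(3)[OF that] by (auto intro: someI_ex)
    have xv: "x v \<in> bond_basis E m v" if "v \<in> V" for v using x that by (auto dest: PiE_mem)
    have "\<kappa> \<in> ?K"
    proof (rule PiE_I)
      fix e assume e: "e \<in> E"
      have "x (SOME v. v \<in> e) \<in> bond_basis E m (SOME v. v \<in> e)"
        using some[OF e] assms(3)[OF e] by (intro xv) blast
      from PiE_mem[OF this[unfolded bond_basis_def], of e] show "\<kappa> e \<in> {..<m e}"
        using some[OF e] e by (simp add: \<kappa>_def)
    qed (simp add: \<kappa>_def)
    moreover have "x = ?f \<kappa>"
    proof (rule PiE_ext[of x V "bond_basis E m"])
      show "x \<in> Pi\<^sub>E V (bond_basis E m)" using x by simp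
      show "?f \<kappa> \<in> Pi\<^sub>E V (bond_basis E m)" using sub \<open>\<kappa> \<in> ?K\<close> by blast
      fix v assume v: "v \<in> V"
      have "x v = restrict \<kappa> {e \<in> E. v \<in> e}"
      proof (rule PiE_ext[OF xv[OF v, unfolded bond_basis_def]])
        show "restrict \<kappa> {e \<in> E. v \<in> e} \<in> Pi\<^sub>E {e \<in> E. v \<in> e} (\<lambda>e. {..<m e})"
          using \<open>\<kappa> \<in> ?K\<close> by auto
        fix e assume "e \<in> {e \<in> E. v \<in> e}"
        then show "x v e = restrict \<kappa> {e \<in> E. v \<in> e} e"
          using cons[of e v "SOME v. v \<in> e"] some[of e] by (simp add: \<kappa>_def)
      qed
      then show "x v = ?f \<kappa> v" using v by simp
    qed
    ultimately show False using x by blast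
  qed
  have one: "graph_tensor V E m (?f \<kappa>) = 1" if "\<kappa> \<in> ?K" for \<kappa>
  proof -
    have "?f \<kappa> \<in> Pi\<^sub>E V (bond_basis E m)" using sub that by blast
    moreover have "\<forall>e\<in>E. \<forall>u\<in>e. \<forall>v\<in>e. ?f \<kappa> u e = ?f \<kappa> v e"
    proof (intro ballI)
      fix e u v assume e: "e \<in> E" "u \<in> e" "v \<in> e"
      then have "u \<in> V" "v \<in> V" using assms(3) by blast+
      then show "?f \<kappa> u e = ?f \<kappa> v e" using e by simp
    qed
    ultimately show ?thesis unfolding graph_tensor_def of_bool_def by (intro if_P conjI)
  qed
  have "local_maps V (bond_basis E m) C X (graph_tensor V E m) y =
      (\<Sum>x\<in>?f ` ?K. (\<Prod>v\<in>V. X v (y v) (x v)) * graph_tensor V E m x)"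
  proof -
    have "(\<Sum>x\<in>Pi\<^sub>E V (bond_basis E m). (\<Prod>v\<in>V. X v (y v) (x v)) * graph_tensor V E m x) =
      (\<Sum>x\<in>?f ` ?K. (\<Prod>v\<in>V. X v (y v) (x v)) * graph_tensor V E m x)"
    proof (rule sum.mono_neutral_right[OF fin sub], rule ballI)
      fix x assume "x \<in> Pi\<^sub>E V (bond_basis E m) - ?f ` ?K"
      from zero[OF this] show "(\<Prod>v\<in>V. X v (y v) (x v)) * graph_tensor V E m x = 0" by (simp only: mult_zero_right)
    qed
    then show ?thesis using y by (simp only: local_maps_def if_True)
  qed
  also have "\<dots> = (\<Sum>\<kappa>\<in>?K. (\<Prod>v\<in>V. X v (y v) (?f \<kappa> v)) * graph_tensor V E m (?f \<kappa>))"
    by (simp only: sum.reindex[OF inj] o_def)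
  also have "\<dots> = (\<Sum>\<kappa>\<in>?K. \<Prod>v\<in>V. X v (y v) (restrict \<kappa> {e \<in> E. v \<in> e}))"
  proof (rule sum.cong[OF refl])
    fix \<kappa> assume "\<kappa> \<in> ?K"
    then show "(\<Prod>v\<in>V. X v (y v) (?f \<kappa> v)) * graph_tensor V E m (?f \<kappa>) = (\<Prod>v\<in>V. X v (y v) (restrict \<kappa> {e \<in> E. v \<in> e}))"
      unfolding one[OF \<open>\<kappa> \<in> ?K\<close>] mult_1_right by (intro prod.cong refl) simp
  qed
  finally show ?thesis .
qed

locale augmentation =
  fixes d s :: nat and E' :: "nat set set" and m' :: "nat set \<Rightarrow> nat" and i j q :: "nat \<Rightarrow> nat"
    and V :: "(nat + nat) set" and E :: "(nat + nat) set set"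
    and m :: "(nat + nat) set \<Rightarrow> nat" and n :: "nat + nat \<Rightarrow> nat"
    and \<alpha> :: "nat \<Rightarrow> nat \<Rightarrow> nat" and \<beta> :: "nat \<Rightarrow> nat \<Rightarrow> nat set \<Rightarrow> nat"
  assumes network: "network {1..d} E'"
    and bond_pos: "\<forall>e\<in>E'. 0 < m' e" "\<forall>r\<in>{1..s}. 0 < q r"
    and nodes: "i ` {1..s} \<union> j ` {1..s} \<subseteq> {1..d}" "card (i ` {1..s} \<union> j ` {1..s}) = 2 * s"
    and edges: "\<forall>r\<in>{1..s}. {i r, j r} \<in> E'"
    and V: "V = aug_vertices d s" and E: "E = aug_edges E' s i j"
    and m_old: "\<forall>e\<in>E'. m (Inl ` e) = m' e"
    and m_new: "\<forall>r\<in>{1..s}. m {Inr r, Inl (i r)} = q r \<and> m {Inr r, Inl (j r)} = q r"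
    and n_new: "\<forall>r\<in>{1..s}. n (Inr r) = 2"
    and n_crit: "\<forall>k\<in>{1..d}. n (Inl k) = (\<Prod>e \<in> {e \<in> E. Inl k \<in> e}. m e)"
    and ident: "identification d s i j q E' m' n \<alpha> \<beta>"
begin

abbreviation "S \<equiv> {1..s}"
text \<open>\<open>lbl k b c\<close> attaches the index \<open>b\<close> of the new bond at \<open>k\<close> to the edge \<open>er r\<close> through \<open>k\<close>, so that
  \<open>(er r, b)\<close> becomes one parallel bond of \<open>block_network\<close>.\<close>

definition "er r = {i r, j r}"
definition "special = er ` S"
definition "ro k = (THE r. r \<in> S \<and> (k = i r \<or> k = j r))"
definition "rof e = inv_into S er e"
definition "QQ e = (if e \<in> special then q (rof e) else 1)"
definition "src e = (SOME u. u \<in> e)"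
definition "tgt e = (SOME v. v \<in> e \<and> v \<noteq> src e)" for e :: "nat set"
abbreviation "columns k \<equiv> Pi\<^sub>E {e \<in> E'. k \<in> e} (\<lambda>e. {..<QQ e} \<times> {..<m' e})"
definition "lbl k b c = (\<lambda>e\<in>{e \<in> E'. k \<in> e}. (if e \<in> special then b else 0, c e))" for b :: nat and c :: "nat set \<Rightarrow> nat"
definition "\<gamma> k a = lbl k (\<alpha> k a) (\<beta> k a)"

text \<open>A union of two images of an s-element set reaches \<open>2 * s\<close> elements only if
  both maps are injective and the images are disjoint.\<close>

lemma node_inj: "inj_on i S" "inj_on j S" "i ` S \<inter> j ` S = {}"
proof -
  have le: "card (i ` S) \<le> s" "card (j ` S) \<le> s" using card_image_le[of S i] card_image_le[of S j] by auto
  have "card (i ` S) + card (j ` S) = card (i ` S \<union> j ` S) + card (i ` S \<inter> j ` S)"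
    by (rule card_Un_Int) auto
  then have eq: "card (i ` S) = s" "card (j ` S) = s" "card (i ` S \<inter> j ` S) = 0" using le nodes(2) by linarith+
  show "inj_on i S" "inj_on j S" using eq by (auto intro: eq_card_imp_inj_on)
  show "i ` S \<inter> j ` S = {}" using eq(3) by simp
qed

lemma ij_eq: "r \<in> S \<Longrightarrow> r' \<in> S \<Longrightarrow> i r = i r' \<longleftrightarrow> r = r'" "r \<in> S \<Longrightarrow> r' \<in> S \<Longrightarrow> j r = j r' \<longleftrightarrow> r = r'"
  "r \<in> S \<Longrightarrow> r' \<in> S \<Longrightarrow> i r \<noteq> j r'"  "r \<in> S \<Longrightarrow> r' \<in> S \<Longrightarrow> j r \<noteq> i r'"
proof -
  show "r \<in> S \<Longrightarrow> r' \<in> S \<Longrightarrow> i r = i r' \<longleftrightarrow> r = r'" "r \<in> S \<Longrightarrow> r' \<in> S \<Longrightarrow> j r = j r' \<longleftrightarrow> r = r'"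
    using node_inj(1,2) by (simp_all add: inj_on_eq_iff)
  show *: "r \<in> S \<Longrightarrow> r' \<in> S \<Longrightarrow> i r \<noteq> j r'" for r r'
    using node_inj(3) by blast
  show "r \<in> S \<Longrightarrow> r' \<in> S \<Longrightarrow> j r \<noteq> i r'"
    using *[of r' r] by metis
qed

lemma ro: "r \<in> S \<Longrightarrow> ro (i r) = r" "r \<in> S \<Longrightarrow> ro (j r) = r"
  unfolding ro_def by (rule the_equality; use ij_eq in auto)+

lemma ij_V: "r \<in> S \<Longrightarrow> i r \<in> {1..d}" "r \<in> S \<Longrightarrow> j r \<in> {1..d}"
  using nodes(1) by blast+

lemma mem_er: "r \<in> S \<Longrightarrow> k \<in> er r \<Longrightarrow> ro k = r"
  using ro by (auto simp: er_def)

lemma inj_er: "inj_on er S"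
proof (rule inj_onI)
  fix r r' assume r: "r \<in> S" "r' \<in> S" "er r = er r'"
  then have "i r \<in> er r'" by (auto simp: er_def)
  then show "r = r'" using mem_er[OF r(2)] ro(1)[OF r(1)] by simp
qed

lemma rof: "r \<in> S \<Longrightarrow> rof (er r) = r"
  unfolding rof_def by (rule inv_into_f_f[OF inj_er])

lemma special_at: "e \<in> special \<Longrightarrow> k \<in> e \<Longrightarrow> ro k \<in> S \<and> e = er (ro k) \<and> (k = i (ro k) \<or> k = j (ro k))"
  unfolding special_def using mem_er ro by (auto simp: er_def)

lemma er_E': "r \<in> S \<Longrightarrow> er r \<in> E'" using edges by (simp add: er_def)

lemma QQ_er: "r \<in> S \<Longrightarrow> QQ (er r) = q r"
  by (simp add: QQ_def special_def rof)

lemma edgeE':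
  assumes "e \<in> E'"
  shows "e = {src e, tgt e} \<and> src e \<noteq> tgt e \<and> src e \<in> {1..d} \<and> tgt e \<in> {1..d}"
proof -
  obtain u v where uv: "u \<in> {1..d}" "v \<in> {1..d}" "u \<noteq> v" "e = {u, v}"
  proof -
    have "\<forall>e\<in>E'. \<exists>u\<in>{1..d}. \<exists>v\<in>{1..d}. u \<noteq> v \<and> e = {u, v}" using network unfolding network_def by (elim conjE)
    then show ?thesis using assms that by blast
  qed
  have s: "src e \<in> e" unfolding src_def by (rule someI_ex) (use uv in auto)
  have "\<exists>v. v \<in> e \<and> v \<noteq> src e" using uv(3,4) by (metis insertCI)
  then have t: "tgt e \<in> e \<and> tgt e \<noteq> src e" unfolding tgt_def by (rule someI_ex)
  show ?thesis using s t uv by auto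
qed

text \<open>Exactly one edge through a node is special, namely \<open>er r\<close>. Its block
  component stores the index of the new bond, so nothing is lost; on the other edges the block
  component is 0.\<close>

lemma lbl_bij_node:
  assumes r: "r \<in> S" and k: "k = i r \<or> k = j r"
  shows "bij_betw (\<lambda>(b, c). lbl k b c) ({..<q r} \<times> bond_basis E' m' k) (columns k)"
proof (rule bij_betw_byWitness[where f' = "\<lambda>cc. (fst (cc (er r)), \<lambda>e\<in>{e \<in> E'. k \<in> e}. snd (cc e))"])
  have ek: "er r \<in> E'" "k \<in> er r" "er r \<in> special" using er_E'[OF r] k r by (auto simp: er_def special_def)
  have sp: "e = er r" if "e \<in> special" "k \<in> e" for e using special_at[OF that] mem_er[OF r ek(2)] by simp
  show "\<forall>a\<in>{..<q r} \<times> bond_basis E' m' k. (fst ((case a of (b, c) \<Rightarrow> lbl k b c) (er r)), \<lambda>e\<in>{e \<in> E'. k \<in> e}. snd ((case a of (b, c) \<Rightarrow> lbl k b c) e)) = a"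
  proof
    fix p assume "p \<in> {..<q r} \<times> bond_basis E' m' k"
    then obtain b c where p: "p = (b, c)" and c: "c \<in> bond_basis E' m' k" by blast
    have "(\<lambda>e\<in>{e \<in> E'. k \<in> e}. snd (lbl k b c e)) = c"
    proof (rule ext)
      fix e show "(\<lambda>e\<in>{e \<in> E'. k \<in> e}. snd (lbl k b c e)) e = c e"
        using PiE_arb[OF c[unfolded bond_basis_def], of e] by (cases "e \<in> E' \<and> k \<in> e") (simp_all add: lbl_def)
    qed
    moreover have "fst (lbl k b c (er r)) = b" using ek by (simp add: lbl_def)
    ultimately show "(fst ((case p of (b, c) \<Rightarrow> lbl k b c) (er r)), \<lambda>e\<in>{e \<in> E'. k \<in> e}. snd ((case p of (b, c) \<Rightarrow> lbl k b c) e)) = p"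
      unfolding p prod.case by (simp only:)
  qed
  show "\<forall>cc\<in>columns k. (case (fst (cc (er r)), \<lambda>e\<in>{e \<in> E'. k \<in> e}. snd (cc e)) of (b, c) \<Rightarrow> lbl k b c) = cc"
  proof
    fix cc assume cc: "cc \<in> columns k"
    have "lbl k (fst (cc (er r))) (\<lambda>e\<in>{e \<in> E'. k \<in> e}. snd (cc e)) e = cc e" for e
    proof (cases "e \<in> E' \<and> k \<in> e")
      case True
      have "cc e \<in> {..<QQ e} \<times> {..<m' e}" using cc True by (auto dest: PiE_mem)
      then show ?thesis using True sp[of e] by (cases "e \<in> special") (auto simp: lbl_def QQ_def prod_eq_iff)
    next
      case False
      then show ?thesis using PiE_arb[OF cc, of e] by (auto simp: lbl_def)
    qed
    then show "(case (fst (cc (er r)), \<lambda>e\<in>{e \<in> E'. k \<in> e}. snd (cc e)) of (b, c) \<Rightarrow> lbl k b c) = cc" by auto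
  qed
  show "(\<lambda>(b, c). lbl k b c) ` ({..<q r} \<times> bond_basis E' m' k) \<subseteq> columns k"
  proof (rule image_subsetI)
    fix p assume "p \<in> {..<q r} \<times> bond_basis E' m' k"
    then obtain b c where p: "p = (b, c)" "b < q r" and c: "c \<in> bond_basis E' m' k" by blast
    have "(if e \<in> special then b else 0, c e) \<in> {..<QQ e} \<times> {..<m' e}" if "e \<in> {e \<in> E'. k \<in> e}" for e
      using PiE_mem[OF c[unfolded bond_basis_def] that] sp[of e] that QQ_er[OF r] p(2)
      by (cases "e \<in> special") (simp_all add: QQ_def)
    then show "(case p of (b, c) \<Rightarrow> lbl k b c) \<in> columns k"
      unfolding p prod.case lbl_def restrict_PiE_iff by blast
  qed
  show "(\<lambda>cc. (fst (cc (er r)), \<lambda>e\<in>{e \<in> E'. k \<in> e}. snd (cc e))) ` columns k \<subseteq> {..<q r} \<times> bond_basis E' m' k"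
  proof (rule image_subsetI)
    fix cc assume cc: "cc \<in> columns k"
    have *: "cc e \<in> {..<QQ e} \<times> {..<m' e}" if "e \<in> E'" "k \<in> e" for e using cc that by (auto dest: PiE_mem)
    show "(fst (cc (er r)), \<lambda>e\<in>{e \<in> E'. k \<in> e}. snd (cc e)) \<in> {..<q r} \<times> bond_basis E' m' k"
      unfolding mem_Times_iff fst_conv snd_conv bond_basis_def restrict_PiE_iff using *[OF ek(1,2)] * QQ_er[OF r] by (auto simp: mem_Times_iff)
  qed
qed

lemma lbl_bij_other:
  assumes k: "k \<notin> i ` S \<union> j ` S"
  shows "bij_betw (\<lambda>c. lbl k 0 c) (bond_basis E' m' k) (columns k)"
proof (rule bij_betw_byWitness[where f' = "\<lambda>cc. \<lambda>e\<in>{e \<in> E'. k \<in> e}. snd (cc e)"])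
  have ns: "QQ e = 1" "e \<notin> special" if "k \<in> e" for e
    using special_at[of e k] that k by (auto simp: QQ_def)
  show "\<forall>c\<in>bond_basis E' m' k. (\<lambda>e\<in>{e \<in> E'. k \<in> e}. snd (lbl k 0 c e)) = c"
  proof
    fix c assume c: "c \<in> bond_basis E' m' k"
    show "(\<lambda>e\<in>{e \<in> E'. k \<in> e}. snd (lbl k 0 c e)) = c"
    proof (rule ext)
      fix e show "(\<lambda>e\<in>{e \<in> E'. k \<in> e}. snd (lbl k 0 c e)) e = c e"
        using PiE_arb[OF c[unfolded bond_basis_def], of e] by (cases "e \<in> E' \<and> k \<in> e") (simp_all add: lbl_def)
    qed
  qed
  show "\<forall>cc\<in>columns k. lbl k 0 (\<lambda>e\<in>{e \<in> E'. k \<in> e}. snd (cc e)) = cc"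
  proof
    fix cc assume cc: "cc \<in> columns k"
    have "lbl k 0 (\<lambda>e\<in>{e \<in> E'. k \<in> e}. snd (cc e)) e = cc e" for e
    proof (cases "e \<in> E' \<and> k \<in> e")
      case True
      have "cc e \<in> {..<QQ e} \<times> {..<m' e}" using cc True by (auto dest: PiE_mem)
      then show ?thesis using True ns[of e] by (auto simp: lbl_def prod_eq_iff)
    next
      case False
      then show ?thesis using PiE_arb[OF cc, of e] by (auto simp: lbl_def)
    qed
    then show "lbl k 0 (\<lambda>e\<in>{e \<in> E'. k \<in> e}. snd (cc e)) = cc" by auto
  qed
  show "lbl k 0 ` bond_basis E' m' k \<subseteq> columns k"
  proof (rule image_subsetI)
    fix c assume c: "c \<in> bond_basis E' m' k"
    have "(if e \<in> special then 0 else 0, c e) \<in> {..<QQ e} \<times> {..<m' e}" if "e \<in> {e \<in> E'. k \<in> e}" for e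
      using PiE_mem[OF c[unfolded bond_basis_def] that] ns[of e] that by simp
    then show "lbl k 0 c \<in> columns k"
      unfolding lbl_def restrict_PiE_iff by blast
  qed
  show "(\<lambda>cc. \<lambda>e\<in>{e \<in> E'. k \<in> e}. snd (cc e)) ` columns k \<subseteq> bond_basis E' m' k"
  proof (rule image_subsetI)
    fix cc assume cc: "cc \<in> columns k"
    have "cc e \<in> {..<QQ e} \<times> {..<m' e}" if "e \<in> E'" "k \<in> e" for e using cc that by (auto dest: PiE_mem)
    then show "(\<lambda>e\<in>{e \<in> E'. k \<in> e}. snd (cc e)) \<in> bond_basis E' m' k"
      unfolding bond_basis_def restrict_PiE_iff by (auto simp: mem_Times_iff)
  qed
qed

lemma \<gamma>_bij:
  assumes k: "k \<in> {1..d}"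
  shows "bij_betw (\<gamma> k) {..<n (Inl k)} (columns k)"
proof (cases "k \<in> i ` S \<union> j ` S")
  case True
  then obtain r where r: "r \<in> S" "k = i r \<or> k = j r" by blast
  then have "bij_betw (\<lambda>a. (\<alpha> k a, \<beta> k a)) (phys_basis n (Inl k)) ({..<q r} \<times> bond_basis E' m' k)"
    using ident unfolding identification_def by blast
  from bij_betw_trans[OF this lbl_bij_node[OF r]] show ?thesis
    by (simp add: \<gamma>_def[abs_def] comp_def phys_basis_def)
next
  case False
  then have "bij_betw (\<beta> k) (phys_basis n (Inl k)) (bond_basis E' m' k)"
    using ident k unfolding identification_def by blast
  from bij_betw_trans[OF this lbl_bij_other[OF False]]
  have "bij_betw (\<lambda>a. lbl k 0 (\<beta> k a)) {..<n (Inl k)} (columns k)"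
    by (simp add: comp_def phys_basis_def)
  moreover have "lbl k 0 (\<beta> k a) = \<gamma> k a" for a
    unfolding \<gamma>_def lbl_def
  proof (rule restrict_ext)
    fix e assume "e \<in> {e \<in> E'. k \<in> e}"
    then have "e \<notin> special" using special_at[of e k] False by blast
    then show "(if e \<in> special then 0 else 0, \<beta> k a e) = (if e \<in> special then \<alpha> k a else 0, \<beta> k a e)" by simp
  qed
  ultimately show ?thesis by simp
qed

sublocale block_network "{1..d}" E' S er QQ m' "\<lambda>k. n (Inl k)" \<gamma> src tgt 1
proof
  show "1 \<in> {1..d}" using network by (auto simp: network_def)
  show "\<And>r. r \<in> S \<Longrightarrow> er r \<in> E'" by (rule er_E')
  show "inj_on er S" by (rule inj_er)
  show "0 < QQ e" if "e \<in> E'" for e using bond_pos(2) rof by (auto simp: QQ_def special_def)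
  show "QQ e = 1" if "e \<in> E'" "e \<notin> er ` S" for e using that by (simp add: QQ_def special_def)
qed (use edgeE' \<gamma>_bij bond_pos in auto)

lemma out_index_eq: "Pi\<^sub>E V (phys_basis n) = out_index"
  unfolding out_index_def V aug_vertices_def
  by (rule PiE_cong) (use n_new in \<open>auto simp: phys_basis_def\<close>)

end


context augmentation
begin

lemma prod_aug: "(\<Prod>v\<in>V. f v) = (\<Prod>k\<in>{1..d}. f (Inl k)) * (\<Prod>r\<in>S. f (Inr r) :: complex)"
  unfolding V aug_vertices_def by (subst prod.union_disjoint) (auto simp: prod.reindex)

lemma finV_aug: "finite V" by (simp add: V aug_vertices_def)

lemma finE_aug: "finite E" using finE by (simp add: E aug_edges_def)

lemma aug_edge_cases:
  assumes "e \<in> E"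
  obtains (old) f where "f \<in> E'" "e = Inl ` f"
    | (new) r k where "r \<in> S" "k = i r \<or> k = j r" "e = {Inr r, Inl k}"
  using assms unfolding E aug_edges_def by blast

lemma old_edge: "f \<in> E' \<Longrightarrow> Inl ` f \<in> E" and new_edge: "r \<in> S \<Longrightarrow> k = i r \<or> k = j r \<Longrightarrow> {Inr r, Inl k} \<in> E"
  unfolding E aug_edges_def by blast+

lemma new_not_old: "{Inr r, Inl k} \<notin> (`) Inl ` E'"
  by auto

lemma aug_edges_V:
  assumes "e \<in> E"
  shows "e \<subseteq> V \<and> e \<noteq> {}"
  using assms
proof (cases rule: aug_edge_cases)
  case (old f)
  then have "f \<subseteq> {1..d}" "f \<noteq> {}" using edgeE'[OF old(1)] by (metis empty_subsetI insert_subset, metis insert_not_empty)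
  then show ?thesis using old by (auto simp: V aug_vertices_def)
next
  case (new r k)
  then show ?thesis using ij_V by (auto simp: V aug_vertices_def)
qed

text \<open>An index of the augmented network is a pair of an index \<open>c\<close> of the old edges and a function \<open>t\<close>,
  where \<open>t k\<close> is the index of the new edge at \<open>k\<close>, and \<open>0\<close> if there is none.\<close>

definition "Bl k = (if k \<in> i ` S \<union> j ` S then {..<q (ro k)} else {..<1::nat})"
definition "mk k c b = (\<lambda>e\<in>{e \<in> E. Inl k \<in> e}. if e \<in> (`) Inl ` E' then c (Inl -` e) else b)"
  for c :: "nat set \<Rightarrow> nat" and b :: nat
definition "glue c t = (\<lambda>e\<in>E. if e \<in> (`) Inl ` E' then c (Inl -` e) else t (THE k. Inl k \<in> e))"
  for c :: "nat set \<Rightarrow> nat" and t :: "nat \<Rightarrow> nat"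

abbreviation "CC \<equiv> Pi\<^sub>E E' (\<lambda>e. {..<m' e})"
abbreviation "TT \<equiv> Pi\<^sub>E {1..d} Bl"
abbreviation "LL \<equiv> Pi\<^sub>E S (\<lambda>r. {..<q r})"

lemma vimage_Inl: "Inl -` (Inl ` f) = f"
  by auto

lemma Bl_node: "r \<in> S \<Longrightarrow> k = i r \<or> k = j r \<Longrightarrow> Bl k = {..<q r}"
proof -
  assume r: "r \<in> S" "k = i r \<or> k = j r"
  then have "k \<in> i ` S \<union> j ` S" "ro k = r" using ro by blast+
  then show ?thesis by (simp only: Bl_def if_True)
qed

lemma glue_old: "f \<in> E' \<Longrightarrow> glue c t (Inl ` f) = c f"
  unfolding glue_def using old_edge by (simp add: vimage_Inl)

lemma glue_new: "r \<in> S \<Longrightarrow> k = i r \<or> k = j r \<Longrightarrow> glue c t {Inr r, Inl k} = t k"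
  unfolding glue_def using new_edge[of r k] new_not_old[of r k] by simp

lemma restrict_glue: "restrict (glue c t) {e \<in> E. Inl k \<in> e} = mk k (restrict c (inc k)) (t k)"
  unfolding mk_def
proof (rule restrict_ext)
  fix e assume e: "e \<in> {e \<in> E. Inl k \<in> e}"
  then have "e \<in> E" by simp
  then show "glue c t e = (if e \<in> (`) Inl ` E' then restrict c (inc k) (Inl -` e) else t k)"
  proof (cases rule: aug_edge_cases)
    case (old f)
    then have "k \<in> f" using e by auto
    then show ?thesis using old glue_old[OF old(1)] by (simp add: vimage_Inl)
  next
    case (new r l)
    then have "l = k" using e by auto
    then show ?thesis using new glue_new[OF new(1,2)] new_not_old[of r l] by simp
  qed
qed

lemma glue_bij: "bij_betw (\<lambda>(c, t). glue c t) (CC \<times> TT) (Pi\<^sub>E E (\<lambda>e. {..<m e}))"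
proof (rule bij_betw_byWitness[where f' = "\<lambda>\<kappa>. (\<lambda>e\<in>E'. \<kappa> (Inl ` e), \<lambda>k\<in>{1..d}. if k \<in> i ` S \<union> j ` S then \<kappa> {Inr (ro k), Inl k} else 0)"])
  have node: "\<exists>r\<in>S. ro k = r \<and> (k = i r \<or> k = j r)" if "k \<in> i ` S \<union> j ` S" for k
    using that ro by blast
  show "\<forall>p\<in>CC \<times> TT. (\<lambda>e\<in>E'. (case p of (c, t) \<Rightarrow> glue c t) (Inl ` e),
      \<lambda>k\<in>{1..d}. if k \<in> i ` S \<union> j ` S then (case p of (c, t) \<Rightarrow> glue c t) {Inr (ro k), Inl k} else 0) = p"
  proof
    fix p assume "p \<in> CC \<times> TT"
    then obtain c t where p: "p = (c, t)" and c: "c \<in> CC" and t: "t \<in> TT" by blast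
    have "(\<lambda>e\<in>E'. glue c t (Inl ` e)) = c"
    proof (rule ext)
      fix e show "(\<lambda>e\<in>E'. glue c t (Inl ` e)) e = c e"
        using PiE_arb[OF c, of e] glue_old[of e c t] by (cases "e \<in> E'") simp_all
    qed
    moreover have "(\<lambda>k\<in>{1..d}. if k \<in> i ` S \<union> j ` S then glue c t {Inr (ro k), Inl k} else 0) = t"
    proof (rule ext)
      fix k show "(\<lambda>k\<in>{1..d}. if k \<in> i ` S \<union> j ` S then glue c t {Inr (ro k), Inl k} else 0) k = t k"
      proof (cases "k \<in> {1..d}")
        case True
        show ?thesis
        proof (cases "k \<in> i ` S \<union> j ` S")
          case node': True
          then obtain r where r: "r \<in> S" "ro k = r" "k = i r \<or> k = j r" using node by blast
          show ?thesis using True node' glue_new[OF r(1,3), of c t] r(2) by simp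
        next
          case False
          then have "t k \<in> {..<1}" using PiE_mem[OF t True] by (simp add: Bl_def)
          then show ?thesis using True False by simp
        qed
      next
        case False
        then show ?thesis using PiE_arb[OF t False] by (simp only: restrict_apply if_False)
      qed
    qed
    ultimately show "(\<lambda>e\<in>E'. (case p of (c, t) \<Rightarrow> glue c t) (Inl ` e),
      \<lambda>k\<in>{1..d}. if k \<in> i ` S \<union> j ` S then (case p of (c, t) \<Rightarrow> glue c t) {Inr (ro k), Inl k} else 0) = p"
      unfolding p prod.case by (simp only:)
  qed
  show "\<forall>\<kappa>\<in>Pi\<^sub>E E (\<lambda>e. {..<m e}). (case (\<lambda>e\<in>E'. \<kappa> (Inl ` e), \<lambda>k\<in>{1..d}. if k \<in> i ` S \<union> j ` S then \<kappa> {Inr (ro k), Inl k} else 0) of (c, t) \<Rightarrow> glue c t) = \<kappa>"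
  proof
    fix \<kappa> assume \<kappa>: "\<kappa> \<in> Pi\<^sub>E E (\<lambda>e. {..<m e})"
    let ?c = "\<lambda>e\<in>E'. \<kappa> (Inl ` e)" and ?t = "\<lambda>k\<in>{1..d}. if k \<in> i ` S \<union> j ` S then \<kappa> {Inr (ro k), Inl k} else 0"
    have "glue ?c ?t e = \<kappa> e" for e
    proof (cases "e \<in> E")
      case True
      then show ?thesis
      proof (cases rule: aug_edge_cases)
        case (old f)
        then show ?thesis using glue_old[OF old(1), of ?c ?t] by simp
      next
        case (new r k)
        then have "k \<in> {1..d}" "k \<in> i ` S \<union> j ` S" "ro k = r" using ij_V ro by auto
        then show ?thesis using new glue_new[OF new(1,2), of ?c ?t] by simp
      qed
    qed (use PiE_arb[OF \<kappa>, of e] in \<open>simp add: glue_def\<close>)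
    then show "(case (?c, ?t) of (c, t) \<Rightarrow> glue c t) = \<kappa>" unfolding prod.case by (rule ext)
  qed
  show "(\<lambda>(c, t). glue c t) ` (CC \<times> TT) \<subseteq> Pi\<^sub>E E (\<lambda>e. {..<m e})"
  proof (rule image_subsetI)
    fix p assume "p \<in> CC \<times> TT"
    then obtain c t where p: "p = (c, t)" and c: "c \<in> CC" and t: "t \<in> TT" by blast
    have "glue c t \<in> Pi\<^sub>E E (\<lambda>e. {..<m e})"
    proof (rule PiE_I)
      fix e assume "e \<in> E"
      then show "glue c t e \<in> {..<m e}"
      proof (cases rule: aug_edge_cases)
        case (old f)
        then show ?thesis using glue_old[OF old(1), of c t] PiE_mem[OF c old(1)] m_old by simp
      next
        case (new r k)
        then have "k \<in> {1..d}" "m e = q r" using ij_V m_new by auto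
        then show ?thesis using new glue_new[OF new(1,2), of c t] PiE_mem[OF t, of k] Bl_node[OF new(1,2)] by simp
      qed
    qed (simp add: glue_def)
    then show "(case p of (c, t) \<Rightarrow> glue c t) \<in> Pi\<^sub>E E (\<lambda>e. {..<m e})" by (simp only: p prod.case)
  qed
  show "(\<lambda>\<kappa>. (\<lambda>e\<in>E'. \<kappa> (Inl ` e), \<lambda>k\<in>{1..d}. if k \<in> i ` S \<union> j ` S then \<kappa> {Inr (ro k), Inl k} else 0)) ` Pi\<^sub>E E (\<lambda>e. {..<m e}) \<subseteq> CC \<times> TT"
  proof (rule image_subsetI)
    fix \<kappa> assume \<kappa>: "\<kappa> \<in> Pi\<^sub>E E (\<lambda>e. {..<m e})"
    have "\<kappa> (Inl ` e) \<in> {..<m' e}" if "e \<in> E'" for e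
      using PiE_mem[OF \<kappa> old_edge[OF that]] m_old that by simp
    moreover have "(if k \<in> i ` S \<union> j ` S then \<kappa> {Inr (ro k), Inl k} else 0) \<in> Bl k" for k
    proof (cases "k \<in> i ` S \<union> j ` S")
      case True
      then obtain r where r: "r \<in> S" "ro k = r" "k = i r \<or> k = j r" using node by blast
      then have "m {Inr r, Inl k} = q r" using bspec[OF m_new r(1)] by metis
      then show ?thesis using True PiE_mem[OF \<kappa> new_edge[OF r(1,3)]] r(2) Bl_node[OF r(1,3)] by simp
    qed (simp add: Bl_def)
    ultimately show "(\<lambda>e\<in>E'. \<kappa> (Inl ` e), \<lambda>k\<in>{1..d}. if k \<in> i ` S \<union> j ` S then \<kappa> {Inr (ro k), Inl k} else 0) \<in> CC \<times> TT"
      unfolding mem_Times_iff fst_conv snd_conv restrict_PiE_iff by blast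
  qed
qed

text \<open>A new vertex has two incident edges, so its map is a pencil of \<open>q r\<close> by
  \<open>q r\<close> matrices; \<open>p\<close> lists the entries of all these pencils.\<close>

definition "vertex_maps p X v a \<xi> = (case v of Inl k \<Rightarrow> X k a \<xi> | Inr r \<Rightarrow> p (r, a, \<xi> {Inr r, Inl (i r)}, \<xi> {Inr r, Inl (j r)}))"
  for p :: "nat \<times> nat \<times> nat \<times> nat \<Rightarrow> complex" and X :: "nat \<Rightarrow> nat \<Rightarrow> ((nat + nat) set \<Rightarrow> nat) \<Rightarrow> complex"

definition "state p X = local_maps V (bond_basis E m) (phys_basis n) (vertex_maps p X) (graph_tensor V E m)"

lemma state_eq:
  assumes y: "y \<in> out_index"
  shows "state p X y = (\<Sum>c\<in>CC. \<Sum>t\<in>TT. (\<Prod>k\<in>{1..d}. X k (y (Inl k)) (mk k (restrict c (inc k)) (t k))) *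
    (\<Prod>r\<in>S. p (r, y (Inr r), t (i r), t (j r))))"
proof -
  have "state p X y = (\<Sum>\<kappa>\<in>Pi\<^sub>E E (\<lambda>e. {..<m e}). \<Prod>v\<in>V. vertex_maps p X v (y v) (restrict \<kappa> {e \<in> E. v \<in> e}))"
    unfolding state_def by (rule local_maps_graph_tensor[OF finV_aug finE_aug aug_edges_V]) (use y out_index_eq in auto)
  also have "\<dots> = (\<Sum>(c, t)\<in>CC \<times> TT. \<Prod>v\<in>V. vertex_maps p X v (y v) (restrict (glue c t) {e \<in> E. v \<in> e}))"
    by (subst sum.reindex_bij_betw[OF glue_bij, symmetric]) (simp only: case_prod_unfold)
  also have "\<dots> = (\<Sum>(c, t)\<in>CC \<times> TT. (\<Prod>k\<in>{1..d}. X k (y (Inl k)) (mk k (restrict c (inc k)) (t k))) *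
    (\<Prod>r\<in>S. p (r, y (Inr r), t (i r), t (j r))))"
  proof (rule sum.cong[OF refl], unfold prod_aug, clarify)
    fix c t
    have "(\<Prod>r\<in>S. vertex_maps p X (Inr r) (y (Inr r)) (restrict (glue c t) {e \<in> E. Inr r \<in> e})) =
        (\<Prod>r\<in>S. p (r, y (Inr r), t (i r), t (j r)))"
    proof (rule prod.cong[OF refl])
      fix r assume r: "r \<in> S"
      then show "vertex_maps p X (Inr r) (y (Inr r)) (restrict (glue c t) {e \<in> E. Inr r \<in> e}) = p (r, y (Inr r), t (i r), t (j r))"
        using new_edge[OF r, of "i r"] new_edge[OF r, of "j r"] glue_new[OF r, of "i r" c t] glue_new[OF r, of "j r" c t]
        by (simp add: vertex_maps_def)
    qed
    then show "(\<Prod>k\<in>{1..d}. vertex_maps p X (Inl k) (y (Inl k)) (restrict (glue c t) {e \<in> E. Inl k \<in> e})) *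
        (\<Prod>r\<in>S. vertex_maps p X (Inr r) (y (Inr r)) (restrict (glue c t) {e \<in> E. Inr r \<in> e})) =
        (\<Prod>k\<in>{1..d}. X k (y (Inl k)) (mk k (restrict c (inc k)) (t k))) * (\<Prod>r\<in>S. p (r, y (Inr r), t (i r), t (j r)))"
      unfolding restrict_glue by (simp add: vertex_maps_def)
  qed
  finally show ?thesis by (simp add: sum.cartesian_product)
qed

lemma state_coord_space: "state p X \<in> coord_space out_index"
  by (auto simp: state_def local_maps_def coord_space_def out_index_eq)

lemma local_maps_is_state:
  "\<exists>p X. local_maps V (bond_basis E m) (phys_basis n) X0 (graph_tensor V E m) = state p X"
proof -
  define p where "p = (\<lambda>(r, a, b, b'). X0 (Inr r) a (\<lambda>e\<in>{e \<in> E. Inr r \<in> e}. if e = {Inr r, Inl (i r)} then b else b'))"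
  define X where "X k = X0 (Inl k)" for k
  have "local_maps V (bond_basis E m) (phys_basis n) X0 (graph_tensor V E m) y = state p X y" for y
  proof (cases "y \<in> Pi\<^sub>E V (phys_basis n)")
    case True
    have "vertex_maps p X v (y v) (restrict \<kappa> {e \<in> E. v \<in> e}) = X0 v (y v) (restrict \<kappa> {e \<in> E. v \<in> e})" if v: "v \<in> V" for v \<kappa>
    proof (cases v)
      case (Inr r)
      then have r: "r \<in> S" using v by (auto simp: V aug_vertices_def)
      have "(\<lambda>e\<in>{e \<in> E. Inr r \<in> e}. if e = {Inr r, Inl (i r)} then \<kappa> {Inr r, Inl (i r)} else \<kappa> {Inr r, Inl (j r)}) = restrict \<kappa> {e \<in> E. Inr r \<in> e}"
      proof (rule restrict_ext)
        fix e assume e: "e \<in> {e \<in> E. Inr r \<in> e}"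
        then have "e \<in> E" by simp
        then show "(if e = {Inr r, Inl (i r)} then \<kappa> {Inr r, Inl (i r)} else \<kappa> {Inr r, Inl (j r)}) = \<kappa> e"
          by (cases rule: aug_edge_cases) (use e in auto)
      qed
      then show ?thesis using Inr new_edge[OF r, of "i r"] new_edge[OF r, of "j r"] by (simp add: vertex_maps_def p_def)
    qed (simp add: vertex_maps_def X_def)
    moreover have "local_maps V (bond_basis E m) (phys_basis n) X' (graph_tensor V E m) y =
        (\<Sum>\<kappa>\<in>Pi\<^sub>E E (\<lambda>e. {..<m e}). \<Prod>v\<in>V. X' v (y v) (restrict \<kappa> {e \<in> E. v \<in> e}))" for X'
      by (rule local_maps_graph_tensor[OF finV_aug finE_aug aug_edges_V True])
    ultimately show ?thesis unfolding state_def by simp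
  qed (simp add: state_def local_maps_def)
  then show ?thesis by blast
qed

text \<open>\<open>P\<close> acts on the row index at \<open>i r\<close> and \<open>R\<close> on the
  column index at \<open>j r\<close>, hence the transposed arguments; other vertices have nothing to
  absorb.\<close>

definition "gauge_mat P R k b l = (if k \<in> i ` S then P (ro k, b, l) else if k \<in> j ` S then R (ro k, l, b) else 1)"
  for P R :: "nat \<times> nat \<times> nat \<Rightarrow> complex"

text \<open>The pencil with slices \<open>P\<close> times \<open>diag z\<close> times \<open>R\<close> may be replaced by \<open>diag z\<close> after absorbing \<open>P\<close>
  into the map at \<open>i r\<close> and \<open>R\<close> into the map at \<open>j r\<close>.\<close>

definition "absorb P z R X p = (case p of Inl (r, b, a) \<Rightarrow> z (r, b, a)
   | Inr (k, a, cc) \<Rightarrow> \<Sum>b\<in>Bl k. gauge_mat P R k b (fst (cc (er (ro k)))) * X k a (mk k (\<lambda>e\<in>inc k. snd (cc e)) b))"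
  for z :: "nat \<times> nat \<times> nat \<Rightarrow> complex"

definition "mult_pencil P z R = (\<lambda>(r, a, b, b'). \<Sum>l<q r. P (r, b, l) * z (r, l, a) * R (r, l, b'))"
  for z :: "nat \<times> nat \<times> nat \<Rightarrow> complex"

text \<open>The summation index \<open>l r\<close> of the diagonal pencil becomes the block
  component of the label on \<open>er r\<close>.\<close>

definition "join_conf c l = (\<lambda>e\<in>E'. (if e \<in> special then l (rof e) else 0, c e))"
  for c :: "nat set \<Rightarrow> nat" and l :: "nat \<Rightarrow> nat"

lemma join_conf_er: "r \<in> S \<Longrightarrow> join_conf c l (er r) = (l r, c (er r))"
  using er_E'[of r] rof[of r] by (simp add: join_conf_def special_def)

lemma join_conf_bij: "bij_betw (\<lambda>(c, l). join_conf c l) (CC \<times> LL) Conf"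
proof (rule bij_betw_byWitness[where f' = "\<lambda>\<kappa>. (\<lambda>e\<in>E'. snd (\<kappa> e), \<lambda>r\<in>S. fst (\<kappa> (er r)))"])
  show "\<forall>p\<in>CC \<times> LL. (\<lambda>e\<in>E'. snd ((case p of (c, l) \<Rightarrow> join_conf c l) e), \<lambda>r\<in>S. fst ((case p of (c, l) \<Rightarrow> join_conf c l) (er r))) = p"
  proof
    fix p assume "p \<in> CC \<times> LL"
    then obtain c l where p: "p = (c, l)" and c: "c \<in> CC" and l: "l \<in> LL" by blast
    have "(\<lambda>e\<in>E'. snd (join_conf c l e)) = c"
    proof (rule ext)
      fix e show "(\<lambda>e\<in>E'. snd (join_conf c l e)) e = c e"
        using PiE_arb[OF c, of e] by (cases "e \<in> E'") (simp_all add: join_conf_def)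
    qed
    moreover have "(\<lambda>r\<in>S. fst (join_conf c l (er r))) = l"
    proof (rule ext)
      fix r show "(\<lambda>r\<in>S. fst (join_conf c l (er r))) r = l r"
        using PiE_arb[OF l, of r] by (cases "r \<in> S") (simp_all add: join_conf_er)
    qed
    ultimately show "(\<lambda>e\<in>E'. snd ((case p of (c, l) \<Rightarrow> join_conf c l) e), \<lambda>r\<in>S. fst ((case p of (c, l) \<Rightarrow> join_conf c l) (er r))) = p"
      unfolding p prod.case by (simp only:)
  qed
  show "\<forall>\<kappa>\<in>Conf. (case (\<lambda>e\<in>E'. snd (\<kappa> e), \<lambda>r\<in>S. fst (\<kappa> (er r))) of (c, l) \<Rightarrow> join_conf c l) = \<kappa>"
  proof
    fix \<kappa> assume \<kappa>: "\<kappa> \<in> Conf"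
    have "join_conf (\<lambda>e\<in>E'. snd (\<kappa> e)) (\<lambda>r\<in>S. fst (\<kappa> (er r))) e = \<kappa> e" for e
    proof (cases "e \<in> E'")
      case True
      then have "\<kappa> e \<in> Lab e" using \<kappa> by (auto dest: PiE_mem)
      then show ?thesis using True rof
        by (cases "e \<in> special") (auto simp: join_conf_def QQ_def special_def prod_eq_iff)
    qed (use PiE_arb[OF \<kappa>, of e] in \<open>simp add: join_conf_def\<close>)
    then show "(case (\<lambda>e\<in>E'. snd (\<kappa> e), \<lambda>r\<in>S. fst (\<kappa> (er r))) of (c, l) \<Rightarrow> join_conf c l) = \<kappa>"
      unfolding prod.case by (rule ext)
  qed
  show "(\<lambda>(c, l). join_conf c l) ` (CC \<times> LL) \<subseteq> Conf"
  proof (rule image_subsetI)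
    fix p assume "p \<in> CC \<times> LL"
    then obtain c l where p: "p = (c, l)" and c: "c \<in> CC" and l: "l \<in> LL" by blast
    have "join_conf c l \<in> Conf"
      unfolding join_conf_def restrict_PiE_iff
    proof
      fix e assume e: "e \<in> E'"
      show "(if e \<in> special then l (rof e) else 0, c e) \<in> Lab e"
      proof (cases "e \<in> special")
        case True
        then obtain r where r: "r \<in> S" "e = er r" by (auto simp: special_def)
        then show ?thesis using True PiE_mem[OF c e] PiE_mem[OF l r(1)] rof[OF r(1)] QQ_er[OF r(1)] by simp
      qed (use PiE_mem[OF c e] in \<open>simp add: QQ_def\<close>)
    qed
    then show "(case p of (c, l) \<Rightarrow> join_conf c l) \<in> Conf" by (simp only: p prod.case)
  qed
  show "(\<lambda>\<kappa>. (\<lambda>e\<in>E'. snd (\<kappa> e), \<lambda>r\<in>S. fst (\<kappa> (er r)))) ` Conf \<subseteq> CC \<times> LL"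
  proof (rule image_subsetI)
    fix \<kappa> assume \<kappa>: "\<kappa> \<in> Conf"
    have *: "\<kappa> e \<in> Lab e" if "e \<in> E'" for e using \<kappa> that by (auto dest: PiE_mem)
    show "(\<lambda>e\<in>E'. snd (\<kappa> e), \<lambda>r\<in>S. fst (\<kappa> (er r))) \<in> CC \<times> LL"
      unfolding mem_Times_iff fst_conv snd_conv restrict_PiE_iff
      using * *[OF er_E'] QQ_er by (simp add: mem_Times_iff)
  qed
qed

lemma prod_gauge_mat:
  "(\<Prod>k\<in>{1..d}. gauge_mat P R k (t k) (l (ro k))) = (\<Prod>r\<in>S. P (r, t (i r), l r) * R (r, l r, t (j r)))"
proof -
  let ?g = "\<lambda>k. gauge_mat P R k (t k) (l (ro k))"
  have "(\<Prod>k\<in>{1..d}. ?g k) = (\<Prod>k\<in>i ` S \<union> j ` S. ?g k)"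
    by (rule prod.mono_neutral_right) (use nodes(1) in \<open>auto simp: gauge_mat_def\<close>)
  also have "\<dots> = (\<Prod>k\<in>i ` S. ?g k) * (\<Prod>k\<in>j ` S. ?g k)"
    using node_inj(3) by (intro prod.union_disjoint) auto
  also have "\<dots> = (\<Prod>r\<in>S. ?g (i r)) * (\<Prod>r\<in>S. ?g (j r))"
    by (simp only: prod.reindex[OF node_inj(1)] prod.reindex[OF node_inj(2)] o_def)
  also have "(\<Prod>r\<in>S. ?g (i r)) = (\<Prod>r\<in>S. P (r, t (i r), l r))"
    by (rule prod.cong[OF refl]) (simp add: gauge_mat_def ro)
  also have "(\<Prod>r\<in>S. ?g (j r)) = (\<Prod>r\<in>S. R (r, l r, t (j r)))"
  proof (rule prod.cong[OF refl])
    fix r assume r: "r \<in> S"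
    then have "j r \<notin> i ` S" using node_inj(3) by blast
    then show "?g (j r) = R (r, l r, t (j r))" using r by (simp add: gauge_mat_def ro)
  qed
  finally show ?thesis by (simp add: prod.distrib)
qed

text \<open>The product over the new vertices of sums over the diagonal index is expanded into a sum
  over families \<open>l\<close>. For fixed \<open>c\<close> and \<open>l\<close> the factors
  \<open>P\<close> and \<open>R\<close> are distributed to the nodes, so the sum over the labels
  \<open>t\<close> of the new bonds factors vertex by vertex, and each factor is an entry of
  \<open>absorb\<close>.\<close>

lemma state_mult_pencil: "state (mult_pencil P z R) X = tensor_map (absorb P z R X)"
proof
  fix y
  show "state (mult_pencil P z R) X y = tensor_map (absorb P z R X) y"
  proof (cases "y \<in> out_index")
    case False
    then have "state (mult_pencil P z R) X y = 0" using state_coord_space unfolding coord_space_def by blast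
    then show ?thesis using False by (simp only: tensor_map_def if_False)
  next
    case y: True
    let ?Y = "\<lambda>c k b. X k (y (Inl k)) (mk k (restrict c (inc k)) b)"
    have "state (mult_pencil P z R) X y = (\<Sum>c\<in>CC. \<Sum>t\<in>TT. (\<Prod>k\<in>{1..d}. ?Y c k (t k)) *
      (\<Prod>r\<in>S. \<Sum>l<q r. P (r, t (i r), l) * z (r, l, y (Inr r)) * R (r, l, t (j r))))"
      unfolding state_eq[OF y] mult_pencil_def prod.case ..
    also have "\<dots> = (\<Sum>c\<in>CC. \<Sum>t\<in>TT. \<Sum>l\<in>LL. (\<Prod>r\<in>S. z (r, l r, y (Inr r))) *
      (\<Prod>k\<in>{1..d}. gauge_mat P R k (t k) (l (ro k)) * ?Y c k (t k)))"
    proof (intro sum.cong refl)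
      fix c t
      have "(\<Prod>r\<in>S. \<Sum>l<q r. P (r, t (i r), l) * z (r, l, y (Inr r)) * R (r, l, t (j r))) =
          (\<Sum>l\<in>LL. \<Prod>r\<in>S. P (r, t (i r), l r) * z (r, l r, y (Inr r)) * R (r, l r, t (j r)))"
        by (rule prod_sum_PiE) auto
      also have "\<dots> = (\<Sum>l\<in>LL. (\<Prod>r\<in>S. z (r, l r, y (Inr r))) * (\<Prod>k\<in>{1..d}. gauge_mat P R k (t k) (l (ro k))))"
        unfolding prod_gauge_mat by (intro sum.cong refl) (simp add: prod.distrib mult_ac)
      finally show "(\<Prod>k\<in>{1..d}. ?Y c k (t k)) *
        (\<Prod>r\<in>S. \<Sum>l<q r. P (r, t (i r), l) * z (r, l, y (Inr r)) * R (r, l, t (j r))) =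
        (\<Sum>l\<in>LL. (\<Prod>r\<in>S. z (r, l r, y (Inr r))) * (\<Prod>k\<in>{1..d}. gauge_mat P R k (t k) (l (ro k)) * ?Y c k (t k)))"
        by (simp add: sum_distrib_left prod.distrib mult_ac)
    qed
    also have "\<dots> = (\<Sum>c\<in>CC. \<Sum>l\<in>LL. (\<Prod>r\<in>S. z (r, l r, y (Inr r))) *
      (\<Sum>t\<in>TT. \<Prod>k\<in>{1..d}. gauge_mat P R k (t k) (l (ro k)) * ?Y c k (t k)))"
      unfolding sum_distrib_left by (intro sum.cong refl sum.swap)
    also have "\<dots> = (\<Sum>c\<in>CC. \<Sum>l\<in>LL. (\<Prod>r\<in>S. z (r, l r, y (Inr r))) *
      (\<Prod>k\<in>{1..d}. \<Sum>b\<in>Bl k. gauge_mat P R k b (l (ro k)) * ?Y c k b))"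
      by (subst prod_sum_PiE) (auto simp: Bl_def)
    also have "\<dots> = (\<Sum>c\<in>CC. \<Sum>l\<in>LL. (\<Prod>r\<in>S. absorb P z R X (Inl (r, fst (join_conf c l (er r)), y (Inr r)))) *
      (\<Prod>k\<in>{1..d}. absorb P z R X (Inr (k, y (Inl k), loc k (join_conf c l)))))"
    proof (intro sum.cong refl arg_cong2[of _ _ _ _ "(*)"] prod.cong)
      fix c l r assume "r \<in> S"
      then show "z (r, l r, y (Inr r)) = absorb P z R X (Inl (r, fst (join_conf c l (er r)), y (Inr r)))"
        by (simp add: absorb_def join_conf_er)
    next
      fix c l k
      have 1: "(\<lambda>e\<in>inc k. snd (loc k (join_conf c l) e)) = restrict c (inc k)"
        by (rule restrict_ext) (simp add: join_conf_def)
      have 2: "gauge_mat P R k b (fst (loc k (join_conf c l) (er (ro k)))) = gauge_mat P R k b (l (ro k))" for b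
      proof (cases "k \<in> i ` S \<union> j ` S")
        case True
        then obtain r where r: "r \<in> S" "k = i r \<or> k = j r" by blast
        then have "ro k = r" "er r \<in> inc k" using ro er_E' by (auto simp: er_def)
        then show ?thesis using join_conf_er[OF r(1), of c l] by simp
      qed (simp add: gauge_mat_def)
      show "(\<Sum>b\<in>Bl k. gauge_mat P R k b (l (ro k)) * ?Y c k b) = absorb P z R X (Inr (k, y (Inl k), loc k (join_conf c l)))"
        unfolding absorb_def sum.case prod.case 1 2 ..
    qed
    also have "\<dots> = (\<Sum>(c, l)\<in>CC \<times> LL. (\<Prod>r\<in>S. absorb P z R X (Inl (r, fst (join_conf c l (er r)), y (Inr r)))) *
      (\<Prod>k\<in>{1..d}. absorb P z R X (Inr (k, y (Inl k), loc k (join_conf c l)))))"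
      by (simp only: sum.cartesian_product)
    also have "\<dots> = (\<Sum>\<kappa>\<in>Conf. (\<Prod>r\<in>S. absorb P z R X (Inl (r, fst (\<kappa> (er r)), y (Inr r)))) *
      (\<Prod>k\<in>{1..d}. absorb P z R X (Inr (k, y (Inl k), loc k \<kappa>))))"
      by (subst sum.reindex_bij_betw[OF join_conf_bij, symmetric]) (simp only: case_prod_unfold)
    finally show ?thesis using y by (simp only: tensor_map_def tensor_def pencil_part_def if_True)
  qed
qed

end


context augmentation
begin

text \<open>If \<open>P\<close> and \<open>R\<close> are identities, absorbing them merely renames
  columns; the maps \<open>X\<close> are chosen to undo this renaming.\<close>

lemma tensor_map_is_state: "\<exists>p X. tensor_map x = state p X"
proof -
  define P :: "nat \<times> nat \<times> nat \<Rightarrow> complex" where "P = (\<lambda>(r, b, l). of_bool (b = l))"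
  define z :: "nat \<times> nat \<times> nat \<Rightarrow> complex" where "z t = x (Inl t)" for t
  define X where "X k a \<xi> = x (Inr (k, a, lbl k (\<xi> {Inr (ro k), Inl k}) (\<lambda>e\<in>inc k. \<xi> (Inl ` e))))" for k a \<xi>
  have "absorb P z P X p = x p" if p: "p \<in> params" for p
  proof (cases p)
    case (Inl t)
    obtain r b a where "t = (r, b, a)" by (cases t) auto
    then show ?thesis using Inl by (simp add: absorb_def z_def)
  next
    case (Inr t)
    then obtain k a cc where t: "p = Inr (k, a, cc)" "k \<in> {1..d}" "cc \<in> Col k"
      using p unfolding params_def by blast
    let ?c = "\<lambda>e\<in>inc k. snd (cc e)"
    have cc: "cc e \<in> Lab e" if "e \<in> inc k" for e by (rule PiE_mem[OF t(3) that])
    have c: "(\<lambda>e\<in>inc k. mk k ?c b (Inl ` e)) = ?c" for b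
    proof (rule restrict_ext)
      fix e assume e: "e \<in> inc k"
      then have "Inl ` e \<in> E" "Inl k \<in> Inl ` e" "Inl ` e \<in> (`) Inl ` E'" using old_edge by auto
      then show "mk k ?c b (Inl ` e) = snd (cc e)" using e by (simp add: mk_def vimage_Inl)
    qed
    have Xeq: "X k a (mk k ?c b) = x p" if b: "\<And>e. e \<in> inc k \<Longrightarrow> e \<in> special \<Longrightarrow> mk k ?c b {Inr (ro k), Inl k} = fst (cc e)" for b
    proof -
      have "lbl k (mk k ?c b {Inr (ro k), Inl k}) ?c = cc"
      proof (rule ext)
        fix e
        show "lbl k (mk k ?c b {Inr (ro k), Inl k}) ?c e = cc e"
        proof (cases "e \<in> inc k")
          case True
          show ?thesis
          proof (cases "e \<in> special")
            case sp: True
            then show ?thesis using True b[OF True sp] by (simp add: lbl_def)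
          next
            case False
            then have "fst (cc e) = 0" using cc[OF True] by (auto simp: QQ_def)
            then show ?thesis using True False by (simp add: lbl_def prod_eq_iff)
          qed
        next
          case False
          then show ?thesis using PiE_arb[OF t(3) False] by (simp only: lbl_def restrict_apply if_False)
        qed
      qed
      then show ?thesis by (simp only: X_def c t)
    qed
    show ?thesis
    proof (cases "k \<in> i ` S \<union> j ` S")
      case True
      then obtain r where r: "r \<in> S" "k = i r \<or> k = j r" by blast
      have rok: "ro k = r" using r ro by blast
      have er: "er r \<in> inc k" using er_E'[OF r(1)] r(2) by (auto simp: er_def)
      have "fst (cc (er r)) < q r" using cc[OF er] QQ_er[OF r(1)] by (simp add: mem_Times_iff)
      have G: "gauge_mat P P k b l = of_bool (b = l)" for b l
        using True by (auto simp: gauge_mat_def P_def)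
      have "absorb P z P X p = (\<Sum>b<q r. of_bool (b = fst (cc (er r))) * X k a (mk k ?c b))"
        by (simp only: t(1) absorb_def sum.case prod.case G rok Bl_node[OF r])
      also have "\<dots> = X k a (mk k ?c (fst (cc (er r))))"
        using \<open>fst (cc (er r)) < q r\<close> by (subst sum_eq_single[where ?p0.0 = "fst (cc (er r))"]) auto
      also have "\<dots> = x p"
      proof (rule Xeq)
        fix e assume e: "e \<in> inc k" "e \<in> special"
        then have "e = er r" using special_at[of e k] rok by simp
        then show "mk k ?c (fst (cc (er r))) {Inr (ro k), Inl k} = fst (cc e)"
          using new_edge[OF r] new_not_old[of r k] rok by (simp add: mk_def)
      qed
      finally show ?thesis .
    next
      case False
      have "absorb P z P X p = (\<Sum>b<1. X k a (mk k ?c b))"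
        using False by (simp add: t(1) absorb_def Bl_def gauge_mat_def)
      also have "\<dots> = x p"
      proof -
        have "X k a (mk k ?c 0) = x p"
          by (rule Xeq) (use special_at[of _ k] False in blast)
        then show ?thesis by (simp only: lessThan_Suc lessThan_0 One_nat_def sum.insert_if) simp
      qed
      finally show ?thesis .
    qed
  qed
  then have "tensor_map (absorb P z P X) = tensor_map x"
    by (intro ext tensor_map_cong)
  then show ?thesis using state_mult_pencil[of P z P X] by metis
qed

text \<open>A generic pencil is \<open>P\<close> times a diagonal pencil times \<open>R\<close>: at \<open>P = R = 1\<close> and a diagonal
  pencil with pairwise independent entries, the derivative of this parametrisation is surjective.\<close>

lemma state_vanish:
  assumes f: "f \<in> poly_fun out_index" "\<And>x. f (tensor_map x) = 0"
  shows "f (state p X) = 0"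
proof -
  let ?PP = "SIGMA r:S. {..<2::nat} \<times> {..<q r} \<times> {..<q r}"
  define F :: "((nat \<times> nat \<times> nat) + ((nat \<times> nat \<times> nat) + (nat \<times> nat \<times> nat)) \<Rightarrow> complex) \<Rightarrow> nat \<times> nat \<times> nat \<times> nat \<Rightarrow> complex"
    where "F w = mult_pencil (\<lambda>t. w (Inl t)) (\<lambda>t. w (Inr (Inl t))) (\<lambda>t. w (Inr (Inr t)))" for w
  define w0 :: "(nat \<times> nat \<times> nat) + ((nat \<times> nat \<times> nat) + (nat \<times> nat \<times> nat)) \<Rightarrow> complex"
    where "w0 = case_sum (\<lambda>(r, b, l). of_bool (b = l))
      (case_sum (\<lambda>(r, l, a). if a = 0 then 1 else of_nat l) (\<lambda>(r, l, b). of_bool (l = b)))"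
  show ?thesis
  proof (rule surjective_derivative_imp_dominant[where P = "\<lambda>p. f (state p X)" and F = F and J = ?PP and a = w0])
    show "(\<lambda>p. f (state p X)) \<in> poly_fun ?PP"
    proof (rule poly_fun_compose[OF f(1)])
      fix y assume y: "y \<in> out_index"
      show "(\<lambda>p. state p X y) \<in> poly_fun ?PP"
        unfolding state_eq[OF y]
      proof (intro poly_fun_sum poly_fun_cmult poly_fun_prod poly_fun.coord)
        fix t r assume t: "t \<in> TT" and r: "r \<in> S"
        have "t (i r) \<in> Bl (i r)" "t (j r) \<in> Bl (j r)" using PiE_mem[OF t] ij_V[OF r] by blast+
        then have "t (i r) < q r" "t (j r) < q r" using Bl_node[OF r] by simp_all
        then show "(r, y (Inr r), t (i r), t (j r)) \<in> ?PP" using out_indexD(1)[OF y r] r by simp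
      qed
    qed
    show "f (state (F w) X) = 0" for w
      unfolding F_def state_mult_pencil by (rule f(2))
    fix v :: "nat \<times> nat \<times> nat \<times> nat \<Rightarrow> complex"
    \<comment> \<open>Off the diagonal the two slices require
      \<open>w1 + w3 = v (r, 0, b, l)\<close> and \<open>l * w1 + b * w3 = v (r, 1, b, l)\<close>, a
      system with determinant \<open>b - l\<close>; on the diagonal \<open>w2\<close> alone produces
      the wanted tangent.\<close>
    define w1 where "w1 = (\<lambda>(r, b, l). if b = l then 0 else (v (r, 1, b, l) - of_nat b * v (r, 0, b, l)) / (of_nat l - of_nat b))"
    define w3 where "w3 = (\<lambda>(r, b, l). if b = l then 0 else v (r, 0, b, l) - w1 (r, b, l))"
    define w2 where "w2 = (\<lambda>(r, b, a). v (r, a, b, b))"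
    define w where "w = case_sum w1 (case_sum w2 w3)"
    show "\<exists>w. \<forall>t\<in>?PP. ((\<lambda>h. F (\<lambda>i. w0 i + h * w i) t) has_field_derivative v t) (at 0)"
    proof (intro exI[of _ w] ballI)
      fix t assume "t \<in> ?PP"
      then obtain r a b c where t: "t = (r, a, b, c)" "a < 2" "b < q r" "c < q r" by auto
      let ?z = "\<lambda>l. if a = 0 then 1 else of_nat l :: complex"
      have D: "((\<lambda>h. (A + h * A') * (B + h * B') * (C + h * C')) has_field_derivative A' * B * C + A * B' * C + A * B * C') (at 0)"
        for A A' B B' C C' :: complex
        by (auto intro!: derivative_eq_intros simp: algebra_simps)
      have "((\<lambda>h. \<Sum>l<q r. (of_bool (b = l) + h * w1 (r, b, l)) * (?z l + h * w2 (r, l, a)) * (of_bool (l = c) + h * w3 (r, l, c)))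
          has_field_derivative (\<Sum>l<q r. w1 (r, b, l) * ?z l * of_bool (l = c) + of_bool (b = l) * w2 (r, l, a) * of_bool (l = c)
            + of_bool (b = l) * ?z l * w3 (r, l, c))) (at 0)"
        by (rule DERIV_sum) (rule D)
      moreover have "(\<lambda>h. F (\<lambda>i. w0 i + h * w i) t) =
          (\<lambda>h. \<Sum>l<q r. (of_bool (b = l) + h * w1 (r, b, l)) * (?z l + h * w2 (r, l, a)) * (of_bool (l = c) + h * w3 (r, l, c)))"
        by (simp add: F_def mult_pencil_def t(1) w0_def w_def)
      moreover have "(\<Sum>l<q r. w1 (r, b, l) * ?z l * of_bool (l = c) + of_bool (b = l) * w2 (r, l, a) * of_bool (l = c)
            + of_bool (b = l) * ?z l * w3 (r, l, c)) = v t"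
      proof -
        have "(\<Sum>l<q r. w1 (r, b, l) * ?z l * of_bool (l = c)) = w1 (r, b, c) * ?z c"
          using t by (subst sum_eq_single[where ?p0.0 = c]) auto
        moreover have "(\<Sum>l<q r. of_bool (b = l) * w2 (r, l, a) * of_bool (l = c)) = w2 (r, b, a) * of_bool (b = c)"
          using t by (subst sum_eq_single[where ?p0.0 = b]) auto
        moreover have "(\<Sum>l<q r. of_bool (b = l) * ?z l * w3 (r, l, c)) = ?z b * w3 (r, b, c)"
          using t by (subst sum_eq_single[where ?p0.0 = b]) auto
        moreover have "w1 (r, b, c) * ?z c + w2 (r, b, a) * of_bool (b = c) + ?z b * w3 (r, b, c) = v t"
        proof (cases "b = c")
          case True
          then show ?thesis by (simp add: w1_def w2_def w3_def t(1))
        next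
          case False
          define D where "D = (of_nat c - of_nat b :: complex)"
          have D0: "D \<noteq> 0" using False by (simp add: D_def)
          have w1: "w1 (r, b, c) = (v (r, 1, b, c) - of_nat b * v (r, 0, b, c)) / D"
            using False by (simp add: w1_def D_def)
          have w3: "w3 (r, b, c) = v (r, 0, b, c) - w1 (r, b, c)" using False by (simp add: w3_def)
          have w1D: "w1 (r, b, c) * D = v (r, 1, b, c) - of_nat b * v (r, 0, b, c)" using D0 w1 by simp
          have "a = 0 \<or> a = 1" using t(2) by auto
          then show ?thesis
          proof
            assume "a = 0"
            then show ?thesis using False by (simp add: w3 t(1))
          next
            assume a: "a = 1"
            have "w1 (r, b, c) * of_nat c + of_nat b * w3 (r, b, c) = w1 (r, b, c) * D + of_nat b * v (r, 0, b, c)"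
              by (simp add: w3 D_def algebra_simps)
            then show ?thesis using a False by (simp add: w1D t(1))
          qed
        qed
        ultimately show ?thesis by (simp only: sum.distrib)
      qed
      ultimately show "((\<lambda>h. F (\<lambda>i. w0 i + h * w i) t) has_field_derivative v t) (at 0)" by simp
    qed
  qed
qed

text \<open>Every state lies in the closure of the parametrised tensors by
  \<open>state_vanish\<close>, and every parametrised tensor is itself a state.\<close>

lemma tns_eq: "tns V E m n = zariski_closure out_index (range tensor_map)"
proof
  let ?R = "range (\<lambda>X. local_maps V (bond_basis E m) (phys_basis n) X (graph_tensor V E m))"
  have "?R \<subseteq> zariski_closure out_index (range tensor_map)"
  proof
    fix T assume "T \<in> ?R"
    then obtain p X where T: "T = state p X" using local_maps_is_state by blast
    show "T \<in> zariski_closure out_index (range tensor_map)"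
      unfolding T zariski_closure_eq[OF tensor_map_coord_space]
      using state_coord_space state_vanish by blast
  qed
  then show "tns V E m n \<subseteq> zariski_closure out_index (range tensor_map)"
    unfolding tns_def out_index_eq
    by (rule zariski_closure_minimal[OF zariski_closed_closure[OF tensor_map_coord_space]])
  have "range tensor_map \<subseteq> ?R"
  proof
    fix T assume "T \<in> range tensor_map"
    then obtain x where "T = tensor_map x" by blast
    then obtain p X where "T = state p X" using tensor_map_is_state[of x] by blast
    then show "T \<in> ?R" unfolding state_def by blast
  qed
  then show "zariski_closure out_index (range tensor_map) \<subseteq> tns V E m n"
    unfolding tns_def out_index_eq by (rule zariski_closure_mono)
qed

subsection \<open>The normal form\<close>

text \<open>Columns are renamed by \<open>row\<close>, as the group elements are indexed by physical
  indices and the parameters by families of labels.\<close>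

definition "nf_params z g p = (case p of Inl (r, b, a) \<Rightarrow> z (r, b, a) | Inr (k, a, cc) \<Rightarrow> g k $$ (a, row k cc))"
  for z :: "nat \<times> nat \<times> nat \<Rightarrow> complex" and g :: "nat \<Rightarrow> complex mat"

lemma diagonal_pencil_eq: "diagonal_pencil q' z a b c = (if b = c \<and> b < q' then z b a else 0)"
proof -
  have "diagonal_pencil q' z a b c = (\<Sum>k<q'. if k = b then (if b = c then z b a else 0) else 0)"
    unfolding diagonal_pencil_def by (intro sum.cong) auto
  then show ?thesis by simp
qed

lemma \<beta>_mem:
  assumes k: "k \<in> {1..d}" and a: "a < n (Inl k)"
  shows "\<beta> k a \<in> bond_basis E' m' k"
proof (cases "k \<in> i ` S \<union> j ` S")
  case True
  then obtain r where "r \<in> S" "k = i r \<or> k = j r" by blast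
  then have "bij_betw (\<lambda>a. (\<alpha> k a, \<beta> k a)) (phys_basis n (Inl k)) ({..<q r} \<times> bond_basis E' m' k)"
    using ident unfolding identification_def by blast
  from bij_betwE[OF this] show ?thesis using a by (auto simp: phys_basis_def)
next
  case False
  then have "bij_betw (\<beta> k) (phys_basis n (Inl k)) (bond_basis E' m' k)"
    using ident k unfolding identification_def by blast
  from bij_betwE[OF this] show ?thesis using a by (auto simp: phys_basis_def)
qed

lemma \<gamma>_apply: "e \<in> inc k \<Longrightarrow> \<gamma> k a e = (if e \<in> special then \<alpha> k a else 0, \<beta> k a e)"
  by (simp add: \<gamma>_def lbl_def)

text \<open>The normal form is supported on indices that come from configurations: the diagonal
  pencils force equal block indices at \<open>i r\<close> and \<open>j r\<close>, and the graph
  tensor forces equal old labels along every edge. Summing over this support reproduces the sum in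
  \<open>tensor\<close>.\<close>

lemma gl_act_normal_form:
  "gl_act d s n g (normal_form d s i j q E' m' n \<alpha> \<beta> z) = tensor_map (nf_params z g)"
proof
  fix y
  let ?NF = "normal_form d s i j q E' m' n \<alpha> \<beta> z"
  let ?M = "\<lambda>v a b. case v of Inl k \<Rightarrow> g k $$ (a, b) | Inr r \<Rightarrow> of_bool (a = b)"
  have aug: "aug_vertices d s = V" by (simp add: V)
  show "gl_act d s n g ?NF y = tensor_map (nf_params z g) y"
  proof (cases "y \<in> out_index")
    case False
    then show ?thesis by (simp only: gl_act_def local_maps_def aug out_index_eq tensor_map_def if_False)
  next
    case y: True
    \<comment> \<open>The index determined by a configuration. At the new vertices the group acts
      trivially, so the index there must be that of \<open>y\<close>.\<close>
    define F where "F \<kappa> = (\<lambda>v\<in>V. case v of Inl k \<Rightarrow> row k (loc k \<kappa>) | Inr r \<Rightarrow> y (Inr r))" for \<kappa>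
    have F_Inl: "F \<kappa> (Inl k) = row k (loc k \<kappa>)" if "k \<in> {1..d}" for \<kappa> k
      using that by (simp add: F_def V aug_vertices_def)
    have F_Inr: "F \<kappa> (Inr r) = y (Inr r)" if "r \<in> S" for \<kappa> r
      using that by (simp add: F_def V aug_vertices_def)
    have V_cases: "(\<exists>k\<in>{1..d}. v = Inl k) \<or> (\<exists>r\<in>S. v = Inr r)" if "v \<in> V" for v
      using that unfolding V aug_vertices_def by blast
    have F_out: "F \<kappa> \<in> Pi\<^sub>E V (phys_basis n)" if \<kappa>: "\<kappa> \<in> Conf" for \<kappa>
    proof (rule PiE_I)
      fix v assume "v \<in> V"
      then show "F \<kappa> v \<in> phys_basis n v"
        using V_cases[of v] row[OF _ loc_Col[OF \<kappa>]] F_Inl F_Inr y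
        by (auto simp: phys_basis_def n_new dest: out_indexD simp del: One_nat_def)
    qed (simp add: F_def)
    have injF: "inj_on F Conf"
    proof (rule inj_onI)
      fix \<kappa> \<kappa>' assume \<kappa>: "\<kappa> \<in> Conf" "\<kappa>' \<in> Conf" "F \<kappa> = F \<kappa>'"
      show "\<kappa> = \<kappa>'"
      proof (rule conf_eq_off_vertex[OF \<kappa>(1,2)])
        fix k assume "k \<in> {1..d} - {1}"
        then have k: "k \<in> {1..d}" by blast
        have "row k (loc k \<kappa>) = F \<kappa> (Inl k)" by (rule F_Inl[OF k, symmetric])
        also have "\<dots> = row k (loc k \<kappa>')" unfolding \<kappa>(3) by (rule F_Inl[OF k])
        finally have "\<gamma> k (row k (loc k \<kappa>)) = \<gamma> k (row k (loc k \<kappa>'))" by (rule arg_cong)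
        then show "loc k \<kappa> = loc k \<kappa>'"
          unfolding row[OF k loc_Col[OF \<kappa>(1)], THEN conjunct2] row[OF k loc_Col[OF \<kappa>(2)], THEN conjunct2] .
      qed
    qed
    have zero: "(\<Prod>v\<in>V. ?M v (y v) (x v)) * ?NF x = 0" if x: "x \<in> Pi\<^sub>E V (phys_basis n) - F ` Conf" for x
    proof (rule ccontr)
      assume nz: "(\<Prod>v\<in>V. ?M v (y v) (x v)) * ?NF x \<noteq> 0"
      have xV: "x \<in> Pi\<^sub>E V (phys_basis n)" using x by blast
      have xk: "x (Inl k) < n (Inl k)" if "k \<in> {1..d}" for k
        using out_indexD(2)[OF _ that, of x] xV by (simp only: out_index_eq)
      have "(\<Prod>v\<in>V. ?M v (y v) (x v)) \<noteq> 0" using nz by auto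
      then have "\<forall>v\<in>V. ?M v (y v) (x v) \<noteq> 0" using finV_aug by (simp only: prod_zero_iff) blast
      then have yx: "y (Inr r) = x (Inr r)" if "r \<in> S" for r
        using that by (force simp: V aug_vertices_def)
      have NF: "(\<Prod>r\<in>S. diagonal_pencil (q r) (\<lambda>k a. z (r, k, a)) (x (Inr r)) (\<alpha> (i r) (x (Inl (i r)))) (\<alpha> (j r) (x (Inl (j r))))) *
          graph_tensor {1..d} E' m' (\<lambda>k\<in>{1..d}. \<beta> k (x (Inl k))) \<noteq> 0"
      proof
        assume "(\<Prod>r\<in>S. diagonal_pencil (q r) (\<lambda>k a. z (r, k, a)) (x (Inr r)) (\<alpha> (i r) (x (Inl (i r)))) (\<alpha> (j r) (x (Inl (j r))))) *
          graph_tensor {1..d} E' m' (\<lambda>k\<in>{1..d}. \<beta> k (x (Inl k))) = 0"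
        then have "?NF x = 0" using xV unfolding normal_form_def aug by (simp only: if_True)
        then show False using nz by (simp only: mult_zero_right)
      qed
      have \<alpha>: "\<alpha> (i r) (x (Inl (i r))) = \<alpha> (j r) (x (Inl (j r)))" if "r \<in> S" for r
      proof (rule ccontr)
        assume "\<alpha> (i r) (x (Inl (i r))) \<noteq> \<alpha> (j r) (x (Inl (j r)))"
        then have "(\<Prod>r\<in>S. diagonal_pencil (q r) (\<lambda>k a. z (r, k, a)) (x (Inr r)) (\<alpha> (i r) (x (Inl (i r)))) (\<alpha> (j r) (x (Inl (j r))))) = 0"
          using that by (intro prod_zero) (auto simp: diagonal_pencil_eq)
        then show False using NF by (simp only: mult_zero_left)
      qed
      have "graph_tensor {1..d} E' m' (\<lambda>k\<in>{1..d}. \<beta> k (x (Inl k))) \<noteq> 0" using NF by (simp only: mult_eq_0_iff) blast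
      then have cons: "\<forall>e\<in>E'. \<forall>u\<in>e. \<forall>v\<in>e. (\<lambda>k\<in>{1..d}. \<beta> k (x (Inl k))) u e = (\<lambda>k\<in>{1..d}. \<beta> k (x (Inl k))) v e"
        unfolding graph_tensor_def of_bool_eq_0_iff not_not by (rule conjunct2)
      have \<beta>: "\<beta> u (x (Inl u)) e = \<beta> v (x (Inl v)) e" if "e \<in> E'" "u \<in> e" "v \<in> e" "u \<in> {1..d}" "v \<in> {1..d}" for e u v
        using bspec[OF bspec[OF bspec[OF cons that(1)] that(2)] that(3)] by (simp only: restrict_apply that(4,5) if_True)
      \<comment> \<open>The label of each edge is read off at its source; \<open>\<alpha>\<close>
        and \<open>\<beta>\<close> show that the other endpoint yields the same label.\<close>
      define \<kappa> where "\<kappa> = (\<lambda>e\<in>E'. \<gamma> (src e) (x (Inl (src e))) e)"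
      have \<kappa>C: "\<kappa> \<in> Conf"
        unfolding \<kappa>_def restrict_PiE_iff
      proof
        fix e assume e: "e \<in> E'"
        then have "src e \<in> {1..d}" using edge by blast
        then have "\<gamma> (src e) (x (Inl (src e))) \<in> Col (src e)" using row_surj xk by blast
        then show "\<gamma> (src e) (x (Inl (src e))) e \<in> Lab e" using src_inc[OF e] by (rule PiE_mem)
      qed
      have loc\<kappa>: "loc k \<kappa> = \<gamma> k (x (Inl k))" if k: "k \<in> {1..d}" for k
      proof (rule PiE_ext[OF loc_Col[OF \<kappa>C]])
        show "\<gamma> k (x (Inl k)) \<in> Col k" using row_surj[OF k xk[OF k]] by blast
        fix e assume e: "e \<in> inc k"
        then have eE: "e \<in> E'" and se: "src e \<in> {1..d}" "e \<in> inc (src e)" using edge[of e] src_inc[of e] by blast+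
        have "(if e \<in> special then \<alpha> (src e) (x (Inl (src e))) else 0) = (if e \<in> special then \<alpha> k (x (Inl k)) else 0)"
        proof (cases "e \<in> special")
          case True
          then obtain r where r: "r \<in> S" "e = {i r, j r}" by (auto simp: special_def er_def)
          have "src e = i r \<or> src e = j r" "k = i r \<or> k = j r" using se(2) e r(2) by auto
          then show ?thesis using \<alpha>[OF r(1)] by metis
        qed simp
        moreover have "\<beta> (src e) (x (Inl (src e))) e = \<beta> k (x (Inl k)) e"
          by (rule \<beta>[OF eE _ _ se(1) k]) (use e se in blast)+
        ultimately show "loc k \<kappa> e = \<gamma> k (x (Inl k)) e"
          using e eE \<gamma>_apply[OF e] \<gamma>_apply[OF se(2)] by (simp add: \<kappa>_def)
      qed
      have "x = F \<kappa>"
      proof (rule PiE_ext[OF xV F_out[OF \<kappa>C]])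
        fix v assume "v \<in> V"
        then consider k where "k \<in> {1..d}" "v = Inl k" | r where "r \<in> S" "v = Inr r" using V_cases by blast
        then show "x v = F \<kappa> v"
        proof cases
          case 1
          then show ?thesis using row_surj[OF 1(1) xk[OF 1(1)]] F_Inl[OF 1(1), of \<kappa>] loc\<kappa>[OF 1(1)] by metis
        next
          case 2
          then show ?thesis using F_Inr[OF 2(1), of \<kappa>] yx[OF 2(1)] by metis
        qed
      qed
      then show False using x \<kappa>C by blast
    qed
    have val: "(\<Prod>v\<in>V. ?M v (y v) (F \<kappa> v)) * ?NF (F \<kappa>) =
        pencil_part (nf_params z g) (\<lambda>r. y (Inr r)) \<kappa> * (\<Prod>k\<in>{1..d}. nf_params z g (Inr (k, y (Inl k), loc k \<kappa>)))"
      if \<kappa>: "\<kappa> \<in> Conf" for \<kappa>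
    proof -
      have \<gamma>F: "\<gamma> k (F \<kappa> (Inl k)) = loc k \<kappa>" if k: "k \<in> {1..d}" for k
        using row[OF k loc_Col[OF \<kappa>]] F_Inl[OF k, of \<kappa>] by metis
      have comp: "\<beta> k (F \<kappa> (Inl k)) e = snd (\<kappa> e)" "e \<in> special \<Longrightarrow> \<alpha> k (F \<kappa> (Inl k)) = fst (\<kappa> e)"
        if k: "k \<in> {1..d}" and e: "e \<in> inc k" for k e
        using \<gamma>_apply[OF e, of "F \<kappa> (Inl k)"] \<gamma>F[OF k] e by (auto simp: restrict_apply split: if_splits)
      have M: "(\<Prod>v\<in>V. ?M v (y v) (F \<kappa> v)) = (\<Prod>k\<in>{1..d}. nf_params z g (Inr (k, y (Inl k), loc k \<kappa>)))"
      proof -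
        have "(\<Prod>k\<in>{1..d}. ?M (Inl k) (y (Inl k)) (F \<kappa> (Inl k))) = (\<Prod>k\<in>{1..d}. nf_params z g (Inr (k, y (Inl k), loc k \<kappa>)))"
          by (rule prod.cong[OF refl]) (simp only: F_Inl nf_params_def sum.case prod.case)
        moreover have "(\<Prod>r\<in>S. ?M (Inr r) (y (Inr r)) (F \<kappa> (Inr r))) = 1"
          by (rule prod.neutral) (simp add: F_Inr)
        ultimately show ?thesis by (simp only: prod_aug mult_1_right)
      qed
      have P: "(\<Prod>r\<in>S. diagonal_pencil (q r) (\<lambda>k a. z (r, k, a)) (F \<kappa> (Inr r)) (\<alpha> (i r) (F \<kappa> (Inl (i r)))) (\<alpha> (j r) (F \<kappa> (Inl (j r)))))
          = pencil_part (nf_params z g) (\<lambda>r. y (Inr r)) \<kappa>"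
        unfolding pencil_part_def
      proof (rule prod.cong[OF refl])
        fix r assume r: "r \<in> S"
        have sp: "er r \<in> special" "er r \<in> inc (i r)" "er r \<in> inc (j r)" using r er_E'[OF r] by (auto simp: special_def er_def)
        have "\<alpha> (i r) (F \<kappa> (Inl (i r))) = fst (\<kappa> (er r))" "\<alpha> (j r) (F \<kappa> (Inl (j r))) = fst (\<kappa> (er r))"
          using comp(2)[OF ij_V(1)[OF r] sp(2,1)] comp(2)[OF ij_V(2)[OF r] sp(3,1)] by auto
        moreover have "fst (\<kappa> (er r)) < q r"
          using PiE_mem[OF \<kappa> er_E'[OF r]] QQ_er[OF r] by (simp add: mem_Times_iff)
        ultimately show "diagonal_pencil (q r) (\<lambda>k a. z (r, k, a)) (F \<kappa> (Inr r)) (\<alpha> (i r) (F \<kappa> (Inl (i r)))) (\<alpha> (j r) (F \<kappa> (Inl (j r))))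
            = nf_params z g (Inl (r, fst (\<kappa> (er r)), y (Inr r)))"
          by (simp only: diagonal_pencil_eq nf_params_def sum.case prod.case F_Inr[OF r] simp_thms if_True)
      qed
      have G: "graph_tensor {1..d} E' m' (\<lambda>k\<in>{1..d}. \<beta> k (F \<kappa> (Inl k))) = 1"
        unfolding graph_tensor_def of_bool_def
      proof (intro if_P conjI ballI)
        show "(\<lambda>k\<in>{1..d}. \<beta> k (F \<kappa> (Inl k))) \<in> Pi\<^sub>E {1..d} (bond_basis E' m')"
          unfolding restrict_PiE_iff
        proof
          fix k assume k: "k \<in> {1..d}"
          have "F \<kappa> (Inl k) < n (Inl k)" using row[OF k loc_Col[OF \<kappa>]] F_Inl[OF k, of \<kappa>] by metis
          then show "\<beta> k (F \<kappa> (Inl k)) \<in> bond_basis E' m' k" by (rule \<beta>_mem[OF k])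
        qed
        fix e u v assume e: "e \<in> E'" "u \<in> e" "v \<in> e"
        then have uv: "u \<in> {1..d}" "v \<in> {1..d}" using edge[OF e(1)] by (metis insertE singletonD)+
        have inc: "e \<in> inc u" "e \<in> inc v" using e by auto
        show "(\<lambda>k\<in>{1..d}. \<beta> k (F \<kappa> (Inl k))) u e = (\<lambda>k\<in>{1..d}. \<beta> k (F \<kappa> (Inl k))) v e"
          using comp(1)[OF uv(1) inc(1)] comp(1)[OF uv(2) inc(2)] uv by (simp only: restrict_apply if_True)
      qed
      show ?thesis
        using F_out[OF \<kappa>] unfolding normal_form_def aug by (simp only: if_True M P G mult_1_right mult.commute mult_1_left)
    qed
    have finO: "finite (Pi\<^sub>E V (phys_basis n))" using finite_out_index by (simp only: out_index_eq)
    have sub: "F ` Conf \<subseteq> Pi\<^sub>E V (phys_basis n)" using F_out by blast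
    have "gl_act d s n g ?NF y = (\<Sum>x\<in>Pi\<^sub>E V (phys_basis n). (\<Prod>v\<in>V. ?M v (y v) (x v)) * ?NF x)"
      using y unfolding gl_act_def local_maps_def aug by (simp only: out_index_eq if_True)
    also have "\<dots> = (\<Sum>x\<in>F ` Conf. (\<Prod>v\<in>V. ?M v (y v) (x v)) * ?NF x)"
      by (rule sum.mono_neutral_right[OF finO sub]) (use zero in blast)
    also have "\<dots> = (\<Sum>\<kappa>\<in>Conf. (\<Prod>v\<in>V. ?M v (y v) (F \<kappa> v)) * ?NF (F \<kappa>))"
      by (simp only: sum.reindex[OF injF] o_def)
    also have "\<dots> = (\<Sum>\<kappa>\<in>Conf. pencil_part (nf_params z g) (\<lambda>r. y (Inr r)) \<kappa> * (\<Prod>k\<in>{1..d}. nf_params z g (Inr (k, y (Inl k), loc k \<kappa>))))"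
      by (rule sum.cong[OF refl val])
    finally show ?thesis using y by (simp only: tensor_map_def tensor_def if_True)
  qed
qed

end


lemma invertible_mat_of_det:
  fixes A :: "complex mat"
  assumes "A \<in> carrier_mat k k" "det A \<noteq> 0"
  shows "A \<in> carrier_mat k k \<and> invertible_mat A"
proof -
  from det_non_zero_imp_unit[OF assms, of undefined] obtain B where
    "B \<in> carrier_mat k k" "B * A = 1\<^sub>m k" "A * B = 1\<^sub>m k"
    unfolding Units_def ring_mat_def by auto
  then have "inverts_mat A B" "inverts_mat B A" using assms(1) by (auto simp: inverts_mat_def)
  then show ?thesis using assms(1) unfolding invertible_mat_def square_mat.simps by auto
qed

section \<open>The parameter count\<close>

text \<open>Expanding both sides in \<open>b e - 1\<close>, the products over at least two edges on the left occur
  for at most one vertex, since the graph is simple.\<close>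

lemma sum_vertex_prod_bound:
  fixes b :: "'v set \<Rightarrow> int"
  assumes "finite F" "finite V" "\<And>e. e \<in> F \<Longrightarrow> \<exists>u\<in>V. \<exists>v\<in>V. u \<noteq> v \<and> e = {u, v}" "\<And>e. e \<in> F \<Longrightarrow> 1 \<le> b e"
  shows "(\<Sum>k\<in>V. (\<Prod>e\<in>{e \<in> F. k \<in> e}. b e) - 1) \<le> (\<Sum>e\<in>F. b e - 1) + (\<Prod>e\<in>F. b e) - 1"
  using assms(1,3,4)
proof (induction F rule: finite_induct)
  case (insert e F)
  let ?P = "\<lambda>k. \<Prod>e\<in>{e \<in> F. k \<in> e}. b e"
  obtain u v where uv: "u \<in> V" "v \<in> V" "u \<noteq> v" "e = {u, v}" using insert.prems(1)[of e] by auto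
  have be: "1 \<le> b e" using insert.prems(2) by simp
  have step: "(\<Prod>f\<in>{f \<in> insert e F. k \<in> f}. b f) = (if k \<in> e then b e * ?P k else ?P k)" for k
  proof -
    have "{f \<in> insert e F. k \<in> f} = (if k \<in> e then insert e {f \<in> F. k \<in> f} else {f \<in> F. k \<in> f})" by auto
    then show ?thesis using insert.hyps by simp
  qed
  have "(\<Sum>k\<in>V. (\<Prod>f\<in>{f \<in> insert e F. k \<in> f}. b f) - 1) = (\<Sum>k\<in>V. (?P k - 1) + (if k \<in> {u, v} then (b e - 1) * ?P k else 0))"
  proof (rule sum.cong[OF refl])
    fix k
    have "(k \<in> e) = (k \<in> {u, v})" by (simp only: uv(4))
    then show "(\<Prod>f\<in>{f \<in> insert e F. k \<in> f}. b f) - 1 = (?P k - 1) + (if k \<in> {u, v} then (b e - 1) * ?P k else 0)"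
      unfolding step by (simp only:) (simp add: algebra_simps)
  qed
  also have "\<dots> = (\<Sum>k\<in>V. ?P k - 1) + (b e - 1) * (?P u + ?P v)"
  proof -
    have "(\<Sum>k\<in>V. if k \<in> {u, v} then (b e - 1) * ?P k else 0) = (\<Sum>k\<in>{u, v}. (b e - 1) * ?P k)"
      using uv assms(2) by (subst sum.inter_restrict[symmetric]) (auto intro!: sum.cong)
    moreover have "(\<Sum>k\<in>{u, v}. (b e - 1) * ?P k) = (b e - 1) * (?P u + ?P v)"
      using uv(3) by (simp add: distrib_left)
    ultimately show ?thesis unfolding sum.distrib by (simp only:)
  qed
  also have "\<dots> \<le> ((\<Sum>e\<in>F. b e - 1) + (\<Prod>e\<in>F. b e) - 1) + (b e - 1) * (1 + (\<Prod>e\<in>F. b e))"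
  proof (rule add_mono[OF _ mult_left_mono])
    show "(\<Sum>k\<in>V. ?P k - 1) \<le> (\<Sum>e\<in>F. b e - 1) + (\<Prod>e\<in>F. b e) - 1"
      by (rule insert.IH) (use insert.prems in auto)
    have ge1: "1 \<le> (\<Prod>f\<in>G. b f)" if "G \<subseteq> F" for G
      by (rule prod_ge_1) (use that insert.prems(2) in auto)
    have disj: "{f \<in> F. u \<in> f} \<inter> {f \<in> F. v \<in> f} = {}"
    proof (rule ccontr)
      assume "\<not> ?thesis"
      then obtain f where f: "f \<in> F" "u \<in> f" "v \<in> f" by blast
      obtain u' v' where "f = {u', v'}" using insert.prems(1)[of f] f(1) by auto
      then have "f = {u, v}" using f uv(3) by auto
      then show False using insert.hyps uv(4) f(1) by simp
    qed
    have "?P u * ?P v = (\<Prod>f\<in>{f \<in> F. u \<in> f} \<union> {f \<in> F. v \<in> f}. b f)"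
      using insert.hyps(1) disj by (intro prod.union_disjoint[symmetric]) auto
    also have "\<dots> \<le> (\<Prod>f\<in>F. b f)"
    proof (rule prod_mono2)
      show "1 \<le> b f" if "f \<in> F - ({f \<in> F. u \<in> f} \<union> {f \<in> F. v \<in> f})" for f using insert.prems(2)[of f] that by simp
      show "0 \<le> b f" if "f \<in> {f \<in> F. u \<in> f} \<union> {f \<in> F. v \<in> f}" for f using insert.prems(2)[of f] that by force
    qed (use insert.hyps(1) in auto)
    finally have le: "?P u * ?P v \<le> (\<Prod>f\<in>F. b f)" .
    \<comment> \<open>For two numbers at least 1, the sum is at most one plus the product.\<close>
    have "0 \<le> (?P u - 1) * (?P v - 1)" using ge1[of "{f \<in> F. u \<in> f}"] ge1[of "{f \<in> F. v \<in> f}"] by (intro mult_nonneg_nonneg) auto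
    then show "?P u + ?P v \<le> 1 + (\<Prod>f\<in>F. b f)" using le by (simp add: algebra_simps)
  qed (use be in auto)
  also have "\<dots> = (\<Sum>e\<in>insert e F. b e - 1) + (\<Prod>e\<in>insert e F. b e) - 1"
    using insert.hyps by (simp add: algebra_simps)
  finally show ?case .
qed simp

context augmentation
begin

lemma N_prod: "k \<in> {1..d} \<Longrightarrow> n (Inl k) = (\<Prod>e\<in>inc k. QQ e * m' e)"
  using bij_betw_same_card[OF \<gamma>_bij[of k]] finE by (simp add: card_PiE card_cartesian_product)

lemma sum_special: "(\<Sum>e\<in>E'. if e \<in> special then f e else 0) = (\<Sum>r\<in>S. f (er r) :: int)"
proof -
  have "(\<Sum>e\<in>E'. if e \<in> special then f e else 0) = (\<Sum>e\<in>special. f e)"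
    using finE er_E' by (subst sum.inter_restrict[symmetric]) (auto simp: special_def intro!: sum.cong)
  then show ?thesis unfolding special_def by (simp only: sum.reindex[OF inj_er] o_def)
qed

lemma sum_aug: "(\<Sum>v\<in>V. f v) = (\<Sum>k\<in>{1..d}. f (Inl k)) + (\<Sum>r\<in>S. f (Inr r) :: int)"
  unfolding V aug_vertices_def by (subst sum.union_disjoint) (auto simp: sum.reindex)

lemma sum_aug_edges: "(\<Sum>e\<in>E. f e) = (\<Sum>e\<in>E'. f (Inl ` e)) + (\<Sum>r\<in>S. f {Inr r, Inl (i r)} + f {Inr r, Inl (j r)} :: int)"
proof -
  let ?i = "\<lambda>r. {Inr r, Inl (i r)} :: (nat + nat) set" and ?j = "\<lambda>r. {Inr r, Inl (j r)} :: (nat + nat) set"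
  have inj: "inj_on ((`) Inl) E'" "inj_on ?i S" "inj_on ?j S"
    by (auto simp: inj_on_def doubleton_eq_iff inj_image_eq_iff)
  have disj: "(`) Inl ` E' \<inter> ?i ` S = {}" "((`) Inl ` E' \<union> ?i ` S) \<inter> ?j ` S = {}"
    using ij_eq(3) by (fastforce simp: doubleton_eq_iff)+
  have "(\<Sum>e\<in>E. f e) = (\<Sum>e\<in>(`) Inl ` E'. f e) + (\<Sum>e\<in>?i ` S. f e) + (\<Sum>e\<in>?j ` S. f e)"
    unfolding E aug_edges_def using finE disj by (subst sum.union_disjoint; (subst sum.union_disjoint)?) auto
  then show ?thesis by (simp only: sum.reindex[OF inj(1)] sum.reindex[OF inj(2)] sum.reindex[OF inj(3)] o_def sum.distrib add.assoc)
qed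

text \<open>A new vertex contributes \<open>2 * q r ^ 2 - 1\<close> and its two edges remove
  \<open>2 * (q r ^ 2 - 1)\<close>, so 1 remains for each r. At the old vertices the critical
  dimension turns the contribution into a square.\<close>

lemma param_count_eq:
  "param_count V E m n = (\<Sum>k\<in>{1..d}. (int (n (Inl k)))\<^sup>2 - 1) - (\<Sum>e\<in>E'. (int (m' e))\<^sup>2 - 1) + int s + 1"
proof -
  have "(\<Sum>k\<in>{1..d}. int (n (Inl k) * (\<Prod>e\<in>{e \<in> E. Inl k \<in> e}. m e)) - 1) = (\<Sum>k\<in>{1..d}. (int (n (Inl k)))\<^sup>2 - 1)"
    using n_crit by (intro sum.cong refl) (simp add: power2_eq_square)
  moreover have "(\<Sum>r\<in>S. int (n (Inr r) * (\<Prod>e\<in>{e \<in> E. Inr r \<in> e}. m e)) - 1) = (\<Sum>r\<in>S. 2 * (int (q r))\<^sup>2 - 1)"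
  proof (rule sum.cong[OF refl])
    fix r assume r: "r \<in> S"
    have "{e \<in> E. Inr r \<in> e} = {{Inr r, Inl (i r)}, {Inr r, Inl (j r)}}"
      using r unfolding E aug_edges_def by auto
    moreover have "{Inr r, Inl (i r)} \<noteq> {Inr r, Inl (j r) :: nat + nat}"
      using ij_eq(3)[OF r r] by (auto simp: doubleton_eq_iff)
    ultimately have "(\<Prod>e\<in>{e \<in> E. Inr r \<in> e}. m e) = q r * q r" using bspec[OF m_new r] by simp
    then show "int (n (Inr r) * (\<Prod>e\<in>{e \<in> E. Inr r \<in> e}. m e)) - 1 = 2 * (int (q r))\<^sup>2 - 1"
      using bspec[OF n_new r] by (simp add: power2_eq_square)
  qed
  moreover have "(\<Sum>e\<in>E. (int (m e))\<^sup>2 - 1) = (\<Sum>e\<in>E'. (int (m' e))\<^sup>2 - 1) + (\<Sum>r\<in>S. 2 * ((int (q r))\<^sup>2 - 1))"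
    unfolding sum_aug_edges using m_old m_new by (intro arg_cong2[of _ _ _ _ "(+)"] sum.cong refl) auto
  ultimately have "param_count V E m n = (\<Sum>k\<in>{1..d}. (int (n (Inl k)))\<^sup>2 - 1) - (\<Sum>e\<in>E'. (int (m' e))\<^sup>2 - 1)
      + ((\<Sum>r\<in>S. 2 * (int (q r))\<^sup>2 - 1) - (\<Sum>r\<in>S. 2 * ((int (q r))\<^sup>2 - 1))) + 1"
    unfolding param_count_def sum_aug by linarith
  also have "(\<Sum>r\<in>S. 2 * (int (q r))\<^sup>2 - 1) - (\<Sum>r\<in>S. 2 * ((int (q r))\<^sup>2 - 1)) = (\<Sum>r\<in>S. 1)"
    unfolding sum_subtractf[symmetric] by (rule sum.cong) (auto simp: algebra_simps)
  finally show ?thesis by simp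
qed

text \<open>Compared with the parameter count, the blockwise changes of basis on \<open>er r\<close>
  cost \<open>(q r - 1) * m' (er r) ^ 2\<close> further dimensions, while the pencil keeps
  \<open>q r\<close> parameters modulo rescaling where the count has 1. The difference is the r-th
  summand.\<close>

lemma fiberdefect_eq:
  "fiberdefect V E m n = (\<Sum>r\<in>S. (int (q r) - 1) * ((int (m' (er r)))\<^sup>2 - 1))"
proof -
  have "zariski_dim out_index (zariski_closure out_index (range tensor_map)) + card kidx = card params"
    by (rule zariski_dim_tensor_map)
  then have "tns_dim V E m n + int (card kidx) = int (card params)"
    unfolding tns_dim_def tns_eq out_index_eq by (simp only: of_nat_add[symmetric] of_nat_eq_iff)
  moreover have "int (card params) = (\<Sum>r\<in>S. 2 * int (q r)) + (\<Sum>k\<in>{1..d}. (int (n (Inl k)))\<^sup>2)"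
  proof -
    have "(\<Sum>r\<in>S. 2 * QQ (er r)) = (\<Sum>r\<in>S. 2 * q r)" by (rule sum.cong) (simp_all add: QQ_er)
    then show ?thesis unfolding card_params by simp
  qed
  moreover have "int (card kidx) + int (card E') + 1 = (\<Sum>r\<in>S. int (q r)) + (\<Sum>e\<in>E'. int (QQ e) * (int (m' e))\<^sup>2) + int d"
  proof -
    have "(\<Sum>r\<in>S. QQ (er r)) = (\<Sum>r\<in>S. q r)" by (rule sum.cong) (simp_all add: QQ_er)
    then have "card kidx + card E' + 1 = (\<Sum>r\<in>S. q r) + (\<Sum>e\<in>E'. QQ e * (m' e)\<^sup>2) + d"
      using card_kidx by simp
    then have "int (card kidx + card E' + 1) = int ((\<Sum>r\<in>S. q r) + (\<Sum>e\<in>E'. QQ e * (m' e)\<^sup>2) + d)" by (simp only:)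
    then show ?thesis by simp
  qed
  moreover have "(\<Sum>e\<in>E'. int (QQ e) * (int (m' e))\<^sup>2) = (\<Sum>e\<in>E'. (int (m' e))\<^sup>2) + (\<Sum>r\<in>S. (int (q r) - 1) * (int (m' (er r)))\<^sup>2)"
  proof -
    have "(\<Sum>e\<in>E'. int (QQ e) * (int (m' e))\<^sup>2) = (\<Sum>e\<in>E'. (int (m' e))\<^sup>2 + (if e \<in> special then (int (QQ e) - 1) * (int (m' e))\<^sup>2 else 0))"
      by (intro sum.cong refl) (auto simp: QQ_def algebra_simps)
    also have "\<dots> = (\<Sum>e\<in>E'. (int (m' e))\<^sup>2) + (\<Sum>r\<in>S. (int (QQ (er r)) - 1) * (int (m' (er r)))\<^sup>2)"
      unfolding sum.distrib sum_special ..
    finally show ?thesis by (simp add: QQ_er)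
  qed
  moreover have "(\<Sum>r\<in>S. (int (q r) - 1) * ((int (m' (er r)))\<^sup>2 - 1)) =
      (\<Sum>r\<in>S. (int (q r) - 1) * (int (m' (er r)))\<^sup>2) - (\<Sum>r\<in>S. int (q r)) + int s"
    by (simp add: algebra_simps sum.distrib sum_subtractf)
  moreover have "(\<Sum>r\<in>S. 2 * int (q r)) = 2 * (\<Sum>r\<in>S. int (q r))" by (simp add: sum_distrib_left)
  moreover have "(\<Sum>k\<in>{1..d}. (int (n (Inl k)))\<^sup>2 - 1) = (\<Sum>k\<in>{1..d}. (int (n (Inl k)))\<^sup>2) - int d"
    by (simp add: sum_subtractf)
  moreover have "(\<Sum>e\<in>E'. (int (m' e))\<^sup>2 - 1) = (\<Sum>e\<in>E'. (int (m' e))\<^sup>2) - int (card E')"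
    by (simp add: sum_subtractf)
  ultimately show ?thesis unfolding fiberdefect_def param_count_eq by linarith
qed

text \<open>The ambient dimension is \<open>2 ^ s\<close> times the product of all
  \<open>b e\<close>, because each edge enters at both endpoints.
  \<open>sum_vertex_prod_bound\<close> controls the vertices, each special edge costs at most one
  more such product minus 1, and \<open>s + 1 \<le> 2 ^ s\<close>.\<close>

lemma param_count_le: "param_count V E m n \<le> int (\<Prod>v\<in>V. n v)"
proof -
  define b where "b e = (int (QQ e * m' e))\<^sup>2" for e
  let ?B = "\<Prod>e\<in>E'. b e"
  have b1: "1 \<le> b e" if "e \<in> E'" for e
  proof -
    have "0 < QQ e * m' e" using Qpos[OF that] Mpos[OF that] by simp
    then show ?thesis unfolding b_def by (simp add: int_one_le_iff_zero_less)
  qed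
  have B1: "1 \<le> ?B" by (rule prod_ge_1) (rule b1)
  have N: "(int (n (Inl k)))\<^sup>2 = (\<Prod>e\<in>inc k. b e)" if "k \<in> {1..d}" for k
    unfolding N_prod[OF that] b_def by (simp add: prod_power_distrib)
  have "(\<Sum>k\<in>{1..d}. (int (n (Inl k)))\<^sup>2 - 1) = (\<Sum>k\<in>{1..d}. (\<Prod>e\<in>inc k. b e) - 1)"
    by (intro sum.cong refl) (simp only: N)
  also have "\<dots> \<le> (\<Sum>e\<in>E'. b e - 1) + ?B - 1"
  proof (rule sum_vertex_prod_bound[OF finE _ _ b1])
    fix e assume "e \<in> E'"
    then show "\<exists>u\<in>{1..d}. \<exists>v\<in>{1..d}. u \<noteq> v \<and> e = {u, v}" using edge by blast
  qed auto
  finally have 1: "(\<Sum>k\<in>{1..d}. (int (n (Inl k)))\<^sup>2 - 1) \<le> (\<Sum>e\<in>E'. b e - 1) + ?B - 1" .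
  have "(\<Sum>e\<in>E'. b e - 1) - (\<Sum>e\<in>E'. (int (m' e))\<^sup>2 - 1) = (\<Sum>e\<in>E'. if e \<in> special then b e - (int (m' e))\<^sup>2 else 0)"
    unfolding sum_subtractf[symmetric] by (intro sum.cong refl) (auto simp: b_def QQ_def)
  also have "\<dots> = (\<Sum>r\<in>S. b (er r) - (int (m' (er r)))\<^sup>2)" by (rule sum_special)
  also have "\<dots> \<le> (\<Sum>r\<in>S. ?B - 1)"
  proof (rule sum_mono)
    fix r assume r: "r \<in> S"
    have "b (er r) \<le> ?B"
    proof -
      have "(\<Prod>e\<in>{er r}. b e) \<le> ?B"
      proof (rule prod_mono2)
        show "1 \<le> b e" if "e \<in> E' - {er r}" for e using b1[of e] that by simp
        show "0 \<le> b e" for e by (simp add: b_def)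
      qed (use er_E'[OF r] finE in auto)
      then show ?thesis by simp
    qed
    moreover have "1 \<le> (int (m' (er r)))\<^sup>2" using Mpos[OF er_E'[OF r]] by (simp add: int_one_le_iff_zero_less)
    ultimately show "b (er r) - (int (m' (er r)))\<^sup>2 \<le> ?B - 1" by simp
  qed
  also have "\<dots> = int s * (?B - 1)" by simp
  finally have 2: "(\<Sum>e\<in>E'. b e - 1) - (\<Sum>e\<in>E'. (int (m' e))\<^sup>2 - 1) \<le> int s * (?B - 1)" .
  have "param_count V E m n \<le> int s * (?B - 1) + ?B + int s"
    using 1 2 unfolding param_count_eq by linarith
  also have "\<dots> = (int s + 1) * ?B" by (simp add: algebra_simps)
  also have "\<dots> \<le> 2 ^ s * ?B"
  proof (rule mult_right_mono)
    have "s + 1 \<le> 2 ^ s" by (induction s) auto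
    then have "int (s + 1) \<le> int (2 ^ s)" by (simp only: of_nat_le_iff)
    then show "int s + 1 \<le> 2 ^ s" by simp
  qed (use B1 in simp)
  also have "2 ^ s * ?B = int (\<Prod>v\<in>V. n v)"
  proof -
    have "(\<Prod>k\<in>{1..d}. n (Inl k)) = (\<Prod>k\<in>{1..d}. \<Prod>e\<in>{e \<in> E'. k \<in> e}. QQ e * m' e)"
      by (intro prod.cong refl N_prod)
    also have "\<dots> = (\<Prod>e\<in>E'. \<Prod>k\<in>{k \<in> {1..d}. k \<in> e}. QQ e * m' e)"
      by (rule prod.swap_restrict) (use finE in auto)
    also have "\<dots> = (\<Prod>e\<in>E'. (QQ e * m' e)\<^sup>2)"
    proof (rule prod.cong[OF refl])
      fix e assume e: "e \<in> E'"
      have "{k \<in> {1..d}. k \<in> e} = {src e, tgt e}" using edge[OF e] by blast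
      moreover have "(\<Prod>k\<in>{src e, tgt e}. QQ e * m' e) = (QQ e * m' e)\<^sup>2"
        using edge[OF e] by (subst prod.insert) (auto simp: power2_eq_square)
      ultimately show "(\<Prod>k\<in>{k \<in> {1..d}. k \<in> e}. QQ e * m' e) = (QQ e * m' e)\<^sup>2" by (simp only:)
    qed
    finally have "int (\<Prod>k\<in>{1..d}. n (Inl k)) = ?B" by (simp add: b_def)
    moreover have "(\<Prod>r\<in>S. n (Inr r)) = 2 ^ s" using n_new by simp
    moreover have "(\<Prod>v\<in>V. n v) = (\<Prod>k\<in>{1..d}. n (Inl k)) * (\<Prod>r\<in>S. n (Inr r))"
      unfolding V aug_vertices_def by (subst prod.union_disjoint) (auto simp: prod.reindex)
    ultimately show ?thesis by simp
  qed
  finally show ?thesis .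
qed

lemma defect_eq: "defect V E m n = fiberdefect V E m n"
  using param_count_le unfolding defect_def fiberdefect_def expected_dim_def by simp

text \<open>A polynomial that vanishes on \<open>Z\<close> but not everywhere is multiplied by
  \<open>nondeg\<close>. Preimages at which the product is nonzero have their pencil vectors outside
  \<open>Z\<close> and invertible matrices at the vertices.\<close>

lemma generic_normal_form:
  assumes Z: "zariski_closed (pencil_params s q) Z" "Z \<noteq> coord_space (pencil_params s q)"
  shows "generically (Pi\<^sub>E V (phys_basis n)) (tns V E m n)
        (\<lambda>T. \<exists>z \<in> coord_space (pencil_params s q) - Z. \<exists>g. (\<forall>k\<in>{1..d}. g k \<in> GL (n (Inl k))) \<and>
           T = gl_act d s n g (normal_form d s i j q E' m' n \<alpha> \<beta> z))"
proof -
  obtain z1 where z1: "z1 \<in> coord_space (pencil_params s q)" "z1 \<notin> Z"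
    using zariski_closed_subset[OF Z(1)] Z(2) by blast
  obtain f where f: "f \<in> poly_fun (pencil_params s q)" "\<And>z. z \<in> Z \<Longrightarrow> f z = 0" "f z1 \<noteq> 0"
    by (rule zariski_closed_separate[OF Z(1) z1]) (rule that)
  have pp: "Inl t \<in> params \<longleftrightarrow> t \<in> pencil_params s q" for t
    unfolding params_def pencil_params_def by (cases t) (auto simp: QQ_er simp del: One_nat_def)
  have fp: "(\<lambda>x. f (\<lambda>t. x (Inl t))) \<in> poly_fun params"
    by (rule poly_fun_compose[OF f(1)], rule poly_fun.coord) (simp only: pp)
  have "\<exists>x. nondeg x * f (\<lambda>t. x (Inl t)) \<noteq> 0"
  proof (rule poly_fun_domain[where f = nondeg and g = "\<lambda>x. f (\<lambda>t. x (Inl t))" and I = params and a = base_point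
        and b = "case_sum z1 (\<lambda>_. 0)", OF nondeg_poly_fun fp nondeg_base_point])
    have "(\<lambda>t. case_sum z1 (\<lambda>_. 0) (Inl t)) = z1" by (simp only: sum.case)
    then show "f (\<lambda>t. case_sum z1 (\<lambda>_. 0) (Inl t)) \<noteq> 0" using f(3) by metis
  qed
  then obtain x1 where x1: "nondeg x1 * f (\<lambda>t. x1 (Inl t)) \<noteq> 0" ..
  have gen: "generically out_index (zariski_closure out_index (range tensor_map))
      (\<lambda>T. \<exists>x\<in>coord_space params. nondeg x * f (\<lambda>t. x (Inl t)) \<noteq> 0 \<and> T = tensor_map x)"
    by (rule image_contains_open[where h = "\<lambda>x. nondeg x * f (\<lambda>t. x (Inl t))" and \<phi> = tensor_map and I = params and ?x0.0 = x1,
          OF finparams tensor_map_poly_fun tensor_map_coord_space])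
      (fact poly_fun.mult[OF nondeg_poly_fun fp] x1)+
  have nf: "\<exists>z \<in> coord_space (pencil_params s q) - Z. \<exists>g. (\<forall>k\<in>{1..d}. g k \<in> GL (n (Inl k))) \<and>
           tensor_map x = gl_act d s n g (normal_form d s i j q E' m' n \<alpha> \<beta> z)"
    if x: "x \<in> coord_space params" "nondeg x * f (\<lambda>t. x (Inl t)) \<noteq> 0" for x
  proof (intro bexI exI conjI ballI)
    let ?z = "\<lambda>t. x (Inl t)"
    show "?z \<in> coord_space (pencil_params s q) - Z" using x f(2) pp by (auto simp: coord_space_def)
    show "tensor_map x = gl_act d s n (vertex_mat x) (normal_form d s i j q E' m' n \<alpha> \<beta> ?z)"
      unfolding gl_act_normal_form
    proof (rule ext, rule tensor_map_cong)
      fix p assume "p \<in> params"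
      then consider r b a where "p = Inl (r, b, a)" | k a cc where "p = Inr (k, a, cc)" "k \<in> {1..d}" "a < n (Inl k)" "cc \<in> Col k"
        unfolding params_def by blast
      then show "x p = nf_params ?z (vertex_mat x) p"
      proof cases
        case 2
        then show ?thesis using row[OF 2(2,4)] by (simp add: nf_params_def vertex_mat_def)
      qed (simp add: nf_params_def)
    qed
    fix k assume k: "k \<in> {1..d}"
    have "det (vertex_mat x k) \<noteq> 0"
    proof
      assume "det (vertex_mat x k) = 0"
      then have "(\<Prod>k\<in>{1..d}. det (vertex_mat x k)) = 0" using k by (intro prod_zero) blast+
      then have "nondeg x = 0" unfolding nondeg_def by (simp only: mult_zero_right)
      then show False using x(2) by (simp only: mult_zero_left)
    qed
    then show "vertex_mat x k \<in> GL (n (Inl k))"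
      unfolding GL_def using invertible_mat_of_det[of "vertex_mat x k" "n (Inl k)"] by (simp add: vertex_mat_def)
  qed
  obtain Z0 where Z0: "zariski_closed out_index Z0" "zariski_closure out_index (tns V E m n - Z0) = tns V E m n"
    "\<forall>T\<in>tns V E m n - Z0. \<exists>x\<in>coord_space params. nondeg x * f (\<lambda>t. x (Inl t)) \<noteq> 0 \<and> T = tensor_map x"
    using gen unfolding generically_def tns_eq[symmetric] by blast
  show ?thesis
    unfolding generically_def out_index_eq
  proof (intro exI[of _ Z0] conjI ballI)
    fix T assume "T \<in> tns V E m n - Z0"
    then obtain x where "x \<in> coord_space params" "nondeg x * f (\<lambda>t. x (Inl t)) \<noteq> 0" "T = tensor_map x"
      using Z0(3) by blast
    then show "\<exists>z \<in> coord_space (pencil_params s q) - Z. \<exists>g. (\<forall>k\<in>{1..d}. g k \<in> GL (n (Inl k))) \<and>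
           T = gl_act d s n g (normal_form d s i j q E' m' n \<alpha> \<beta> z)" using nf by blast
  qed (fact Z0)+
qed

end

theorem corollary6p4:
  fixes d s :: nat
    and E' :: "nat set set" and m' :: "nat set \<Rightarrow> nat"
    and i j q :: "nat \<Rightarrow> nat"
    and V :: "(nat + nat) set" and E :: "(nat + nat) set set"
    and m :: "(nat + nat) set \<Rightarrow> nat" and n :: "nat + nat \<Rightarrow> nat"
    and \<alpha> :: "nat \<Rightarrow> nat \<Rightarrow> nat" and \<beta> :: "nat \<Rightarrow> nat \<Rightarrow> nat set \<Rightarrow> nat"
  assumes network: "network {1..d} E'"
    and bond_pos: "\<forall>e\<in>E'. 0 < m' e" "\<forall>r\<in>{1..s}. 0 < q r"
    and nodes: "i ` {1..s} \<union> j ` {1..s} \<subseteq> {1..d}" "card (i ` {1..s} \<union> j ` {1..s}) = 2 * s"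
    and edges: "\<forall>r\<in>{1..s}. {i r, j r} \<in> E'"
    and V: "V = aug_vertices d s" and E: "E = aug_edges E' s i j"
    and m_old: "\<forall>e\<in>E'. m (Inl ` e) = m' e"
    and m_new: "\<forall>r\<in>{1..s}. m {Inr r, Inl (i r)} = q r \<and> m {Inr r, Inl (j r)} = q r"
    and n_new: "\<forall>r\<in>{1..s}. n (Inr r) = 2"
    and n_crit: "\<forall>k\<in>{1..d}. n (Inl k) = (\<Prod>e \<in> {e \<in> E. Inl k \<in> e}. m e)"
    and ident: "identification d s i j q E' m' n \<alpha> \<beta>"
  shows "((\<exists>r\<in>{1..s}. 2 \<le> q r \<and> 2 \<le> m {Inl (i r), Inl (j r)}) \<longrightarrow> defective V E m n) \<and>
    defect V E m n = fiberdefect V E m n \<and>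
    fiberdefect V E m n =
      (\<Sum>r\<in>{1..s}. (int (q r) - 1) * ((int (m {Inl (i r), Inl (j r)}))\<^sup>2 - 1)) \<and>
    (\<forall>Z. zariski_closed (pencil_params s q) Z \<and> Z \<noteq> coord_space (pencil_params s q) \<longrightarrow>
      generically (Pi\<^sub>E V (phys_basis n)) (tns V E m n)
        (\<lambda>T. \<exists>z \<in> coord_space (pencil_params s q) - Z. \<exists>g. (\<forall>k\<in>{1..d}. g k \<in> GL (n (Inl k))) \<and>
           T = gl_act d s n g (normal_form d s i j q E' m' n \<alpha> \<beta> z)))"
proof -
  interpret augmentation d s E' m' i j q V E m n \<alpha> \<beta>
    by unfold_locales (fact assms)+
  have m_er: "m {Inl (i r), Inl (j r)} = m' (er r)" if "r \<in> {1..s}" for r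
    using bspec[OF m_old er_E'[OF that]] by (simp add: er_def)
  have fib: "fiberdefect V E m n = (\<Sum>r\<in>{1..s}. (int (q r) - 1) * ((int (m {Inl (i r), Inl (j r)}))\<^sup>2 - 1))"
    unfolding fiberdefect_eq by (intro sum.cong refl) (simp only: m_er)
  have "defective V E m n" if ex: "\<exists>r\<in>{1..s}. 2 \<le> q r \<and> 2 \<le> m {Inl (i r), Inl (j r)}"
  proof -
    \<comment> \<open>Positive bond dimensions make all summands nonnegative, so the one strictly
      positive summand makes the sum positive.\<close>
    have nonneg: "0 \<le> (int (q r) - 1) * ((int (m {Inl (i r), Inl (j r)}))\<^sup>2 - 1)" if r: "r \<in> {1..s}" for r
    proof -
      have "1 \<le> int (q r)" "1 \<le> int (m {Inl (i r), Inl (j r)})"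
        using bspec[OF bond_pos(2) r] bspec[OF bond_pos(1) er_E'[OF r]] m_er[OF r] by auto
      then show ?thesis by (intro mult_nonneg_nonneg) auto
    qed
    obtain r where r: "r \<in> {1..s}" "2 \<le> q r" "2 \<le> m {Inl (i r), Inl (j r)}" using ex by blast
    have "(2::int)\<^sup>2 \<le> (int (m {Inl (i r), Inl (j r)}))\<^sup>2" using r(3) by (intro power_mono) auto
    then have "0 < (int (q r) - 1) * ((int (m {Inl (i r), Inl (j r)}))\<^sup>2 - 1)" using r(2) by (intro mult_pos_pos) auto
    then have "0 < fiberdefect V E m n"
      unfolding fib using nonneg r(1) by (intro sum_pos2[of _ r]) auto
    then show ?thesis using defect_eq unfolding defective_def defect_def by simp
  qed
  then show ?thesis using defect_eq fib generic_normal_form by blast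
qed

end
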